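(* Let $k\in\mathbb{N}$, $k\ge 1$. The map \[\Phi\colon L^\infty(\mathbb{C})\to\mathcal{L}(F^2_{(k)}),\qquad f\mapsto (k_{0,(k)}\otimes k_{0,(k)})\ast f\] is injective if and only if $k=1$. For $k>1$, the kernel of $\Phi$ is exactly the weak$^\ast$ closure (with respect to the predual $L^1(\mathbb{C})$ of $L^\infty(\mathbb{C})$) of the linear span of all characters $w\mapsto e^{i\sigma(\xi,w)}$ with $\xi\in\Sigma_k$, where $\Sigma_k:=\{\xi\in\mathbb{C}: L^0_{k-1}(|\xi|^2)=0\}$.
   Context: Let $\mathrm{d}\mu(z)=\frac1\pi e^{-|z|^2}\,\mathrm{d}z$ on $\mathbb{C}\cong\mathbb{R}^2$ ($\mathrm{d}z$ is Lebesgue measure). For $n\ge1$, $F_n^2$ is the closed subspace of $L^2(\mathbb{C},\mu)$ of smooth functions $f$ with $\partial^n f/\partial\overline z^n=0$ (polyanalytic Fock space); the true polyanalytic Fock spaces are $F^2_{(1)}:=F^2_1$ and $F^2_{(k)}:=F^2_k\ominus F^2_{k-1}$ for $k\ge2$. $\mathcal{L}(H)$ denotes the bounded operators and $\mathcal{T}^1(H)$ the trace class operators on a Hilbert space $H$. The symplectic form is $\sigma(z,w)=2\operatorname{Im}(z\overline w)$. The Weyl operators $W_z f(w)=e^{w\overline z-|z|^2/2}f(w-z)$ are unitary on $L^2(\mathbb{C},\mu)$ and leave each $F^2_{(k)}$ invariant. The generalized Laguerre polynomials are $L_m^\alpha(x)=\sum_{j=0}^m(-1)^j\binom{m+\alpha}{m-j}\frac{x^j}{j!}$.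 The function $k_{0,(k)}(z)=L^0_{k-1}(|z|^2)$ is the normalized reproducing kernel of $F^2_{(k)}$ at $0$. For $g,h$ in a Hilbert space, $(g\otimes h)(\varphi)=\langle\varphi,h\rangle g$ (inner product linear in the first entry). For $A\in\mathcal{T}^1(F^2_{(k)})$ and $f\in L^\infty(\mathbb{C})$, the convolution $A\ast f\in\mathcal{L}(F^2_{(k)})$ is the weak$^\ast$ integral $\int_{\mathbb{C}}f(z)\,W_zAW_{-z}\,\mathrm{d}z$, i.e. $\operatorname{tr}((A\ast f)B)=\int_{\mathbb{C}}f(z)\operatorname{tr}(W_zAW_{-z}B)\,\mathrm{d}z$ for all $B\in\mathcal{T}^1(F^2_{(k)})$. *)

theory Defs
  imports "HOL-Analysis.Analysis"
begin

text \<open>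
  Elements of the Fock spaces are smooth, so they are represented by genuine functions
  \<^typ>\<open>complex \<Rightarrow> complex\<close>, equality being pointwise. Elements of \<open>L\<^sup>\<infinity>\<close> are represented by
  essentially bounded functions, to be compared almost everywhere. Hilbert spaces are carrier
  sets \<open>H\<close> of functions, and operators on \<open>H\<close> are extensional functions on \<open>H\<close>, so that
  equality of operators is HOL equality.
\<close>

subsection \<open>Polyanalytic Fock spaces\<close>

definition gauss :: "complex measure" where
  "gauss = density lborel (\<lambda>z. ennreal (exp (- (cmod z)\<^sup>2) / pi))"

definition ip :: "(complex \<Rightarrow> complex) \<Rightarrow> (complex \<Rightarrow> complex) \<Rightarrow> complex" where
  "ip f g = (LINT z|gauss. f z * cnj (g z))"

definition L2norm :: "(complex \<Rightarrow> complex) \<Rightarrow> real" where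
  "L2norm f = sqrt (LINT z|gauss. (cmod (f z))\<^sup>2)"

text \<open>Real differentiability classes: \<^typ>\<open>complex\<close> is regarded as the real plane.\<close>

primrec C_diff :: "nat \<Rightarrow> (complex \<Rightarrow> complex) \<Rightarrow> bool" where
  "C_diff 0 f \<longleftrightarrow> continuous_on UNIV f"
| "C_diff (Suc n) f \<longleftrightarrow>
     f differentiable_on UNIV \<and> (\<forall>v. C_diff n (\<lambda>z. frechet_derivative f (at z) v))"

definition smooth :: "(complex \<Rightarrow> complex) \<Rightarrow> bool" where
  "smooth f \<longleftrightarrow> (\<forall>n. C_diff n f)"

text \<open>
  The Wirtinger derivative with respect to the conjugate variable,
  \<open>(\<partial>f/\<partial>x + \<i> \<partial>f/\<partial>y) / 2\<close>.
\<close>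

definition dbar :: "(complex \<Rightarrow> complex) \<Rightarrow> complex \<Rightarrow> complex" where
  "dbar f z = (frechet_derivative f (at z) 1 + \<i> * frechet_derivative f (at z) \<i>) / 2"

definition fock :: "nat \<Rightarrow> (complex \<Rightarrow> complex) set" where
  "fock n = {f. smooth f \<and> integrable gauss (\<lambda>z. (cmod (f z))\<^sup>2) \<and> (\<forall>z. (dbar ^^ n) f z = 0)}"

definition true_fock :: "nat \<Rightarrow> (complex \<Rightarrow> complex) set" where
  "true_fock k = (if k = 1 then fock 1 else {f \<in> fock k. \<forall>g\<in>fock (k - 1). ip f g = 0})"

definition weyl :: "complex \<Rightarrow> (complex \<Rightarrow> complex) \<Rightarrow> complex \<Rightarrow> complex" where
  "weyl z f w = exp (w * cnj z - complex_of_real ((cmod z)\<^sup>2 / 2)) * f (w - z)"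

definition laguerre :: "nat \<Rightarrow> real \<Rightarrow> real \<Rightarrow> real" where
  "laguerre m \<alpha> x = (\<Sum>j\<le>m. (-1) ^ j * ((real m + \<alpha>) gchoose (m - j)) * x ^ j / fact j)"

definition kernel0 :: "nat \<Rightarrow> complex \<Rightarrow> complex" where
  "kernel0 k z = complex_of_real (laguerre (k - 1) 0 ((cmod z)\<^sup>2))"


subsection \<open>Operators\<close>

definition bounded_ops ::
  "(complex \<Rightarrow> complex) set \<Rightarrow> ((complex \<Rightarrow> complex) \<Rightarrow> (complex \<Rightarrow> complex)) set" where
  "bounded_ops H = {T \<in> H \<rightarrow>\<^sub>E H.
     (\<forall>f\<in>H. \<forall>g\<in>H. \<forall>a b. T (\<lambda>z. a * f z + b * g z) = (\<lambda>z. a * T f z + b * T g z)) \<and>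
     (\<exists>C. \<forall>f\<in>H. L2norm (T f) \<le> C * L2norm f)}"

definition zero_op ::
  "(complex \<Rightarrow> complex) set \<Rightarrow> (complex \<Rightarrow> complex) \<Rightarrow> (complex \<Rightarrow> complex)" where
  "zero_op H = (\<lambda>\<phi>\<in>H. (\<lambda>_. 0))"

definition rank_one ::
  "(complex \<Rightarrow> complex) set \<Rightarrow> (complex \<Rightarrow> complex) \<Rightarrow> (complex \<Rightarrow> complex) \<Rightarrow>
   (complex \<Rightarrow> complex) \<Rightarrow> (complex \<Rightarrow> complex)" where
  "rank_one H g h = (\<lambda>\<phi>\<in>H. (\<lambda>z. ip \<phi> h * g z))"

definition orthonormal_basis ::
  "(complex \<Rightarrow> complex) set \<Rightarrow> (complex \<Rightarrow> complex) set \<Rightarrow> bool" where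
  "orthonormal_basis H E \<longleftrightarrow> E \<subseteq> H \<and>
     (\<forall>e\<in>E. \<forall>e'\<in>E. ip e e' = (if e = e' then 1 else 0)) \<and>
     (\<forall>f\<in>H. (\<forall>e\<in>E. ip f e = 0) \<longrightarrow> f = (\<lambda>_. 0))"

text \<open>
  \<open>P\<close> is the absolute value of \<open>A\<close>, i.e. the positive square root of \<open>A\<^sup>* A\<close>; the last condition
  is the equation \<open>P\<^sup>2 = A\<^sup>* A\<close> tested against vectors.
\<close>

definition is_abs_op ::
  "(complex \<Rightarrow> complex) set \<Rightarrow> ((complex \<Rightarrow> complex) \<Rightarrow> (complex \<Rightarrow> complex)) \<Rightarrow>
   ((complex \<Rightarrow> complex) \<Rightarrow> (complex \<Rightarrow> complex)) \<Rightarrow> bool" where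
  "is_abs_op H A P \<longleftrightarrow> P \<in> bounded_ops H \<and>
     (\<forall>f\<in>H. ip (P f) f \<in> \<real>\<^sub>\<ge>\<^sub>0) \<and>
     (\<forall>f\<in>H. \<forall>g\<in>H. ip (P (P f)) g = ip (A f) (A g))"

definition trace_class ::
  "(complex \<Rightarrow> complex) set \<Rightarrow> ((complex \<Rightarrow> complex) \<Rightarrow> (complex \<Rightarrow> complex)) set" where
  "trace_class H = {A \<in> bounded_ops H. \<exists>P. is_abs_op H A P \<and>
     (\<forall>E. orthonormal_basis H E \<longrightarrow> (\<lambda>e. ip (P e) e) summable_on E)}"

text \<open>For trace class operators the value does not depend on the choice of the basis.\<close>

definition tr ::
  "(complex \<Rightarrow> complex) set \<Rightarrow> ((complex \<Rightarrow> complex) \<Rightarrow> (complex \<Rightarrow> complex)) \<Rightarrow> complex" where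
  "tr H A = (\<Sum>\<^sub>\<infinity>e\<in>(SOME E. orthonormal_basis H E). ip (A e) e)"


subsection \<open>Bounded functions and the convolution\<close>

definition Linf :: "(complex \<Rightarrow> complex) set" where
  "Linf = {f \<in> borel_measurable lborel. \<exists>C. AE z in lborel. cmod (f z) \<le> C}"

text \<open>
  The weak* topology on \<^const>\<open>Linf\<close>, as a space of representatives: it does not separate
  functions that agree almost everywhere, so closed sets are unions of classes.
\<close>

definition weak_star :: "(complex \<Rightarrow> complex) topology" where
  "weak_star = topology_generated_by
     {{f \<in> Linf. (LINT z|lborel. f z * g z) \<in> U} | g U. integrable lborel g \<and> open U}"

text \<open>
  The weak* integral of \<open>f z * W\<^sub>z A W\<^sub>-\<^sub>z\<close>: the unique bounded operator with the prescribed
  traces against the predual of the bounded operators. Integrability is required explicitly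
  because the Bochner integral of a non-integrable function is 0.
\<close>

definition convolution ::
  "(complex \<Rightarrow> complex) set \<Rightarrow> ((complex \<Rightarrow> complex) \<Rightarrow> (complex \<Rightarrow> complex)) \<Rightarrow>
   (complex \<Rightarrow> complex) \<Rightarrow> ((complex \<Rightarrow> complex) \<Rightarrow> (complex \<Rightarrow> complex))" where
  "convolution H A f = (THE T. T \<in> bounded_ops H \<and> (\<forall>B\<in>trace_class H.
     integrable lborel (\<lambda>z. f z * tr H (weyl z \<circ> A \<circ> weyl (- z) \<circ> B)) \<and>
     tr H (T \<circ> B) = (LINT z|lborel. f z * tr H (weyl z \<circ> A \<circ> weyl (- z) \<circ> B))))"

definition Phi ::
  "nat \<Rightarrow> (complex \<Rightarrow> complex) \<Rightarrow> ((complex \<Rightarrow> complex) \<Rightarrow> (complex \<Rightarrow> complex))" where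
  "Phi k f = convolution (true_fock k) (rank_one (true_fock k) (kernel0 k) (kernel0 k)) f"

definition sympl :: "complex \<Rightarrow> complex \<Rightarrow> real" where
  "sympl z w = 2 * Im (z * cnj w)"

definition character :: "complex \<Rightarrow> complex \<Rightarrow> complex" where
  "character \<xi> w = exp (\<i> * complex_of_real (sympl \<xi> w))"

definition Sigma_set :: "nat \<Rightarrow> complex set" where
  "Sigma_set k = {\<xi>. laguerre (k - 1) 0 ((cmod \<xi>)\<^sup>2) = 0}"

definition lin_span :: "(complex \<Rightarrow> complex) set \<Rightarrow> (complex \<Rightarrow> complex) set" where
  "lin_span S = {(\<lambda>w. \<Sum>s\<in>X. c s * s w) | X c. finite X \<and> X \<subseteq> S}"

end

theory Submission
  imports Defs "HOL-Probability.Probability" "HOL-Complex_Analysis.Complex_Analysis"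
begin

text \<open>
  Put \<open>m = k - 1\<close>. The complex Hermite polynomials \<open>H\<^sub>m\<^sub>,\<^sub>q\<close>, normalised, form an orthonormal basis of the
  true polyanalytic Fock space, and by the reproducing property of the kernel \<open>\<Phi> f\<close> is \<open>\<pi>\<close> times the
  Toeplitz operator with symbol \<open>f\<close>. Hence \<open>\<Phi> f = 0\<close> iff \<open>f\<close> is orthogonal to all products
  \<open>H\<^sub>m\<^sub>,\<^sub>q H\<^sub>p\<^sub>,\<^sub>m\<close>. Suitable triangular combinations of these products equal
  \<open>\<Sum>\<^sub>j j! (m choose j)\<^sup>2 H\<close> with \<open>H\<close> of index \<open>(p+m-j, q+m-j)\<close>, so the condition is a linear recurrence for the
  Hermite coefficients of \<open>f\<close> along each diagonal \<open>p - q = n\<close>. Its characteristic polynomial is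
  \<open>m! L\<^sub>m(-x)\<close>, and \<open>L\<^sub>m\<close> has \<open>m\<close> distinct positive zeros.

  The character with parameter \<open>\<xi>\<close> has Hermite coefficients \<open>(-cnj \<xi>)\<^sup>p \<xi>\<^sup>q exp (-\<bar>\<xi>\<bar>\<^sup>2)\<close>, a geometric sequence
  of ratio \<open>-\<bar>\<xi>\<bar>\<^sup>2\<close> on every diagonal. The recurrence therefore says that on each diagonal \<open>f\<close> has the
  coefficients of a combination of characters with parameters in \<open>\<Sigma>\<^sub>k\<close>; since Hermite coefficients
  determine a bounded function, each angular Fourier mode of \<open>f\<close> is a combination of modes of such
  characters. If \<open>g \<in> L\<^sup>1\<close> annihilates all these characters, then the continuous function
  \<open>u \<mapsto> \<integral> f(uz) g(z) dz\<close> on the circle has vanishing Fourier coefficients, so \<open>g\<close> annihilates \<open>f\<close>, and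
  the bipolar theorem gives the weak* closure.
\<close>

subsection \<open>The Gaussian measure\<close>

text \<open>The obstacle is that the Fourier transform of a bounded \<open>f\<close> is only a
  distribution, and that for k > 1 the set \<open>Sigma_set k\<close> contains whole circles, so
  \<open>f\<close> itself need not be a finite combination of characters. Rotation symmetry removes
  both difficulties: on one angular mode each circle contributes a single function, and a recurrence
  of order m remains. Its m roots have to be distinct, since a double root would add solutions l *
  mu^l, and nonzero, since a root 0 would add finitely supported ones; no characters would supply
  these on every diagonal. The convolution is given by its traces against all trace class
  \<open>B\<close>. Exchanging trace and integral needs an absolutely summable expansion of
  \<open>B\<close> into rank-one operators; both sides then become series of Gaussian integrals of
  \<open>f\<close>. The factor pi compares exp(-|z|^2) dz with \<open>gauss\<close>. That the kernel
  is weak* closed follows because each relation of the recurrence is a pairing with an integrable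
  density.\<close>

lemma lborel_distr_isometry:
  fixes f :: "'a::euclidean_space \<Rightarrow> 'a"
  assumes lin: "linear f" and iso: "\<And>x. norm (f x) = norm x"
  shows "distr lborel borel f = lborel"
proof -
  have [measurable]: "f \<in> borel_measurable borel"
    using lin by (intro borel_measurable_continuous_onI linear_continuous_on)
      (simp add: linear_conv_bounded_linear)
  have bij: "bij f"
  proof -
    have "inj f"
      using lin iso by (simp add: linear_injective_0) (metis norm_eq_zero)
    then show ?thesis
      using lin by (simp add: bij_def linear_inj_imp_surj)
  qed
  let ?N = "distr lborel borel f"
  \<comment> \<open>By uniqueness of Haar measure the image measure is a multiple of
    \<open>lborel\<close>. The unit ball fixes the multiple, being its own preimage under
    \<open>f\<close>; it is also symmetric, which the double integral uses.\<close>
  define B where "B = ball (0 :: 'a) 1"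
  have [measurable]: "B \<in> sets borel"
    by (simp add: B_def)
  have N_ball: "emeasure ?N B = emeasure lborel B"
    by (subst emeasure_distr) (auto simp: iso B_def intro!: arg_cong[where f = "emeasure lborel"])
  have N_finite: "sigma_finite_measure ?N"
  proof (rule sigma_finite_measure.intro)
    let ?A = "range (\<lambda>n::nat. ball 0 (real n) :: 'a set)"
    have "emeasure ?N (ball 0 (real n)) \<noteq> \<infinity>" for n
    proof -
      have "f -` ball 0 (real n) = ball 0 (real n)"
        by (auto simp: iso)
      then show ?thesis
        using emeasure_bounded_finite[of "ball 0 (real n) :: 'a set"] by (subst emeasure_distr) auto
    qed
    moreover have "\<Union>?A = space ?N"
      using reals_Archimedean2 by (fastforce simp: dist_norm)
    ultimately show "\<exists>A. countable A \<and> A \<subseteq> sets ?N \<and> \<Union>A = space ?N \<and> (\<forall>a\<in>A. emeasure ?N a \<noteq> \<infinity>)"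
      by (intro exI[of _ ?A]) auto
  qed
  interpret N: sigma_finite_measure ?N by (rule N_finite)
  interpret P: pair_sigma_finite ?N "lborel :: 'a measure" ..
  have transl: "(\<integral>\<^sup>+x. g (x + y) \<partial>?N) = (\<integral>\<^sup>+x. g x \<partial>?N)"
    if [measurable]: "g \<in> borel_measurable borel" for g :: "'a \<Rightarrow> ennreal" and y
  proof -
    obtain y' where y': "y = f y'"
      using bij by (metis bij_pointE)
    have "(\<integral>\<^sup>+x. g (x + y) \<partial>?N) = (\<integral>\<^sup>+x. g (f (y' + x)) \<partial>lborel)"
      by (subst nn_integral_distr) (simp_all add: linear_add[OF lin] y' add.commute)
    also have "\<dots> = (\<integral>\<^sup>+x. g (f x) \<partial>distr lborel borel ((+) y'))"
      by (subst nn_integral_distr) simp_all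
    also have "\<dots> = (\<integral>\<^sup>+x. g x \<partial>?N)"
      unfolding lborel_distr_plus by (subst nn_integral_distr) simp_all
    finally show ?thesis .
  qed
  have transl': "(\<integral>\<^sup>+x. g (x + y) \<partial>lborel) = (\<integral>\<^sup>+x. g x \<partial>lborel)"
    if [measurable]: "g \<in> borel_measurable borel" for g :: "'a \<Rightarrow> ennreal" and y
  proof -
    have "(\<integral>\<^sup>+x. g x \<partial>lborel) = (\<integral>\<^sup>+x. g x \<partial>distr lborel borel ((+) y))"
      by (simp add: lborel_distr_plus)
    also have "\<dots> = (\<integral>\<^sup>+x. g (x + y) \<partial>lborel)"
      by (subst nn_integral_distr) (simp_all add: add.commute)
    finally show ?thesis by simp
  qed
  have eq: "emeasure ?N A = emeasure lborel A" if [measurable]: "A \<in> sets borel" for A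
  proof -
    \<comment> \<open>Haar uniqueness: integrate \<open>indicator A x * indicator B (y - x)\<close>
      over both variables. Invariance of one measure at a time, with Fubini in between, exchanges
      the roles of \<open>?N\<close> and \<open>lborel\<close>.\<close>
    have "emeasure ?N A * emeasure lborel B = (\<integral>\<^sup>+x. indicator A x * emeasure lborel B \<partial>?N)"
      by (simp add: nn_integral_multc)
    also have "\<dots> = (\<integral>\<^sup>+x. (\<integral>\<^sup>+y. indicator A x * indicator B (y + - x) \<partial>lborel) \<partial>?N)"
    proof (rule nn_integral_cong)
      fix x :: 'a
      have "(\<integral>\<^sup>+y. indicator B (y + - x) \<partial>lborel) = emeasure lborel B"
        using transl'[OF borel_measurable_indicator, of B "- x"] by simp
      moreover have "(\<lambda>y. indicator B (y + - x) :: ennreal) \<in> borel_measurable lborel"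
        by measurable
      ultimately show "indicator A x * emeasure lborel B = (\<integral>\<^sup>+y. indicator A x * indicator B (y + - x) \<partial>lborel)"
        by (simp add: nn_integral_cmult)
    qed
    also have "\<dots> = (\<integral>\<^sup>+y. (\<integral>\<^sup>+x. indicator A x * indicator B (y + - x) \<partial>?N) \<partial>lborel)"
      by (rule P.Fubini'[symmetric]) measurable
    also have "\<dots> = (\<integral>\<^sup>+y. (\<integral>\<^sup>+x. indicator A (x + y) * indicator B (- x) \<partial>?N) \<partial>lborel)"
    proof (rule nn_integral_cong)
      fix y
      show "(\<integral>\<^sup>+x. indicator A x * indicator B (y + - x) \<partial>?N) = (\<integral>\<^sup>+x. indicator A (x + y) * indicator B (- x) \<partial>?N)"
        using transl[of "\<lambda>x. indicator A x * indicator B (y + - x)" y] by simp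
    qed
    also have "\<dots> = (\<integral>\<^sup>+x. (\<integral>\<^sup>+y. indicator A (x + y) * indicator B (- x) \<partial>lborel) \<partial>?N)"
      by (rule P.Fubini') measurable
    also have "\<dots> = (\<integral>\<^sup>+x. emeasure lborel A * indicator B x \<partial>?N)"
    proof (rule nn_integral_cong)
      fix x :: 'a
      have "(\<integral>\<^sup>+y. indicator A (x + y) \<partial>lborel) = emeasure lborel A"
        using transl'[of "indicator A" x] by (simp add: add.commute)
      then show "(\<integral>\<^sup>+y. indicator A (x + y) * indicator B (- x) \<partial>lborel) = emeasure lborel A * indicator B x"
        by (subst nn_integral_multc) (simp_all add: indicator_def B_def)
    qed
    also have "\<dots> = emeasure lborel A * emeasure lborel B"
      by (simp add: nn_integral_cmult N_ball)
    finally have "emeasure ?N A * emeasure lborel B = emeasure lborel A * emeasure lborel B" .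
    moreover have "emeasure lborel B = ennreal (unit_ball_vol (DIM('a)))"
      by (simp add: B_def emeasure_ball)
    moreover have "unit_ball_vol (DIM('a)) > 0"
      by simp
    ultimately show ?thesis
      by (simp add: mult_right_ennreal_cancel)
  qed
  show ?thesis
    by (rule measure_eqI) (simp_all add: eq)
qed

text \<open>A substitute for polar coordinates: the disc of radius sqrt a has area pi * a, so the
  image of Lebesgue measure under |z|^2 and pi times Lebesgue measure on the half line agree on a
  generating family of sets.\<close>

lemma nn_integral_lborel_norm_squared:
  assumes [measurable]: "h \<in> borel_measurable borel"
  shows "(\<integral>\<^sup>+(z::complex). h ((cmod z)\<^sup>2) \<partial>lborel) = ennreal pi * (\<integral>\<^sup>+x. h x * indicator {0..} x \<partial>lborel)"
proof -
  let ?D = "density lborel (\<lambda>x::real. ennreal pi * indicator {0..} x)"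
  let ?E = "range (atMost :: real \<Rightarrow> real set)"
  have em: "emeasure (distr lborel borel (\<lambda>z::complex. (cmod z)\<^sup>2)) {..a} = ennreal pi * emeasure lborel {0..a}" for a
  proof (cases "a \<ge> 0")
    case True
    have "(\<lambda>z::complex. (cmod z)\<^sup>2) -` {..a} \<inter> space lborel = cball 0 (sqrt a)"
      using real_le_rsqrt real_le_lsqrt True
      by (auto simp: dist_norm) (metis norm_ge_zero power_mono real_sqrt_pow2)
    then show ?thesis
      using True by (simp add: emeasure_distr emeasure_cball unit_ball_vol_2 ennreal_mult)
  next
    case False
    then have "(\<lambda>z::complex. (cmod z)\<^sup>2) -` {..a} \<inter> space lborel = {}"
      by auto (metis order.trans zero_le_power2)
    then show ?thesis
      using False by (simp add: emeasure_distr)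
  qed
  have em': "emeasure ?D {..a} = ennreal pi * emeasure lborel {0..a}" for a
  proof -
    have "emeasure ?D {..a} = (\<integral>\<^sup>+x. ennreal pi * indicator {0..a} x \<partial>lborel)"
      by (subst emeasure_density) (auto intro!: nn_integral_cong split: split_indicator)
    then show ?thesis
      by (simp add: nn_integral_cmult)
  qed
  have eq: "distr lborel borel (\<lambda>z::complex. (cmod z)\<^sup>2) = ?D"
  proof (rule measure_eqI_generator_eq_countable[where E = ?E and \<Omega> = UNIV and A = "range (\<lambda>n::nat. {..real n})"])
    show "Int_stable ?E"
      by (auto simp: Int_stable_def)
    show "sets (distr lborel borel (\<lambda>z::complex. (cmod z)\<^sup>2)) = sigma_sets UNIV ?E"
      "sets ?D = sigma_sets UNIV ?E"
      unfolding sets_distr sets_density sets_lborel by (subst borel_eq_atMost, rule sets_measure_of, simp)+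
    show "\<Union> (range (\<lambda>n::nat. {..real n})) = UNIV"
      using real_arch_simple by auto
    show "emeasure (distr lborel borel (\<lambda>z::complex. (cmod z)\<^sup>2)) a \<noteq> \<infinity>"
      if "a \<in> range (\<lambda>n::nat. {..real n})" for a
      using that by (auto simp: em ennreal_mult_eq_top_iff emeasure_lborel_Icc_eq)
  qed (auto simp: em em')
  have "(\<integral>\<^sup>+(z::complex). h ((cmod z)\<^sup>2) \<partial>lborel) = (\<integral>\<^sup>+x. h x \<partial>distr lborel borel (\<lambda>z::complex. (cmod z)\<^sup>2))"
    by (subst nn_integral_distr) simp_all
  also have "\<dots> = (\<integral>\<^sup>+x. ennreal pi * (h x * indicator {0..} x) \<partial>lborel)"
    unfolding eq by (subst nn_integral_density) (auto simp: ac_simps)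
  finally show ?thesis
    by (simp add: nn_integral_cmult)
qed

lemma space_gauss [simp]: "space gauss = UNIV"
  and sets_gauss [simp, measurable_cong]: "sets gauss = sets borel"
  by (simp_all add: gauss_def)

lemma measurable_gauss [simp]: "borel_measurable gauss = borel_measurable borel"
  "measurable gauss borel = measurable borel borel"
  by (auto intro!: measurable_cong_sets)

lemma nn_integral_gauss:
  assumes [measurable]: "f \<in> borel_measurable borel"
  shows "(\<integral>\<^sup>+z. f z \<partial>gauss) = (\<integral>\<^sup>+z. ennreal (exp (- (cmod z)\<^sup>2) / pi) * f z \<partial>lborel)"
  unfolding gauss_def by (subst nn_integral_density) simp_all

text \<open>Under \<open>gauss\<close> the variable |z|^2 is exponentially distributed with mean 1,
  and its moments are the factorials.\<close>

lemma nn_integral_gauss_power: "(\<integral>\<^sup>+z. ennreal ((cmod z) ^ (2 * n)) \<partial>gauss) = ennreal (fact n)"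
proof -
  have "(\<integral>\<^sup>+z. ennreal ((cmod z) ^ (2 * n)) \<partial>gauss)
      = (\<integral>\<^sup>+(z::complex). ennreal (exp (- (cmod z)\<^sup>2) / pi * ((cmod z)\<^sup>2) ^ n) \<partial>lborel)"
    by (subst nn_integral_gauss) (simp_all add: ennreal_mult[symmetric] power_mult)
  also have "\<dots> = ennreal pi * (\<integral>\<^sup>+x. ennreal (exp (- x) / pi * x ^ n) * indicator {0..} x \<partial>lborel)"
    by (rule nn_integral_lborel_norm_squared[where h = "\<lambda>x. ennreal (exp (- x) / pi * x ^ n)"]) simp
  also have "\<dots> = ennreal pi * (\<integral>\<^sup>+x. ennreal (1 / pi) * (ennreal (x ^ n * exp (- x)) * indicator {0..} x) \<partial>lborel)"
    by (intro arg_cong[where f = "\<lambda>x. _ * x"] nn_integral_cong)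
      (auto simp: ennreal_mult[symmetric] split: split_indicator)
  also have "\<dots> = ennreal pi * (ennreal (1 / pi) * real_of_nat (fact n))"
    by (subst nn_integral_cmult) (simp_all add: nn_intergal_power_times_exp_Ici)
  also have "\<dots> = ennreal (pi * (1 / pi * fact n))"
    by (subst ennreal_mult[symmetric]; simp)+
  finally show ?thesis
    by simp
qed

lemma prob_space_gauss: "prob_space gauss"
  using nn_integral_gauss_power[of 0] by (intro prob_spaceI) simp

interpretation gauss: prob_space gauss
  by (rule prob_space_gauss)

lemma integrable_gauss_iff:
  fixes f :: "complex \<Rightarrow> 'a::{banach, second_countable_topology}"
  assumes [measurable]: "f \<in> borel_measurable borel"
  shows "integrable gauss f \<longleftrightarrow> integrable lborel (\<lambda>z. (exp (- (cmod z)\<^sup>2) / pi) *\<^sub>R f z)"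
  unfolding gauss_def by (rule integrable_density) auto

lemma integral_gauss:
  fixes f :: "complex \<Rightarrow> 'a::{banach, second_countable_topology}"
  assumes [measurable]: "f \<in> borel_measurable borel"
  shows "integral\<^sup>L gauss f = (LINT z|lborel. (exp (- (cmod z)\<^sup>2) / pi) *\<^sub>R f z)"
  unfolding gauss_def by (rule integral_density) auto

lemma AE_gauss_iff:
  "(AE z in gauss. P z) \<longleftrightarrow> (AE z in lborel. P z)"
  unfolding gauss_def by (subst AE_density) auto

lemma integral_gauss_norm_power: "(LINT z|gauss. (cmod z) ^ (2 * n)) = fact n"
  using nn_integral_gauss_power[of n] by (subst integral_eq_nn_integral) auto

lemma gauss_rotate:
  assumes "cmod u = 1"
  shows "distr gauss borel ((*) u) = gauss"
proof -
  have "distr lborel borel ((*) u) = (lborel :: complex measure)"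
    by (rule lborel_distr_isometry) (auto simp: norm_mult assms bounded_linear_mult_right bounded_linear.linear)
  then have L: "distr lborel lborel ((*) u) = (lborel :: complex measure)"
    by (metis distr_cong sets_lborel)
  have "gauss = density (distr lborel lborel ((*) u)) (\<lambda>z. ennreal (exp (- (cmod z)\<^sup>2) / pi))"
    by (simp add: L gauss_def)
  also have "\<dots> = distr (density lborel (\<lambda>z. ennreal (exp (- (cmod (u * z))\<^sup>2) / pi))) lborel ((*) u)"
    by (rule density_distr) auto
  also have "\<dots> = distr gauss borel ((*) u)"
    by (simp add: norm_mult assms gauss_def cong: distr_cong)
  finally show ?thesis by simp
qed

lemma integral_gauss_rotate:
  fixes f :: "complex \<Rightarrow> 'a::{banach, second_countable_topology}"
  assumes "cmod u = 1" and [measurable]: "f \<in> borel_measurable borel"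
  shows "(LINT z|gauss. f (u * z)) = integral\<^sup>L gauss f"
proof -
  have "integral\<^sup>L (distr gauss borel ((*) u)) f = (LINT z|gauss. f (u * z))"
    by (rule integral_distr) auto
  then show ?thesis
    by (simp add: gauss_rotate[OF assms(1)])
qed

lemma integrable_gauss_rotate:
  fixes f :: "complex \<Rightarrow> 'a::{banach, second_countable_topology}"
  assumes "cmod u = 1" and "integrable gauss f"
  shows "integrable gauss (\<lambda>z. f (u * z))"
proof -
  have "integrable (distr gauss borel ((*) u)) f"
    using assms by (simp add: gauss_rotate)
  then show ?thesis
    by (subst (asm) integrable_distr_eq) (use assms in auto)
qed

lemma integrable_gauss_exp: "integrable gauss (\<lambda>z. (cmod z) ^ n * exp (R * cmod z))"
proof -
  \<comment> \<open>From x^n <= n! exp x and 2ab <= a^2 + b^2 with a = R + 1 and b = x. The majorant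
    exp(|z|^2 / 2) is still integrable against exp(-|z|^2).\<close>
  define C where "C = fact n * exp ((R + 1)\<^sup>2 / 2)"
  have C: "x ^ n * exp (R * x) \<le> C * exp (x\<^sup>2 / 2)" if "x \<ge> 0" for x :: real
  proof -
    have "x ^ n / fact n \<le> exp x"
      using sum_le_suminf[OF summable_exp[of x], of "{n}"] that
      by (simp add: exp_def divide_inverse mult.commute)
    then have "x ^ n * exp (R * x) \<le> fact n * exp x * exp (R * x)"
      by (simp add: field_simps)
    also have "\<dots> = fact n * exp ((R + 1) * x)"
      by (simp add: algebra_simps exp_add)
    also have "\<dots> \<le> fact n * exp ((R + 1)\<^sup>2 / 2 + x\<^sup>2 / 2)"
    proof -
      have "(R + 1) * x \<le> (R + 1)\<^sup>2 / 2 + x\<^sup>2 / 2"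
        using sum_squares_bound[of "R + 1" x] by linarith
      then show ?thesis by simp
    qed
    finally show ?thesis
      by (simp add: C_def exp_add)
  qed
  have "(\<integral>\<^sup>+z. ennreal (exp ((cmod z)\<^sup>2 / 2)) \<partial>gauss)
      = (\<integral>\<^sup>+(z::complex). ennreal (exp (- ((cmod z)\<^sup>2 / 2)) / pi) \<partial>lborel)"
    by (subst nn_integral_gauss)
      (auto simp: ennreal_mult[symmetric] mult_exp_exp intro!: nn_integral_cong arg_cong[where f = ennreal])
  also have "\<dots> = ennreal pi * (\<integral>\<^sup>+x. ennreal (exp (- (x / 2)) / pi) * indicator {0..} x \<partial>lborel)"
    by (rule nn_integral_lborel_norm_squared[where h = "\<lambda>x. ennreal (exp (- (x / 2)) / pi)"]) simp
  also have "(\<integral>\<^sup>+x. ennreal (exp (- (x / 2)) / pi) * indicator {0..} x \<partial>lborel)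
      = 2 * (\<integral>\<^sup>+x. ennreal (exp (- x) / pi) * indicator {0..} x \<partial>lborel)"
    by (subst nn_integral_real_affine[where c = 2 and t = 0])
      (auto simp: indicator_def zero_le_mult_iff intro!: arg_cong[where f = "\<lambda>x. _ * x"] nn_integral_cong)
  also have "(\<integral>\<^sup>+x. ennreal (exp (- x) / pi) * indicator {0..} x \<partial>lborel)
      = (\<integral>\<^sup>+x. ennreal (1 / pi) * (ennreal (x ^ 0 * exp (- x)) * indicator {0..} x) \<partial>lborel)"
    by (intro nn_integral_cong) (auto simp: ennreal_mult[symmetric] split: split_indicator)
  also have "\<dots> = ennreal (1 / pi)"
    by (subst nn_integral_cmult) (simp_all only: nn_intergal_power_times_exp_Ici, simp_all)
  finally have "(\<integral>\<^sup>+z. ennreal (exp ((cmod z)\<^sup>2 / 2)) \<partial>gauss) < \<infinity>"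
    by (simp add: ennreal_mult_less_top)
  then have "integrable gauss (\<lambda>z. exp ((cmod z)\<^sup>2 / 2))"
    by (intro integrableI_bounded) auto
  then have "integrable gauss (\<lambda>z. C * exp ((cmod z)\<^sup>2 / 2))"
    by simp
  then show ?thesis
  proof (rule Bochner_Integration.integrable_bound)
    show "AE z in gauss. norm (cmod z ^ n * exp (R * cmod z)) \<le> norm (C * exp ((cmod z)\<^sup>2 / 2))"
      using C by (intro AE_I2) (simp add: order.trans[OF C abs_ge_self])
  qed simp
qed

lemma measure_gauss_UNIV [simp]: "measure gauss UNIV = 1"
  using gauss.prob_space by simp

lemma borel_measurable_cnj [measurable (raw)]:
  "f \<in> borel_measurable M \<Longrightarrow> (\<lambda>x. cnj (f x)) \<in> borel_measurable M"
  by (rule measurable_compose[of f M borel cnj borel])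
    (auto intro!: borel_measurable_continuous_onI continuous_intros)

subsection \<open>Uniqueness of Fourier coefficients on the circle\<close>

text \<open>Stated for general measure-preserving maps because it serves both for small translations
  and for rotations near the identity. Density arguments reduce to indicators, outer regularity to
  indicators of open sets, where pointwise convergence is immediate inside the set and preservation
  of measure controls the rest.\<close>

lemma L1_continuity:
  fixes g :: "'a::euclidean_space \<Rightarrow> 'b::{banach, second_countable_topology}"
  assumes T [measurable]: "\<And>n::nat. T n \<in> borel_measurable borel"
    and pres: "\<And>n. distr lborel borel (T n) = lborel"
    and lim: "\<And>z. (\<lambda>n. T n z) \<longlonglongrightarrow> z"
    and g: "integrable lborel g"
  shows "(\<lambda>n. LINT z|lborel. norm (g (T n z) - g z)) \<longlonglongrightarrow> 0"
proof -
  have int_T: "integrable lborel (\<lambda>z. h (T n z))"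
    if h: "integrable lborel h" for h :: "'a \<Rightarrow> 'c::{banach, second_countable_topology}" and n
  proof -
    have "integrable (distr lborel borel (T n)) h"
      using h by (simp add: pres)
    then show ?thesis
      using h by (subst (asm) integrable_distr_eq) auto
  qed
  have lint_T: "(LINT z|lborel. h (T n z)) = integral\<^sup>L lborel h"
    if h: "integrable lborel h" for h :: "'a \<Rightarrow> 'c::{banach, second_countable_topology}" and n
  proof -
    have "integral\<^sup>L (distr lborel borel (T n)) h = (LINT z|lborel. h (T n z))"
      using h by (intro integral_distr) auto
    then show ?thesis
      by (simp add: pres)
  qed
  \<comment> \<open>The error \<open>f - s\<close> enters twice, once moved by \<open>T n\<close>,
    and moving does not change its integral.\<close>
  have approx: "(LINT z|lborel. norm (f (T n z) - f z))
      \<le> (LINT z|lborel. norm (s (T n z) - s z)) + 2 * (LINT z|lborel. norm (f z - s z))"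
    if f: "integrable lborel f" and s: "integrable lborel s" for f s :: "'a \<Rightarrow> 'c::{banach, second_countable_topology}" and n
  proof -
    note [simp] = int_T[OF f] int_T[OF s] f s
    have i: "integrable lborel (\<lambda>z. norm (f z - s z))"
      by simp
    have "(LINT z|lborel. norm (f (T n z) - f z))
        \<le> (LINT z|lborel. norm (s (T n z) - s z) + (norm (f (T n z) - s (T n z)) + norm (f z - s z)))"
    proof (rule integral_mono)
      show "norm (f (T n z) - f z) \<le> norm (s (T n z) - s z) + (norm (f (T n z) - s (T n z)) + norm (f z - s z))" for z
        by norm
    qed simp_all
    also have "\<dots> = (LINT z|lborel. norm (s (T n z) - s z)) + ((LINT z|lborel. norm (f (T n z) - s (T n z))) + (LINT z|lborel. norm (f z - s z)))"
      by (subst Bochner_Integration.integral_add; simp)+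
    also have "(LINT z|lborel. norm (f (T n z) - s (T n z))) = (LINT z|lborel. norm (f z - s z))"
      by (rule lint_T[OF i])
    finally show ?thesis by simp
  qed
  have nonneg: "0 \<le> (LINT z|lborel. norm (f (T n z) - f z))" for f :: "'a \<Rightarrow> 'c::{banach, second_countable_topology}" and n
    by simp
  have limitI: "(\<lambda>n. LINT z|lborel. norm (f (T n z) - f z)) \<longlonglongrightarrow> 0"
    if f: "integrable lborel f"
      and ex: "\<And>e. e > 0 \<Longrightarrow> \<exists>s. integrable lborel s \<and> (LINT z|lborel. norm (f z - s z)) < e \<and>
        (\<lambda>n. LINT z|lborel. norm (s (T n z) - s z)) \<longlonglongrightarrow> 0"
    for f :: "'a \<Rightarrow> 'c::{banach, second_countable_topology}"
  proof (rule LIMSEQ_I)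
    fix e :: real assume "e > 0"
    then obtain s where s: "integrable lborel s" "(LINT z|lborel. norm (f z - s z)) < e / 4"
        "(\<lambda>n. LINT z|lborel. norm (s (T n z) - s z)) \<longlonglongrightarrow> 0"
      using ex[of "e / 4"] by auto
    obtain N where N: "\<And>n. n \<ge> N \<Longrightarrow> norm ((LINT z|lborel. norm (s (T n z) - s z)) - 0) < e / 4"
      using LIMSEQ_D[OF s(3), of "e / 4"] \<open>e > 0\<close> by auto
    have "norm ((LINT z|lborel. norm (f (T n z) - f z)) - 0) < e" if "n \<ge> N" for n
    proof -
      have "(LINT z|lborel. norm (s (T n z) - s z)) < e / 4"
        using N[OF that] by simp
      then have "(LINT z|lborel. norm (f (T n z) - f z)) < e"
        using approx[OF f s(1), of n] s(2) \<open>e > 0\<close> by linarith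
      then show ?thesis by simp
    qed
    then show "\<exists>N. \<forall>n\<ge>N. norm ((LINT z|lborel. norm (f (T n z) - f z)) - 0) < e"
      by blast
  qed
  have open_lim: "(\<lambda>n. LINT z|lborel. norm (indicat_real U (T n z) - indicator U z)) \<longlonglongrightarrow> 0"
    if U: "open U" "emeasure lborel U < \<infinity>" for U
  proof -
    have [measurable]: "U \<in> sets borel"
      using U by simp
    have i: "integrable lborel (indicat_real U)"
      using U by simp
    note iT = int_T[OF i]
    have iprod: "integrable lborel (\<lambda>z. indicat_real U z * indicator U (T n z))" for n
      by (rule Bochner_Integration.integrable_bound[OF i]) (auto split: split_indicator)
    \<comment> \<open>After integration the moved indicator has the same mass as the original, so
      only the product of the two matters. It is supported in \<open>U\<close>, where openness makes
      \<open>T n z\<close> eventually stay.\<close>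
    have "(LINT z|lborel. norm (indicat_real U (T n z) - indicator U z))
        = (LINT z|lborel. indicat_real U (T n z) + indicator U z - 2 * (indicator U z * indicator U (T n z)))" for n
      by (intro Bochner_Integration.integral_cong) (auto split: split_indicator)
    also have "\<dots> n = 2 * (integral\<^sup>L lborel (indicat_real U) - (LINT z|lborel. indicat_real U z * indicator U (T n z)))" for n
      using i iT[of n] iprod[of n] lint_T[OF i, of n] by simp
    finally have eq: "(LINT z|lborel. norm (indicat_real U (T n z) - indicator U z))
        = 2 * (integral\<^sup>L lborel (indicat_real U) - (LINT z|lborel. indicat_real U z * indicator U (T n z)))" for n .
    have "(\<lambda>n. LINT z|lborel. indicat_real U z * indicator U (T n z)) \<longlonglongrightarrow> integral\<^sup>L lborel (indicat_real U)"
    proof (rule integral_dominated_convergence[where w = "indicat_real U"])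
      show "AE z in lborel. (\<lambda>n. indicat_real U z * indicator U (T n z)) \<longlonglongrightarrow> indicat_real U z"
      proof (rule AE_I2)
        fix z
        show "(\<lambda>n. indicat_real U z * indicator U (T n z)) \<longlonglongrightarrow> indicat_real U z"
        proof (cases "z \<in> U")
          case True
          then have "\<forall>\<^sub>F n in sequentially. T n z \<in> U"
            using lim[of z] U(1) by (auto simp: tendsto_def)
          then have "\<forall>\<^sub>F n in sequentially. indicat_real U z * indicator U (T n z) = indicat_real U z"
            by eventually_elim (use True in auto)
          then show ?thesis
            by (rule tendsto_eventually)
        qed simp
      qed
    qed (use i in \<open>auto split: split_indicator\<close>)
    then have "(\<lambda>n. 2 * (integral\<^sup>L lborel (indicat_real U) - (LINT z|lborel. indicat_real U z * indicator U (T n z))))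
        \<longlonglongrightarrow> 2 * (integral\<^sup>L lborel (indicat_real U) - integral\<^sup>L lborel (indicat_real U))"
      by (intro tendsto_intros)
    then show ?thesis
      unfolding eq by simp
  qed
  have ind_lim: "(\<lambda>n. LINT z|lborel. norm (indicat_real A (T n z) - indicator A z)) \<longlonglongrightarrow> 0"
    if A: "A \<in> sets lborel" "emeasure lborel A < \<infinity>" for A
  proof (rule limitI)
    show iA: "integrable lborel (indicat_real A)"
      using A by simp
    fix e :: real assume e: "e > 0"
    obtain U where U: "open U" "A \<subseteq> U" "emeasure lborel (U - A) < e"
      using outer_regular_lborel[of A e] A e by auto
    have [measurable]: "U \<in> sets borel" "A \<in> sets borel"
      using U A by auto
    have "emeasure lborel U \<le> emeasure lborel A + emeasure lborel (U - A)"
      using U by (subst plus_emeasure) (auto intro!: emeasure_mono)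
    also have "\<dots> < \<infinity>"
      using A U(3) by (auto simp: less_top[symmetric])
    finally have Ufin: "emeasure lborel U < \<infinity>" .
    have iUA: "integrable lborel (indicat_real (U - A))"
      using less_trans[OF U(3) ennreal_less_top] by simp
    have "(LINT z|lborel. norm (indicat_real A z - indicator U z)) = (LINT z|lborel. indicat_real (U - A) z)"
      using U by (intro Bochner_Integration.integral_cong) (auto split: split_indicator)
    also have "\<dots> = measure lborel (U - A)"
      by simp
    also have "\<dots> < e"
    proof -
      have "emeasure lborel (U - A) = ennreal (measure lborel (U - A))"
        using less_trans[OF U(3) ennreal_less_top] by (intro emeasure_eq_ennreal_measure) auto
      then show ?thesis
        using U(3) by (simp add: ennreal_less_iff)
    qed
    finally show "\<exists>s. integrable lborel s \<and> (LINT z|lborel. norm (indicat_real A z - s z)) < e \<and>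
        (\<lambda>n. LINT z|lborel. norm (s (T n z) - s z)) \<longlonglongrightarrow> 0"
      using Ufin U(1) open_lim[OF U(1) Ufin] by (intro exI[of _ "indicat_real U"]) auto
  qed
  show ?thesis
    using g
  proof (induction rule: integrable_induct)
    case (base A c)
    have "(LINT z|lborel. norm (indicat_real A (T n z) *\<^sub>R c - indicator A z *\<^sub>R c))
        = (LINT z|lborel. norm (indicat_real A (T n z) - indicator A z)) * norm c" for n
      by (simp flip: scaleR_diff_left)
    then show ?case
      using tendsto_mult_left_zero[OF ind_lim[OF base]] by simp
  next
    case (add f s)
    note [simp] = int_T[OF add.hyps(1)] int_T[OF add.hyps(2)] add.hyps
    have le: "(LINT z|lborel. norm (f (T n z) + s (T n z) - (f z + s z)))
        \<le> (LINT z|lborel. norm (f (T n z) - f z)) + (LINT z|lborel. norm (s (T n z) - s z))" for n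
    proof -
      have "(LINT z|lborel. norm (f (T n z) + s (T n z) - (f z + s z)))
          \<le> (LINT z|lborel. norm (f (T n z) - f z) + norm (s (T n z) - s z))"
        by (rule integral_mono) (simp_all add: norm_diff_triangle_ineq)
      then show ?thesis
        by simp
    qed
    show ?case
      by (rule tendsto_sandwich[OF _ _ tendsto_const tendsto_add_zero[OF add.IH]])
        (auto intro!: always_eventually le)
  next
    case (lim f s)
    have approx_lim: "(\<lambda>i. LINT z|lborel. norm (f z - s i z)) \<longlonglongrightarrow> (LINT z::'a|lborel. 0)"
    proof (rule integral_dominated_convergence[where w = "\<lambda>z. 3 * norm (f z)"])
      show "AE z in lborel. (\<lambda>i. norm (f z - s i z)) \<longlonglongrightarrow> 0"
        using lim.hyps(2) by (auto intro!: AE_I2 tendsto_eq_intros)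
      show "AE z in lborel. norm (norm (f z - s i z)) \<le> 3 * norm (f z)" for i
      proof (rule AE_I2)
        fix z
        show "norm (norm (f z - s i z)) \<le> 3 * norm (f z)"
          using norm_triangle_ineq4[of "f z" "s i z"] lim.hyps(3)[of z i] by simp
      qed
    qed (use lim.hyps in auto)
    show ?case
    proof (rule limitI[OF lim.hyps(4)])
      fix e :: real assume "e > 0"
      then obtain i where "norm ((LINT z|lborel. norm (f z - s i z)) - 0) < e"
        using LIMSEQ_D[OF approx_lim, of e] by auto
      then show "\<exists>s. integrable lborel s \<and> (LINT z|lborel. norm (f z - s z)) < e \<and>
          (\<lambda>n. LINT z|lborel. norm (s (T n z) - s z)) \<longlonglongrightarrow> 0"
        using lim.hyps(1) lim.IH by (intro exI[of _ "s i"]) auto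
    qed
  qed
qed


text \<open>Normalised arc length on the unit circle, parametrised by the angle.\<close>

definition circ :: "real measure" where
  "circ = density lborel (\<lambda>t. ennreal (indicator {- pi..pi} t / (2 * pi)))"

lemma space_circ [simp]: "space circ = UNIV"
  and sets_circ [simp, measurable_cong]: "sets circ = sets borel"
  by (simp_all add: circ_def)

lemma prob_space_circ: "prob_space circ"
proof (rule prob_spaceI)
  have "emeasure circ (space circ) = (\<integral>\<^sup>+t. ennreal (1 / (2 * pi)) * indicator {- pi..pi} t \<partial>lborel)"
    by (simp add: circ_def emeasure_density) (auto intro!: nn_integral_cong split: split_indicator)
  also have "\<dots> = 1"
    by (simp add: nn_integral_cmult ennreal_mult[symmetric])
  finally show "emeasure circ (space circ) = 1" .
qed

interpretation circ: prob_space circ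
  by (rule prob_space_circ)

lemma measure_circ_UNIV [simp]: "measure circ UNIV = 1"
  using circ.prob_space by simp

lemma integrable_circ:
  fixes h :: "real \<Rightarrow> complex"
  assumes [measurable]: "h \<in> borel_measurable borel" and "\<And>t. cmod (h t) \<le> B"
  shows "integrable circ h"
  by (rule circ.integrable_const_bound[of _ B]) (use assms in auto)

lemma integral_circ:
  fixes h :: "real \<Rightarrow> complex"
  assumes [measurable]: "h \<in> borel_measurable borel"
  shows "integral\<^sup>L circ h = (LINT t:{- pi..pi}|lborel. h t) / (2 * pi)"
proof -
  have "integral\<^sup>L circ h = (LINT t|lborel. (indicator {- pi..pi} t / (2 * pi)) *\<^sub>R h t)"
    unfolding circ_def by (rule integral_density) auto
  also have "\<dots> = (LINT t|lborel. (indicator {- pi..pi} t *\<^sub>R h t) / (2 * pi))"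
    by (intro Bochner_Integration.integral_cong) (auto simp: scaleR_conv_of_real)
  finally show ?thesis
    by (simp add: set_lebesgue_integral_def)
qed

lemma integral_circ_cis: "(LINT t|circ. cis (of_int n * t)) = (if n = 0 then 1 else 0)"
proof (cases "n = 0")
  case False
  have meas: "(\<lambda>t. cis (of_int n * t)) \<in> borel_measurable borel"
    by (intro borel_measurable_continuous_onI continuous_intros)
  define F where "F t = cis (of_int n * t) / (\<i> * of_int n)" for t
  have "((\<lambda>t. cis (of_int n * t)) has_integral F pi - F (- pi)) {- pi..pi}"
  proof (rule fundamental_theorem_of_calculus)
    fix t
    have "((\<lambda>z. exp (\<i> * (of_int n * z)) / (\<i> * of_int n)) has_field_derivative exp (\<i> * (of_int n * of_real t))) (at (of_real t))"
      using False by (auto intro!: derivative_eq_intros simp: mult.left_commute[of \<i>])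
    then have "((\<lambda>t. exp (\<i> * (of_int n * of_real t)) / (\<i> * of_int n)) has_vector_derivative exp (\<i> * (of_int n * of_real t))) (at t within {- pi..pi})"
      by (rule has_vector_derivative_real_field)
    then show "(F has_vector_derivative cis (of_int n * t)) (at t within {- pi..pi})"
      by (simp add: F_def[abs_def] cis_conv_exp)
  qed simp
  moreover have "F pi = F (- pi)"
  proof -
    have "sin (of_int n * pi) = 0"
      by (auto simp: sin_zero_iff_int2)
    then have "cis (of_int n * - pi) = cis (of_int n * pi)"
      by (simp add: complex_eq_iff)
    then show ?thesis
      by (simp only: F_def)
  qed
  ultimately have "((\<lambda>t. cis (of_int n * t)) has_integral 0) {- pi..pi}"
    by simp
  moreover have "set_integrable lborel {- pi..pi} (\<lambda>t. cis (of_int n * t))"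
    unfolding set_integrable_def by (intro borel_integrable_compact continuous_intros) simp
  ultimately have "(LINT t:{- pi..pi}|lborel. cis (of_int n * t)) = 0"
    by (simp add: set_borel_integral_eq_integral integral_unique)
  then show ?thesis
    using False by (simp add: integral_circ meas)
qed simp

lemma zero_if_AE_zero:
  fixes h :: "'a::euclidean_space \<Rightarrow> 'b::real_normed_vector"
  assumes "continuous_on UNIV h" "AE z in lborel. h z = 0"
  shows "h z = 0"
proof -
  have "closed {z. h z = 0}"
    by (rule closed_Collect_eq) (use assms in \<open>auto intro: continuous_intros\<close>)
  moreover have "AE z in lebesgue. z \<in> {z. h z = 0}"
    using assms(2) by (simp add: AE_completion_iff AE_completion)
  ultimately show ?thesis
    using mem_closed_if_AE_lebesgue by blast
qed

text \<open>\<open>circ\<close> sees \<open>h\<close> only on [-pi, pi], but 0 is an interior point,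
  so continuity applies there. Angle 0 is the point 1 of the circle.\<close>

lemma zero_if_integral_circ_norm_zero:
  fixes h :: "real \<Rightarrow> complex"
  assumes cont: "continuous_on UNIV h" and bound: "\<And>t. cmod (h t) \<le> B"
    and zero: "(LINT t|circ. cmod (h t)) = 0"
  shows "h 0 = 0"
proof -
  have [measurable]: "h \<in> borel_measurable borel"
    using cont by (rule borel_measurable_continuous_onI)
  have "integrable circ (\<lambda>t. cmod (h t))"
    using integrable_circ[of h B] bound by auto
  then have "AE t in circ. cmod (h t) = 0"
    using zero by (subst (asm) integral_nonneg_eq_0_iff_AE) auto
  then have "AE t in lborel. t \<in> {- pi..pi} \<longrightarrow> h t = 0"
    unfolding circ_def by (subst (asm) AE_density) (auto simp: indicator_def elim!: eventually_mono)
  then have "AE t in lebesgue. t \<in> {- pi<..<pi} \<longrightarrow> t \<in> {t. h t = 0}"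
    by (intro AE_completion) (auto elim!: eventually_mono)
  moreover have "closed {t. h t = 0}"
    by (rule closed_Collect_eq) (use cont in \<open>auto intro: continuous_intros\<close>)
  ultimately show ?thesis
    using mem_closed_if_AE_lebesgue_open[of "{- pi<..<pi}" "{t. h t = 0}" 0] by auto
qed

text \<open>The function is orthogonal to all trigonometric polynomials, and by Stone-Weierstrass
  these approximate its own conjugate uniformly; hence its mean square vanishes.\<close>

lemma Fourier_uniqueness:
  fixes \<psi> :: "complex \<Rightarrow> complex"
  assumes cont: "continuous_on (sphere 0 1) \<psi>"
    and zero: "\<And>n::int. (LINT t|circ. \<psi> (cis t) * cis (- (of_int n * t))) = 0"
  shows "\<psi> 1 = 0"
proof -
  have cont_circle: "continuous_on UNIV (\<lambda>t. f (cis t))"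
    if "continuous_on (sphere 0 1) f" for f :: "complex \<Rightarrow> complex"
    by (rule continuous_on_compose2[OF that]) (auto intro!: continuous_intros)
  have bound_circle: "\<exists>B. \<forall>t. cmod (f (cis t)) \<le> B"
    if "continuous_on (sphere 0 1) f" for f :: "complex \<Rightarrow> complex"
  proof -
    have "bounded (f ` sphere 0 1)"
      using that by (intro compact_imp_bounded compact_continuous_image) auto
    then show ?thesis
      by (fastforce simp: bounded_iff)
  qed
  obtain B where B: "\<And>t. cmod (\<psi> (cis t)) \<le> B"
    using bound_circle[OF cont] by blast
  have B0: "B \<ge> 0"
    using norm_ge_zero order.trans B by blast
  have [measurable]: "(\<lambda>t. \<psi> (cis t)) \<in> borel_measurable borel"
    using cont_circle[OF cont] by (rule borel_measurable_continuous_onI)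
  have [measurable]: "(\<lambda>t. cis (c * t)) \<in> borel_measurable borel" for c
    by (intro borel_measurable_continuous_onI continuous_intros)
  \<comment> \<open>Multipliers that keep all Fourier coefficients zero. Demanding every frequency
    \<open>n\<close> at once makes \<open>K\<close> stable under multiplication by
    \<open>cis\<close>, which is what an induction over polynomial functions needs.\<close>
  define K where "K = {k :: real \<Rightarrow> complex. k \<in> borel_measurable borel \<and> (\<exists>C. \<forall>t. cmod (k t) \<le> C) \<and>
      (\<forall>n::int. (LINT t|circ. \<psi> (cis t) * k t * cis (of_int n * t)) = 0)}"
  have K_int: "integrable circ (\<lambda>t. \<psi> (cis t) * k t * cis (of_int n * t))"
    if k: "k \<in> K" for k n
  proof -
    obtain C where C: "\<And>t. cmod (k t) \<le> C"
      using k by (auto simp: K_def)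
    have [measurable]: "k \<in> borel_measurable borel"
      using k by (simp add: K_def)
    show ?thesis
      by (rule integrable_circ[where B = "B * C"]) (auto simp: norm_mult intro!: mult_mono B C B0)
  qed
  have K_1: "(\<lambda>t. 1) \<in> K"
    using zero[of "- n" for n] by (auto simp: K_def)
  have K_add: "(\<lambda>t. k t + k' t) \<in> K" if k: "k \<in> K" "k' \<in> K" for k k'
  proof -
    obtain C C' where "\<And>t. cmod (k t) \<le> C" "\<And>t. cmod (k' t) \<le> C'"
      using k by (auto simp: K_def)
    then have "cmod (k t + k' t) \<le> C + C'" for t
      by (meson add_mono norm_triangle_le)
    moreover have "(LINT t|circ. \<psi> (cis t) * (k t + k' t) * cis (of_int n * t)) = 0" for n
    proof -
      have "(LINT t|circ. \<psi> (cis t) * (k t + k' t) * cis (of_int n * t))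
          = (LINT t|circ. \<psi> (cis t) * k t * cis (of_int n * t) + \<psi> (cis t) * k' t * cis (of_int n * t))"
        by (simp add: algebra_simps)
      also have "\<dots> = 0"
        using k K_int[OF k(1)] K_int[OF k(2)] by (simp add: K_def)
      finally show ?thesis .
    qed
    ultimately show ?thesis
      using k by (auto simp: K_def)
  qed
  have K_cmult: "(\<lambda>t. c * k t) \<in> K" if k: "k \<in> K" for k c
  proof -
    obtain C where "\<And>t. cmod (k t) \<le> C"
      using k by (auto simp: K_def)
    then have "cmod (c * k t) \<le> cmod c * C" for t
      by (simp add: norm_mult mult_left_mono)
    moreover have "(LINT t|circ. \<psi> (cis t) * (c * k t) * cis (of_int n * t)) = 0" for n
    proof -
      have "(LINT t|circ. \<psi> (cis t) * (c * k t) * cis (of_int n * t))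
          = (LINT t|circ. c * (\<psi> (cis t) * k t * cis (of_int n * t)))"
        by (simp add: algebra_simps)
      also have "\<dots> = 0"
        using k by (simp add: K_def)
      finally show ?thesis .
    qed
    ultimately show ?thesis
      using k by (auto simp: K_def)
  qed
  have K_cis: "(\<lambda>t. cis (of_int m * t) * k t) \<in> K" if k: "k \<in> K" for k m
  proof -
    have "(LINT t|circ. \<psi> (cis t) * (cis (of_int m * t) * k t) * cis (of_int n * t)) = 0" for n
    proof -
      have "(LINT t|circ. \<psi> (cis t) * (cis (of_int m * t) * k t) * cis (of_int n * t))
          = (LINT t|circ. \<psi> (cis t) * k t * cis (of_int (m + n) * t))"
        by (intro Bochner_Integration.integral_cong) (auto simp: cis_mult algebra_simps)
      also have "\<dots> = 0"
        using k by (simp add: K_def del: of_int_add)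
      finally show ?thesis .
    qed
    then show ?thesis
      using k by (auto simp: K_def norm_mult)
  qed
  have K_poly: "real_polynomial_function r \<Longrightarrow> \<forall>k\<in>K. (\<lambda>t. of_real (r (cis t)) * k t) \<in> K" for r
  proof (induction rule: real_polynomial_function.induct)
    case (linear f)
    interpret f: bounded_linear f by fact
    show ?case
    proof
      fix k assume k: "k \<in> K"
      \<comment> \<open>A real linear form on the plane restricts to the circle as a combination of
        \<open>cis t\<close> and \<open>cis (- t)\<close>.\<close>
      have "of_real (f (cis t)) * k t = (of_real (f 1) / 2 - of_real (f \<i>) * \<i> / 2) * (cis (of_int 1 * t) * k t)
          + (of_real (f 1) / 2 + of_real (f \<i>) * \<i> / 2) * (cis (of_int (-1) * t) * k t)" for t
      proof -
        have "cis t = cos t *\<^sub>R 1 + sin t *\<^sub>R \<i>"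
          by (simp add: complex_eq_iff)
        then have "f (cis t) = cos t * f 1 + sin t * f \<i>"
          by (simp add: f.add f.scaleR)
        then have eq: "of_real (f (cis t)) = (of_real (f 1) / 2 - of_real (f \<i>) * \<i> / 2) * cis t
            + (of_real (f 1) / 2 + of_real (f \<i>) * \<i> / 2) * cis (- t)"
          by (simp add: complex_eq_iff)
        show ?thesis
          unfolding eq by (simp add: algebra_simps)
      qed
      then show "(\<lambda>t. of_real (f (cis t)) * k t) \<in> K"
        using K_add[OF K_cmult[OF K_cis[OF k, of 1]] K_cmult[OF K_cis[OF k, of "-1"]]] by presburger
    qed
  next
    case (const c)
    then show ?case
      using K_cmult by simp
  next
    case (add f g)
    then show ?case
      using K_add by (simp add: distrib_right)
  next
    case (mult f g)
    then show ?case
      by (simp add: mult.assoc)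
  qed
  have small: "(LINT t|circ. cmod (\<psi> (cis t) * cnj (\<psi> (cis t)))) \<le> B * e" if e: "e > 0" for e
  proof -
    have "continuous_on (sphere 0 1) (\<lambda>z. cnj (\<psi> z))"
      using cont by (intro continuous_intros)
    then obtain p :: "complex \<Rightarrow> complex" where p: "polynomial_function p"
      and pe: "\<And>z. z \<in> sphere 0 1 \<Longrightarrow> cmod (cnj (\<psi> z) - p z) < e"
      using Stone_Weierstrass_polynomial_function[of "sphere 0 1" "\<lambda>z. cnj (\<psi> z)" e] e by auto
    have "real_polynomial_function (Re \<circ> p)" "real_polynomial_function (Im \<circ> p)"
      using p bounded_linear_Re bounded_linear_Im unfolding polynomial_function_def by blast+
    note r = this
    have "(\<lambda>t. of_real ((Re \<circ> p) (cis t)) * 1) \<in> K" "(\<lambda>t. of_real ((Im \<circ> p) (cis t)) * 1) \<in> K"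
      by (rule bspec[OF K_poly[OF r(1)] K_1], rule bspec[OF K_poly[OF r(2)] K_1])
    then have "(\<lambda>t. of_real ((Re \<circ> p) (cis t)) * 1 + \<i> * (of_real ((Im \<circ> p) (cis t)) * 1)) \<in> K"
      by (intro K_add K_cmult)
    moreover have "(\<lambda>t. of_real ((Re \<circ> p) (cis t)) * 1 + \<i> * (of_real ((Im \<circ> p) (cis t)) * 1)) = (\<lambda>t. p (cis t))"
      by (auto simp: complex_eq_iff)
    ultimately have pK: "(\<lambda>t. p (cis t)) \<in> K"
      by simp
    have pz: "(LINT t|circ. \<psi> (cis t) * p (cis t)) = 0" "integrable circ (\<lambda>t. \<psi> (cis t) * p (cis t))"
      using pK K_int[OF pK, of 0] by (auto simp: K_def dest: spec[of _ 0])
    have i: "integrable circ (\<lambda>t. \<psi> (cis t) * cnj (\<psi> (cis t)))"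
      by (rule integrable_circ[where B = "B * B"]) (auto simp: norm_mult intro!: mult_mono B B0)
    have "of_real (LINT t|circ. cmod (\<psi> (cis t) * cnj (\<psi> (cis t)))) = (LINT t|circ. \<psi> (cis t) * cnj (\<psi> (cis t)))"
    proof -
      have "of_real (cmod (w * cnj w)) = w * cnj w" for w
        by (simp add: norm_mult complex_norm_square[symmetric] power2_eq_square)
      then show ?thesis
        unfolding integral_complex_of_real[symmetric] by (simp only:)
    qed
    also have "\<dots> = (LINT t|circ. \<psi> (cis t) * cnj (\<psi> (cis t))) - (LINT t|circ. \<psi> (cis t) * p (cis t))"
      by (simp add: pz)
    also have "\<dots> = (LINT t|circ. \<psi> (cis t) * (cnj (\<psi> (cis t)) - p (cis t)))"
      using i pz by (simp add: right_diff_distrib)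
    finally have "cmod (of_real (LINT t|circ. cmod (\<psi> (cis t) * cnj (\<psi> (cis t)))))
        = cmod (LINT t|circ. \<psi> (cis t) * (cnj (\<psi> (cis t)) - p (cis t)))"
      by (rule arg_cong)
    moreover have "(LINT t|circ. cmod (\<psi> (cis t) * cnj (\<psi> (cis t)))) \<ge> 0"
      by (rule Bochner_Integration.integral_nonneg) (rule norm_ge_zero)
    ultimately have eq: "(LINT t|circ. cmod (\<psi> (cis t) * cnj (\<psi> (cis t))))
        = cmod (LINT t|circ. \<psi> (cis t) * (cnj (\<psi> (cis t)) - p (cis t)))"
      by (simp only: norm_of_real abs_of_nonneg)
    have i2: "integrable circ (\<lambda>t. \<psi> (cis t) * (cnj (\<psi> (cis t)) - p (cis t)))"
      using i pz by (simp add: right_diff_distrib)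
    have "cmod (LINT t|circ. \<psi> (cis t) * (cnj (\<psi> (cis t)) - p (cis t))) \<le> (LINT t|circ. B * e)"
    proof (rule order.trans[OF integral_norm_bound integral_mono])
      show "integrable circ (\<lambda>t. cmod (\<psi> (cis t) * (cnj (\<psi> (cis t)) - p (cis t))))"
        using i2 by (rule integrable_norm)
      show "cmod (\<psi> (cis t) * (cnj (\<psi> (cis t)) - p (cis t))) \<le> B * e" for t
        unfolding norm_mult by (intro mult_mono B B0 less_imp_le[OF pe]) auto
    qed simp
    then show ?thesis
      using eq by simp
  qed
  have "(LINT t|circ. cmod (\<psi> (cis t) * cnj (\<psi> (cis t)))) \<le> 0"
  proof (rule field_le_epsilon)
    fix e :: real assume "e > 0"
    \<comment> \<open>Dividing by \<open>B + 1\<close> rather than \<open>B\<close> covers the case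
      \<open>B = 0\<close>.\<close>
    then have "(LINT t|circ. cmod (\<psi> (cis t) * cnj (\<psi> (cis t)))) \<le> B * (e / (B + 1))"
      using B0 by (intro small) auto
    also have "\<dots> \<le> e"
      using \<open>e > 0\<close> B0 by (simp add: field_simps)
    finally show "(LINT t|circ. cmod (\<psi> (cis t) * cnj (\<psi> (cis t)))) \<le> 0 + e" by simp
  qed
  then have "(LINT t|circ. cmod (\<psi> (cis t) * cnj (\<psi> (cis t)))) = 0"
    by (simp add: antisym)
  moreover have "continuous_on UNIV (\<lambda>t. \<psi> (cis t) * cnj (\<psi> (cis t)))"
    by (intro continuous_intros cont_circle[OF cont])
  moreover have "cmod (\<psi> (cis t) * cnj (\<psi> (cis t))) \<le> B * B" for t
    by (auto simp: norm_mult intro!: mult_mono B B0)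
  ultimately have "\<psi> (cis 0) * cnj (\<psi> (cis 0)) = 0"
    using zero_if_integral_circ_norm_zero[of "\<lambda>t. \<psi> (cis t) * cnj (\<psi> (cis t))"] by blast
  then show ?thesis
    by simp
qed

subsection \<open>Complex Hermite polynomials\<close>

text \<open>The Ito polynomials, that is exp(- d/dz d/dcnj z) applied to
  \<open>cnj z ^ p * z ^ q\<close>; the first index counts conjugate factors. Truncated exponents
  are harmless because the binomial coefficient in front is then 0.\<close>

definition hermite :: "nat \<Rightarrow> nat \<Rightarrow> complex \<Rightarrow> complex" where
  "hermite p q z = (\<Sum>j\<le>p. (-1) ^ j * of_nat (fact j * (p choose j) * (q choose j)) * cnj z ^ (p - j) * z ^ (q - j))"

text \<open>Terms beyond min p q vanish, so either index may bound the sum. This exposes the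
  symmetry that the definition hides.\<close>

lemma hermite_altdef:
  assumes "p \<le> N \<or> q \<le> N"
  shows "hermite p q z = (\<Sum>j\<le>N. (-1) ^ j * of_nat (fact j * (p choose j) * (q choose j)) * cnj z ^ (p - j) * z ^ (q - j))"
  unfolding hermite_def
proof (cases "p \<le> N")
  case True
  then show "(\<Sum>j\<le>p. (-1) ^ j * of_nat (fact j * (p choose j) * (q choose j)) * cnj z ^ (p - j) * z ^ (q - j))
      = (\<Sum>j\<le>N. (-1) ^ j * of_nat (fact j * (p choose j) * (q choose j)) * cnj z ^ (p - j) * z ^ (q - j))"
    by (intro sum.mono_neutral_left) auto
next
  case False
  then show "(\<Sum>j\<le>p. (-1) ^ j * of_nat (fact j * (p choose j) * (q choose j)) * cnj z ^ (p - j) * z ^ (q - j))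
      = (\<Sum>j\<le>N. (-1) ^ j * of_nat (fact j * (p choose j) * (q choose j)) * cnj z ^ (p - j) * z ^ (q - j))"
    using assms by (intro sum.mono_neutral_right) auto
qed

lemma cnj_hermite: "cnj (hermite p q z) = hermite q p z"
  unfolding hermite_def[of p] by (subst hermite_altdef[of _ p]) (auto simp: ac_simps)

lemma hermite_0_left [simp]: "hermite 0 q z = z ^ q"
  by (simp add: hermite_def)

lemma hermite_0_right [simp]: "hermite p 0 z = cnj z ^ p"
  by (subst hermite_altdef[of _ 0]) auto

text \<open>Pascal's rule for the binomial of \<open>Suc q\<close>, followed by absorption of
  \<open>Suc j\<close> into the one of \<open>p\<close>. For \<open>p = 0\<close> the truncated
  \<open>p - 1\<close> is multiplied by 0.\<close>

lemma hermite_Suc_right: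
  "hermite p (Suc q) z = z * hermite p q z - of_nat p * hermite (p - 1) q z"
proof -
  define t where "t c j = (-1) ^ j * of_nat (fact j * (p choose j)) * cnj z ^ (p - j) * z ^ (Suc q - j) * (of_nat c :: complex)" for c j
  have t_add: "t (c + d) j = t c j + t d j" for c d j
    by (simp add: t_def algebra_simps)
  have "hermite p (Suc q) z = (\<Sum>j\<le>Suc q. t (Suc q choose j) j)"
    by (subst hermite_altdef[of _ "Suc q"]) (auto simp: t_def ac_simps)
  also have "\<dots> = t 1 0 + (\<Sum>j\<le>q. t (q choose Suc j) (Suc j)) + (\<Sum>j\<le>q. t (q choose j) (Suc j))"
    by (subst sum.atMost_Suc_shift) (simp add: t_add sum.distrib add.commute add.left_commute)
  also have "t 1 0 + (\<Sum>j\<le>q. t (q choose Suc j) (Suc j)) = (\<Sum>j\<le>Suc q. t (q choose j) j)"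
    by (subst sum.atMost_Suc_shift) simp
  also have "\<dots> = (\<Sum>j\<le>q. t (q choose j) j)"
    by (simp add: t_def)
  also have "\<dots> = z * hermite p q z"
    by (subst hermite_altdef[of _ q])
      (auto simp: t_def sum_distrib_left Suc_diff_le ac_simps intro!: sum.cong)
  also have "(\<Sum>j\<le>q. t (q choose j) (Suc j)) = - (of_nat p * hermite (p - 1) q z)"
  proof -
    have "t (q choose j) (Suc j) = - (of_nat p * ((-1) ^ j * of_nat (fact j * (p - 1 choose j) * (q choose j)) * cnj z ^ (p - 1 - j) * z ^ (q - j)))" for j
    proof -
      have "Suc j * (p choose Suc j) = p * (p - 1 choose j)"
        using times_binomial_minus1_eq[of "Suc j" p] by simp
      then have "fact j * (Suc j * (p choose Suc j)) = fact j * (p * (p - 1 choose j))"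
        by (rule arg_cong)
      then have "fact (Suc j) * (p choose Suc j) = p * (fact j * (p - 1 choose j))"
        by (simp only: fact_Suc of_nat_id ac_simps)
      from arg_cong[OF this, of "of_nat :: nat \<Rightarrow> complex"] have eq: "of_nat (fact (Suc j) * (p choose Suc j)) = (of_nat p * of_nat (fact j * (p - 1 choose j)) :: complex)"
        by (simp only: of_nat_mult)
      show ?thesis
        unfolding t_def eq by (simp add: ac_simps)
    qed
    then show ?thesis
      by (subst hermite_altdef[of _ q]) (auto simp: sum_distrib_left sum_negf)
  qed
  finally show ?thesis by simp
qed

lemma hermite_Suc_left:
  "hermite (Suc p) q z = cnj z * hermite p q z - of_nat q * hermite p (q - 1) z"
proof -
  have "cnj (hermite q (Suc p) z) = cnj (z * hermite q p z - of_nat q * hermite (q - 1) p z)"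
    by (simp only: hermite_Suc_right)
  then show ?thesis
    by (simp add: cnj_hermite)
qed

lemma of_nat_binomial_diff:
  "of_nat (n choose r) * of_nat (n - r) = (of_nat n * of_nat (n - 1 choose r) :: complex)"
proof -
  have "(n - r) * (n choose r) = n * (n - 1 choose r)"
    by (rule binomial_absorb_comp)
  from arg_cong[OF this, of "of_nat :: nat \<Rightarrow> complex"] show ?thesis
    by (simp only: of_nat_mult mult.commute)
qed

text \<open>The base case a = 0 of the linearization, where \<open>hermite 0 q\<close> is a power of
  z. Raising \<open>b\<close> acts on each summand by \<open>hermite_Suc_right\<close>, and the
  lowered terms recombine into the same sum for \<open>p - 1\<close>.\<close>

lemma hermite_add_right:
  "(\<Sum>r\<le>p. (-1) ^ r * of_nat (fact r * (p choose r) * (q choose r)) * z ^ (q - r) * hermite (p - r) b z) = hermite p (q + b) z"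
proof (induction b arbitrary: p)
  case 0
  show ?case
    by (simp add: hermite_def[of p] ac_simps)
next
  case (Suc b)
  define t where "t p r = (-1) ^ r * of_nat (fact r * (p choose r) * (q choose r)) * z ^ (q - r) * hermite (p - r) b z" for p r
  have eq: "(-1) ^ r * of_nat (fact r * (p choose r) * (q choose r)) * z ^ (q - r) * hermite (p - r) (Suc b) z
      = z * t p r - of_nat p * t (p - 1) r" for r
  proof -
    have "(-1) ^ r * of_nat (fact r * (p choose r) * (q choose r)) * z ^ (q - r) * hermite (p - r) (Suc b) z
        = z * t p r - (of_nat (p choose r) * of_nat (p - r)) * ((-1) ^ r * of_nat (fact r * (q choose r)) * z ^ (q - r) * hermite (p - r - 1) b z)"
      unfolding hermite_Suc_right t_def by (simp add: algebra_simps)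
    then show ?thesis
      unfolding of_nat_binomial_diff t_def by (simp add: ac_simps)
  qed
  have "(\<Sum>r\<le>p. (-1) ^ r * of_nat (fact r * (p choose r) * (q choose r)) * z ^ (q - r) * hermite (p - r) (Suc b) z)
      = z * (\<Sum>r\<le>p. t p r) - of_nat p * (\<Sum>r\<le>p. t (p - 1) r)"
    by (simp only: eq sum_subtractf sum_distrib_left)
  also have "(\<Sum>r\<le>p. t (p - 1) r) = (\<Sum>r\<le>p - 1. t (p - 1) r)"
    by (intro sum.mono_neutral_right) (auto simp: t_def)
  also have "z * (\<Sum>r\<le>p. t p r) - of_nat p * \<dots> = hermite p (q + Suc b) z"
    using Suc[of p] Suc[of "p - 1"] by (simp add: t_def hermite_Suc_right)
  finally show ?case .
qed

text \<open>A product of two Hermite polynomials expands by contracting indices \<open>a\<close>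
  with \<open>b\<close> and \<open>p\<close> with \<open>q\<close> (Wick's rule). The alternating
  sum on the left cancels every contraction of \<open>p\<close> with \<open>q\<close>, so that only
  those of \<open>a\<close> with \<open>b\<close> survive. With a = b = m the right side has fixed
  coefficients: this is where the recurrence comes from.\<close>

lemma hermite_linearization:
  "(\<Sum>r\<le>p. (-1) ^ r * of_nat (fact r * (p choose r) * (q choose r)) * (hermite a (q - r) z * hermite (p - r) b z))
    = (\<Sum>j\<le>a. of_nat (fact j * (a choose j) * (b choose j)) * hermite (p + a - j) (q + b - j) z)"
proof (induction a arbitrary: q)
  case 0
  then show ?case
    using hermite_add_right[of p q z b] by (simp add: mult.assoc)
next
  case (Suc a)
  define t where "t q r = (-1) ^ r * of_nat (fact r * (p choose r) * (q choose r)) * (hermite a (q - r) z * hermite (p - r) b z)" for q r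
  define u where "u c j = of_nat (fact j * (b choose j)) * hermite (p + Suc a - j) (q + b - j) z * (of_nat c :: complex)" for c j
  have u_add: "u (c + d) j = u c j + u d j" for c d j
    by (simp add: u_def algebra_simps)
  have eq1: "(-1) ^ r * of_nat (fact r * (p choose r) * (q choose r)) * (hermite (Suc a) (q - r) z * hermite (p - r) b z)
      = cnj z * t q r - of_nat q * t (q - 1) r" for r
  proof -
    have "(-1) ^ r * of_nat (fact r * (p choose r) * (q choose r)) * (hermite (Suc a) (q - r) z * hermite (p - r) b z)
        = cnj z * t q r - (of_nat (q choose r) * of_nat (q - r)) * ((-1) ^ r * of_nat (fact r * (p choose r)) * (hermite a (q - r - 1) z * hermite (p - r) b z))"
      unfolding hermite_Suc_left t_def by (simp add: algebra_simps)
    then show ?thesis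
      unfolding of_nat_binomial_diff t_def by (simp add: ac_simps)
  qed
  have "(\<Sum>r\<le>p. (-1) ^ r * of_nat (fact r * (p choose r) * (q choose r)) * (hermite (Suc a) (q - r) z * hermite (p - r) b z))
      = cnj z * (\<Sum>r\<le>p. t q r) - of_nat q * (\<Sum>r\<le>p. t (q - 1) r)"
    by (simp only: eq1 sum_subtractf sum_distrib_left)
  also have "\<dots> = cnj z * (\<Sum>j\<le>a. of_nat (fact j * (a choose j) * (b choose j)) * hermite (p + a - j) (q + b - j) z)
      - of_nat q * (\<Sum>j\<le>a. of_nat (fact j * (a choose j) * (b choose j)) * hermite (p + a - j) (q - 1 + b - j) z)"
    by (simp only: t_def Suc)
  also have "\<dots> = (\<Sum>j\<le>a. of_nat (fact j * (a choose j) * (b choose j)) *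
      (cnj z * hermite (p + a - j) (q + b - j) z - of_nat q * hermite (p + a - j) (q - 1 + b - j) z))"
    by (simp add: sum_subtractf sum_distrib_left algebra_simps)
  also have "\<dots> = (\<Sum>j\<le>a. u (a choose j) j + u (a choose j) (Suc j))"
  proof (intro sum.cong refl)
    fix j assume "j \<in> {..a}"
    show "of_nat (fact j * (a choose j) * (b choose j)) *
      (cnj z * hermite (p + a - j) (q + b - j) z - of_nat q * hermite (p + a - j) (q - 1 + b - j) z)
      = u (a choose j) j + u (a choose j) (Suc j)"
    proof (cases "j \<le> b")
      case True
      have S: "p + Suc a - j = Suc (p + a - j)"
        using \<open>j \<in> {..a}\<close> by auto
      \<comment> \<open>Raising the first index subtracts a multiple \<open>q + b - j\<close>, while
        only \<open>q\<close> is present on the left; the surplus \<open>b - j\<close> feeds the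
        term with one more contraction.\<close>
      have *: "cnj z * hermite (p + a - j) (q + b - j) z - of_nat q * hermite (p + a - j) (q - 1 + b - j) z
          = hermite (p + Suc a - j) (q + b - j) z + of_nat (b - j) * hermite (p + a - j) (q + b - Suc j) z"
      proof (cases "q = 0")
        case True
        then show ?thesis
          unfolding S hermite_Suc_left by simp
      next
        case False
        then have e: "q - 1 + b - j = q + b - Suc j" "q + b - j - 1 = q + b - Suc j"
          "of_nat (q + b - j) = (of_nat q + of_nat (b - j) :: complex)"
          using \<open>j \<le> b\<close> by (auto simp flip: of_nat_add)
        show ?thesis
          unfolding S hermite_Suc_left e by (simp add: distrib_right)
      qed
      have "Suc j * (b choose Suc j) = (b - j) * (b choose j)"
        by (simp only: binomial_absorption binomial_absorb_comp)
      then have "fact j * (Suc j * (b choose Suc j)) = fact j * ((b - j) * (b choose j))"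
        by (rule arg_cong)
      then have "fact (Suc j) * (b choose Suc j) = (b - j) * (fact j * (b choose j))"
        by (simp only: fact_Suc of_nat_id ac_simps)
      from arg_cong[OF this, of "of_nat :: nat \<Rightarrow> complex"] have **: "of_nat (fact (Suc j) * (b choose Suc j)) = (of_nat (b - j) * (of_nat (fact j) * of_nat (b choose j)) :: complex)"
        by (simp only: of_nat_mult)
      show ?thesis
        unfolding * u_def ** by (simp add: algebra_simps)
    qed (auto simp: u_def binomial_eq_0)
  qed
  also have "\<dots> = (\<Sum>j\<le>Suc a. u (a choose j) j) + (\<Sum>j\<le>a. u (a choose j) (Suc j))"
    by (simp add: sum.distrib u_def)
  also have "\<dots> = u 1 0 + (\<Sum>j\<le>a. u (a choose Suc j) (Suc j)) + (\<Sum>j\<le>a. u (a choose j) (Suc j))"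
    by (subst sum.atMost_Suc_shift) simp
  also have "\<dots> = (\<Sum>j\<le>Suc a. u (Suc a choose j) j)"
    by (subst sum.atMost_Suc_shift) (simp add: u_add sum.distrib)
  finally show ?case
    by (simp add: u_def ac_simps)
qed

text \<open>The case p = q = 0 of the linearization: \<open>hermite a 0\<close> and
  \<open>hermite 0 b\<close> are pure powers.\<close>

lemma monomial_hermite:
  "cnj z ^ a * z ^ b = (\<Sum>j\<le>a. of_nat (fact j * (a choose j) * (b choose j)) * hermite (a - j) (b - j) z)"
  using hermite_linearization[of 0 0 a z b] by simp

subsection \<open>Integrals of Hermite polynomials\<close>

text \<open>An algebra of functions that contains the polynomials in z and \<open>cnj z\<close> and
  consists of \<open>gauss\<close>-integrable functions, so that integrability follows from the
  shape of a term.\<close>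

definition exp_bounded :: "(complex \<Rightarrow> complex) \<Rightarrow> bool" where
  "exp_bounded f \<longleftrightarrow> f \<in> borel_measurable borel \<and> (\<exists>C R. \<forall>z. cmod (f z) \<le> C * exp (R * cmod z))"

lemma exp_boundedI:
  assumes "f \<in> borel_measurable borel" "\<And>z. cmod (f z) \<le> C * exp (R * cmod z)"
  shows "exp_bounded f"
  using assms by (auto simp: exp_bounded_def)

lemma exp_bounded_measurable: "exp_bounded f \<Longrightarrow> f \<in> borel_measurable borel"
  by (simp add: exp_bounded_def)

lemma exp_boundedE:
  assumes "exp_bounded f"
  obtains C R where "C \<ge> 0" "R \<ge> 0" "\<And>z. cmod (f z) \<le> C * exp (R * cmod z)"
proof -
  obtain C R where CR: "\<And>z. cmod (f z) \<le> C * exp (R * cmod z)"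
    using assms by (auto simp: exp_bounded_def)
  have "C \<ge> 0"
    using order.trans[OF norm_ge_zero CR[of 0]] by simp
  have "cmod (f z) \<le> C * exp (\<bar>R\<bar> * cmod z)" for z
    by (rule order.trans[OF CR]) (use \<open>C \<ge> 0\<close> in \<open>auto intro!: mult_left_mono mult_right_mono\<close>)
  then show ?thesis
    using \<open>C \<ge> 0\<close> by (intro that[of C "\<bar>R\<bar>"]) auto
qed

lemma exp_bounded_const: "exp_bounded (\<lambda>_. c)"
  by (rule exp_boundedI[of _ "cmod c" 0]) auto

lemma exp_bounded_ident: "exp_bounded (\<lambda>z. z)"
proof (rule exp_boundedI[of _ 1 1])
  show "cmod z \<le> 1 * exp (1 * cmod z)" for z
    unfolding mult_1_left using exp_ge_add_one_self[of "cmod z"] by linarith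
qed auto

lemma exp_bounded_cnj: "exp_bounded f \<Longrightarrow> exp_bounded (\<lambda>z. cnj (f z))"
  by (auto simp: exp_bounded_def)

lemma exp_bounded_add:
  assumes "exp_bounded f" "exp_bounded g"
  shows "exp_bounded (\<lambda>z. f z + g z)"
proof -
  obtain C R where f: "C \<ge> 0" "R \<ge> 0" "\<And>z. cmod (f z) \<le> C * exp (R * cmod z)"
    by (rule exp_boundedE[OF assms(1)]) blast
  obtain D S where g: "D \<ge> 0" "S \<ge> 0" "\<And>z. cmod (g z) \<le> D * exp (S * cmod z)"
    by (rule exp_boundedE[OF assms(2)]) blast
  show ?thesis
  proof (rule exp_boundedI[of _ "C + D" "R + S"])
    fix z
    have "C * exp (R * cmod z) \<le> C * exp ((R + S) * cmod z)" "D * exp (S * cmod z) \<le> D * exp ((R + S) * cmod z)"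
      using f g by (auto intro!: mult_left_mono mult_right_mono)
    then have "cmod (f z) + cmod (g z) \<le> (C + D) * exp ((R + S) * cmod z)"
      using f(3)[of z] g(3)[of z] by (simp add: distrib_right)
    then show "cmod (f z + g z) \<le> (C + D) * exp ((R + S) * cmod z)"
      using norm_triangle_ineq order.trans by blast
  qed (use assms[THEN exp_bounded_measurable] in auto)
qed

lemma exp_bounded_mult:
  assumes "exp_bounded f" "exp_bounded g"
  shows "exp_bounded (\<lambda>z. f z * g z)"
proof -
  obtain C R where f: "C \<ge> 0" "R \<ge> 0" "\<And>z. cmod (f z) \<le> C * exp (R * cmod z)"
    by (rule exp_boundedE[OF assms(1)]) blast
  obtain D S where g: "D \<ge> 0" "S \<ge> 0" "\<And>z. cmod (g z) \<le> D * exp (S * cmod z)"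
    by (rule exp_boundedE[OF assms(2)]) blast
  show ?thesis
  proof (rule exp_boundedI[of _ "C * D" "R + S"])
    fix z
    have "cmod (f z) * cmod (g z) \<le> (C * exp (R * cmod z)) * (D * exp (S * cmod z))"
      using f g by (intro mult_mono) auto
    moreover have "exp ((R + S) * cmod z) = exp (R * cmod z) * exp (S * cmod z)"
      by (simp add: distrib_right exp_add)
    ultimately show "cmod (f z * g z) \<le> (C * D) * exp ((R + S) * cmod z)"
      by (simp add: norm_mult ac_simps)
  qed (use assms[THEN exp_bounded_measurable] in auto)
qed

lemma exp_bounded_power: "exp_bounded f \<Longrightarrow> exp_bounded (\<lambda>z. f z ^ n)"
  by (induction n) (auto intro: exp_bounded_const exp_bounded_mult)

lemma exp_bounded_sum:
  "(\<And>i. i \<in> I \<Longrightarrow> exp_bounded (f i)) \<Longrightarrow> exp_bounded (\<lambda>z. \<Sum>i\<in>I. f i z)"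
  by (induction I rule: infinite_finite_induct) (auto intro: exp_bounded_const exp_bounded_add)

lemmas exp_bounded_intros = exp_bounded_const exp_bounded_ident exp_bounded_cnj exp_bounded_add
  exp_bounded_mult exp_bounded_power exp_bounded_sum

lemma exp_bounded_hermite: "exp_bounded (hermite p q)"
  unfolding hermite_def[abs_def] by (intro exp_bounded_intros)

lemma measurable_hermite [measurable]: "hermite p q \<in> borel_measurable borel"
  by (rule exp_bounded_measurable[OF exp_bounded_hermite])

lemma exp_bounded_imp_integrable_exp:
  assumes "exp_bounded f"
  shows "integrable gauss (\<lambda>z. f z * of_real (exp (R * cmod z)))"
proof -
  obtain C S where f: "C \<ge> 0" "S \<ge> 0" "\<And>z. cmod (f z) \<le> C * exp (S * cmod z)"
    by (rule exp_boundedE[OF assms]) blast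
  have [measurable]: "f \<in> borel_measurable borel"
    using assms by (rule exp_bounded_measurable)
  have "integrable gauss (\<lambda>z. C * exp ((S + R) * cmod z))"
    using integrable_gauss_exp[of 0 "S + R"] by simp
  then show ?thesis
  proof (rule Bochner_Integration.integrable_bound)
    show "AE z in gauss. norm (f z * of_real (exp (R * cmod z))) \<le> norm (C * exp ((S + R) * cmod z))"
    proof (rule AE_I2)
      fix z
      have "cmod (f z) * exp (R * cmod z) \<le> (C * exp (S * cmod z)) * exp (R * cmod z)"
        using f(3) by (intro mult_right_mono) auto
      then show "norm (f z * of_real (exp (R * cmod z))) \<le> norm (C * exp ((S + R) * cmod z))"
        using f(1) by (simp add: norm_mult distrib_right exp_add)
    qed
  qed simp
qed

lemma exp_bounded_imp_integrable: "exp_bounded f \<Longrightarrow> integrable gauss f"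
  using exp_bounded_imp_integrable_exp[of f 0] by simp

lemma exp_bounded_imp_square_integrable:
  assumes "exp_bounded f"
  shows "integrable gauss (\<lambda>z. (cmod (f z))\<^sup>2)"
  using integrable_norm[OF exp_bounded_imp_integrable[OF exp_bounded_mult[OF assms assms]]]
  by (simp add: norm_mult power2_eq_square)

lemma integral_gauss_monomial:
  "(LINT z|gauss. cnj z ^ p * z ^ q) = (if p = q then fact p else 0)"
proof (cases "p = q")
  case True
  have "cnj z ^ p * z ^ p = of_real (cmod z ^ (2 * p))" for z
  proof -
    have "cnj z ^ p * z ^ p = (z * cnj z) ^ p"
      by (simp add: power_mult_distrib mult.commute)
    also have "\<dots> = of_real (cmod z ^ (2 * p))"
      by (simp add: complex_norm_square[symmetric] power_mult)
    finally show ?thesis .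
  qed
  then show ?thesis
    using True integral_gauss_norm_power[of p] by (simp del: of_real_power)
next
  case False
  \<comment> \<open>Rotation by this angle multiplies the monomial by -1, which forces its integral
    to vanish.\<close>
  define u where "u = cis (pi / (real q - real p))"
  have "cnj u ^ p * u ^ q = cis (real q * (pi / (real q - real p)) - real p * (pi / (real q - real p)))"
    by (simp add: u_def cis_cnj Complex.DeMoivre cis_mult)
  also have "real q * (pi / (real q - real p)) - real p * (pi / (real q - real p)) = pi"
    unfolding left_diff_distrib[symmetric] using False by simp
  finally have u: "cnj u ^ p * u ^ q = -1"
    by simp
  have "(LINT z|gauss. cnj z ^ p * z ^ q) = (LINT z|gauss. cnj (u * z) ^ p * (u * z) ^ q)"
    by (rule integral_gauss_rotate[symmetric, where f = "\<lambda>z. cnj z ^ p * z ^ q"]) (simp_all add: u_def)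
  also have "\<dots> = (LINT z|gauss. (cnj u ^ p * u ^ q) * (cnj z ^ p * z ^ q))"
    by (simp add: power_mult_distrib ac_simps)
  also have "\<dots> = - (LINT z|gauss. cnj z ^ p * z ^ q)"
    unfolding u by simp
  finally have "2 * (LINT z|gauss. cnj z ^ p * z ^ q) = 0"
    by (simp only: mult_2) (metis add.right_inverse)
  then show ?thesis
    using False by simp
qed

lemma integral_hermite: "integral\<^sup>L gauss (hermite p q) = (if p = 0 \<and> q = 0 then 1 else 0)"
proof -
  have "integral\<^sup>L gauss (hermite p q)
      = (\<Sum>j\<le>p. (LINT z|gauss. (-1) ^ j * of_nat (fact j * (p choose j) * (q choose j)) * (cnj z ^ (p - j) * z ^ (q - j))))"
    unfolding hermite_def[abs_def] mult.assoc
    by (subst Bochner_Integration.integral_sum)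
      (auto intro!: exp_bounded_imp_integrable exp_bounded_intros)
  also have "\<dots> = (\<Sum>j\<le>p. (-1) ^ j * of_nat (fact j * (p choose j) * (q choose j)) * (if p - j = q - j then fact (p - j) else 0))"
    by (simp add: integral_gauss_monomial)
  also have "\<dots> = (\<Sum>j\<le>p. if p = q then fact p * ((-1) ^ j * of_nat (p choose j)) else 0)"
  proof (intro sum.cong refl)
    fix j assume "j \<in> {..p}"
    then have "fact j * fact (p - j) * (p choose j) = fact p"
      by (simp add: binomial_fact_lemma)
    then have "of_nat (fact j) * of_nat (fact (p - j)) * of_nat (p choose j) = (of_nat (fact p) :: complex)"
      by (simp only: of_nat_mult[symmetric])
    moreover have "j \<le> q \<or> q choose j = 0"
      by (auto simp: binomial_eq_0)
    ultimately show "(-1) ^ j * of_nat (fact j * (p choose j) * (q choose j)) * (if p - j = q - j then fact (p - j) else 0)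
        = (if p = q then fact p * ((-1) ^ j * of_nat (p choose j)) else (0::complex))"
      using \<open>j \<in> {..p}\<close> by (auto simp: ac_simps)
  qed
  also have "\<dots> = (if p = q then fact p * (\<Sum>j\<le>p. (-1) ^ j * of_nat (p choose j)) else 0)"
    by (simp add: sum_distrib_left)
  also have "\<dots> = (if p = 0 \<and> q = 0 then 1 else 0)"
    using choose_alternating_sum[of p, where ?'a = complex] by auto
  finally show ?thesis .
qed

text \<open>Integrate the linearization formula: on the right only index (0, 0) has nonzero mean. On
  the left the terms with r > 0 are known by induction on \<open>p\<close>, and the alternating
  binomial sum isolates r = 0.\<close>

lemma integral_hermite_hermite:
  "(LINT z|gauss. hermite m q z * hermite p m' z) = (if m = m' \<and> q = p then fact m * fact p else 0)"
proof (induction p arbitrary: q rule: less_induct)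
  case (less p)
  define I where "I r = (LINT z|gauss. hermite m (q - r) z * hermite (p - r) m' z)" for r
  define c where "c r = ((-1) ^ r * of_nat (fact r * (p choose r) * (q choose r)) :: complex)" for r :: nat
  have int: "integrable gauss (\<lambda>z. hermite m (q - r) z * hermite (p - r) m' z)" for r
    by (intro exp_bounded_imp_integrable exp_bounded_mult exp_bounded_hermite)
  have "(\<Sum>r\<le>p. c r * I r) = (LINT z|gauss. (\<Sum>r\<le>p. c r * (hermite m (q - r) z * hermite (p - r) m' z)))"
    unfolding I_def by (subst Bochner_Integration.integral_sum) (auto intro: int)
  also have "\<dots> = (LINT z|gauss. (\<Sum>j\<le>m. of_nat (fact j * (m choose j) * (m' choose j)) * hermite (p + m - j) (q + m' - j) z))"
    unfolding c_def by (simp only: hermite_linearization)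
  also have "\<dots> = (\<Sum>j\<le>m. of_nat (fact j * (m choose j) * (m' choose j)) * (if p + m - j = 0 \<and> q + m' - j = 0 then 1 else 0))"
    by (subst Bochner_Integration.integral_sum)
      (auto intro!: exp_bounded_imp_integrable exp_bounded_mult exp_bounded_hermite exp_bounded_const simp: integral_hermite)
  also have "\<dots> = (\<Sum>j\<le>m. if j = m then (if p = 0 \<and> q = 0 \<and> m = m' then fact m else 0) else 0)"
    by (intro sum.cong refl) (auto simp: binomial_eq_0)
  also have "\<dots> = (if p = 0 \<and> q = 0 \<and> m = m' then fact m else 0)"
    by simp
  finally have sum: "(\<Sum>r\<le>p. c r * I r) = (if p = 0 \<and> q = 0 \<and> m = m' then fact m else 0)" .
  have "c r * I r = (if m = m' \<and> q = p then fact m * fact p * ((-1) ^ r * of_nat (p choose r)) else 0)" if r: "r \<in> {..p} - {0}" for r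
  proof (cases "r \<le> q")
    case True
    have "I r = (if m = m' \<and> q - r = p - r then fact m * fact (p - r) else 0)"
      unfolding I_def using r by (intro less.IH) auto
    moreover have "fact r * fact (p - r) * (p choose r) = fact p"
      using r by (simp add: binomial_fact_lemma)
    then have "of_nat (fact r) * of_nat (fact (p - r)) * of_nat (p choose r) = (of_nat (fact p) :: complex)"
      by (simp only: of_nat_mult[symmetric])
    ultimately show ?thesis
      using r True by (auto simp: c_def ac_simps)
  next
    case False
    then show ?thesis
      using r by (auto simp: c_def binomial_eq_0)
  qed
  then have "(\<Sum>r\<in>{..p} - {0}. c r * I r) = (\<Sum>r\<in>{..p} - {0}. if m = m' \<and> q = p then fact m * fact p * ((-1) ^ r * of_nat (p choose r)) else 0)"
    by (rule sum.cong[OF refl])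
  also have "\<dots> = (if m = m' \<and> q = p then fact m * fact p * (\<Sum>r\<in>{..p} - {0}. (-1) ^ r * of_nat (p choose r)) else 0)"
    by (cases "m = m' \<and> q = p") (auto simp: sum_distrib_left)
  also have "(\<Sum>r\<in>{..p} - {0}. (-1) ^ r * of_nat (p choose r)) = (\<Sum>r\<le>p. (-1) ^ r * of_nat (p choose r) :: complex) - 1"
    by (subst sum_diff1) auto
  also have "(\<Sum>r\<le>p. (-1) ^ r * of_nat (p choose r) :: complex) = (if p = 0 then 1 else 0)"
    using choose_alternating_sum[of p, where ?'a = complex] by auto
  finally have "(\<Sum>r\<in>{..p} - {0}. c r * I r) = (if m = m' \<and> q = p then fact m * fact p * ((if p = 0 then 1 else 0) - 1) else 0)" .
  moreover have "(\<Sum>r\<le>p. c r * I r) = c 0 * I 0 + (\<Sum>r\<in>{..p} - {0}. c r * I r)"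
    by (subst sum.remove[of _ 0]) auto
  ultimately have "I 0 = (if m = m' \<and> q = p then fact m * fact p else 0)"
    using sum by (auto simp: c_def split: if_splits)
  then show ?case
    by (simp add: I_def)
qed

text \<open>All partial sums of the exponential series are dominated by exp(R |z|), so dominated
  convergence allows termwise integration.\<close>

lemma sums_integral_exp:
  assumes [measurable]: "d \<in> borel_measurable borel"
    and int: "integrable gauss (\<lambda>z. d z * of_real (exp (R * cmod z)))"
    and R: "cmod a + cmod b \<le> R"
  shows "(\<lambda>n. LINT z|gauss. d z * ((a * z + b * cnj z) ^ n /\<^sub>R fact n)) sums (LINT z|gauss. d z * exp (a * z + b * cnj z))"
    and "integrable gauss (\<lambda>z. d z * ((a * z + b * cnj z) ^ n /\<^sub>R fact n))"
proof -
  have le: "cmod (a * z + b * cnj z) \<le> R * cmod z" for z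
  proof -
    have "cmod (a * z + b * cnj z) \<le> (cmod a + cmod b) * cmod z"
      using norm_triangle_ineq[of "a * z" "b * cnj z"] by (simp add: norm_mult distrib_right)
    also have "\<dots> \<le> R * cmod z"
      using R by (rule mult_right_mono) simp
    finally show ?thesis .
  qed
  have part: "(\<Sum>i\<in>I. cmod ((a * z + b * cnj z) ^ i /\<^sub>R fact i)) \<le> exp (R * cmod z)" if "finite I" for I z
  proof -
    have "(\<Sum>i\<in>I. cmod ((a * z + b * cnj z) ^ i /\<^sub>R fact i)) \<le> (\<Sum>i\<in>I. (R * cmod z) ^ i /\<^sub>R fact i)"
    proof (rule sum_mono)
      fix i
      have "cmod (a * z + b * cnj z) ^ i \<le> (R * cmod z) ^ i"
        by (intro power_mono le) simp
      from divide_right_mono[OF this, of "fact i"]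
      show "cmod ((a * z + b * cnj z) ^ i /\<^sub>R fact i) \<le> (R * cmod z) ^ i /\<^sub>R fact i"
        by (simp add: norm_power divide_inverse mult.commute)
    qed
    also have "\<dots> \<le> (\<Sum>i. (R * cmod z) ^ i /\<^sub>R fact i)"
      using order.trans[OF norm_ge_zero le[of z]]
      by (intro sum_le_suminf summable_exp_generic that) auto
    finally show ?thesis
      by (simp add: exp_def)
  qed
  have int': "integrable gauss (\<lambda>z. cmod (d z) * exp (R * cmod z))"
    using integrable_norm[OF int] by (simp add: norm_mult)
  show int_n: "integrable gauss (\<lambda>z. d z * ((a * z + b * cnj z) ^ n /\<^sub>R fact n))" for n
  proof (rule Bochner_Integration.integrable_bound[OF int'])
    show "AE z in gauss. norm (d z * ((a * z + b * cnj z) ^ n /\<^sub>R fact n)) \<le> norm (cmod (d z) * exp (R * cmod z))"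
    proof (rule AE_I2)
      fix z
      show "norm (d z * ((a * z + b * cnj z) ^ n /\<^sub>R fact n)) \<le> norm (cmod (d z) * exp (R * cmod z))"
        using mult_left_mono[OF part[of "{n}" z], of "cmod (d z)"] by (simp add: norm_mult mult.left_commute)
    qed
  qed simp
  have "(\<lambda>n. LINT z|gauss. (\<Sum>i<n. d z * ((a * z + b * cnj z) ^ i /\<^sub>R fact i))) \<longlonglongrightarrow> (LINT z|gauss. d z * exp (a * z + b * cnj z))"
  proof (rule integral_dominated_convergence[where w = "\<lambda>z. cmod (d z) * exp (R * cmod z)"])
    show "AE z in gauss. (\<lambda>n. \<Sum>i<n. d z * ((a * z + b * cnj z) ^ i /\<^sub>R fact i)) \<longlonglongrightarrow> d z * exp (a * z + b * cnj z)"
    proof (rule AE_I2)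
      fix z
      have "(\<lambda>i. d z * ((a * z + b * cnj z) ^ i /\<^sub>R fact i)) sums (d z * exp (a * z + b * cnj z))"
        by (intro sums_mult exp_converges)
      then show "(\<lambda>n. \<Sum>i<n. d z * ((a * z + b * cnj z) ^ i /\<^sub>R fact i)) \<longlonglongrightarrow> d z * exp (a * z + b * cnj z)"
        by (simp add: sums_def)
    qed
    show "AE z in gauss. norm (\<Sum>i<n. d z * ((a * z + b * cnj z) ^ i /\<^sub>R fact i)) \<le> cmod (d z) * exp (R * cmod z)" for n
    proof (rule AE_I2)
      fix z
      have "norm (\<Sum>i<n. (a * z + b * cnj z) ^ i /\<^sub>R fact i) \<le> exp (R * cmod z)"
        by (rule order.trans[OF norm_sum part]) simp
      then show "norm (\<Sum>i<n. d z * ((a * z + b * cnj z) ^ i /\<^sub>R fact i)) \<le> cmod (d z) * exp (R * cmod z)"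
        unfolding sum_distrib_left[symmetric] norm_mult by (rule mult_left_mono) simp
    qed
  qed (use int' in auto)
  then show "(\<lambda>n. LINT z|gauss. d z * ((a * z + b * cnj z) ^ n /\<^sub>R fact n)) sums (LINT z|gauss. d z * exp (a * z + b * cnj z))"
  proof -
    have "(LINT z|gauss. (\<Sum>i<n. d z * ((a * z + b * cnj z) ^ i /\<^sub>R fact i)))
        = (\<Sum>i<n. LINT z|gauss. d z * ((a * z + b * cnj z) ^ i /\<^sub>R fact i))" for n
      by (rule Bochner_Integration.integral_sum) (rule int_n)
    moreover assume "(\<lambda>n. LINT z|gauss. (\<Sum>i<n. d z * ((a * z + b * cnj z) ^ i /\<^sub>R fact i))) \<longlonglongrightarrow> (LINT z|gauss. d z * exp (a * z + b * cnj z))"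
    ultimately show ?thesis
      by (simp only: sums_def)
  qed
qed

text \<open>The Hermite expansion of the monomial leaves the single term l = j - q. The support
  condition matters later: monomials with fewer than \<open>q\<close> conjugate factors are
  annihilated, which gives orthogonality to lower polyanalytic order.\<close>

lemma integral_monomial_hermite:
  "(LINT z|gauss. cnj z ^ j * z ^ i * hermite p q z)
    = (if p \<le> i \<and> q \<le> j \<and> i - p = j - q then fact i * fact j / fact (i - p) else 0)"
proof -
  have "(LINT z|gauss. cnj z ^ j * z ^ i * hermite p q z)
      = (LINT z|gauss. (\<Sum>l\<le>j. of_nat (fact l * (j choose l) * (i choose l)) * (hermite (j - l) (i - l) z * hermite p q z)))"
    unfolding monomial_hermite sum_distrib_right by (simp only: mult.assoc)
  also have "\<dots> = (\<Sum>l\<le>j. of_nat (fact l * (j choose l) * (i choose l)) * (if j - l = q \<and> i - l = p then fact (j - l) * fact p else 0))"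
    by (subst Bochner_Integration.integral_sum)
      (auto intro!: exp_bounded_imp_integrable exp_bounded_mult exp_bounded_hermite exp_bounded_const
        simp: integral_hermite_hermite)
  also have "\<dots> = (\<Sum>l\<le>j. if l = j - q then (if p \<le> i \<and> q \<le> j \<and> i - p = j - q then fact i * fact j / fact (i - p) else 0) else 0)"
  proof (intro sum.cong refl)
    fix l assume l: "l \<in> {..j}"
    show "of_nat (fact l * (j choose l) * (i choose l)) * (if j - l = q \<and> i - l = p then fact (j - l) * fact p else 0)
      = (if l = j - q then (if p \<le> i \<and> q \<le> j \<and> i - p = j - q then fact i * fact j / fact (i - p) else 0) else (0::complex))"
    proof (cases "j - l = q \<and> i - l = p \<and> l \<le> i")
      case True
      then have e: "i - p = l" "j - q = l" "p \<le> i" "q \<le> j" "l \<le> i" "l \<le> j" "i - l = p" "j - l = q"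
        using l by auto
      have bc: "of_nat (j choose l) = (fact j / (fact l * fact q) :: complex)"
        "of_nat (i choose l) = (fact i / (fact l * fact p) :: complex)"
        by (simp_all only: binomial_fact[OF e(5)] binomial_fact[OF e(6)] e(7,8))
      show ?thesis
        unfolding of_nat_mult bc e(1,2,7,8) using e(3,4) by simp
    next
      case False
      have neg: "\<not> (l = j - q \<and> p \<le> i \<and> q \<le> j \<and> i - p = j - q)"
      proof
        assume "l = j - q \<and> p \<le> i \<and> q \<le> j \<and> i - p = j - q"
        then have "j - l = q \<and> i - l = p \<and> l \<le> i"
          by linarith
        then show False
          using False by blast
      qed
      have "of_nat (fact l * (j choose l) * (i choose l)) * (if j - l = q \<and> i - l = p then fact (j - l) * fact p else 0) = (0::complex)"
      proof (cases "l \<le> i")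
        case True
        then have "\<not> (j - l = q \<and> i - l = p)"
          using False by blast
        then show ?thesis
          by (simp only: if_False mult_zero_right)
      next
        case False
        then have "i choose l = 0"
          by (intro binomial_eq_0) simp
        then show ?thesis
          by (simp only: mult_zero_right of_nat_0 mult_zero_left)
      qed
      moreover have "(if l = j - q then (if p \<le> i \<and> q \<le> j \<and> i - p = j - q then c else 0) else 0)
          = (if l = j - q \<and> p \<le> i \<and> q \<le> j \<and> i - p = j - q then c else 0)" for c :: complex
        by (cases "l = j - q") (simp_all only: simp_thms if_True if_False)
      ultimately show ?thesis
        by (simp only: neg if_False)
    qed
  qed
  also have "\<dots> = (if p \<le> i \<and> q \<le> j \<and> i - p = j - q then fact i * fact j / fact (i - p) else 0)"
    by simp
  finally show ?thesis .
qed

text \<open>The generating function of the Hermite polynomials in integrated form; with a = - cnj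
  \<xi> and b = \<xi> it yields the coefficients of a character.\<close>

lemma integral_exp_hermite:
  "(LINT z|gauss. exp (a * z + b * cnj z) * hermite p q z) = a ^ p * b ^ q * exp (a * b)"
proof -
  let ?T = "\<lambda>n. LINT z|gauss. hermite p q z * ((a * z + b * cnj z) ^ n /\<^sub>R fact n)"
  have sums: "?T sums (LINT z|gauss. hermite p q z * exp (a * z + b * cnj z))"
    by (rule sums_integral_exp(1)[where R = "cmod a + cmod b"])
      (auto intro: exp_bounded_imp_integrable_exp exp_bounded_hermite)
  have T: "?T n = (\<Sum>i\<le>n. if p \<le> i \<and> q \<le> n - i \<and> i - p = n - i - q then a ^ i * b ^ (n - i) / fact (i - p) else 0)" for n
  proof -
    have "?T n = (LINT z|gauss. (\<Sum>i\<le>n. (of_nat (n choose i) / fact n * a ^ i * b ^ (n - i)) * (cnj z ^ (n - i) * z ^ i * hermite p q z)))"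
      unfolding binomial_ring scaleR_conv_of_real
      by (simp add: sum_distrib_left power_mult_distrib divide_inverse mult_ac)
    also have "\<dots> = (\<Sum>i\<le>n. (of_nat (n choose i) / fact n * a ^ i * b ^ (n - i)) *
        (if p \<le> i \<and> q \<le> n - i \<and> i - p = n - i - q then fact i * fact (n - i) / fact (i - p) else 0))"
      by (subst Bochner_Integration.integral_sum, rule exp_bounded_imp_integrable,
        intro exp_bounded_intros exp_bounded_hermite, simp only: integral_mult_right_zero integral_monomial_hermite)
    also have "\<dots> = (\<Sum>i\<le>n. if p \<le> i \<and> q \<le> n - i \<and> i - p = n - i - q then a ^ i * b ^ (n - i) / fact (i - p) else 0)"
      by (intro sum.cong refl) (auto simp: binomial_fact field_simps)
    finally show ?thesis .
  qed
  \<comment> \<open>Only the homogeneous degrees p + q + 2 l contribute, each through the single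
    exponent p + l of z.\<close>
  define g where "g l = p + q + 2 * l" for l
  have "(\<lambda>l. ?T (g l)) sums (a ^ p * b ^ q * exp (a * b))"
  proof -
    have "?T (g l) = a ^ p * b ^ q * ((a * b) ^ l /\<^sub>R fact l)" for l
    proof -
      have "?T (g l) = (\<Sum>i\<le>g l. if i = p + l then a ^ (p + l) * b ^ (q + l) / fact l else 0)"
        unfolding T by (intro sum.cong refl if_cong) (auto simp: g_def add.commute[of q l])
      also have "\<dots> = a ^ (p + l) * b ^ (q + l) / fact l"
        by (simp add: g_def)
      also have "\<dots> = a ^ p * b ^ q * ((a * b) ^ l /\<^sub>R fact l)"
        by (simp add: power_add power_mult_distrib scaleR_conv_of_real divide_inverse mult_ac)
      finally show ?thesis .
    qed
    then show ?thesis
      using sums_mult[OF exp_converges[of "a * b"], of "a ^ p * b ^ q"] by simp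
  qed
  moreover have "?T n = 0" if "n \<notin> range g" for n
  proof -
    have "\<not> (p \<le> i \<and> q \<le> n - i \<and> i - p = n - i - q)" if "i \<le> n" for i
    proof
      assume "p \<le> i \<and> q \<le> n - i \<and> i - p = n - i - q"
      then have "n = g (i - p)"
        using that by (auto simp: g_def)
      then show False
        using \<open>n \<notin> range g\<close> by blast
    qed
    then show ?thesis
      unfolding T by (intro sum.neutral) auto
  qed
  moreover have "strict_mono g"
    by (rule strict_monoI) (simp add: g_def)
  ultimately have "?T sums (a ^ p * b ^ q * exp (a * b))"
    by (subst (asm) sums_mono_reindex) auto
  then have "(LINT z|gauss. hermite p q z * exp (a * z + b * cnj z)) = a ^ p * b ^ q * exp (a * b)"
    using sums sums_unique2 by blast
  then show ?thesis
    by (simp add: mult.commute)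
qed

lemma integral_exp: "(LINT z|gauss. exp (a * z + b * cnj z)) = exp (a * b)"
  using integral_exp_hermite[of a b 0 0] by simp

subsection \<open>Uniqueness of the Fourier transform\<close>

lemma lborel_integral_translate:
  fixes h :: "'a::euclidean_space \<Rightarrow> 'b::{banach, second_countable_topology}"
  shows "(LINT z|lborel. h (w + z)) = integral\<^sup>L lborel h"
    and "integrable lborel (\<lambda>z. h (w + z)) \<longleftrightarrow> integrable lborel h"
proof -
  have "integral\<^sup>L lborel h = (LINT z|lborel. h (w + z))" if "integrable lborel h" for h :: "'a \<Rightarrow> 'b" and w
  proof -
    have "integral\<^sup>L (distr lborel borel ((+) w)) h = (LINT z|lborel. h (w + z))"
      using that by (intro integral_distr) auto
    then show ?thesis
      by (simp add: lborel_distr_plus)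
  qed
  have *: "integrable lborel (\<lambda>z. h (w + z))" if "integrable lborel h" for h :: "'a \<Rightarrow> 'b" and w
  proof -
    have "integrable (distr lborel borel ((+) w)) h"
      using that by (simp add: lborel_distr_plus)
    then show ?thesis
      using that by (subst (asm) integrable_distr_eq) auto
  qed
  show **: "integrable lborel (\<lambda>z. h (w + z)) \<longleftrightarrow> integrable lborel h"
    using *[of h w] *[of "\<lambda>z. h (w + z)" "- w"] by auto
  show "(LINT z|lborel. h (w + z)) = integral\<^sup>L lborel h"
  proof (cases "integrable lborel h")
    case True
    have "integral\<^sup>L (distr lborel borel ((+) w)) h = (LINT z|lborel. h (w + z))"
      using True by (intro integral_distr) auto
    then show ?thesis
      by (simp add: lborel_distr_plus)
  next
    case False
    then show ?thesis
      using ** by (simp add: not_integrable_integral_eq)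
  qed
qed

text \<open>
  Averaging the hypothesis against a Gaussian in \<open>\<xi>\<close> shows that all Gaussian regularisations of
  \<open>h\<close> vanish, and these converge to \<open>h\<close> in \<open>L\<^sup>1\<close>.
\<close>

lemma Fourier_transform_unique:
  fixes h :: "complex \<Rightarrow> complex"
  assumes h: "integrable lborel h"
    and zero: "\<And>\<xi>. (LINT z|lborel. h z * exp (\<xi> * cnj z - cnj \<xi> * z)) = 0"
  shows "AE z in lborel. h z = 0"
proof -
  have [measurable]: "h \<in> borel_measurable borel"
    using h by auto
  interpret P: pair_sigma_finite gauss "lborel :: complex measure" ..
  have smooth_zero: "(LINT z|lborel. h z * of_real (exp (- (s * cmod (z - w))\<^sup>2))) = 0" for w and s :: real
  proof -
    \<comment> \<open>For fixed \<open>\<zeta>\<close> this is \<open>h\<close> times a character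
      centred at \<open>w\<close>, with zero integral by hypothesis. Averaging over
      \<open>\<zeta>\<close> against \<open>gauss\<close> produces a Gaussian of width 1 / s around
      \<open>w\<close>.\<close>
    define F where "F = (\<lambda>\<zeta> z. h z * exp (of_real s * (\<zeta> * cnj (z - w) - cnj \<zeta> * (z - w))))"
    have norm_F: "cmod (F \<zeta> z) = cmod (h z)" for \<zeta> z
    proof -
      have "Re (of_real s * (\<zeta> * cnj (z - w) - cnj \<zeta> * (z - w))) = 0"
        by (simp add: algebra_simps)
      then show ?thesis
        by (simp add: F_def norm_mult norm_exp_eq_Re)
    qed
    have inner: "(LINT z|lborel. F \<zeta> z) = 0" for \<zeta>
    proof -
      have "(LINT z|lborel. F \<zeta> z) = (LINT z|lborel. exp (of_real s * (cnj \<zeta> * w - \<zeta> * cnj w)) *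
          (h z * exp ((of_real s * \<zeta>) * cnj z - cnj (of_real s * \<zeta>) * z)))"
        unfolding F_def by (intro Bochner_Integration.integral_cong refl) (simp add: mult_exp_exp algebra_simps)
      also have "\<dots> = 0"
        using zero[of "of_real s * \<zeta>"] by simp
      finally show ?thesis .
    qed
    have avg: "(LINT \<zeta>|gauss. F \<zeta> z) = h z * of_real (exp (- (s * cmod (z - w))\<^sup>2))" for z
    proof -
      have "(LINT \<zeta>|gauss. F \<zeta> z) = (LINT \<zeta>|gauss. h z * exp ((of_real s * cnj (z - w)) * \<zeta> + (- of_real s * (z - w)) * cnj \<zeta>))"
        unfolding F_def by (intro Bochner_Integration.integral_cong refl) (simp add: algebra_simps)
      also have "\<dots> = h z * exp ((of_real s * cnj (z - w)) * (- of_real s * (z - w)))"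
        by (simp only: integral_mult_right_zero integral_exp)
      also have "(of_real s * cnj (z - w)) * (- of_real s * (z - w)) = of_real (- (s * cmod (z - w))\<^sup>2)"
      proof -
        have "cnj (z - w) * (z - w) = (of_real (cmod (z - w)))\<^sup>2"
          using complex_norm_square[of "z - w"] by (simp only: of_real_power mult.commute)
        then show ?thesis
          by (simp add: power2_eq_square ac_simps del: complex_cnj_diff)
      qed
      finally show ?thesis
        by (simp add: exp_of_real del: of_real_minus)
    qed
    have "integrable (gauss \<Otimes>\<^sub>M lborel) (case_prod F)"
    proof (rule P.Fubini_integrable)
      show "case_prod F \<in> borel_measurable (gauss \<Otimes>\<^sub>M lborel)"
        unfolding F_def by measurable
      show "AE \<zeta> in gauss. integrable lborel (\<lambda>z. case (\<zeta>, z) of (\<zeta>, z) \<Rightarrow> F \<zeta> z)"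
      proof (rule AE_I2)
        fix \<zeta>
        show "integrable lborel (\<lambda>z. case (\<zeta>, z) of (\<zeta>, z) \<Rightarrow> F \<zeta> z)"
          by (rule Bochner_Integration.integrable_bound[OF h]) (auto simp: norm_F, simp add: F_def)
      qed
    qed (simp add: norm_F)
    then have "(LINT z|lborel. LINT \<zeta>|gauss. F \<zeta> z) = (LINT \<zeta>|gauss. LINT z|lborel. F \<zeta> z)"
      by (rule P.Fubini_integral)
    also have "\<dots> = 0"
      by (simp add: inner)
    finally show ?thesis
      by (simp only: avg)
  qed
  \<comment> \<open>The regularisation of width 1 / n is a \<open>gauss\<close>-average of shifts by
    v / n. Continuity of shifts in L^1 makes \<open>D n v\<close> small for each v, and dominated
    convergence then treats the average.\<close>
  define D where "D n v = (LINT w|lborel. cmod (h (w + v /\<^sub>R real n) - h w))" for n v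
  have avg: "(LINT v|gauss. h (w + v /\<^sub>R real n)) = 0" if n: "n > 0" for n w
  proof -
    let ?f = "\<lambda>z. h z * of_real (exp (- (real n * cmod (z - w))\<^sup>2))"
    have "0 = integral\<^sup>L lborel ?f"
      using smooth_zero[of "real n" w] by simp
    also have "integral\<^sup>L lborel ?f = integral\<^sup>L (density (distr lborel borel (\<lambda>x. w + (1 / real n) *\<^sub>R x)) (\<lambda>_. ennreal (\<bar>1 / real n\<bar> ^ DIM(complex)))) ?f"
      using lborel_affine[of "1 / real n" w] n by simp
    also have "\<dots> = \<bar>1 / real n\<bar> ^ DIM(complex) *\<^sub>R (LINT v|lborel. ?f (w + (1 / real n) *\<^sub>R v))"
      by (subst integral_density) (auto simp: integral_distr)
    finally have "(LINT v|lborel. ?f (w + (1 / real n) *\<^sub>R v)) = 0"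
      using n by simp
    also have "(\<lambda>v. ?f (w + (1 / real n) *\<^sub>R v)) = (\<lambda>v. of_real pi * ((exp (- (cmod v)\<^sup>2) / pi) *\<^sub>R h (w + v /\<^sub>R real n)))"
    proof
      fix v
      have "real n * cmod (w + (1 / real n) *\<^sub>R v - w) = cmod v"
        using n by simp
      then show "?f (w + (1 / real n) *\<^sub>R v) = of_real pi * ((exp (- (cmod v)\<^sup>2) / pi) *\<^sub>R h (w + v /\<^sub>R real n))"
        by (simp only:) (simp add: scaleR_conv_of_real divide_inverse)
    qed
    finally have "of_real pi * (LINT v|lborel. (exp (- (cmod v)\<^sup>2) / pi) *\<^sub>R h (w + v /\<^sub>R real n)) = 0"
      by (simp only: integral_mult_right_zero)
    then show ?thesis
      by (subst integral_gauss) simp_all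
  qed
  have T: "(\<lambda>n. w + v /\<^sub>R real n) \<longlonglongrightarrow> w" for w v :: complex
    using tendsto_add[OF tendsto_const tendsto_scaleR[OF lim_inverse_n tendsto_const], of w v] by simp
  have D_lim: "(\<lambda>n. D n v) \<longlonglongrightarrow> 0" for v
    unfolding D_def
  proof (rule L1_continuity[OF _ _ T h])
    show "distr lborel borel (\<lambda>w. w + v /\<^sub>R real n) = lborel" for n
    proof -
      have "(\<lambda>w. w + v /\<^sub>R real n) = (+) (v /\<^sub>R real n)"
        by (simp add: fun_eq_iff add.commute)
      then show ?thesis
        by (simp only: lborel_distr_plus)
    qed
  qed simp
  have D_int: "integrable lborel (\<lambda>w. h (w + v /\<^sub>R real n) - h w)" for n v
    using lborel_integral_translate(2)[of h "v /\<^sub>R real n"] h by (auto simp: add.commute)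
  have D_bound: "norm (D n v) \<le> 2 * (LINT w|lborel. cmod (h w))" for n v
  proof -
    have i: "integrable lborel (\<lambda>w. cmod (h (w + v /\<^sub>R real n)))"
      using lborel_integral_translate(2)[of "\<lambda>w. cmod (h w)" "v /\<^sub>R real n"] h by (auto simp: add.commute)
    have "D n v \<le> (LINT w|lborel. cmod (h (w + v /\<^sub>R real n)) + cmod (h w))"
      unfolding D_def using D_int i h by (intro integral_mono) (auto intro: norm_triangle_ineq4)
    also have "\<dots> = 2 * (LINT w|lborel. cmod (h w))"
      using lborel_integral_translate(1)[of "\<lambda>w. cmod (h w)" "v /\<^sub>R real n"] i h by (simp add: add.commute)
    finally show ?thesis
      by (simp add: D_def)
  qed
  have D_meas [measurable]: "D n \<in> borel_measurable borel" for n
    unfolding D_def by measurable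
  have "(\<lambda>n. integral\<^sup>L gauss (D n)) \<longlonglongrightarrow> (LINT v|gauss. 0)"
    by (rule integral_dominated_convergence[where w = "\<lambda>_. 2 * (LINT w|lborel. cmod (h w))"])
      (use D_lim D_bound in auto)
  then have int_D: "(\<lambda>n. integral\<^sup>L gauss (D n)) \<longlonglongrightarrow> 0"
    by simp
  \<comment> \<open>The average of the shifted functions is 0, so \<open>- h\<close> is the average
    of the differences, and the norm may be moved inside.\<close>
  have "(LINT w|lborel. cmod (h w)) \<le> integral\<^sup>L gauss (D n)" if n: "n > 0" for n
  proof -
    have "integrable (gauss \<Otimes>\<^sub>M lborel) (\<lambda>(v, w). h (w + v /\<^sub>R real n) - h w)"
    proof (rule P.Fubini_integrable)
      show "integrable gauss (\<lambda>v. LINT w|lborel. norm (case (v, w) of (v, w) \<Rightarrow> h (w + v /\<^sub>R real n) - h w))"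
        using D_bound[of n] D_meas[of n]
        by (intro gauss.integrable_const_bound[of _ "2 * (LINT w|lborel. cmod (h w))"]) (auto simp: D_def[abs_def])
    qed (use D_int in auto)
    then have P: "integrable (gauss \<Otimes>\<^sub>M lborel) (\<lambda>(v, w). cmod (h (w + v /\<^sub>R real n) - h w))"
      using integrable_norm by (fastforce simp: case_prod_unfold)
    have "(LINT w|lborel. cmod (h w)) \<le> (LINT w|lborel. LINT v|gauss. cmod (h (w + v /\<^sub>R real n) - h w))"
    proof (rule integral_mono_AE)
      show "AE w in lborel. cmod (h w) \<le> (LINT v|gauss. cmod (h (w + v /\<^sub>R real n) - h w))"
        using P.AE_integrable_snd[OF P]
      proof eventually_elim
        case (elim w)
        have i: "integrable gauss (\<lambda>v. h (w + v /\<^sub>R real n) - h w)"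
          by (rule integrable_norm_cancel[OF elim]) simp
        then have "integrable gauss (\<lambda>v. (h (w + v /\<^sub>R real n) - h w) + h w)"
          by (intro Bochner_Integration.integrable_add) simp_all
        then have "integrable gauss (\<lambda>v. h (w + v /\<^sub>R real n))"
          by simp
        then have "(LINT v|gauss. h (w + v /\<^sub>R real n) - h w) = - h w"
          using avg[OF n, of w] by simp
        then show ?case
          using integral_norm_bound[of gauss "\<lambda>v. h (w + v /\<^sub>R real n) - h w"] by simp
      qed
    qed (use h P.integrable_snd[OF P] in auto)
    also have "\<dots> = integral\<^sup>L gauss (D n)"
      unfolding D_def by (rule P.Fubini_integral[OF P])
    finally show ?thesis .
  qed
  then have "(LINT w|lborel. cmod (h w)) \<le> 0"
    by (intro LIMSEQ_le_const[OF int_D] exI[of _ 1]) auto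
  then have "(LINT w|lborel. cmod (h w)) = 0"
    by (simp add: antisym)
  then show ?thesis
    using h by (subst (asm) integral_nonneg_eq_0_iff_AE) auto
qed

section \<open>Essentially bounded functions are determined by their Hermite coefficients\<close>

lemma Linf_measurable: "f \<in> Linf \<Longrightarrow> f \<in> borel_measurable borel"
  by (simp add: Linf_def)

lemma LinfE:
  assumes "f \<in> Linf"
  obtains C where "C \<ge> 0" "AE z in lborel. cmod (f z) \<le> C"
proof -
  obtain C where "AE z in lborel. cmod (f z) \<le> C"
    using assms by (auto simp: Linf_def)
  then have "AE z in lborel. cmod (f z) \<le> max 0 C"
    by eventually_elim auto
  then show ?thesis
    by (intro that[of "max 0 C"]) auto
qed

lemma LinfI: "f \<in> borel_measurable borel \<Longrightarrow> (\<And>z. cmod (f z) \<le> C) \<Longrightarrow> f \<in> Linf"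
  by (auto simp: Linf_def intro!: exI[of _ C])

lemma Linf_mult_integrable:
  assumes f: "f \<in> Linf" and g: "integrable lborel g"
  shows "integrable lborel (\<lambda>z. f z * g z)"
proof -
  obtain C where C: "C \<ge> 0" "AE z in lborel. cmod (f z) \<le> C"
    by (rule LinfE[OF f]) blast
  have [measurable]: "f \<in> borel_measurable borel" "g \<in> borel_measurable borel"
    using f g by (auto simp: Linf_measurable)
  have "integrable lborel (\<lambda>z. of_real C * g z)"
    using g by simp
  then show ?thesis
  proof (rule Bochner_Integration.integrable_bound)
    show "AE z in lborel. norm (f z * g z) \<le> norm (of_real C * g z)"
      using C(2) by eventually_elim (use C(1) in \<open>auto simp: norm_mult intro!: mult_right_mono\<close>)
  qed simp
qed

lemma Linf_mult_integrable_gauss: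
  assumes f: "f \<in> Linf" and g: "integrable gauss g"
  shows "integrable gauss (\<lambda>z. f z * g z)"
proof -
  have [measurable]: "f \<in> borel_measurable borel" "g \<in> borel_measurable borel"
    using f g by (auto simp: Linf_measurable)
  have "integrable lborel (\<lambda>z. f z * ((exp (- (cmod z)\<^sup>2) / pi) *\<^sub>R g z))"
    using g by (intro Linf_mult_integrable[OF f]) (simp add: integrable_gauss_iff)
  then show ?thesis
    by (simp add: integrable_gauss_iff)
qed

text \<open>Vanishing Hermite coefficients give vanishing moments, these give vanishing integrals
  against all exponentials by termwise integration, and imaginary exponents make this the Fourier
  transform of \<open>f\<close> times the Gaussian density.\<close>

lemma Linf_hermite_unique:
  assumes f: "f \<in> Linf" and zero: "\<And>p q. (LINT z|gauss. f z * hermite p q z) = 0"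
  shows "AE z in lborel. f z = 0"
proof -
  have [measurable]: "f \<in> borel_measurable borel"
    using f by (rule Linf_measurable)
  have int: "integrable gauss (\<lambda>z. f z * g z)" if "exp_bounded g" for g
    using that by (intro Linf_mult_integrable_gauss[OF f] exp_bounded_imp_integrable)
  have mono: "(LINT z|gauss. f z * (cnj z ^ a * z ^ b)) = 0" for a b
  proof -
    have "(LINT z|gauss. f z * (cnj z ^ a * z ^ b))
        = (LINT z|gauss. (\<Sum>j\<le>a. of_nat (fact j * (a choose j) * (b choose j)) * (f z * hermite (a - j) (b - j) z)))"
      unfolding monomial_hermite sum_distrib_left by (simp only: mult.left_commute)
    also have "\<dots> = (\<Sum>j\<le>a. (LINT z|gauss. of_nat (fact j * (a choose j) * (b choose j)) * (f z * hermite (a - j) (b - j) z)))"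
      by (rule Bochner_Integration.integral_sum) (intro integrable_mult_right int exp_bounded_hermite)
    also have "\<dots> = 0"
      by (simp only: integral_mult_right_zero zero mult_zero_right sum.neutral_const)
    finally show ?thesis .
  qed
  have zero_exp: "(LINT z|gauss. f z * exp (a * z + b * cnj z)) = 0" for a b
  proof -
    have "(\<lambda>n. LINT z|gauss. f z * ((a * z + b * cnj z) ^ n /\<^sub>R fact n)) sums (LINT z|gauss. f z * exp (a * z + b * cnj z))"
    proof (rule sums_integral_exp(1)[where R = "cmod a + cmod b"])
      show "integrable gauss (\<lambda>z. f z * of_real (exp ((cmod a + cmod b) * cmod z)))"
        using exp_bounded_imp_integrable_exp[OF exp_bounded_const[of 1], of "cmod a + cmod b"]
        by (intro Linf_mult_integrable_gauss[OF f]) simp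
    qed auto
    moreover have "(LINT z|gauss. f z * ((a * z + b * cnj z) ^ n /\<^sub>R fact n)) = 0" for n
    proof -
      have "(LINT z|gauss. f z * ((a * z + b * cnj z) ^ n /\<^sub>R fact n))
          = (LINT z|gauss. (\<Sum>i\<le>n. (of_nat (n choose i) / fact n * a ^ i * b ^ (n - i)) * (f z * (cnj z ^ (n - i) * z ^ i))))"
        unfolding binomial_ring scaleR_conv_of_real
        by (simp add: sum_distrib_left power_mult_distrib divide_inverse mult_ac)
      also have "\<dots> = (\<Sum>i\<le>n. (LINT z|gauss. (of_nat (n choose i) / fact n * a ^ i * b ^ (n - i)) * (f z * (cnj z ^ (n - i) * z ^ i))))"
        by (rule Bochner_Integration.integral_sum) (intro integrable_mult_right int exp_bounded_intros)
      also have "\<dots> = 0"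
        by (simp only: integral_mult_right_zero mono mult_zero_right sum.neutral_const)
      finally show ?thesis .
    qed
    ultimately show ?thesis
      by (simp add: sums_iff)
  qed
  define h where "h z = (exp (- (cmod z)\<^sup>2) / pi) *\<^sub>R f z" for z
  have "AE z in lborel. h z = 0"
  proof (rule Fourier_transform_unique)
    show "integrable lborel h"
      using int[OF exp_bounded_const[of 1]] by (simp add: integrable_gauss_iff h_def[abs_def])
    show "(LINT z|lborel. h z * exp (\<xi> * cnj z - cnj \<xi> * z)) = 0" for \<xi>
    proof -
      have "(LINT z|gauss. f z * exp (- cnj \<xi> * z + \<xi> * cnj z)) = 0"
        by (rule zero_exp)
      then show ?thesis
        by (subst (asm) integral_gauss) (simp_all add: h_def)
    qed
  qed
  then show ?thesis
    by eventually_elim (simp add: h_def)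
qed

subsection \<open>Angular components\<close>

text \<open>The component of \<open>f\<close> transforming by \<open>cis (n * t)\<close> under the rotation by \<open>t\<close>.\<close>

definition ang :: "int \<Rightarrow> (complex \<Rightarrow> complex) \<Rightarrow> complex \<Rightarrow> complex" where
  "ang n f z = (LINT t|circ. f (cis t * z) * cis (- (of_int n * t)))"

lemma measurable_cis [measurable]: "cis \<in> borel_measurable borel"
  by (intro borel_measurable_continuous_onI continuous_intros)

lemma measurable_ang [measurable]:
  assumes [measurable]: "f \<in> borel_measurable borel"
  shows "ang n f \<in> borel_measurable borel"
  unfolding ang_def[abs_def] by measurable

lemma ang_bounded:
  assumes [measurable]: "f \<in> borel_measurable borel" and C: "\<And>z. cmod (f z) \<le> C"
  shows "cmod (ang n f z) \<le> C"
proof -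
  have "cmod (ang n f z) \<le> (LINT t|circ. C)"
    unfolding ang_def
  proof (rule order.trans[OF integral_norm_bound integral_mono])
    have "integrable circ (\<lambda>t. f (cis t * z) * cis (- (of_int n * t)))"
      by (rule integrable_circ[where B = C]) (auto simp: norm_mult C)
    then show "integrable circ (\<lambda>t. cmod (f (cis t * z) * cis (- (of_int n * t))))"
      by (rule integrable_norm)
  qed (auto simp: norm_mult C)
  then show ?thesis
    by simp
qed

text \<open>The measure is left general because the exchange is needed for \<open>gauss\<close> in
  Hilbert space arguments and for \<open>lborel\<close> in pairings with integrable
  functions.\<close>

lemma ang_Fubini:
  fixes f g :: "complex \<Rightarrow> complex"
  assumes [measurable]: "f \<in> borel_measurable borel" "g \<in> borel_measurable borel"
    and M: "sigma_finite_measure M" and sets: "sets M = sets borel"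
    and int: "\<And>t. integrable M (\<lambda>z. f (cis t * z) * g z)"
    and bound: "\<And>t. (LINT z|M. cmod (f (cis t * z) * g z)) \<le> K"
  shows "(LINT z|M. ang n f z * g z) = (LINT t|circ. cis (- (of_int n * t)) * (LINT z|M. f (cis t * z) * g z))"
proof -
  interpret M: sigma_finite_measure M by fact
  interpret P: pair_sigma_finite circ M ..
  note [measurable_cong] = sets
  let ?F = "\<lambda>t z. cis (- (of_int n * t)) * (f (cis t * z) * g z)"
  have meas: "(\<lambda>t. LINT z|M. cmod (f (cis t * z) * g z)) \<in> borel_measurable borel"
    by measurable
  have "integrable (circ \<Otimes>\<^sub>M M) (case_prod ?F)"
  proof (rule P.Fubini_integrable)
    show "integrable circ (\<lambda>t. LINT z|M. norm (case (t, z) of (t, z) \<Rightarrow> ?F t z))"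
    proof -
      have "integrable circ (\<lambda>t. LINT z|M. cmod (f (cis t * z) * g z))"
        by (rule circ.integrable_const_bound[of _ K]) (use meas bound in auto)
      then show ?thesis
        by (simp add: norm_mult)
    qed
    show "AE t in circ. integrable M (\<lambda>z. case (t, z) of (t, z) \<Rightarrow> ?F t z)"
      by (intro AE_I2) (simp add: int)
  qed measurable
  then have "(LINT z|M. LINT t|circ. ?F t z) = (LINT t|circ. LINT z|M. ?F t z)"
    by (rule P.Fubini_integral)
  moreover have "(LINT t|circ. ?F t z) = ang n f z * g z" for z
  proof -
    have "(LINT t|circ. ?F t z) = (LINT t|circ. (f (cis t * z) * cis (- (of_int n * t))) * g z)"
      by (simp only: mult_ac)
    then show ?thesis
      by (simp add: ang_def)
  qed
  ultimately show ?thesis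
    by simp
qed

lemma hermite_rotate: "hermite p q (cis t * z) = cis ((real q - real p) * t) * hermite p q z"
proof -
  have "cnj (cis t * z) ^ (p - j) * (cis t * z) ^ (q - j) = cis ((real q - real p) * t) * (cnj z ^ (p - j) * z ^ (q - j))"
    if "j \<le> p" "j \<le> q" for j
  proof -
    have "cnj (cis t) ^ (p - j) * cis t ^ (q - j) = cis ((real q - real p) * t)"
      using that by (simp add: cis_cnj Complex.DeMoivre cis_mult of_nat_diff algebra_simps)
    moreover have "cnj (cis t * z) ^ (p - j) * (cis t * z) ^ (q - j)
        = (cnj (cis t) ^ (p - j) * cis t ^ (q - j)) * (cnj z ^ (p - j) * z ^ (q - j))"
      unfolding complex_cnj_mult power_mult_distrib by (simp only: mult_ac)
    ultimately show ?thesis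
      by (simp only:)
  qed
  then have "(-1) ^ j * of_nat (fact j * (p choose j) * (q choose j)) * cnj (cis t * z) ^ (p - j) * (cis t * z) ^ (q - j)
      = cis ((real q - real p) * t) * ((-1) ^ j * of_nat (fact j * (p choose j) * (q choose j)) * cnj z ^ (p - j) * z ^ (q - j))" if "j \<le> p" for j
  proof (cases "j \<le> q")
    case True
    then show ?thesis
      using \<open>\<And>j. j \<le> p \<Longrightarrow> j \<le> q \<Longrightarrow> _ j = _ j\<close>[OF that True]
      unfolding mult.assoc by (simp only: mult.left_commute[of _ "cis ((real q - real p) * t)"])
  qed (simp add: binomial_eq_0)
  then show ?thesis
    unfolding hermite_def sum_distrib_left by (intro sum.cong) auto
qed

text \<open>By invariance of \<open>gauss\<close> the rotation moves from \<open>f\<close> to the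
  Hermite polynomial, which has a definite weight; the integral over the angle then selects one
  diagonal.\<close>

lemma ang_hermite_integral:
  assumes f [measurable]: "f \<in> borel_measurable borel" and int: "integrable gauss (\<lambda>z. f z * hermite p q z)"
  shows "(LINT z|gauss. ang n f z * hermite p q z)
    = (if n = int p - int q then (LINT z|gauss. f z * hermite p q z) else 0)"
proof -
  let ?g = "\<lambda>z. f z * hermite p q z"
  have eq: "f (cis t * z) * hermite p q z = cis ((real p - real q) * t) * ?g (cis t * z)" for t z
    unfolding hermite_rotate by (simp add: cis_mult algebra_simps)
  have int_t: "integrable gauss (\<lambda>z. ?g (cis t * z))" for t
    by (rule integrable_gauss_rotate[of "cis t" ?g]) (use int in auto)
  have "(LINT z|gauss. ang n f z * hermite p q z)
      = (LINT t|circ. cis (- (of_int n * t)) * (LINT z|gauss. f (cis t * z) * hermite p q z))"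
  proof (rule ang_Fubini)
    show "integrable gauss (\<lambda>z. f (cis t * z) * hermite p q z)" for t
      unfolding eq using int_t by simp
    show "(LINT z|gauss. cmod (f (cis t * z) * hermite p q z)) \<le> (LINT z|gauss. cmod (?g z))" for t
      unfolding eq norm_mult[of "cis _"] norm_cis mult_1_left
      by (subst integral_gauss_rotate[of "cis t" "\<lambda>z. cmod (?g z)"]) auto
  qed (auto simp: gauss.sigma_finite_measure_axioms)
  also have "(\<lambda>t. LINT z|gauss. f (cis t * z) * hermite p q z) = (\<lambda>t. cis ((real p - real q) * t) * integral\<^sup>L gauss ?g)"
    unfolding eq by (subst integral_mult_right_zero, subst integral_gauss_rotate[of "cis _" ?g]) auto
  then have "(LINT t|circ. cis (- (of_int n * t)) * (LINT z|gauss. f (cis t * z) * hermite p q z))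
      = (LINT t|circ. cis (of_int (int p - int q - n) * t) * integral\<^sup>L gauss ?g)"
    by (simp add: fun_eq_iff cis_mult mult.assoc[symmetric]) (simp add: algebra_simps)
  also have "\<dots> = (if n = int p - int q then integral\<^sup>L gauss ?g else 0)"
    by (subst integral_mult_left_zero) (auto simp: integral_circ_cis simp del: of_int_diff)
  finally show ?thesis .
qed

subsection \<open>The structure of the polyanalytic Fock spaces\<close>

text \<open>The explicit solutions of the n-fold \<open>dbar\<close> equation. The coefficients are
  indexed by all naturals, but only those below \<open>n\<close> enter, so order 0 leaves just the
  zero function.\<close>

definition polyanalytic :: "nat \<Rightarrow> (complex \<Rightarrow> complex) set" where
  "polyanalytic n = {(\<lambda>z. \<Sum>b<n. cnj z ^ b * F b z) | F. \<forall>b. F b holomorphic_on UNIV}"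

lemma polyanalyticI:
  "(\<And>b. F b holomorphic_on UNIV) \<Longrightarrow> (\<And>z. f z = (\<Sum>b<n. cnj z ^ b * F b z)) \<Longrightarrow> f \<in> polyanalytic n"
  by (auto simp: polyanalytic_def fun_eq_iff)

lemma polyanalyticE:
  assumes "f \<in> polyanalytic n"
  obtains F where "\<And>b. F b holomorphic_on UNIV" "\<And>z. f z = (\<Sum>b<n. cnj z ^ b * F b z)"
  using assms by (auto simp: polyanalytic_def)

lemma polyanalytic_has_derivative:
  assumes F: "\<And>b. F b holomorphic_on UNIV"
  shows "((\<lambda>z. \<Sum>b<n. cnj z ^ b * F b z) has_derivative
    (\<lambda>v. \<Sum>b<n. cnj z ^ b * (deriv (F b) z * v) + of_nat b * cnj z ^ (b - 1) * F b z * cnj v)) (at z)"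
proof (rule has_derivative_sum)
  fix b
  have "(F b has_field_derivative deriv (F b) z) (at z)"
    using F by (intro holomorphic_derivI[of _ UNIV]) auto
  then have 1: "(F b has_derivative (\<lambda>v. deriv (F b) z * v)) (at z)"
    by (simp add: has_field_derivative_def)
  have 2: "((\<lambda>z. cnj z ^ b) has_derivative (\<lambda>v. of_nat b * cnj v * cnj z ^ (b - 1))) (at z)"
    by (auto intro!: derivative_eq_intros)
  show "((\<lambda>z. cnj z ^ b * F b z) has_derivative
      (\<lambda>v. cnj z ^ b * (deriv (F b) z * v) + of_nat b * cnj z ^ (b - 1) * F b z * cnj v)) (at z)"
    by (rule has_derivative_eq_rhs[OF has_derivative_mult[OF 2 1]]) (auto simp: fun_eq_iff)
qed

lemma frechet_derivative_polyanalytic: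
  assumes F: "\<And>b. F b holomorphic_on UNIV"
  shows "frechet_derivative (\<lambda>z. \<Sum>b<n. cnj z ^ b * F b z) (at z) v =
    (\<Sum>b<n. cnj z ^ b * (deriv (F b) z * v) + of_nat b * cnj z ^ (b - 1) * F b z * cnj v)"
  by (subst frechet_derivative_at[OF polyanalytic_has_derivative[OF F], symmetric]) (rule refl)

lemma sum_lower_index:
  fixes G :: "nat \<Rightarrow> complex"
  shows "(\<Sum>b<n. of_nat b * cnj z ^ (b - 1) * G b) = (\<Sum>b<n - 1. cnj z ^ b * (of_nat (Suc b) * G (Suc b)))"
proof (cases n)
  case (Suc k)
  show ?thesis
    unfolding Suc by (subst sum.lessThan_Suc_shift) (simp add: ac_simps)
qed simp

text \<open>Every directional derivative of such a sum is again of this form with the same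
  \<open>n\<close>, so induction over the differentiability order closes.\<close>

lemma polyanalytic_smooth:
  assumes "f \<in> polyanalytic n"
  shows "smooth f"
proof -
  have "f \<in> polyanalytic n \<Longrightarrow> C_diff k f" for k
  proof (induction k arbitrary: f)
    case 0
    then obtain F where F: "\<And>b. F b holomorphic_on UNIV" "f = (\<lambda>z. \<Sum>b<n. cnj z ^ b * F b z)"
      by (auto simp: polyanalytic_def)
    show ?case
      unfolding F(2) C_diff.simps
      by (intro continuous_intros holomorphic_on_imp_continuous_on F(1))
  next
    case (Suc k)
    then obtain F where F: "\<And>b. F b holomorphic_on UNIV" "f = (\<lambda>z. \<Sum>b<n. cnj z ^ b * F b z)"
      by (auto simp: polyanalytic_def)
    have "f differentiable_on UNIV"
      unfolding F(2) differentiable_on_def differentiable_def using polyanalytic_has_derivative[of F n, OF F(1)] by blast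
    moreover have "(\<lambda>z. frechet_derivative f (at z) v) \<in> polyanalytic n" for v
    proof (rule polyanalyticI)
      let ?G = "\<lambda>b z. deriv (F b) z * v + (if Suc b < n then of_nat (Suc b) * F (Suc b) z * cnj v else 0)"
      show "?G b holomorphic_on UNIV" for b
        by (cases "Suc b < n") (auto intro!: holomorphic_intros holomorphic_deriv F)
      fix z
      have "frechet_derivative f (at z) v = (\<Sum>b<n. cnj z ^ b * (deriv (F b) z * v)) + (\<Sum>b<n. of_nat b * cnj z ^ (b - 1) * (F b z * cnj v))"
        unfolding F(2) frechet_derivative_polyanalytic[OF F(1)] sum.distrib by (simp only: mult.assoc)
      also have "(\<Sum>b<n. of_nat b * cnj z ^ (b - 1) * (F b z * cnj v)) = (\<Sum>b<n - 1. cnj z ^ b * (of_nat (Suc b) * (F (Suc b) z * cnj v)))"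
        by (rule sum_lower_index)
      also have "\<dots> = (\<Sum>b<n. cnj z ^ b * (if Suc b < n then of_nat (Suc b) * F (Suc b) z * cnj v else 0))"
        by (rule sum.mono_neutral_cong_left) (auto simp: mult.assoc)
      finally show "frechet_derivative f (at z) v = (\<Sum>b<n. cnj z ^ b * ?G b z)"
        by (simp add: distrib_left sum.distrib)
    qed
    ultimately show ?case
      using Suc.IH by simp
  qed
  then show ?thesis
    using assms by (simp add: smooth_def)
qed

lemma dbar_polyanalytic_sum:
  assumes F: "\<And>b. F b holomorphic_on UNIV"
  shows "dbar (\<lambda>z. \<Sum>b<n. cnj z ^ b * F b z) = (\<lambda>z. \<Sum>b<n - 1. cnj z ^ b * (of_nat (Suc b) * F (Suc b) z))"
proof
  fix z
  have "dbar (\<lambda>z. \<Sum>b<n. cnj z ^ b * F b z) z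
      = ((\<Sum>b<n. cnj z ^ b * (deriv (F b) z * 1) + of_nat b * cnj z ^ (b - 1) * F b z * cnj 1)
        + \<i> * (\<Sum>b<n. cnj z ^ b * (deriv (F b) z * \<i>) + of_nat b * cnj z ^ (b - 1) * F b z * cnj \<i>)) / 2"
    unfolding dbar_def frechet_derivative_polyanalytic[OF F] ..
  also have "\<dots> = (\<Sum>b<n. 2 * (of_nat b * cnj z ^ (b - 1) * F b z)) / 2"
    unfolding sum_distrib_left sum.distrib[symmetric]
    by (intro arg_cong[where f = "\<lambda>x. x / 2"] sum.cong refl) (simp add: algebra_simps)
  also have "\<dots> = (\<Sum>b<n. of_nat b * cnj z ^ (b - 1) * F b z)"
    by (simp add: sum_distrib_left[symmetric])
  also have "\<dots> = (\<Sum>b<n - 1. cnj z ^ b * (of_nat (Suc b) * F (Suc b) z))"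
    by (rule sum_lower_index)
  finally show "dbar (\<lambda>z. \<Sum>b<n. cnj z ^ b * F b z) z = (\<Sum>b<n - 1. cnj z ^ b * (of_nat (Suc b) * F (Suc b) z))" .
qed

lemma polyanalytic_dbar_pow:
  assumes "f \<in> polyanalytic n"
  shows "(dbar ^^ n) f z = 0"
  using assms
proof (induction n arbitrary: f)
  case 0
  then show ?case
    by (auto simp: polyanalytic_def)
next
  case (Suc n)
  then obtain F where F: "\<And>b. F b holomorphic_on UNIV" "f = (\<lambda>z. \<Sum>b<Suc n. cnj z ^ b * F b z)"
    by (auto simp: polyanalytic_def)
  have "dbar f \<in> polyanalytic n"
    unfolding F(2) dbar_polyanalytic_sum[OF F(1)]
    by (rule polyanalyticI[where F = "\<lambda>b z. of_nat (Suc b) * F (Suc b) z"]) (auto intro!: holomorphic_intros F)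
  then show ?case
    by (simp only: funpow_Suc_right o_apply Suc.IH)
qed

section \<open>Solving the iterated \<open>dbar\<close> equation\<close>

lemma C_diff_linear:
  "C_diff k f \<Longrightarrow> C_diff k g \<Longrightarrow> C_diff k (\<lambda>z. a * f z + b * g z)"
proof (induction k arbitrary: f g)
  case 0
  then show ?case
    by (auto intro!: continuous_intros)
next
  case (Suc k)
  have d: "f differentiable (at z)" "g differentiable (at z)" for z
    using Suc.prems by (auto simp: differentiable_on_def)
  have "((\<lambda>z. a * f z + b * g z) has_derivative
      (\<lambda>v. a * frechet_derivative f (at z) v + b * frechet_derivative g (at z) v)) (at z)" for z
    by (intro derivative_intros d[THEN frechet_derivative_works[THEN iffD1]])
  then have "(\<lambda>z. a * f z + b * g z) differentiable_on UNIV"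
    "frechet_derivative (\<lambda>z. a * f z + b * g z) (at z) = (\<lambda>v. a * frechet_derivative f (at z) v + b * frechet_derivative g (at z) v)" for z
    by (auto simp: differentiable_on_def differentiable_def intro: frechet_derivative_at[symmetric])
  then show ?case
    using Suc by simp
qed

lemma smooth_differentiable: "smooth f \<Longrightarrow> f differentiable (at z)"
  by (auto simp: smooth_def differentiable_on_def dest: spec[of _ "Suc 0"])

lemma smooth_dbar:
  assumes "smooth f"
  shows "smooth (dbar f)"
  unfolding smooth_def
proof
  fix k
  have "C_diff (Suc k) f"
    using assms by (auto simp: smooth_def)
  then have "C_diff k (\<lambda>z. 1 / 2 * frechet_derivative f (at z) 1 + \<i> / 2 * frechet_derivative f (at z) \<i>)"
    by (intro C_diff_linear) auto
  moreover have "(\<lambda>z. 1 / 2 * frechet_derivative f (at z) 1 + \<i> / 2 * frechet_derivative f (at z) \<i>) = dbar f"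
    by (auto simp: dbar_def fun_eq_iff field_simps)
  ultimately show "C_diff k (dbar f)"
    by simp
qed

text \<open>The real derivative D of the difference satisfies D i = i * D 1, the Cauchy-Riemann
  equation, and is therefore complex linear.\<close>

lemma holomorphic_if_dbar_eq:
  assumes f: "\<And>z. f differentiable (at z)" and g: "\<And>z. g differentiable (at z)" and eq: "\<And>z. dbar f z = dbar g z"
  shows "(\<lambda>z. f z - g z) holomorphic_on UNIV"
proof -
  have "(\<lambda>z. f z - g z) field_differentiable (at z)" for z
  proof -
    define D where "D v = frechet_derivative f (at z) v - frechet_derivative g (at z) v" for v
    have D: "((\<lambda>z. f z - g z) has_derivative D) (at z)"
      unfolding D_def
      by (intro derivative_intros f[THEN frechet_derivative_works[THEN iffD1]] g[THEN frechet_derivative_works[THEN iffD1]])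
    have "frechet_derivative f (at z) 1 + \<i> * frechet_derivative f (at z) \<i>
        = frechet_derivative g (at z) 1 + \<i> * frechet_derivative g (at z) \<i>"
      using eq[of z] unfolding dbar_def divide_cancel_right by simp
    then have "D 1 + \<i> * D \<i> = 0"
      by (simp add: D_def algebra_simps)
    then have Di: "D \<i> = \<i> * D 1"
      by (auto simp: complex_eq_iff)
    have lin: "linear D"
      using D by (rule has_derivative_linear)
    have "D v = D 1 * v" for v
    proof -
      have "v = Re v *\<^sub>R 1 + Im v *\<^sub>R \<i>"
        by (simp add: complex_eq_iff)
      then have "D v = D (Re v *\<^sub>R 1 + Im v *\<^sub>R \<i>)"
        by (rule arg_cong)
      also have "\<dots> = Re v *\<^sub>R D 1 + Im v *\<^sub>R D \<i>"
        by (simp only: linear_add[OF lin] linear_scale[OF lin])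
      also have "\<dots> = D 1 * (of_real (Re v) + \<i> * of_real (Im v))"
        by (simp add: Di scaleR_conv_of_real algebra_simps)
      also have "\<dots> = D 1 * v"
        by (simp only: complex_eq[symmetric])
      finally show ?thesis .
    qed
    then have "D = (\<lambda>v. D 1 * v)"
      by (rule ext)
    with D have "((\<lambda>z. f z - g z) has_derivative (\<lambda>v. D 1 * v)) (at z)"
      by metis
    then have "((\<lambda>z. f z - g z) has_field_derivative D 1) (at z)"
      by (simp only: has_field_derivative_def)
    then show ?thesis
      unfolding field_differentiable_def by blast
  qed
  then show ?thesis
    by (simp add: holomorphic_on_def field_differentiable_at_within)
qed

text \<open>Integrate the expansion of \<open>dbar f\<close> term by term in the conjugate variable;
  what \<open>f\<close> has beyond this primitive is entire and joins the coefficient of index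
  0.\<close>

lemma polyanalytic_if_dbar_pow:
  assumes "smooth f" "\<And>z. (dbar ^^ n) f z = 0"
  shows "f \<in> polyanalytic n"
  using assms
proof (induction n arbitrary: f)
  case 0
  then show ?case
    by (auto simp: polyanalytic_def fun_eq_iff intro!: exI[of _ "\<lambda>_ _. 0"])
next
  case (Suc n)
  have "(dbar ^^ n) (dbar f) z = 0" for z
    using Suc.prems(2)[of z] by (simp only: funpow_Suc_right o_apply)
  then have "dbar f \<in> polyanalytic n"
    using Suc.prems(1) by (intro Suc.IH smooth_dbar)
  then obtain G where G: "\<And>b. G b holomorphic_on UNIV" "\<And>z. dbar f z = (\<Sum>b<n. cnj z ^ b * G b z)"
    by (rule polyanalyticE) blast
  \<comment> \<open>The primitive of \<open>cnj z ^ (b - 1)\<close> is \<open>cnj z ^ b / b\<close>;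
    the constant term is left free.\<close>
  define F where "F b z = (if b = 0 then 0 else G (b - 1) z / of_nat b)" for b z
  have F: "F b holomorphic_on UNIV" for b
    unfolding F_def by (cases "b = 0") (auto intro!: holomorphic_intros G)
  define g where "g = (\<lambda>z. \<Sum>b<Suc n. cnj z ^ b * F b z)"
  have "g \<in> polyanalytic (Suc n)"
    using F by (intro polyanalyticI[of F]) (auto simp: g_def)
  then have "g differentiable (at z)" for z
    by (intro smooth_differentiable polyanalytic_smooth)
  moreover have "dbar f z = dbar g z" for z
    unfolding g_def dbar_polyanalytic_sum[OF F] G(2) by (simp add: F_def del: of_nat_Suc)
  ultimately have hol: "(\<lambda>z. f z - g z) holomorphic_on UNIV"
    using Suc.prems(1) by (intro holomorphic_if_dbar_eq) (auto intro: smooth_differentiable)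
  show ?case
  proof (rule polyanalyticI[of "\<lambda>b z. F b z + (if b = 0 then f z - g z else 0)"])
    show "(\<lambda>z. F b z + (if b = 0 then f z - g z else 0)) holomorphic_on UNIV" for b
      using F hol by (cases "b = 0") (auto intro!: holomorphic_intros)
    fix z
    have "(\<Sum>b<Suc n. cnj z ^ b * (F b z + (if b = 0 then f z - g z else 0)))
        = g z + (\<Sum>b<Suc n. if b = 0 then f z - g z else 0)"
      unfolding g_def distrib_left sum.distrib by (intro arg_cong2[where f = "(+)"] sum.cong) auto
    then show "f z = (\<Sum>b<Suc n. cnj z ^ b * (F b z + (if b = 0 then f z - g z else 0)))"
      by simp
  qed
qed

section \<open>Fock spaces as square integrable polyanalytic functions\<close>

definition L2 :: "(complex \<Rightarrow> complex) set" where
  "L2 = {f \<in> borel_measurable borel. integrable gauss (\<lambda>z. (cmod (f z))\<^sup>2)}"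

lemma polyanalytic_continuous: "f \<in> polyanalytic n \<Longrightarrow> continuous_on UNIV f"
  using polyanalytic_smooth[of f n] C_diff.simps(1)[of f] unfolding smooth_def by blast

lemma fock_eq: "fock n = polyanalytic n \<inter> L2"
proof -
  have "f \<in> borel_measurable borel" if "f \<in> polyanalytic n" for f
    using polyanalytic_continuous[OF that] by (rule borel_measurable_continuous_onI)
  then show ?thesis
    unfolding fock_def L2_def
    by (auto intro: polyanalytic_if_dbar_pow dest: polyanalytic_smooth polyanalytic_dbar_pow)
qed

lemma polyanalytic_linear:
  assumes "f \<in> polyanalytic n" "g \<in> polyanalytic n"
  shows "(\<lambda>z. a * f z + b * g z) \<in> polyanalytic n"
proof -
  obtain F where F: "\<And>b. F b holomorphic_on UNIV" "\<And>z. f z = (\<Sum>b<n. cnj z ^ b * F b z)"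
    using assms(1) by (rule polyanalyticE) blast
  obtain G where G: "\<And>b. G b holomorphic_on UNIV" "\<And>z. g z = (\<Sum>b<n. cnj z ^ b * G b z)"
    using assms(2) by (rule polyanalyticE) blast
  show ?thesis
    by (rule polyanalyticI[of "\<lambda>i z. a * F i z + b * G i z"])
      (auto intro!: holomorphic_intros F G simp: F(2) G(2) sum_distrib_left sum.distrib algebra_simps)
qed

lemma polyanalytic_weyl:
  assumes "f \<in> polyanalytic n"
  shows "weyl z f \<in> polyanalytic n"
proof -
  obtain F where F: "\<And>b. F b holomorphic_on UNIV" "\<And>z. f z = (\<Sum>b<n. cnj z ^ b * F b z)"
    using assms by (rule polyanalyticE) blast
  define E where "E w = exp (w * cnj z - complex_of_real ((cmod z)\<^sup>2 / 2))" for w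
  \<comment> \<open>Coefficient of \<open>cnj w ^ i\<close> after expanding
    \<open>cnj (w - z) ^ b\<close>; the Weyl factor \<open>E\<close> is entire in
    \<open>w\<close>.\<close>
  define G where "G i w = (\<Sum>b<n. of_nat (b choose i) * (- cnj z) ^ (b - i) * (E w * F b (w - z)))" for i w
  show ?thesis
  proof (rule polyanalyticI[of G])
    have "(\<lambda>w. F b (w - z)) holomorphic_on UNIV" for b
      by (intro holomorphic_on_compose_gen[of "\<lambda>w. w - z" UNIV "F b" UNIV, unfolded o_def] holomorphic_intros F(1)) auto
    then show "G i holomorphic_on UNIV" for i
      unfolding G_def[abs_def] E_def by (intro holomorphic_intros)
    fix w
    have "cnj (w - z) ^ b = (\<Sum>i<n. of_nat (b choose i) * cnj w ^ i * (- cnj z) ^ (b - i))" if "b < n" for b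
    proof -
      have "cnj (w - z) ^ b = (\<Sum>i\<le>b. of_nat (b choose i) * cnj w ^ i * (- cnj z) ^ (b - i))"
        using binomial_ring[of "cnj w" "- cnj z" b] by simp
      also have "\<dots> = (\<Sum>i<n. of_nat (b choose i) * cnj w ^ i * (- cnj z) ^ (b - i))"
        using that by (intro sum.mono_neutral_left) (auto simp: binomial_eq_0)
      finally show ?thesis .
    qed
    then have "weyl z f w = E w * (\<Sum>b<n. (\<Sum>i<n. of_nat (b choose i) * cnj w ^ i * (- cnj z) ^ (b - i)) * F b (w - z))"
      by (simp add: weyl_def E_def F(2))
    also have "\<dots> = (\<Sum>b<n. \<Sum>i<n. cnj w ^ i * (of_nat (b choose i) * (- cnj z) ^ (b - i) * (E w * F b (w - z))))"
      by (simp add: sum_distrib_left sum_distrib_right mult_ac)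
    also have "\<dots> = (\<Sum>i<n. \<Sum>b<n. cnj w ^ i * (of_nat (b choose i) * (- cnj z) ^ (b - i) * (E w * F b (w - z))))"
      by (rule sum.swap)
    finally show "weyl z f w = (\<Sum>i<n. cnj w ^ i * G i w)"
      by (simp add: G_def sum_distrib_left)
  qed
qed

subsection \<open>The inner product\<close>

lemma L2_measurable: "f \<in> L2 \<Longrightarrow> f \<in> borel_measurable borel"
  by (simp add: L2_def)

lemma L2_integrable_square: "f \<in> L2 \<Longrightarrow> integrable gauss (\<lambda>z. (cmod (f z))\<^sup>2)"
  by (simp add: L2_def)

lemma exp_bounded_L2: "exp_bounded f \<Longrightarrow> f \<in> L2"
  by (simp add: L2_def exp_bounded_measurable exp_bounded_imp_square_integrable)

lemma L2_mult_integrable: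
  assumes f: "f \<in> L2" and g: "g \<in> L2"
  shows "integrable gauss (\<lambda>z. f z * g z)"
proof -
  have [measurable]: "f \<in> borel_measurable borel" "g \<in> borel_measurable borel"
    using assms by (auto dest: L2_measurable)
  have "integrable gauss (\<lambda>z. (cmod (f z))\<^sup>2 + (cmod (g z))\<^sup>2)"
    using assms by (simp add: L2_integrable_square)
  then show ?thesis
  proof (rule Bochner_Integration.integrable_bound)
    show "AE z in gauss. norm (f z * g z) \<le> norm ((cmod (f z))\<^sup>2 + (cmod (g z))\<^sup>2)"
    proof (rule AE_I2)
      fix z
      have "2 * cmod (f z) * cmod (g z) \<le> (cmod (f z))\<^sup>2 + (cmod (g z))\<^sup>2" "0 \<le> cmod (f z) * cmod (g z)"
        by (rule sum_squares_bound) simp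
      then show "norm (f z * g z) \<le> norm ((cmod (f z))\<^sup>2 + (cmod (g z))\<^sup>2)"
        unfolding norm_mult real_norm_def by linarith
    qed
  qed simp
qed

lemma L2_cnj: "f \<in> L2 \<Longrightarrow> (\<lambda>z. cnj (f z)) \<in> L2"
  by (auto simp: L2_def)

lemma L2_ip_integrable: "f \<in> L2 \<Longrightarrow> g \<in> L2 \<Longrightarrow> integrable gauss (\<lambda>z. f z * cnj (g z))"
  using L2_mult_integrable[OF _ L2_cnj] .

lemma L2_add:
  assumes f: "f \<in> L2" and g: "g \<in> L2"
  shows "(\<lambda>z. f z + g z) \<in> L2"
proof -
  have [measurable]: "f \<in> borel_measurable borel" "g \<in> borel_measurable borel"
    using assms by (auto dest: L2_measurable)
  have "integrable gauss (\<lambda>z. 2 * ((cmod (f z))\<^sup>2 + (cmod (g z))\<^sup>2))"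
    using assms by (simp add: L2_integrable_square)
  then have "integrable gauss (\<lambda>z. (cmod (f z + g z))\<^sup>2)"
  proof (rule Bochner_Integration.integrable_bound)
    show "AE z in gauss. norm ((cmod (f z + g z))\<^sup>2) \<le> norm (2 * ((cmod (f z))\<^sup>2 + (cmod (g z))\<^sup>2))"
    proof (rule AE_I2)
      fix z
      have "(cmod (f z + g z))\<^sup>2 \<le> (cmod (f z) + cmod (g z))\<^sup>2"
        by (intro power_mono norm_triangle_ineq) simp
      also have "\<dots> \<le> 2 * ((cmod (f z))\<^sup>2 + (cmod (g z))\<^sup>2)"
        using sum_squares_bound[of "cmod (f z)" "cmod (g z)"] by (simp add: power2_sum)
      finally show "norm ((cmod (f z + g z))\<^sup>2) \<le> norm (2 * ((cmod (f z))\<^sup>2 + (cmod (g z))\<^sup>2))"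
        by simp
    qed
  qed simp
  then show ?thesis
    by (simp add: L2_def)
qed

lemma L2_cmult: "f \<in> L2 \<Longrightarrow> (\<lambda>z. a * f z) \<in> L2"
  by (auto simp: L2_def norm_mult power_mult_distrib)

lemma L2_zero: "(\<lambda>_. 0) \<in> L2"
  by (simp add: L2_def)

lemma L2_linear: "f \<in> L2 \<Longrightarrow> g \<in> L2 \<Longrightarrow> (\<lambda>z. a * f z + b * g z) \<in> L2"
  by (intro L2_add L2_cmult)

lemma L2_sum: "(\<And>i. i \<in> I \<Longrightarrow> u i \<in> L2) \<Longrightarrow> (\<lambda>z. \<Sum>i\<in>I. a i * u i z) \<in> L2"
proof (induction I rule: infinite_finite_induct)
  case (insert i I)
  then have "(\<lambda>z. a i * u i z + (\<Sum>i\<in>I. a i * u i z)) \<in> L2"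
    by (intro L2_add[of "\<lambda>z. a i * u i z"] L2_cmult) auto
  then show ?case
    using insert by simp
qed (simp_all add: L2_zero)

lemma cnj_ip: "cnj (ip f g) = ip g f"
  by (simp add: ip_def mult.commute flip: Bochner_Integration.integral_cnj)

lemma ip_linear_left:
  "f \<in> L2 \<Longrightarrow> g \<in> L2 \<Longrightarrow> h \<in> L2 \<Longrightarrow> ip (\<lambda>z. a * f z + b * g z) h = a * ip f h + b * ip g h"
  using L2_ip_integrable[of f h] L2_ip_integrable[of g h] by (simp add: ip_def distrib_right mult.assoc)

lemma ip_zero_left [simp]: "ip (\<lambda>_. 0) h = 0"
  by (simp add: ip_def)

lemma ip_cmult_left: "ip (\<lambda>z. a * f z) h = a * ip f h"
  by (simp add: ip_def mult.assoc)

lemma ip_add_left: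
  "f \<in> L2 \<Longrightarrow> g \<in> L2 \<Longrightarrow> h \<in> L2 \<Longrightarrow> ip (\<lambda>z. f z + g z) h = ip f h + ip g h"
  using ip_linear_left[of f g h 1 1] by simp

lemma ip_diff_left:
  "f \<in> L2 \<Longrightarrow> g \<in> L2 \<Longrightarrow> h \<in> L2 \<Longrightarrow> ip (\<lambda>z. f z - g z) h = ip f h - ip g h"
  using ip_linear_left[of f g h 1 "-1"] by simp

lemma L2_diff: "f \<in> L2 \<Longrightarrow> g \<in> L2 \<Longrightarrow> (\<lambda>z. f z - g z) \<in> L2"
  using L2_linear[of f g 1 "-1"] by simp

lemma ip_sum_left:
  assumes "\<And>i. i \<in> I \<Longrightarrow> u i \<in> L2" "h \<in> L2"
  shows "ip (\<lambda>z. \<Sum>i\<in>I. a i * u i z) h = (\<Sum>i\<in>I. a i * ip (u i) h)"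
  using assms
proof (induction I rule: infinite_finite_induct)
  case (insert i I)
  then have "ip (\<lambda>z. \<Sum>i\<in>insert i I. a i * u i z) h = ip (\<lambda>z. a i * u i z + (\<Sum>i\<in>I. a i * u i z)) h"
    by simp
  also have "\<dots> = a i * ip (u i) h + (\<Sum>i\<in>I. a i * ip (u i) h)"
    using insert by (simp add: ip_add_left L2_cmult L2_sum ip_cmult_left)
  finally show ?case
    using insert by simp
qed simp_all

lemma ip_sum_right:
  assumes "\<And>i. i \<in> I \<Longrightarrow> u i \<in> L2" "h \<in> L2"
  shows "ip h (\<lambda>z. \<Sum>i\<in>I. a i * u i z) = (\<Sum>i\<in>I. cnj (a i) * ip h (u i))"
proof -
  have "cnj (ip (\<lambda>z. \<Sum>i\<in>I. a i * u i z) h) = (\<Sum>i\<in>I. cnj (a i) * cnj (ip (u i) h))"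
    using assms by (simp add: ip_sum_left)
  then show ?thesis
    by (simp add: cnj_ip)
qed

lemma L2norm_nonneg [simp]: "L2norm f \<ge> 0"
  by (simp add: L2norm_def)

lemma L2norm_square: "(L2norm f)\<^sup>2 = (LINT z|gauss. (cmod (f z))\<^sup>2)"
  by (simp add: L2norm_def)

lemma ip_self: "ip f f = of_real ((L2norm f)\<^sup>2)"
proof -
  have "ip f f = (LINT z|gauss. of_real ((cmod (f z))\<^sup>2))"
    unfolding ip_def by (simp only: complex_norm_square)
  then show ?thesis
    by (simp only: integral_complex_of_real L2norm_square)
qed

lemma ip_Cauchy_Schwarz:
  assumes f: "f \<in> L2" and g: "g \<in> L2"
  shows "cmod (ip f g) \<le> L2norm f * L2norm g"
    and "(LINT z|gauss. cmod (f z) * cmod (g z)) \<le> L2norm f * L2norm g"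
proof -
  have [measurable]: "f \<in> borel_measurable borel" "g \<in> borel_measurable borel"
    using assms by (auto dest: L2_measurable)
  let ?I = "LINT z|gauss. cmod (f z) * cmod (g z)"
  have int: "integrable gauss (\<lambda>z. cmod (f z) * cmod (g z))"
    using integrable_norm[OF L2_mult_integrable[OF f g]] by (simp add: norm_mult)
  have sq: "(\<integral>\<^sup>+z. (ennreal (cmod (h z)))\<^sup>2 \<partial>gauss) = ennreal ((L2norm h)\<^sup>2)" if "h \<in> L2" for h
  proof -
    have "(\<integral>\<^sup>+z. (ennreal (cmod (h z)))\<^sup>2 \<partial>gauss) = (\<integral>\<^sup>+z. ennreal ((cmod (h z))\<^sup>2) \<partial>gauss)"
      by (simp add: ennreal_power)
    also have "\<dots> = ennreal (LINT z|gauss. (cmod (h z))\<^sup>2)"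
      by (rule nn_integral_eq_integral[OF L2_integrable_square[OF that]]) simp
    finally show ?thesis
      by (simp add: L2norm_square)
  qed
  have "(ennreal ?I)\<^sup>2 = (\<integral>\<^sup>+z. ennreal (cmod (f z)) * ennreal (cmod (g z)) \<partial>gauss)\<^sup>2"
    using nn_integral_eq_integral[OF int] by (simp add: ennreal_mult)
  also have "\<dots> \<le> (\<integral>\<^sup>+z. (ennreal (cmod (f z)))\<^sup>2 \<partial>gauss) * (\<integral>\<^sup>+z. (ennreal (cmod (g z)))\<^sup>2 \<partial>gauss)"
    by (rule Cauchy_Schwarz_nn_integral) auto
  also have "\<dots> = ennreal ((L2norm f * L2norm g)\<^sup>2)"
    by (simp add: sq assms ennreal_mult[symmetric] power_mult_distrib)
  finally have "?I\<^sup>2 \<le> (L2norm f * L2norm g)\<^sup>2"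
    by (simp add: ennreal_power)
  then show I: "?I \<le> L2norm f * L2norm g"
    by (rule power2_le_imp_le) simp
  have "cmod (ip f g) \<le> ?I"
    unfolding ip_def using integral_norm_bound[of gauss "\<lambda>z. f z * cnj (g z)"] by (simp add: norm_mult)
  then show "cmod (ip f g) \<le> L2norm f * L2norm g"
    using I by linarith
qed

lemma zero_if_L2norm_zero:
  assumes "f \<in> L2" "continuous_on UNIV f" "L2norm f = 0"
  shows "f = (\<lambda>_. 0)"
proof -
  have "(LINT z|gauss. (cmod (f z))\<^sup>2) = 0"
    using assms(3) by (simp add: L2norm_square[symmetric])
  then have "AE z in gauss. (cmod (f z))\<^sup>2 = 0"
    using L2_integrable_square[OF assms(1)] by (subst (asm) integral_nonneg_eq_0_iff_AE) auto
  then have "AE z in lborel. f z = 0"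
    by (simp add: AE_gauss_iff)
  then show ?thesis
    using zero_if_AE_zero[OF assms(2)] by blast
qed

lemma fock_linear: "f \<in> fock n \<Longrightarrow> g \<in> fock n \<Longrightarrow> (\<lambda>z. a * f z + b * g z) \<in> fock n"
  by (simp add: fock_eq polyanalytic_linear L2_linear)

lemma fock_subset_L2: "f \<in> fock n \<Longrightarrow> f \<in> L2"
  by (simp add: fock_eq)

lemma fock_continuous: "f \<in> fock n \<Longrightarrow> continuous_on UNIV f"
  by (auto simp: fock_eq intro: polyanalytic_continuous)

text \<open>\<open>fock 0\<close> contains only the zero function, so the two cases of the
  definition have the same form.\<close>

lemma true_fock_Suc: "true_fock (Suc m) = {f \<in> fock (Suc m). \<forall>g\<in>fock m. ip f g = 0}"
proof (cases m)
  case 0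
  have "ip f g = 0" if "g \<in> fock 0" for f g
  proof -
    have "g = (\<lambda>_. 0)"
      using that by (auto simp: fock_eq polyanalytic_def)
    then show ?thesis
      by (simp add: ip_def)
  qed
  then show ?thesis
    using 0 by (auto simp: true_fock_def)
qed (simp add: true_fock_def)

lemma true_fock_subset_fock: "f \<in> true_fock (Suc m) \<Longrightarrow> f \<in> fock (Suc m)"
  by (simp add: true_fock_Suc)

lemma true_fock_L2: "f \<in> true_fock (Suc m) \<Longrightarrow> f \<in> L2"
  by (auto intro: fock_subset_L2 true_fock_subset_fock)

lemma true_fock_continuous: "f \<in> true_fock (Suc m) \<Longrightarrow> continuous_on UNIV f"
  by (auto intro: fock_continuous true_fock_subset_fock)

lemma true_fock_linear:
  "f \<in> true_fock (Suc m) \<Longrightarrow> g \<in> true_fock (Suc m) \<Longrightarrow> (\<lambda>z. a * f z + b * g z) \<in> true_fock (Suc m)"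
  by (auto simp: true_fock_Suc ip_linear_left fock_subset_L2 intro: fock_linear)

subsection \<open>Weyl operators\<close>

text \<open>The squared modulus of the Weyl factor turns the Gaussian weight at \<open>w\<close>
  into the one at \<open>w - z\<close>; translation invariance does the rest.\<close>

lemma ip_weyl: "ip (weyl z f) (weyl z g) = ip f g" if "f \<in> L2" "g \<in> L2"
proof -
  have [measurable]: "f \<in> borel_measurable borel" "g \<in> borel_measurable borel"
    using that by (auto dest: L2_measurable)
  have "weyl z f w * cnj (weyl z g w) * of_real (exp (- (cmod w)\<^sup>2)) = f (w - z) * cnj (g (w - z)) * of_real (exp (- (cmod (w - z))\<^sup>2))" for w
  proof -
    define e where "e = w * cnj z - complex_of_real ((cmod z)\<^sup>2 / 2)"
    have "exp e * cnj (exp e) * of_real (exp (- (cmod w)\<^sup>2)) = exp (e + cnj e + of_real (- (cmod w)\<^sup>2))"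
      by (simp only: exp_cnj exp_of_real[symmetric] mult_exp_exp)
    also have "e + cnj e + of_real (- (cmod w)\<^sup>2) = of_real (- (cmod (w - z))\<^sup>2)"
    proof -
      have e': "e = w * cnj z - z * cnj z / 2"
        unfolding e_def of_real_divide complex_norm_square by simp
      show ?thesis
        unfolding e' of_real_minus complex_norm_square by (simp add: algebra_simps)
    qed
    finally have "exp e * cnj (exp e) * of_real (exp (- (cmod w)\<^sup>2)) = of_real (exp (- (cmod (w - z))\<^sup>2))"
      by (simp only: exp_of_real)
    moreover have "weyl z f w * cnj (weyl z g w) * of_real (exp (- (cmod w)\<^sup>2))
        = f (w - z) * cnj (g (w - z)) * (exp e * cnj (exp e) * of_real (exp (- (cmod w)\<^sup>2)))"
      unfolding weyl_def e_def[symmetric] complex_cnj_mult by (simp only: mult_ac)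
    ultimately show ?thesis
      by (simp only:)
  qed
  then have eq: "(exp (- (cmod w)\<^sup>2) / pi) *\<^sub>R (weyl z f w * cnj (weyl z g w))
      = (exp (- (cmod (- z + w))\<^sup>2) / pi) *\<^sub>R (f (- z + w) * cnj (g (- z + w)))" for w
    by (simp add: scaleR_conv_of_real divide_inverse mult_ac)
  have [measurable]: "weyl z f \<in> borel_measurable borel" "weyl z g \<in> borel_measurable borel"
    unfolding weyl_def[abs_def] by measurable
  have "ip (weyl z f) (weyl z g) = (LINT w|lborel. (exp (- (cmod (- z + w))\<^sup>2) / pi) *\<^sub>R (f (- z + w) * cnj (g (- z + w))))"
    unfolding ip_def eq[symmetric] by (rule integral_gauss) measurable
  also have "\<dots> = (LINT w|lborel. (exp (- (cmod w)\<^sup>2) / pi) *\<^sub>R (f w * cnj (g w)))"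
    by (rule lborel_integral_translate(1)[where h = "\<lambda>w. (exp (- (cmod w)\<^sup>2) / pi) *\<^sub>R (f w * cnj (g w))"])
  also have "\<dots> = ip f g"
    unfolding ip_def by (rule integral_gauss[symmetric]) measurable
  finally show ?thesis .
qed

lemma weyl_L2:
  assumes "f \<in> L2"
  shows "weyl z f \<in> L2"
proof -
  have [measurable]: "f \<in> borel_measurable borel"
    using assms by (rule L2_measurable)
  have meas [measurable]: "weyl z f \<in> borel_measurable borel"
    unfolding weyl_def[abs_def] by measurable
  have eq: "(exp (- (cmod w)\<^sup>2) / pi) *\<^sub>R (cmod (weyl z f w))\<^sup>2
      = (exp (- (cmod (- z + w))\<^sup>2) / pi) *\<^sub>R (cmod (f (- z + w)))\<^sup>2" for w
  proof -
    have "(cmod (exp (w * cnj z - complex_of_real ((cmod z)\<^sup>2 / 2))))\<^sup>2 * exp (- (cmod w)\<^sup>2)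
        = exp (2 * Re (w * cnj z) - (cmod z)\<^sup>2 - (cmod w)\<^sup>2)"
      unfolding norm_exp_eq_Re power2_eq_square[of "exp _"] mult_exp_exp by (rule arg_cong[where f = exp]) simp
    also have "2 * Re (w * cnj z) - (cmod z)\<^sup>2 - (cmod w)\<^sup>2 = - (cmod (- z + w))\<^sup>2"
      unfolding cmod_power2 by (simp add: power2_eq_square algebra_simps)
    finally show ?thesis
      by (simp add: weyl_def norm_mult power_mult_distrib mult_ac)
  qed
  have "integrable lborel (\<lambda>w. (exp (- (cmod w)\<^sup>2) / pi) *\<^sub>R (cmod (f w))\<^sup>2)"
    using L2_integrable_square[OF assms] by (subst (asm) integrable_gauss_iff) auto
  then have "integrable lborel (\<lambda>w. (exp (- (cmod (- z + w))\<^sup>2) / pi) *\<^sub>R (cmod (f (- z + w)))\<^sup>2)"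
    by (subst lborel_integral_translate(2)[where h = "\<lambda>w. (exp (- (cmod w)\<^sup>2) / pi) *\<^sub>R (cmod (f w))\<^sup>2"])
  then have "integrable gauss (\<lambda>w. (cmod (weyl z f w))\<^sup>2)"
    unfolding eq[symmetric] by (subst integrable_gauss_iff) measurable
  then show ?thesis
    by (simp add: L2_def)
qed

lemma weyl_uminus: "weyl z (weyl (- z) f) = f"
  by (auto simp: weyl_def fun_eq_iff mult_exp_exp algebra_simps complex_norm_square[symmetric]
    simp flip: of_real_power)

lemma fock_weyl: "f \<in> fock n \<Longrightarrow> weyl z f \<in> fock n"
  by (simp add: fock_eq polyanalytic_weyl weyl_L2)

lemma true_fock_weyl:
  assumes "f \<in> true_fock (Suc m)"
  shows "weyl z f \<in> true_fock (Suc m)"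
proof -
  have "ip (weyl z f) g = 0" if g: "g \<in> fock m" for g
  proof -
    have "ip (weyl z f) (weyl z (weyl (- z) g)) = ip f (weyl (- z) g)"
      using assms g by (intro ip_weyl) (auto intro: true_fock_L2 fock_subset_L2 fock_weyl)
    also have "\<dots> = 0"
      using assms fock_weyl[OF g, of "- z"] by (auto simp: true_fock_Suc)
    finally show ?thesis
      by (simp add: weyl_uminus)
  qed
  then show ?thesis
    using assms fock_weyl by (auto simp: true_fock_Suc)
qed

subsection \<open>Angular components in the true polyanalytic Fock spaces\<close>

lemma integrable_circ_rotate:
  assumes "continuous_on UNIV F"
  shows "integrable circ (\<lambda>t. F (cis t * z) * cis (c * t))"
proof -
  have "compact (F ` cball 0 (cmod z))"
    using assms by (intro compact_continuous_image continuous_on_subset[OF assms]) auto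
  then have "bounded (F ` cball 0 (cmod z))"
    by (rule compact_imp_bounded)
  then obtain B where "\<forall>x\<in>F ` cball 0 (cmod z). cmod x \<le> B"
    by (auto simp: bounded_iff)
  then have B: "cmod (F w) \<le> B" if "w \<in> cball 0 (cmod z)" for w
    using that by blast
  have "continuous_on UNIV (\<lambda>t. F (cis t * z))"
    by (intro continuous_on_compose2[OF assms] continuous_intros) auto
  then have [measurable]: "(\<lambda>t. F (cis t * z)) \<in> borel_measurable borel"
    by (rule borel_measurable_continuous_onI)
  show ?thesis
    by (rule integrable_circ[where B = B]) (auto simp: norm_mult intro!: B)
qed

text \<open>Integrating the Taylor series over the circle retains the one term of degree
  \<open>l\<close>.\<close>

lemma ang_entire:
  assumes F: "F holomorphic_on UNIV"
  shows "\<exists>a. \<forall>z. ang l F z = (if 0 \<le> l then a * z ^ nat l else 0)"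
proof -
  define a where "a j = (deriv ^^ j) F 0 / fact j" for j
  have sums: "(\<lambda>j. a j * w ^ j) sums F w" for w
    using holomorphic_power_series[of F 0 "cmod w + 1" w, OF holomorphic_on_subset[OF F]]
    by (simp add: a_def)
  have "ang l F z = (if 0 \<le> l then a (nat l) * z ^ nat l else 0)" for z
  proof -
    let ?f = "\<lambda>j t. a j * z ^ j * cis (of_int (int j - l) * t)"
    have abs: "summable (\<lambda>j. norm (a j * z ^ j))"
      by (rule powser_insidea[OF sums_summable[OF sums[of "of_real (cmod z + 1)"]]])
        (simp del: of_real_add)
    have meas [measurable]: "(\<lambda>t. cis (c * t)) \<in> borel_measurable borel" for c
      by measurable
    have "(\<lambda>j. integral\<^sup>L circ (?f j)) sums (LINT t|circ. (\<Sum>j. ?f j t))"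
    proof (rule sums_integral)
      show "integrable circ (?f j)" for j
        by (rule integrable_circ[where B = "norm (a j * z ^ j)"]) (auto simp: norm_mult)
      show "AE t in circ. summable (\<lambda>j. norm (?f j t))"
        using abs by (simp add: norm_mult)
      show "summable (\<lambda>j. LINT t|circ. norm (?f j t))"
        using abs by (simp add: norm_mult)
    qed
    moreover have "(\<Sum>j. ?f j t) = F (cis t * z) * cis (- (of_int l * t))" for t
    proof -
      have "(\<lambda>j. a j * (cis t * z) ^ j * cis (- (of_int l * t))) sums (F (cis t * z) * cis (- (of_int l * t)))"
        by (rule sums_mult2[OF sums])
      also have "(\<lambda>j. a j * (cis t * z) ^ j * cis (- (of_int l * t))) = (\<lambda>j. ?f j t)"
      proof
        fix j
        have "cis t ^ j * cis (- (of_int l * t)) = cis (of_int (int j - l) * t)"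
          by (simp add: Complex.DeMoivre cis_mult algebra_simps)
        then have "a j * z ^ j * (cis t ^ j * cis (- (of_int l * t))) = ?f j t"
          by (simp only:)
        then show "a j * (cis t * z) ^ j * cis (- (of_int l * t)) = ?f j t"
          unfolding power_mult_distrib by (simp only: mult_ac)
      qed
      finally show ?thesis
        by (rule sums_unique[symmetric])
    qed
    ultimately have 1: "(\<lambda>j. integral\<^sup>L circ (?f j)) sums ang l F z"
      by (simp only: ang_def)
    define c where "c = (if 0 \<le> l then a (nat l) * z ^ nat l else 0)"
    have "integral\<^sup>L circ (?f j) = (if j = nat l then c else 0)" for j
    proof -
      have "integral\<^sup>L circ (?f j) = a j * z ^ j * (if int j - l = 0 then 1 else 0)"
        by (simp only: integral_mult_right_zero integral_circ_cis)
      also have "\<dots> = (if j = nat l then c else 0)"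
        by (cases "int j = l") (auto simp: c_def)
      finally show ?thesis .
    qed
    then have "(\<lambda>j. integral\<^sup>L circ (?f j)) = (\<lambda>j. if j = nat l then c else 0)"
      by (rule ext)
    moreover have "(\<lambda>j. if j = nat l then c else 0) sums c"
      by (rule sums_single)
    ultimately have "(\<lambda>j. integral\<^sup>L circ (?f j)) sums (if 0 \<le> l then a (nat l) * z ^ nat l else 0)"
      by (simp only: c_def)
    from sums_unique2[OF 1 this] show ?thesis .
  qed
  then show ?thesis
    by blast
qed

text \<open>A factor \<open>cnj z ^ b\<close> lowers the weight by \<open>b\<close>, so the
  coefficient F b contributes its Taylor term of degree n + b. The angular component is thus a
  polynomial, although nothing is known about the growth of the single F b.\<close>

lemma ang_polyanalytic:
  assumes "f \<in> polyanalytic N"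
  shows "\<exists>a. \<forall>z. ang n f z = (\<Sum>b<N. if 0 \<le> n + int b then a b * (cnj z ^ b * z ^ nat (n + int b)) else 0)"
proof -
  obtain F where F: "\<And>b. F b holomorphic_on UNIV" "\<And>z. f z = (\<Sum>b<N. cnj z ^ b * F b z)"
    using assms by (rule polyanalyticE) blast
  have "\<forall>b. \<exists>a. \<forall>z. ang (n + int b) (F b) z = (if 0 \<le> n + int b then a * z ^ nat (n + int b) else 0)"
    by (intro allI ang_entire F(1))
  from choice[OF this] obtain a where a: "\<And>b z. ang (n + int b) (F b) z = (if 0 \<le> n + int b then a b * z ^ nat (n + int b) else 0)"
    by blast
  have "ang n f z = (\<Sum>b<N. if 0 \<le> n + int b then a b * (cnj z ^ b * z ^ nat (n + int b)) else 0)" for z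
  proof -
    have eq: "f (cis t * z) * cis (- (of_int n * t)) = (\<Sum>b<N. cnj z ^ b * (F b (cis t * z) * cis (- (of_int (n + int b) * t))))" for t
      unfolding F(2) sum_distrib_right
    proof (intro sum.cong refl)
      fix b
      have "cnj (cis t * z) ^ b * cis (- (of_int n * t)) = cnj z ^ b * (cis (- (of_nat b * t)) * cis (- (of_int n * t)))"
        by (simp add: power_mult_distrib cis_cnj Complex.DeMoivre)
      also have "cis (- (of_nat b * t)) * cis (- (of_int n * t)) = cis (- (of_int (n + int b) * t))"
        by (simp add: cis_mult algebra_simps)
      finally have E: "cnj (cis t * z) ^ b * cis (- (of_int n * t)) = cnj z ^ b * cis (- (of_int (n + int b) * t))" .
      have "cnj (cis t * z) ^ b * F b (cis t * z) * cis (- (of_int n * t))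
          = (cnj (cis t * z) ^ b * cis (- (of_int n * t))) * F b (cis t * z)"
        by (simp only: mult_ac)
      then show "cnj (cis t * z) ^ b * F b (cis t * z) * cis (- (of_int n * t))
          = cnj z ^ b * (F b (cis t * z) * cis (- (of_int (n + int b) * t)))"
        unfolding E by (simp only: mult_ac)
    qed
    have "ang n f z = (\<Sum>b<N. LINT t|circ. cnj z ^ b * (F b (cis t * z) * cis (- (of_int (n + int b) * t))))"
      unfolding ang_def eq
    proof (rule Bochner_Integration.integral_sum)
      fix b
      show "integrable circ (\<lambda>t. cnj z ^ b * (F b (cis t * z) * cis (- (of_int (n + int b) * t))))"
        unfolding minus_mult_left
        by (intro integrable_mult_right integrable_circ_rotate holomorphic_on_imp_continuous_on F(1))
    qed
    also have "\<dots> = (\<Sum>b<N. cnj z ^ b * ang (n + int b) (F b) z)"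
      unfolding ang_def by (simp only: integral_mult_right_zero)
    also have "\<dots> = (\<Sum>b<N. if 0 \<le> n + int b then a b * (cnj z ^ b * z ^ nat (n + int b)) else 0)"
      unfolding a by (intro sum.cong refl) simp
    finally show ?thesis .
  qed
  then show ?thesis
    by blast
qed

text \<open>Averaging over rotations is invisible to a function that itself has weight
  \<open>n\<close>. This holds for general square integrable \<open>f\<close>, before anything is
  known about \<open>ang n f\<close>.\<close>

lemma ang_ip:
  assumes f: "f \<in> L2" and g: "g \<in> L2" and rot: "\<And>t z. g (cis t * z) = cis (of_int n * t) * g z"
  shows "ip (ang n f) g = ip f g"
proof -
  have [measurable]: "f \<in> borel_measurable borel" "g \<in> borel_measurable borel"
    using f g by (auto dest: L2_measurable)
  let ?h = "\<lambda>z. f z * cnj (g z)"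
  have int: "integrable gauss ?h"
    using f g by (rule L2_ip_integrable)
  have eq: "f (cis t * z) * cnj (g z) = cis (of_int n * t) * ?h (cis t * z)" for t z
  proof -
    have E: "cis (of_int n * t) * cnj (cis (of_int n * t)) = 1"
      by (simp add: cis_cnj cis_mult)
    have "cis (of_int n * t) * (f (cis t * z) * (cnj (cis (of_int n * t)) * cnj (g z)))
        = (cis (of_int n * t) * cnj (cis (of_int n * t))) * (f (cis t * z) * cnj (g z))"
      by (simp only: mult_ac)
    then show ?thesis
      unfolding rot complex_cnj_mult E by simp
  qed
  have int_t: "integrable gauss (\<lambda>z. ?h (cis t * z))" for t
    by (rule integrable_gauss_rotate[of "cis t" ?h]) (use int in auto)
  have "ip (ang n f) g = (LINT t|circ. cis (- (of_int n * t)) * (LINT z|gauss. f (cis t * z) * cnj (g z)))"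
    unfolding ip_def
  proof (rule ang_Fubini)
    show "integrable gauss (\<lambda>z. f (cis t * z) * cnj (g z))" for t
      unfolding eq by (intro integrable_mult_right int_t)
    show "(LINT z|gauss. cmod (f (cis t * z) * cnj (g z))) \<le> (LINT z|gauss. cmod (?h z))" for t
      unfolding eq norm_mult[of "cis _"] norm_cis mult_1_left
      by (subst integral_gauss_rotate[of "cis t" "\<lambda>z. cmod (?h z)"]) auto
  qed (auto simp: gauss.sigma_finite_measure_axioms)
  also have "(LINT z|gauss. f (cis t * z) * cnj (g z)) = cis (of_int n * t) * ip f g" for t
    unfolding eq ip_def by (subst integral_mult_right_zero, subst integral_gauss_rotate[of "cis _" ?h]) auto
  then have "(LINT t|circ. cis (- (of_int n * t)) * (LINT z|gauss. f (cis t * z) * cnj (g z)))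
      = (LINT t|circ. ip f g)"
    by (simp add: mult.assoc[symmetric] cis_mult)
  finally show ?thesis
    by simp
qed

lemma hermite_L2: "hermite p q \<in> L2"
  by (intro exp_bounded_L2 exp_bounded_hermite)

text \<open>Isolates the top power of \<open>cnj z\<close>, so that subtracting a multiple can lower
  the polyanalytic order by one.\<close>

lemma hermite_leading:
  "\<exists>G. (\<forall>b. G b holomorphic_on UNIV) \<and> (\<forall>z. hermite m q z = cnj z ^ m * z ^ q + (\<Sum>b<m. cnj z ^ b * G b z))"
proof -
  define F where "F b z = (-1) ^ (m - b) * of_nat (fact (m - b) * (m choose (m - b)) * (q choose (m - b))) * z ^ (q - (m - b))" for b and z :: complex
  define c where "c j z = (-1) ^ j * of_nat (fact j * (m choose j) * (q choose j)) * cnj z ^ (m - j) * z ^ (q - j)" for j and z :: complex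
  have "hermite m q z = cnj z ^ m * z ^ q + (\<Sum>b<m. cnj z ^ b * F b z)" for z
  proof -
    have "hermite m q z = (\<Sum>j<Suc m. c j z)"
      by (simp add: hermite_def c_def lessThan_Suc_atMost)
    also have "\<dots> = (\<Sum>b<Suc m. c (Suc m - Suc b) z)"
      by (rule sum.nat_diff_reindex[symmetric])
    also have "\<dots> = (\<Sum>b<Suc m. cnj z ^ b * F b z)"
      by (intro sum.cong refl) (simp add: c_def F_def mult_ac)
    also have "\<dots> = cnj z ^ m * z ^ q + (\<Sum>b<m. cnj z ^ b * F b z)"
      by (simp add: F_def)
    finally show ?thesis .
  qed
  moreover have "F b holomorphic_on UNIV" for b
    unfolding F_def[abs_def] by (intro holomorphic_intros)
  ultimately show ?thesis
    by blast
qed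

lemma hermite_fock: "hermite m q \<in> fock (Suc m)"
proof -
  obtain G where G: "\<And>b. G b holomorphic_on UNIV" "\<And>z. hermite m q z = cnj z ^ m * z ^ q + (\<Sum>b<m. cnj z ^ b * G b z)"
    using hermite_leading[of m q] by blast
  have "hermite m q \<in> polyanalytic (Suc m)"
  proof (rule polyanalyticI[of "\<lambda>b z. if b = m then z ^ q else G b z"])
    show "(\<lambda>z. if b = m then z ^ q else G b z) holomorphic_on UNIV" for b
      using G(1) by (cases "b = m") (auto intro!: holomorphic_intros)
  qed (simp add: G(2))
  then show ?thesis
    by (simp add: fock_eq hermite_L2)
qed

text \<open>Against a Hermite polynomial only one angular component of g counts. It is a polynomial
  of degree below \<open>m\<close> in \<open>cnj z\<close>, hence annihilated by
  \<open>integral_monomial_hermite\<close>.\<close>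

lemma hermite_true_fock: "hermite m q \<in> true_fock (Suc m)"
proof -
  have "ip g (hermite m q) = 0" if g: "g \<in> fock m" for g
  proof -
    obtain a where a: "\<And>z. ang (int q - int m) g z
        = (\<Sum>b<m. if 0 \<le> int q - int m + int b then a b * (cnj z ^ b * z ^ nat (int q - int m + int b)) else 0)"
      using ang_polyanalytic[of g m] g by (auto simp: fock_eq)
    have "ip g (hermite m q) = ip (ang (int q - int m) g) (hermite m q)"
      by (rule ang_ip[symmetric]) (auto simp: fock_subset_L2[OF g] hermite_L2 hermite_rotate)
    also have "\<dots> = (LINT z|gauss. (\<Sum>b<m. (if 0 \<le> int q - int m + int b then a b else 0) * (cnj z ^ b * z ^ nat (int q - int m + int b) * hermite q m z)))"
      unfolding ip_def a sum_distrib_right cnj_hermite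
      by (intro Bochner_Integration.integral_cong refl sum.cong) auto
    also have "\<dots> = (\<Sum>b<m. (if 0 \<le> int q - int m + int b then a b else 0) * (LINT z|gauss. (cnj z ^ b * z ^ nat (int q - int m + int b) * hermite q m z)))"
      by (subst Bochner_Integration.integral_sum, rule exp_bounded_imp_integrable,
        intro exp_bounded_intros exp_bounded_hermite, simp only: integral_mult_right_zero)
    also have "\<dots> = 0"
      unfolding integral_monomial_hermite by (intro sum.neutral) auto
    finally show ?thesis .
  qed
  then have "ip (hermite m q) g = 0" if g: "g \<in> fock m" for g
    using that cnj_ip[of g "hermite m q"] by simp
  then show ?thesis
    by (simp add: true_fock_Suc hermite_fock)
qed

lemma ip_hermite: "ip (hermite m q) (hermite m' p) = (if m = m' \<and> q = p then fact m * fact p else 0)"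
  by (simp add: ip_def cnj_hermite integral_hermite_hermite)

text \<open>Cancelling the top power of \<open>cnj z\<close> leaves a remainder R in
  \<open>fock m\<close>. Both \<open>f\<close> and the Hermite polynomial are orthogonal to R, and
  pairing with R does not distinguish \<open>f\<close> from its angular component; so R is
  orthogonal to itself and vanishes.\<close>

lemma ang_true_fock:
  assumes "f \<in> true_fock (Suc m)"
  shows "\<exists>c. \<forall>z. ang n f z = (if 0 \<le> n + int m then c * hermite m (nat (n + int m)) z else 0)"
proof -
  have fL2: "f \<in> L2" and poly: "f \<in> polyanalytic (Suc m)" and orth: "\<And>g. g \<in> fock m \<Longrightarrow> ip f g = 0"
    using assms by (auto simp: true_fock_Suc fock_eq)
  obtain a where a: "\<And>z. ang n f z = (\<Sum>b<Suc m. if 0 \<le> n + int b then a b * (cnj z ^ b * z ^ nat (n + int b)) else 0)"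
    using ang_polyanalytic[OF poly] by blast
  show ?thesis
  proof (cases "0 \<le> n + int m")
    case False
    then have "ang n f z = 0" for z
      unfolding a by (intro sum.neutral) auto
    then show ?thesis
      using False by simp
  next
    case True
    define q where "q = nat (n + int m)"
    define R where "R z = ang n f z - a m * hermite m q z" for z
    obtain G where G: "\<And>b. G b holomorphic_on UNIV" "\<And>z. hermite m q z = cnj z ^ m * z ^ q + (\<Sum>b<m. cnj z ^ b * G b z)"
      using hermite_leading[of m q] by blast
    have R: "R z = (\<Sum>b<m. cnj z ^ b * ((if 0 \<le> n + int b then a b * z ^ nat (n + int b) else 0) - a m * G b z))" for z
    proof -
      have "R z = (\<Sum>b<m. if 0 \<le> n + int b then a b * (cnj z ^ b * z ^ nat (n + int b)) else 0) - a m * (\<Sum>b<m. cnj z ^ b * G b z)"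
        using True by (simp add: R_def a G(2) algebra_simps flip: q_def)
      also have "\<dots> = (\<Sum>b<m. (if 0 \<le> n + int b then a b * (cnj z ^ b * z ^ nat (n + int b)) else 0) - a m * (cnj z ^ b * G b z))"
        by (simp add: sum_subtractf sum_distrib_left)
      also have "\<dots> = (\<Sum>b<m. cnj z ^ b * ((if 0 \<le> n + int b then a b * z ^ nat (n + int b) else 0) - a m * G b z))"
        by (intro sum.cong refl) (auto simp: algebra_simps)
      finally show ?thesis .
    qed
    have ang_bd: "exp_bounded (ang n f)"
    proof -
      have "ang n f = (\<lambda>z. \<Sum>b<Suc m. (if 0 \<le> n + int b then a b else 0) * (cnj z ^ b * z ^ nat (n + int b)))"
        by (auto simp: fun_eq_iff a intro!: sum.cong)
      then show ?thesis
        by (simp only:) (intro exp_bounded_intros)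
    qed
    then have ang_L2: "ang n f \<in> L2"
      by (rule exp_bounded_L2)
    have R_L2: "R \<in> L2"
      unfolding R_def[abs_def] by (intro L2_diff L2_cmult ang_L2 hermite_L2)
    have R_poly: "R \<in> polyanalytic m"
    proof (rule polyanalyticI[OF _ R])
      show "(\<lambda>z. (if 0 \<le> n + int b then a b * z ^ nat (n + int b) else 0) - a m * G b z) holomorphic_on UNIV" for b
        using G(1) by (cases "0 \<le> n + int b") (auto intro!: holomorphic_intros)
    qed
    then have R_fock: "R \<in> fock m"
      using R_L2 by (simp add: fock_eq)
    have rot: "R (cis t * z) = cis (of_int n * t) * R z" for t z
    proof -
      have "ang n f (cis t * z) = cis (of_int n * t) * ang n f z"
        unfolding a sum_distrib_left
      proof (intro sum.cong refl)
        fix b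
        show "(if 0 \<le> n + int b then a b * (cnj (cis t * z) ^ b * (cis t * z) ^ nat (n + int b)) else 0)
            = cis (of_int n * t) * (if 0 \<le> n + int b then a b * (cnj z ^ b * z ^ nat (n + int b)) else 0)"
        proof (cases "0 \<le> n + int b")
          case True
          then have "real (nat (n + int b)) = of_int n + of_nat b"
            by simp
          then have "cnj (cis t) ^ b * cis t ^ nat (n + int b) = cis (of_int n * t)"
            by (simp add: cis_cnj Complex.DeMoivre cis_mult algebra_simps)
          from this[symmetric] have "cnj (cis t * z) ^ b * (cis t * z) ^ nat (n + int b) = cis (of_int n * t) * (cnj z ^ b * z ^ nat (n + int b))"
            unfolding complex_cnj_mult power_mult_distrib by (simp only: mult_ac)
          then show ?thesis
            using True by simp
        qed simp
      qed
      moreover have "real q - real m = of_int n"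
        using True by (simp add: q_def)
      ultimately show ?thesis
        unfolding R_def hermite_rotate by (simp add: algebra_simps)
    qed
    have "ip (ang n f) R = ip f R"
      by (rule ang_ip[OF fL2 R_L2 rot])
    also have "\<dots> = 0"
      by (rule orth[OF R_fock])
    finally have "ip (ang n f) R = 0" .
    moreover have "ip (hermite m q) R = 0"
      using hermite_true_fock[of m q] R_fock by (simp add: true_fock_Suc)
    moreover have "ip R R = ip (ang n f) R - a m * ip (hermite m q) R"
    proof -
      have R_eq: "(\<lambda>z. ang n f z - a m * hermite m q z) = R"
        by (simp add: R_def fun_eq_iff)
      show ?thesis
        using ip_diff_left[OF ang_L2 L2_cmult[OF hermite_L2] R_L2, of "a m" m q] by (simp only: R_eq ip_cmult_left)
    qed
    ultimately have "ip R R = 0"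
      by simp
    then have "L2norm R = 0"
      by (simp add: ip_self)
    then have "R = (\<lambda>_. 0)"
      by (rule zero_if_L2norm_zero[OF R_L2 polyanalytic_continuous[OF R_poly]])
    then have "ang n f z = a m * hermite m q z" for z
      by (simp add: R_def fun_eq_iff)
    then show ?thesis
      using True q_def by auto
  qed
qed

text \<open>Each angular component is a multiple of one Hermite polynomial and hence 0. Uniqueness
  of Fourier coefficients on the circle through z then gives \<open>f z = 0\<close>.\<close>

lemma true_fock_hermite_total:
  assumes f: "f \<in> true_fock (Suc m)" and zero: "\<And>q. ip f (hermite m q) = 0"
  shows "f = (\<lambda>_. 0)"
proof
  fix z
  have ang_zero: "ang n f z = 0" for n z
  proof (cases "0 \<le> n + int m")
    case True
    define q where "q = nat (n + int m)"
    obtain c where c: "\<And>z. ang n f z = c * hermite m q z"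
      using ang_true_fock[OF f, of n] True by (auto simp: q_def)
    have n: "n = int q - int m"
      using True by (simp add: q_def)
    have "0 = ip f (hermite m q)"
      by (simp add: zero)
    also have "\<dots> = ip (ang n f) (hermite m q)"
      by (rule ang_ip[symmetric]) (auto simp: true_fock_L2[OF f] hermite_L2 hermite_rotate n)
    also have "ang n f = (\<lambda>z. c * hermite m q z)"
      by (simp add: c fun_eq_iff)
    also have "ip \<dots> (hermite m q) = c * (fact m * fact q)"
      by (simp add: ip_cmult_left ip_hermite)
    finally show ?thesis
      by (simp add: c)
  next
    case False
    then show ?thesis
      using ang_true_fock[OF f, of n] by auto
  qed
  have "(\<lambda>u. f (u * z)) 1 = 0"
  proof (rule Fourier_uniqueness)
    show "continuous_on (sphere 0 1) (\<lambda>u. f (u * z))"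
      by (intro continuous_on_compose2[OF true_fock_continuous[OF f]] continuous_intros) auto
    show "(LINT t|circ. f (cis t * z) * cis (- (of_int n * t))) = 0" for n
      using ang_zero[of n z] by (simp add: ang_def)
  qed
  then show "f z = 0"
    by simp
qed

text \<open>Reversing the summation index gives the Laguerre coefficients. One polynomial thus
  governs the reproducing kernel at 0, the set \<open>Sigma_set\<close> and the characteristic
  equation of the recurrence.\<close>

lemma hermite_diagonal: "hermite m m z = of_real ((-1) ^ m * fact m * laguerre m 0 ((cmod z)\<^sup>2))"
proof -
  have tm: "(-1) ^ j * of_nat (fact j * (m choose j) * (m choose j)) * cnj z ^ (m - j) * z ^ (m - j)
      = of_real ((-1) ^ m * fact m * ((-1) ^ (m - j) * ((real m + 0) gchoose (m - (m - j))) * ((cmod z)\<^sup>2) ^ (m - j) / fact (m - j)))"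
    if "j \<le> m" for j
  proof -
    have sign: "(-1) ^ m * (-1) ^ (m - j) = ((-1) ^ j :: real)"
    proof -
      have "(-1) ^ m = (-1) ^ j * ((-1) ^ (m - j) :: real)"
        using that by (simp flip: power_add)
      then show ?thesis
        by (simp add: mult.assoc flip: power_mult_distrib)
    qed
    have b: "real (m choose j) = fact m / (fact j * fact (m - j))"
      by (rule binomial_fact[OF that])
    have "cnj z ^ (m - j) * z ^ (m - j) = of_real (((cmod z)\<^sup>2) ^ (m - j))"
      unfolding of_real_power[of _ "m - j"] complex_norm_square by (simp add: power_mult_distrib mult.commute)
    then have "(-1) ^ j * of_nat (fact j * (m choose j) * (m choose j)) * cnj z ^ (m - j) * z ^ (m - j)
        = of_real ((-1) ^ j * real (fact j * (m choose j) * (m choose j)) * ((cmod z)\<^sup>2) ^ (m - j))"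
      by (simp add: mult.assoc)
    also have "(-1) ^ j * real (fact j * (m choose j) * (m choose j)) = (-1) ^ m * fact m * ((-1) ^ (m - j) * real (m choose j) / fact (m - j))"
      unfolding sign[symmetric] of_nat_mult by (subst b) (simp add: field_simps)
    finally show ?thesis
      using that by (simp add: binomial_gbinomial[symmetric] mult_ac)
  qed
  have "hermite m m z = (\<Sum>j\<le>m. of_real ((-1) ^ m * fact m * ((-1) ^ (m - j) * ((real m + 0) gchoose (m - (m - j))) * ((cmod z)\<^sup>2) ^ (m - j) / fact (m - j))))"
    unfolding hermite_def by (intro sum.cong refl tm) simp
  also have "\<dots> = of_real ((-1) ^ m * fact m * (\<Sum>j\<le>m. (-1) ^ (m - j) * ((real m + 0) gchoose (m - (m - j))) * ((cmod z)\<^sup>2) ^ (m - j) / fact (m - j)))"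
    by (simp only: of_real_sum[symmetric] sum_distrib_left[symmetric])
  also have "(\<Sum>j\<le>m. (-1) ^ (m - j) * ((real m + 0) gchoose (m - (m - j))) * ((cmod z)\<^sup>2) ^ (m - j) / fact (m - j)) = laguerre m 0 ((cmod z)\<^sup>2)"
    using sum.nat_diff_reindex[of "\<lambda>j. (-1) ^ j * ((real m + 0) gchoose (m - j)) * ((cmod z)\<^sup>2) ^ j / fact j" "Suc m"]
    unfolding laguerre_def lessThan_Suc_atMost[symmetric] diff_Suc_Suc .
  finally show ?thesis .
qed

lemma laguerre_at_zero: "laguerre m 0 0 = 1"
proof -
  have "laguerre m 0 0 = (\<Sum>j\<le>m. if j = 0 then 1 else 0)"
    unfolding laguerre_def by (intro sum.cong refl) (auto simp: power_0_left binomial_gbinomial[symmetric])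
  then show ?thesis
    by simp
qed

lemma kernel0_eq: "kernel0 (Suc m) z = (-1) ^ m / fact m * hermite m m z"
  by (simp add: kernel0_def hermite_diagonal flip: power_add)

lemma kernel0_true_fock: "kernel0 (Suc m) \<in> true_fock (Suc m)"
  using true_fock_linear[OF hermite_true_fock hermite_true_fock, of "(-1) ^ m / fact m" m m 0 m]
  by (simp add: kernel0_eq[abs_def])

text \<open>Evaluation at 0 and pairing with the radial kernel both see only the angular component
  of weight 0, a multiple of \<open>hermite m m\<close>; comparing the constants suffices, since
  L_m(0) = 1.\<close>

lemma kernel0_reproducing:
  assumes f: "f \<in> true_fock (Suc m)"
  shows "ip f (kernel0 (Suc m)) = f 0"
proof -
  obtain c where c: "\<And>z. ang 0 f z = c * hermite m m z"
    using ang_true_fock[OF f, of 0] by auto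
  have "f 0 = ang 0 f 0"
    by (simp add: ang_def)
  also have "\<dots> = c * ((-1) ^ m * fact m)"
    by (simp add: c hermite_diagonal laguerre_at_zero)
  finally have f0: "f 0 = c * ((-1) ^ m * fact m)" .
  have "ip f (hermite m m) = ip (ang 0 f) (hermite m m)"
    by (rule ang_ip[symmetric]) (auto simp: true_fock_L2[OF f] hermite_L2 hermite_rotate)
  also have "ang 0 f = (\<lambda>z. c * hermite m m z)"
    by (simp add: c fun_eq_iff)
  finally have h: "ip f (hermite m m) = c * (fact m * fact m)"
    by (simp add: ip_cmult_left ip_hermite)
  have "ip (kernel0 (Suc m)) f = (-1) ^ m / fact m * ip (hermite m m) f"
    unfolding kernel0_eq[abs_def] by (rule ip_cmult_left)
  then have "cnj (ip (kernel0 (Suc m)) f) = (-1) ^ m / fact m * cnj (ip (hermite m m) f)"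
    by simp
  then have "ip f (kernel0 (Suc m)) = (-1) ^ m / fact m * ip f (hermite m m)"
    by (simp only: cnj_ip)
  then show ?thesis
    unfolding h f0 by simp
qed

subsection \<open>An orthonormal basis and completeness\<close>

definition hbasis :: "nat \<Rightarrow> nat \<Rightarrow> complex \<Rightarrow> complex" where
  "hbasis m q z = hermite m q z / of_real (sqrt (fact m * fact q))"

lemma hbasis_eq: "hbasis m q = (\<lambda>z. (1 / of_real (sqrt (fact m * fact q))) * hermite m q z)"
  by (simp add: hbasis_def fun_eq_iff)

lemma hbasis_true_fock: "hbasis m q \<in> true_fock (Suc m)"
  using true_fock_linear[OF hermite_true_fock[of m q] hermite_true_fock[of m q], of "1 / of_real (sqrt (fact m * fact q))" 0]
  unfolding hbasis_eq by simp

lemma ip_hbasis: "ip (hbasis m q) (hbasis m p) = (if q = p then 1 else 0)"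
proof -
  define c where "c q = 1 / complex_of_real (sqrt (fact m * fact q))" for q
  have "ip (hbasis m q) (hbasis m p) = c q * cnj (ip (\<lambda>z. c p * hermite m p z) (hermite m q))"
    by (simp only: hbasis_eq c_def[symmetric] ip_cmult_left[of _ "hermite m q"] cnj_ip)
  also have "\<dots> = c q * cnj (c p) * (if q = p then fact m * fact q else 0)"
    by (simp add: ip_cmult_left ip_hermite)
  also have "\<dots> = (if q = p then 1 else 0)"
  proof (cases "q = p")
    case True
    define s :: real where "s = sqrt (fact m * fact q)"
    have "s * s = fact m * fact q"
      by (simp add: s_def)
    then have "complex_of_real (s * s) = complex_of_real (fact m * fact q)"
      by (rule arg_cong)
    then have "complex_of_real s * complex_of_real s = fact m * fact q"
      by simp
    moreover have "s \<noteq> 0"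
      by (simp add: s_def)
    ultimately have "c q * cnj (c q) * (fact m * fact q) = 1"
      unfolding c_def s_def[symmetric] by (simp add: field_simps)
    then show ?thesis
      using True by simp
  qed simp
  finally show ?thesis .
qed

lemma hbasis_total:
  assumes "f \<in> true_fock (Suc m)" "\<And>q. ip f (hbasis m q) = 0"
  shows "f = (\<lambda>_. 0)"
proof (rule true_fock_hermite_total[OF assms(1)])
  fix q
  have "ip (hbasis m q) f = 0"
    using assms(2)[of q] cnj_ip[of f "hbasis m q"] by simp
  then have "1 / complex_of_real (sqrt (fact m * fact q)) * ip (hermite m q) f = 0"
    by (simp only: hbasis_eq ip_cmult_left)
  then have "ip (hermite m q) f = 0"
    by simp
  then show "ip f (hermite m q) = 0"
    using cnj_ip[of "hermite m q" f] by simp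
qed

lemma entire_series:
  fixes g :: "nat \<Rightarrow> complex \<Rightarrow> complex"
  assumes hol: "\<And>q. g q holomorphic_on UNIV"
    and bound: "\<And>R. \<exists>M. summable M \<and> (\<forall>q. \<forall>z\<in>cball 0 R. cmod (g q z) \<le> M q)"
  shows "(\<lambda>z. \<Sum>q. g q z) holomorphic_on UNIV" and "summable (\<lambda>q. g q z)"
proof -
  show "(\<lambda>z. \<Sum>q. g q z) holomorphic_on UNIV"
  proof (rule holomorphic_uniform_sequence[where f = "\<lambda>n z. \<Sum>q<n. g q z"])
    show "(\<lambda>z. \<Sum>q<n. g q z) holomorphic_on UNIV" for n
      by (intro holomorphic_intros hol)
    fix x :: complex
    obtain M where M: "summable M" "\<And>q z. z \<in> cball 0 (cmod x + 1) \<Longrightarrow> cmod (g q z) \<le> M q"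
      using bound[of "cmod x + 1"] by blast
    have "cball x 1 \<subseteq> cball 0 (cmod x + 1)"
    proof
      fix y assume "y \<in> cball x 1"
      then show "y \<in> cball 0 (cmod x + 1)"
        using norm_triangle_ineq4[of x "x - y"] by (simp add: dist_norm)
    qed
    then have "uniform_limit (cball x 1) (\<lambda>n z. \<Sum>q<n. g q z) (\<lambda>z. \<Sum>q. g q z) sequentially"
      using M by (intro Weierstrass_m_test[of _ _ M]) blast+
    then show "\<exists>d>0. cball x d \<subseteq> UNIV \<and> uniform_limit (cball x d) (\<lambda>n z. \<Sum>q<n. g q z) (\<lambda>z. \<Sum>q. g q z) sequentially"
      by (intro exI[of _ 1]) auto
  qed simp
  obtain M where M: "summable M" "\<And>q w. w \<in> cball 0 (cmod z) \<Longrightarrow> cmod (g q w) \<le> M q"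
    using bound[of "cmod z"] by blast
  show "summable (\<lambda>q. g q z)"
    by (rule summable_comparison_test[OF _ M(1)]) (auto intro!: exI[of _ 0] M(2))
qed

text \<open>Consecutive terms have ratio |R| / sqrt (q + 1), which is at most 1/2 as soon as q + 1
  >= 4 R^2; hence the threshold in the ratio test.\<close>

lemma summable_power_div_sqrt_fact: "summable (\<lambda>q. R ^ q / sqrt (fact q))" for R :: real
proof (rule summable_ratio_test[where c = "1 / 2" and N = "nat \<lceil>4 * R\<^sup>2\<rceil>"])
  fix q assume "nat \<lceil>4 * R\<^sup>2\<rceil> \<le> q"
  then have "4 * R\<^sup>2 \<le> real (Suc q)"
    by linarith
  then have "sqrt ((2 * R)\<^sup>2) \<le> sqrt (real (Suc q))"
    by (simp add: power_mult_distrib)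
  then have "\<bar>2 * R\<bar> \<le> sqrt (real (Suc q))"
    unfolding real_sqrt_abs .
  then have "2 * \<bar>R\<bar> \<le> sqrt (real (Suc q))"
    by (simp only: abs_mult abs_numeral)
  then have "\<bar>R\<bar> / sqrt (real (Suc q)) \<le> 1 / 2"
    by (simp add: field_simps)
  then have "\<bar>R\<bar> / sqrt (real (Suc q)) * norm (R ^ q / sqrt (fact q)) \<le> 1 / 2 * norm (R ^ q / sqrt (fact q))"
    by (rule mult_right_mono) simp
  moreover have "norm (R ^ Suc q / sqrt (fact (Suc q))) = \<bar>R\<bar> / sqrt (real (Suc q)) * norm (R ^ q / sqrt (fact q))"
    by (simp add: abs_mult power_abs real_sqrt_mult del: of_nat_Suc)
  ultimately show "norm (R ^ Suc q / sqrt (fact (Suc q))) \<le> 1 / 2 * norm (R ^ q / sqrt (fact q))"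
    by simp
qed simp

lemma binomial_le_power2: "n choose k \<le> 2 ^ n"
proof (cases "k \<le> n")
  case True
  then have "n choose k \<le> (\<Sum>k\<le>n. n choose k)"
    by (intro member_le_sum) auto
  then show ?thesis
    by (simp add: choose_row_sum)
qed (simp add: binomial_eq_0)

text \<open>Bounded coefficients already suffice: the binomials grow like 2^q and the normalisation
  decays like 1 / sqrt (q!). Sorting by powers of \<open>cnj z\<close> gives entire coefficient
  functions, so the pointwise sum is polyanalytic.\<close>

lemma hbasis_series:
  assumes A: "\<And>q. cmod (A q) \<le> K"
  shows "(\<lambda>z. \<Sum>q. A q * hbasis m q z) \<in> polyanalytic (Suc m)"
    and "summable (\<lambda>q. A q * hbasis m q z)"
proof -
  have K: "K \<ge> 0"
    using order.trans[OF norm_ge_zero A] .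
  define g where "g j q z = A q * ((-1) ^ j * of_nat (fact j * (m choose j) * (q choose j)) / of_real (sqrt (fact m * fact q))) * z ^ (q - j)" for j q and z :: complex
  have hol: "g j q holomorphic_on UNIV" for j q
    unfolding g_def[abs_def] by (intro holomorphic_intros)
  have bound: "\<exists>M. summable M \<and> (\<forall>q. \<forall>z\<in>cball 0 R. cmod (g j q z) \<le> M q)" for j R
  proof -
    \<comment> \<open>At least 1, so that the exponent \<open>q - j\<close> may be raised to
      \<open>q\<close>.\<close>
    define S where "S = max 1 R"
    define M where "M q = K * of_nat (fact j * (m choose j)) * ((2 * S) ^ q / sqrt (fact q))" for q
    have "summable M"
      unfolding M_def by (intro summable_mult summable_power_div_sqrt_fact)
    moreover have "cmod (g j q z) \<le> M q" if z: "z \<in> cball 0 R" for q z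
    proof -
      have S: "S \<ge> 1" "cmod z \<le> S"
        using z by (auto simp: S_def)
      have "cmod z ^ (q - j) \<le> S ^ (q - j)"
        using S by (intro power_mono) auto
      also have "\<dots> \<le> S ^ q"
        using S by (intro power_increasing) auto
      finally have z_pow: "cmod z ^ (q - j) \<le> S ^ q" .
      have "real (q choose j) \<le> 2 ^ q"
        using binomial_le_power2[of q j] by (metis of_nat_le_iff of_nat_numeral of_nat_power)
      then have "real (q choose j) * cmod z ^ (q - j) \<le> (2 * S) ^ q"
        unfolding power_mult_distrib by (intro mult_mono z_pow) auto
      then have "real (q choose j) * cmod z ^ (q - j) / sqrt (fact m * fact q) \<le> (2 * S) ^ q / sqrt (fact q)"
        using S by (intro frac_le) (auto simp: fact_ge_1 intro: mult_right_mono[of 1 "fact m" "fact q", simplified])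
      then have "K * of_nat (fact j * (m choose j)) * (real (q choose j) * cmod z ^ (q - j) / sqrt (fact m * fact q)) \<le> M q"
        unfolding M_def using K by (intro mult_left_mono) auto
      moreover have "cmod (g j q z) = cmod (A q) * (of_nat (fact j * (m choose j)) * (real (q choose j) * cmod z ^ (q - j) / sqrt (fact m * fact q)))"
        by (simp add: g_def norm_mult norm_divide norm_power)
      moreover have "\<dots> \<le> K * (of_nat (fact j * (m choose j)) * (real (q choose j) * cmod z ^ (q - j) / sqrt (fact m * fact q)))"
        by (intro mult_right_mono A) simp
      ultimately show ?thesis
        by (simp add: mult.assoc)
    qed
    ultimately show ?thesis
      by blast
  qed
  have eq: "A q * hbasis m q z = (\<Sum>j\<le>m. cnj z ^ (m - j) * g j q z)" for q z
    unfolding hbasis_def hermite_def sum_divide_distrib sum_distrib_left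
    by (intro sum.cong refl) (simp add: g_def)
  have summ: "summable (\<lambda>q. cnj z ^ (m - j) * g j q z)" for j z
    by (intro summable_mult entire_series(2) hol bound)
  show "summable (\<lambda>q. A q * hbasis m q z)"
    unfolding eq by (intro summable_sum summ)
  show "(\<lambda>z. \<Sum>q. A q * hbasis m q z) \<in> polyanalytic (Suc m)"
  proof (rule polyanalyticI)
    show "(\<lambda>z. \<Sum>q. g (m - b) q z) holomorphic_on UNIV" for b
      by (intro entire_series(1) hol bound)
    fix z
    have "(\<Sum>q. A q * hbasis m q z) = (\<Sum>j\<le>m. \<Sum>q. cnj z ^ (m - j) * g j q z)"
      unfolding eq by (intro suminf_sum summ)
    also have "\<dots> = (\<Sum>j<Suc m. cnj z ^ (m - j) * (\<Sum>q. g j q z))"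
      unfolding lessThan_Suc_atMost
      by (intro sum.cong refl suminf_mult entire_series(2) hol bound)
    also have "\<dots> = (\<Sum>b<Suc m. cnj z ^ (m - (Suc m - Suc b)) * (\<Sum>q. g (Suc m - Suc b) q z))"
      by (rule sum.nat_diff_reindex[symmetric])
    also have "\<dots> = (\<Sum>b<Suc m. cnj z ^ b * (\<Sum>q. g (m - b) q z))"
      by (intro sum.cong refl) simp
    finally show "(\<Sum>q. A q * hbasis m q z) = (\<Sum>b<Suc m. cnj z ^ b * (\<Sum>q. g (m - b) q z))" .
  qed
qed

lemma L2norm_hbasis_sum:
  assumes "finite I"
  shows "(L2norm (\<lambda>z. \<Sum>q\<in>I. A q * hbasis m q z))\<^sup>2 = (\<Sum>q\<in>I. (cmod (A q))\<^sup>2)"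
proof -
  let ?f = "\<lambda>z. \<Sum>q\<in>I. A q * hbasis m q z"
  have L2: "hbasis m q \<in> L2" for q
    using hbasis_true_fock by (rule true_fock_L2)
  have "ip ?f ?f = (\<Sum>q\<in>I. A q * ip (hbasis m q) ?f)"
    by (intro ip_sum_left L2 L2_sum)
  also have "\<dots> = (\<Sum>q\<in>I. A q * (\<Sum>p\<in>I. cnj (A p) * ip (hbasis m q) (hbasis m p)))"
    by (subst ip_sum_right) (auto intro: L2)
  also have "\<dots> = (\<Sum>q\<in>I. A q * cnj (A q))"
    using assms by (intro sum.cong refl) (simp add: ip_hbasis if_distrib[of "\<lambda>x. _ * x"] cong: if_cong)
  also have "\<dots> = of_real (\<Sum>q\<in>I. (cmod (A q))\<^sup>2)"
    by (simp add: complex_norm_square[symmetric])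
  finally show ?thesis
    by (simp only: ip_self of_real_eq_iff)
qed

text \<open>Completeness with a genuine function as limit: the series converges pointwise to a
  polyanalytic p, and Fatou's lemma turns the Cauchy estimate for partial sums into an estimate of p
  minus a partial sum. Orthogonality to \<open>fock m\<close> passes to the limit.\<close>

lemma Riesz_Fischer_hbasis:
  assumes A: "summable (\<lambda>q. (cmod (A q))\<^sup>2)"
  shows "\<exists>p\<in>true_fock (Suc m). (\<lambda>N. L2norm (\<lambda>z. p z - (\<Sum>q<N. A q * hbasis m q z))) \<longlonglongrightarrow> 0"
proof -
  have K: "cmod (A q) \<le> sqrt (\<Sum>q. (cmod (A q))\<^sup>2)" for q
    using sum_le_suminf[OF A, of "{q}"] by (intro real_le_rsqrt) auto
  define p where "p z = (\<Sum>q. A q * hbasis m q z)" for z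
  define S where "S N z = (\<Sum>q<N. A q * hbasis m q z)" for N z
  have p_poly: "p \<in> polyanalytic (Suc m)"
    unfolding p_def[abs_def] by (rule hbasis_series(1)[OF K])
  have S_lim: "(\<lambda>N. S N z) \<longlonglongrightarrow> p z" for z
    unfolding S_def p_def by (intro summable_LIMSEQ hbasis_series(2)[OF K])
  have L2: "hbasis m q \<in> L2" for q
    using hbasis_true_fock by (rule true_fock_L2)
  have S_L2: "S N \<in> L2" for N
    unfolding S_def[abs_def] by (intro L2_sum L2)
  have [measurable]: "S N \<in> borel_measurable borel" "p \<in> borel_measurable borel" for N
    using S_L2 polyanalytic_continuous[OF p_poly] by (auto dest: L2_measurable intro: borel_measurable_continuous_onI)
  define tail where "tail N = (\<Sum>q. (cmod (A (q + N)))\<^sup>2)" for N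
  have tail_nonneg: "tail N \<ge> 0" for N
    unfolding tail_def by (intro suminf_nonneg summable_ignore_initial_segment A) auto
  have S_diff: "(L2norm (\<lambda>z. S M z - S N z))\<^sup>2 \<le> tail N" if "N \<le> M" for M N
  proof -
    have "S M z - S N z = (\<Sum>q\<in>{N..<M}. A q * hbasis m q z)" for z
      unfolding S_def lessThan_atLeast0 by (rule sum_diff_nat_ivl) (use that in auto)
    then have "(L2norm (\<lambda>z. S M z - S N z))\<^sup>2 = (\<Sum>q\<in>{N..<M}. (cmod (A q))\<^sup>2)"
      by (simp add: L2norm_hbasis_sum)
    also have "\<dots> = (\<Sum>q\<in>{0..<M - N}. (cmod (A (q + N)))\<^sup>2)"
      using sum.shift_bounds_nat_ivl[of "\<lambda>q. (cmod (A q))\<^sup>2" 0 N "M - N"] that by simp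
    also have "\<dots> \<le> tail N"
      unfolding tail_def by (intro sum_le_suminf summable_ignore_initial_segment A) auto
    finally show ?thesis .
  qed
  have nn: "(\<integral>\<^sup>+z. ennreal ((cmod (p z - S N z))\<^sup>2) \<partial>gauss) \<le> ennreal (tail N)" for N
  proof -
    have "(\<integral>\<^sup>+z. ennreal ((cmod (p z - S N z))\<^sup>2) \<partial>gauss) = (\<integral>\<^sup>+z. liminf (\<lambda>M. ennreal ((cmod (S M z - S N z))\<^sup>2)) \<partial>gauss)"
    proof (rule nn_integral_cong)
      fix z
      have "(\<lambda>M. ennreal ((cmod (S M z - S N z))\<^sup>2)) \<longlonglongrightarrow> ennreal ((cmod (p z - S N z))\<^sup>2)"
        by (intro tendsto_intros S_lim)
      from lim_imp_Liminf[OF trivial_limit_sequentially this]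
      show "ennreal ((cmod (p z - S N z))\<^sup>2) = liminf (\<lambda>M. ennreal ((cmod (S M z - S N z))\<^sup>2))"
        by (rule sym)
    qed
    also have "\<dots> \<le> liminf (\<lambda>M. \<integral>\<^sup>+z. ennreal ((cmod (S M z - S N z))\<^sup>2) \<partial>gauss)"
      by (rule nn_integral_liminf) measurable
    also have "\<dots> \<le> ennreal (tail N)"
    proof (rule Liminf_le)
      show "\<forall>\<^sub>F M in sequentially. (\<integral>\<^sup>+z. ennreal ((cmod (S M z - S N z))\<^sup>2) \<partial>gauss) \<le> ennreal (tail N)"
        using eventually_ge_at_top[of N]
      proof eventually_elim
        case (elim M)
        have "(\<integral>\<^sup>+z. ennreal ((cmod (S M z - S N z))\<^sup>2) \<partial>gauss) = ennreal (LINT z|gauss. (cmod (S M z - S N z))\<^sup>2)"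
          by (rule nn_integral_eq_integral[OF L2_integrable_square[OF L2_diff[OF S_L2 S_L2]]]) simp
        then show ?case
          using S_diff[OF elim] by (simp add: L2norm_square ennreal_leI)
      qed
    qed simp
    finally show ?thesis .
  qed
  have diff_L2: "(\<lambda>z. p z - S N z) \<in> L2" for N
  proof -
    have "integrable gauss (\<lambda>z. (cmod (p z - S N z))\<^sup>2)"
      using le_less_trans[OF nn[of N] ennreal_less_top] by (intro integrableI_bounded) auto
    then show ?thesis
      by (simp add: L2_def)
  qed
  have diff_bound: "(L2norm (\<lambda>z. p z - S N z))\<^sup>2 \<le> tail N" for N
  proof -
    have "ennreal (LINT z|gauss. (cmod (p z - S N z))\<^sup>2) = (\<integral>\<^sup>+z. ennreal ((cmod (p z - S N z))\<^sup>2) \<partial>gauss)"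
      by (rule nn_integral_eq_integral[OF L2_integrable_square[OF diff_L2], symmetric]) simp
    with nn[of N] have "ennreal (LINT z|gauss. (cmod (p z - S N z))\<^sup>2) \<le> ennreal (tail N)"
      by (simp only:)
    then show ?thesis
      using tail_nonneg[of N] by (simp add: L2norm_square)
  qed
  have "tail \<longlonglongrightarrow> 0"
    unfolding tail_def[abs_def] by (rule suminf_exist_split2[OF A])
  then have lim2: "(\<lambda>N. (L2norm (\<lambda>z. p z - S N z))\<^sup>2) \<longlonglongrightarrow> 0"
    by (rule tendsto_sandwich[OF _ _ tendsto_const, rotated 2]) (auto intro!: always_eventually diff_bound)
  then have lim: "(\<lambda>N. L2norm (\<lambda>z. p z - S N z)) \<longlonglongrightarrow> 0"
    using tendsto_real_sqrt[OF lim2] by simp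
  have p_L2: "p \<in> L2"
    using L2_add[OF diff_L2[of 0] S_L2[of 0]] by simp
  have "ip p g = 0" if g: "g \<in> fock m" for g
  proof -
    have gL2: "g \<in> L2"
      using g by (rule fock_subset_L2)
    have S_orth: "ip (S N) g = 0" for N
    proof -
      have "ip (S N) g = (\<Sum>q<N. A q * ip (hbasis m q) g)"
        unfolding S_def[abs_def] by (intro ip_sum_left L2 gL2)
      also have "\<dots> = 0"
        using hbasis_true_fock[of m] g by (intro sum.neutral) (auto simp: true_fock_Suc)
      finally show ?thesis .
    qed
    have "cmod (ip p g) \<le> L2norm (\<lambda>z. p z - S N z) * L2norm g" for N
    proof -
      have "ip (\<lambda>z. p z - S N z) g = ip p g"
        by (simp add: ip_diff_left p_L2 S_L2 gL2 S_orth)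
      then show ?thesis
        using ip_Cauchy_Schwarz(1)[OF diff_L2[of N] gL2] by simp
    qed
    then have "cmod (ip p g) \<le> 0 * L2norm g"
      by (intro LIMSEQ_le_const[OF tendsto_mult_right[OF lim]]) auto
    then show ?thesis
      by simp
  qed
  then have "p \<in> true_fock (Suc m)"
    using p_poly p_L2 by (simp add: true_fock_Suc fock_eq)
  then show ?thesis
    using lim unfolding S_def by blast
qed

subsection \<open>Hilbert spaces of functions with a countable orthonormal basis\<close>

lemma ip_diff_right:
  "f \<in> L2 \<Longrightarrow> g \<in> L2 \<Longrightarrow> h \<in> L2 \<Longrightarrow> ip h (\<lambda>z. f z - g z) = ip h f - ip h g"
  using ip_diff_left[of f g h] cnj_ip complex_cnj_diff by metis

lemma ip_commute_zero: "ip f g = 0 \<longleftrightarrow> ip g f = 0"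
  using cnj_ip[of f g] cnj_ip[of g f] by auto

lemma Bessel:
  assumes fin: "finite I" and u: "\<And>i. i \<in> I \<Longrightarrow> u i \<in> L2" and x: "x \<in> L2"
    and ortho: "\<And>i j. i \<in> I \<Longrightarrow> j \<in> I \<Longrightarrow> ip (u i) (u j) = (if i = j then 1 else 0)"
  shows "(\<Sum>i\<in>I. (cmod (ip x (u i)))\<^sup>2) \<le> (L2norm x)\<^sup>2"
proof -
  define y where "y z = (\<Sum>i\<in>I. ip x (u i) * u i z)" for z
  have yL2: "y \<in> L2"
    unfolding y_def[abs_def] by (intro L2_sum u)
  have dL2: "(\<lambda>z. x z - y z) \<in> L2"
    by (intro L2_diff x yL2)
  define S where "S = complex_of_real (\<Sum>i\<in>I. (cmod (ip x (u i)))\<^sup>2)"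
  have S: "S = (\<Sum>i\<in>I. ip x (u i) * cnj (ip x (u i)))"
    by (simp add: S_def complex_norm_square[symmetric])
  have xy: "ip x y = S"
    unfolding y_def[abs_def] by (subst ip_sum_right) (auto simp: u x S mult.commute)
  then have yx: "ip y x = S"
    using cnj_ip[of x y] by (simp add: S_def)
  have "ip y (u j) = ip x (u j)" if "j \<in> I" for j
  proof -
    have "ip y (u j) = (\<Sum>i\<in>I. ip x (u i) * (if i = j then 1 else 0))"
      unfolding y_def[abs_def] by (subst ip_sum_left) (auto simp: u that ortho)
    also have "\<dots> = ip x (u j)"
      using fin that by (simp add: if_distrib[of "\<lambda>x. _ * x"] cong: if_cong)
    finally show ?thesis .
  qed
  then have yy: "ip y y = S"
    using yL2 unfolding S y_def[abs_def] by (subst ip_sum_right) (auto simp: u y_def[abs_def] mult.commute)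
  have "ip (\<lambda>z. x z - y z) (\<lambda>z. x z - y z) = ip x x - S"
    by (simp add: ip_diff_left ip_diff_right x yL2 dL2 xy yx yy)
  then have "of_real ((L2norm (\<lambda>z. x z - y z))\<^sup>2) = (of_real ((L2norm x)\<^sup>2 - (\<Sum>i\<in>I. (cmod (ip x (u i)))\<^sup>2)) :: complex)"
    by (simp only: ip_self S_def of_real_diff)
  then have "(L2norm (\<lambda>z. x z - y z))\<^sup>2 = (L2norm x)\<^sup>2 - (\<Sum>i\<in>I. (cmod (ip x (u i)))\<^sup>2)"
    by (simp only: of_real_eq_iff)
  then show ?thesis
    using zero_le_power2[of "L2norm (\<lambda>z. x z - y z)"] by linarith
qed

text \<open>Collects what the operator theory uses, with Riesz-Fischer along one countable basis in
  the place of completeness. \<open>definite\<close> is an axiom because members are compared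
  pointwise while the norm sees only classes modulo null sets.\<close>

locale function_hilbert =
  fixes H :: "(complex \<Rightarrow> complex) set" and e :: "nat \<Rightarrow> complex \<Rightarrow> complex"
  assumes H_L2: "f \<in> H \<Longrightarrow> f \<in> L2"
    and H_linear: "f \<in> H \<Longrightarrow> g \<in> H \<Longrightarrow> (\<lambda>z. a * f z + b * g z) \<in> H"
    and definite: "f \<in> H \<Longrightarrow> L2norm f = 0 \<Longrightarrow> f = (\<lambda>_. 0)"
    and e_H: "e q \<in> H"
    and e_ortho: "ip (e q) (e p) = (if q = p then 1 else 0)"
    and total: "f \<in> H \<Longrightarrow> (\<And>q. ip f (e q) = 0) \<Longrightarrow> f = (\<lambda>_. 0)"
    and Riesz_Fischer: "summable (\<lambda>q. (cmod (A q))\<^sup>2) \<Longrightarrow>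
      \<exists>p\<in>H. (\<lambda>N. L2norm (\<lambda>z. p z - (\<Sum>q<N. A q * e q z))) \<longlonglongrightarrow> 0"
begin

lemma e_L2: "e q \<in> L2"
  by (rule H_L2[OF e_H])

lemma zero_H: "(\<lambda>_. 0) \<in> H"
  using H_linear[OF e_H[of 0] e_H[of 0], of 0 0] by simp

lemma sum_H: "(\<And>i. i \<in> I \<Longrightarrow> u i \<in> H) \<Longrightarrow> (\<lambda>z. \<Sum>i\<in>I. a i * u i z) \<in> H"
proof (induction I rule: infinite_finite_induct)
  case (insert i I)
  then have "(\<lambda>z. a i * u i z + 1 * (\<Sum>i\<in>I. a i * u i z)) \<in> H"
    by (intro H_linear) auto
  then show ?case
    using insert by simp
qed (simp_all add: zero_H)

lemma diff_H: "f \<in> H \<Longrightarrow> g \<in> H \<Longrightarrow> (\<lambda>z. f z - g z) \<in> H"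
  using H_linear[of f g 1 "-1"] by simp

lemma cmult_H: "f \<in> H \<Longrightarrow> (\<lambda>z. a * f z) \<in> H"
  using H_linear[of f f a 0] by simp

lemma definite_ip: "f \<in> H \<Longrightarrow> ip f f = 0 \<Longrightarrow> f = (\<lambda>_. 0)"
  by (rule definite) (simp_all add: ip_self)

lemma eq_if_ip_eq:
  assumes "f \<in> H" "g \<in> H" "\<And>h. h \<in> H \<Longrightarrow> ip f h = ip g h"
  shows "f = g"
proof -
  let ?d = "\<lambda>z. f z - g z"
  have d: "?d \<in> H"
    using assms by (intro diff_H)
  then have "ip ?d ?d = 0"
    using assms by (simp add: ip_diff_left H_L2)
  then have "?d = (\<lambda>_. 0)"
    by (rule definite_ip[OF d])
  then show ?thesis
    by (simp add: fun_eq_iff)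
qed

section \<open>Bounded functionals and their representation\<close>

definition bounded_functional :: "((complex \<Rightarrow> complex) \<Rightarrow> complex) \<Rightarrow> bool" where
  "bounded_functional l \<longleftrightarrow>
    (\<forall>f\<in>H. \<forall>g\<in>H. \<forall>a b. l (\<lambda>z. a * f z + b * g z) = a * l f + b * l g) \<and>
    (\<exists>C. \<forall>f\<in>H. cmod (l f) \<le> C * L2norm f)"

lemma bounded_functionalI:
  assumes "\<And>f g a b. f \<in> H \<Longrightarrow> g \<in> H \<Longrightarrow> l (\<lambda>z. a * f z + b * g z) = a * l f + b * l g"
    and "\<And>f. f \<in> H \<Longrightarrow> cmod (l f) \<le> C * L2norm f"
  shows "bounded_functional l"
  using assms unfolding bounded_functional_def by blast

lemma bounded_functional_linear:
  "bounded_functional l \<Longrightarrow> f \<in> H \<Longrightarrow> g \<in> H \<Longrightarrow> l (\<lambda>z. a * f z + b * g z) = a * l f + b * l g"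
  unfolding bounded_functional_def by blast

lemma bounded_functional_zero: "bounded_functional l \<Longrightarrow> l (\<lambda>_. 0) = 0"
  using bounded_functional_linear[of l "\<lambda>_. 0" "\<lambda>_. 0" 0 0] zero_H by simp

lemma bounded_functional_sum:
  assumes l: "bounded_functional l"
  shows "(\<And>i. i \<in> I \<Longrightarrow> u i \<in> H) \<Longrightarrow> l (\<lambda>z. \<Sum>i\<in>I. a i * u i z) = (\<Sum>i\<in>I. a i * l (u i))"
proof (induction I rule: infinite_finite_induct)
  case (insert i I)
  have "l (\<lambda>z. a i * u i z + 1 * (\<Sum>i\<in>I. a i * u i z)) = a i * l (u i) + 1 * l (\<lambda>z. \<Sum>i\<in>I. a i * u i z)"
    using insert by (intro bounded_functional_linear[OF l] sum_H) auto
  then show ?case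
    using insert by simp
qed (simp_all add: bounded_functional_zero[OF l])

lemma bounded_functional_diff:
  assumes l: "bounded_functional l" and l': "bounded_functional l'"
  shows "bounded_functional (\<lambda>f. l f - l' f)"
proof -
  obtain C C' where C: "\<And>f. f \<in> H \<Longrightarrow> cmod (l f) \<le> C * L2norm f" "\<And>f. f \<in> H \<Longrightarrow> cmod (l' f) \<le> C' * L2norm f"
    using l l' unfolding bounded_functional_def by blast
  show ?thesis
  proof (rule bounded_functionalI[where C = "C + C'"])
    fix f assume "f \<in> H"
    then show "cmod (l f - l' f) \<le> (C + C') * L2norm f"
      using norm_triangle_ineq4[of "l f" "l' f"] C(1)[of f] C(2)[of f] by (simp add: distrib_right)
  qed (simp add: bounded_functional_linear[OF l] bounded_functional_linear[OF l'] algebra_simps)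
qed

lemma bounded_functional_ip:
  assumes "p \<in> H"
  shows "bounded_functional (\<lambda>f. ip f p)"
proof (rule bounded_functionalI[where C = "L2norm p"])
  show "cmod (ip f p) \<le> L2norm p * L2norm f" if "f \<in> H" for f
    using ip_Cauchy_Schwarz(1)[OF H_L2[OF that] H_L2[OF assms]] by (simp add: mult.commute)
qed (simp add: ip_linear_left H_L2 assms)

lemma coefficients_of_limit:
  assumes p: "p \<in> H" and lim: "(\<lambda>N. L2norm (\<lambda>z. p z - (\<Sum>q<N. A q * e q z))) \<longlonglongrightarrow> 0"
  shows "ip p (e r) = A r"
proof -
  have "cmod (ip p (e r) - A r) \<le> L2norm (\<lambda>z. p z - (\<Sum>q<N. A q * e q z)) * L2norm (e r)" if "N > r" for N
  proof -
    have L2: "(\<lambda>z. \<Sum>q<N. A q * e q z) \<in> L2"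
      by (intro L2_sum e_L2)
    have "ip (\<lambda>z. \<Sum>q<N. A q * e q z) (e r) = (\<Sum>q<N. A q * (if q = r then 1 else 0))"
      by (subst ip_sum_left) (auto simp: e_L2 e_ortho)
    also have "\<dots> = A r"
      using that by (simp add: if_distrib[of "\<lambda>x. _ * x"] cong: if_cong)
    finally have "ip (\<lambda>z. p z - (\<Sum>q<N. A q * e q z)) (e r) = ip p (e r) - A r"
      by (simp add: ip_diff_left H_L2[OF p] L2 e_L2)
    then show ?thesis
      using ip_Cauchy_Schwarz(1)[OF L2_diff[OF H_L2[OF p] L2] e_L2, of r] by simp
  qed
  then have "cmod (ip p (e r) - A r) \<le> 0 * L2norm (e r)"
    by (intro LIMSEQ_le_const[OF tendsto_mult_right[OF lim]]) (auto intro!: exI[of _ "Suc r"])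
  then show ?thesis
    by simp
qed

lemma Bessel_e:
  assumes "x \<in> H"
  shows "summable (\<lambda>q. (cmod (ip x (e q)))\<^sup>2)"
proof (rule summableI_nonneg_bounded)
  show "(\<Sum>q<n. (cmod (ip x (e q)))\<^sup>2) \<le> (L2norm x)\<^sup>2" for n
    by (rule Bessel) (auto simp: e_L2 e_ortho H_L2 assms)
qed simp

lemma expansion:
  assumes x: "x \<in> H"
  shows "(\<lambda>N. L2norm (\<lambda>z. x z - (\<Sum>q<N. ip x (e q) * e q z))) \<longlonglongrightarrow> 0"
proof -
  obtain p where p: "p \<in> H" "(\<lambda>N. L2norm (\<lambda>z. p z - (\<Sum>q<N. ip x (e q) * e q z))) \<longlonglongrightarrow> 0"
    using Riesz_Fischer[OF Bessel_e[OF x]] by blast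
  have "(\<lambda>z. x z - p z) = (\<lambda>_. 0)"
    by (rule total) (auto simp: diff_H x p ip_diff_left H_L2 e_L2 coefficients_of_limit[OF p])
  then have "x = p"
    by (simp add: fun_eq_iff)
  then show ?thesis
    using p by simp
qed

lemma functional_zero:
  assumes l: "bounded_functional l" and zero: "\<And>q. l (e q) = 0" and x: "x \<in> H"
  shows "l x = 0"
proof -
  obtain C where C: "\<And>f. f \<in> H \<Longrightarrow> cmod (l f) \<le> C * L2norm f"
    using l unfolding bounded_functional_def by blast
  have "cmod (l x) \<le> C * L2norm (\<lambda>z. x z - (\<Sum>q<N. ip x (e q) * e q z))" for N
  proof -
    let ?y = "\<lambda>z. \<Sum>q<N. ip x (e q) * e q z"
    have y: "?y \<in> H"
      by (intro sum_H e_H)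
    have "l ?y = 0"
      by (simp add: bounded_functional_sum[OF l] e_H zero)
    then have "l (\<lambda>z. x z - ?y z) = l x"
      using bounded_functional_linear[OF l x y, of 1 "-1"] by simp
    then show ?thesis
      using C[OF diff_H[OF x y]] by simp
  qed
  then have "cmod (l x) \<le> C * 0"
    by (intro LIMSEQ_le_const[OF tendsto_mult_left[OF expansion[OF x]]]) auto
  then show ?thesis
    by simp
qed

text \<open>The representing coefficients are square summable because the functional, tested on
  their own partial sum y, takes the value ||y||^2, which is at most C ||y||.\<close>

lemma Riesz:
  assumes l: "bounded_functional l"
  shows "\<exists>p\<in>H. \<forall>x\<in>H. l x = ip x p"
proof -
  obtain C where C: "\<And>f. f \<in> H \<Longrightarrow> cmod (l f) \<le> C * L2norm f"
    using l unfolding bounded_functional_def by blast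
  define A where "A q = cnj (l (e q))" for q
  have "summable (\<lambda>q. (cmod (A q))\<^sup>2)"
  proof (rule summableI_nonneg_bounded)
    fix n
    let ?S = "\<Sum>q<n. (cmod (A q))\<^sup>2"
    let ?y = "\<lambda>z. \<Sum>q<n. A q * e q z"
    have y: "?y \<in> H"
      by (intro sum_H e_H)
    have "l ?y = (\<Sum>q<n. A q * cnj (A q))"
      by (simp add: bounded_functional_sum[OF l] e_H A_def)
    also have "\<dots> = of_real ?S"
      by (simp add: complex_norm_square[symmetric])
    finally have ly: "l ?y = of_real ?S" .
    have "ip ?y ?y = (\<Sum>q<n. A q * ip (e q) ?y)"
      by (intro ip_sum_left e_L2 H_L2 y)
    also have "\<dots> = (\<Sum>q<n. A q * (\<Sum>p<n. cnj (A p) * ip (e q) (e p)))"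
      by (subst ip_sum_right) (auto intro: e_L2)
    also have "\<dots> = (\<Sum>q<n. A q * cnj (A q))"
      by (intro sum.cong refl) (simp add: e_ortho if_distrib[of "\<lambda>x. _ * x"] cong: if_cong)
    also have "\<dots> = of_real ?S"
      by (simp add: complex_norm_square[symmetric])
    finally have norm_y: "(L2norm ?y)\<^sup>2 = ?S"
      by (simp only: ip_self of_real_eq_iff)
    have "?S \<ge> 0"
      by (intro sum_nonneg) simp
    then have "cmod (l ?y) = ?S"
      unfolding ly norm_of_real by (rule abs_of_nonneg)
    then have "?S \<le> C * L2norm ?y"
      using C[OF y] by (simp only:)
    then have "(L2norm ?y)\<^sup>2 \<le> C * L2norm ?y"
      by (simp only: norm_y)
    then have "L2norm ?y * L2norm ?y \<le> C * L2norm ?y"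
      by (simp only: power2_eq_square)
    then have "L2norm ?y \<le> \<bar>C\<bar>"
      by (cases "L2norm ?y = 0") (auto simp: mult_le_cancel_right less_le)
    then show "?S \<le> \<bar>C\<bar>\<^sup>2"
      unfolding norm_y[symmetric] by (intro power_mono) auto
  qed simp
  then obtain p where p: "p \<in> H" "(\<lambda>N. L2norm (\<lambda>z. p z - (\<Sum>q<N. A q * e q z))) \<longlonglongrightarrow> 0"
    using Riesz_Fischer by blast
  have "l x - ip x p = 0" if "x \<in> H" for x
  proof (rule functional_zero[OF bounded_functional_diff[OF l bounded_functional_ip[OF p(1)]] _ that])
    fix q
    have "cnj (ip p (e q)) = cnj (A q)"
      by (simp only: coefficients_of_limit[OF p])
    then show "l (e q) - ip (e q) p = 0"
      by (simp add: cnj_ip A_def)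
  qed
  then show ?thesis
    using p(1) by auto
qed

section \<open>Arbitrary orthonormal bases\<close>

lemma inj_e: "inj e"
proof (rule injI, rule ccontr)
  fix p q assume "e p = e q" "p \<noteq> q"
  then show False
    using e_ortho[of p q] e_ortho[of p p] by simp
qed

lemma orthonormal_basis_range: "orthonormal_basis H (range e)"
  unfolding orthonormal_basis_def using total e_H by (auto simp: e_ortho inj_eq[OF inj_e])

lemma orthonormal_basis_bound:
  assumes E: "orthonormal_basis H E" and x: "x \<in> H" and y: "y \<in> H" and F: "finite F" "F \<subseteq> E"
  shows "(\<Sum>u\<in>F. cmod (ip x u) * cmod (ip u y)) \<le> L2norm x * L2norm y"
proof -
  have B: "L2_set (\<lambda>u. cmod (ip x u)) F \<le> L2norm x" if "x \<in> H" for x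
  proof -
    have "(\<Sum>u\<in>F. (cmod (ip x u))\<^sup>2) \<le> (L2norm x)\<^sup>2"
      using Bessel[of F "\<lambda>u. u" x] F E H_L2 that by (auto simp: orthonormal_basis_def subset_iff)
    then have "sqrt (\<Sum>u\<in>F. (cmod (ip x u))\<^sup>2) \<le> sqrt ((L2norm x)\<^sup>2)"
      by (rule real_sqrt_le_mono)
    then show ?thesis
      by (simp add: L2_set_def)
  qed
  have "cmod (ip u y) = cmod (ip y u)" for u
    by (metis cnj_ip complex_mod_cnj)
  then have "(\<Sum>u\<in>F. cmod (ip x u) * cmod (ip u y)) = (\<Sum>u\<in>F. \<bar>cmod (ip x u)\<bar> * \<bar>cmod (ip y u)\<bar>)"
    by simp
  also have "\<dots> \<le> L2_set (\<lambda>u. cmod (ip x u)) F * L2_set (\<lambda>u. cmod (ip y u)) F"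
    by (rule L2_set_mult_ineq)
  also have "\<dots> \<le> L2norm x * L2norm y"
    by (intro mult_mono B x y) (auto simp: L2_set_nonneg)
  finally show ?thesis .
qed

lemma orthonormal_basis_abs_summable:
  assumes E: "orthonormal_basis H E" and x: "x \<in> H" and y: "y \<in> H"
  shows "(\<lambda>u. norm (ip x u * ip u y)) summable_on E"
    and "(\<Sum>\<^sub>\<infinity>u\<in>E. cmod (ip x u * ip u y)) \<le> L2norm x * L2norm y"
proof -
  show *: "(\<lambda>u. norm (ip x u * ip u y)) summable_on E"
    unfolding norm_mult
  proof (rule nonneg_bdd_above_summable_on)
    show "bdd_above (sum (\<lambda>u. cmod (ip x u) * cmod (ip u y)) ` {F. F \<subseteq> E \<and> finite F})"
      by (rule bdd_aboveI[of _ "L2norm x * L2norm y"]) (auto intro: orthonormal_basis_bound[OF E x y])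
  qed simp
  show "(\<Sum>\<^sub>\<infinity>u\<in>E. cmod (ip x u * ip u y)) \<le> L2norm x * L2norm y"
    by (rule infsum_le_finite_sums[OF *]) (auto simp: norm_mult intro: orthonormal_basis_bound[OF E x y])
qed

text \<open>Needed for every basis, since \<open>tr\<close> uses an unspecified one. The series is a
  bounded functional of x; its Riesz vector has the same pairings with \<open>E\<close> as y, and
  totality of \<open>E\<close> identifies the two.\<close>

lemma orthonormal_basis_Parseval:
  assumes E: "orthonormal_basis H E" and x: "x \<in> H" and y: "y \<in> H"
  shows "(\<Sum>\<^sub>\<infinity>u\<in>E. ip x u * ip u y) = ip x y"
proof -
  have EH: "u \<in> H" if "u \<in> E" for u
    using E that by (auto simp: orthonormal_basis_def)
  have summ: "(\<lambda>u. ip x u * ip u y) summable_on E" if "x \<in> H" for x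
    using abs_summable_summable[OF orthonormal_basis_abs_summable(1)[OF E that y]] .
  define l where "l x = (\<Sum>\<^sub>\<infinity>u\<in>E. ip x u * ip u y)" for x
  have "bounded_functional l"
  proof (rule bounded_functionalI[where C = "L2norm y"])
    fix f g a b assume fg: "f \<in> H" "g \<in> H"
    have "l (\<lambda>z. a * f z + b * g z) = (\<Sum>\<^sub>\<infinity>u\<in>E. a * (ip f u * ip u y) + b * (ip g u * ip u y))"
      unfolding l_def using fg EH by (intro infsum_cong) (simp add: ip_linear_left H_L2 algebra_simps)
    also have "\<dots> = a * l f + b * l g"
      unfolding l_def using summ fg by (subst infsum_add) (auto intro: summable_on_cmult_right simp: infsum_cmult_right')
    finally show "l (\<lambda>z. a * f z + b * g z) = a * l f + b * l g" .
  next
    fix f assume f: "f \<in> H"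
    have "cmod (l f) \<le> (\<Sum>\<^sub>\<infinity>u\<in>E. cmod (ip f u * ip u y))"
      unfolding l_def by (intro norm_infsum_bound orthonormal_basis_abs_summable(1)[OF E f y])
    also have "\<dots> \<le> L2norm f * L2norm y"
      by (rule orthonormal_basis_abs_summable(2)[OF E f y])
    finally show "cmod (l f) \<le> L2norm y * L2norm f"
      by (simp add: mult.commute)
  qed
  then obtain p where p: "p \<in> H" "\<And>x. x \<in> H \<Longrightarrow> l x = ip x p"
    using Riesz by blast
  have "ip u p = ip u y" if u: "u \<in> E" for u
  proof -
    have "ip u p = (\<Sum>\<^sub>\<infinity>v\<in>E. ip u v * ip v y)"
      using p(2)[OF EH[OF u]] by (simp add: l_def)
    also have "\<dots> = (\<Sum>\<^sub>\<infinity>v\<in>{u}. ip u v * ip v y)"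
      using E u by (intro infsum_cong_neutral) (auto simp: orthonormal_basis_def)
    also have "\<dots> = ip u y"
      using E u by (simp add: orthonormal_basis_def)
    finally show ?thesis .
  qed
  then have "ip (\<lambda>z. p z - y z) u = 0" if "u \<in> E" for u
    using that EH p(1) y ip_diff_right[of p y u] ip_commute_zero[of "\<lambda>z. p z - y z" u] by (simp add: H_L2)
  then have "(\<lambda>z. p z - y z) = (\<lambda>_. 0)"
    using E diff_H[OF p(1) y] by (auto simp: orthonormal_basis_def)
  then have "p = y"
    by (simp add: fun_eq_iff)
  then show ?thesis
    using p(2)[OF x] by (simp add: l_def)
qed

text \<open>A name for the basis selected inside \<open>tr\<close>, so that general facts on
  orthonormal bases apply to it.\<close>

definition trace_basis :: "(complex \<Rightarrow> complex) set" where
  "trace_basis = (SOME E. orthonormal_basis H E)"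

lemma orthonormal_trace_basis: "orthonormal_basis H trace_basis"
  unfolding trace_basis_def using orthonormal_basis_range by (rule someI)

end

subsection \<open>Trace class operators\<close>

text \<open>
  Gram-Schmidt for the semi-inner product \<open>ip (P x) y\<close> of a positive operator. Null vectors are
  replaced by \<open>0\<close>.
\<close>

fun gram_schmidt :: "((complex \<Rightarrow> complex) \<Rightarrow> complex \<Rightarrow> complex) \<Rightarrow> (nat \<Rightarrow> complex \<Rightarrow> complex) \<Rightarrow> nat \<Rightarrow> complex \<Rightarrow> complex" where
  "gram_schmidt P e n =
    (let w = (\<lambda>z. e n z - (\<Sum>j<n. ip (P (e n)) (gram_schmidt P e j) * gram_schmidt P e j z))
     in (\<lambda>z. 1 / of_real (sqrt (Re (ip (P w) w))) * w z))"

declare gram_schmidt.simps [simp del]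

context function_hilbert
begin

lemma bounded_ops_H: "T \<in> bounded_ops H \<Longrightarrow> f \<in> H \<Longrightarrow> T f \<in> H"
  by (auto simp: bounded_ops_def)

lemma bounded_ops_linear:
  "T \<in> bounded_ops H \<Longrightarrow> f \<in> H \<Longrightarrow> g \<in> H \<Longrightarrow> T (\<lambda>z. a * f z + b * g z) = (\<lambda>z. a * T f z + b * T g z)"
  unfolding bounded_ops_def by blast

lemma bounded_opsE:
  assumes "T \<in> bounded_ops H"
  obtains C where "C \<ge> 0" "\<And>f. f \<in> H \<Longrightarrow> L2norm (T f) \<le> C * L2norm f"
proof -
  obtain C where C: "\<And>f. f \<in> H \<Longrightarrow> L2norm (T f) \<le> C * L2norm f"
    using assms unfolding bounded_ops_def by blast
  have "L2norm (T f) \<le> \<bar>C\<bar> * L2norm f" if "f \<in> H" for f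
    by (rule order.trans[OF C[OF that]]) (auto intro!: mult_right_mono)
  then show ?thesis
    by (intro that[of "\<bar>C\<bar>"]) auto
qed

lemma bounded_ops_zero: "T \<in> bounded_ops H \<Longrightarrow> T (\<lambda>_. 0) = (\<lambda>_. 0)"
  using bounded_ops_linear[of T "\<lambda>_. 0" "\<lambda>_. 0" 0 0] zero_H by simp

lemma bounded_functional_ops:
  assumes T: "T \<in> bounded_ops H" and y: "y \<in> H"
  shows "bounded_functional (\<lambda>x. ip (T x) y)"
proof -
  obtain C where C: "C \<ge> 0" "\<And>f. f \<in> H \<Longrightarrow> L2norm (T f) \<le> C * L2norm f"
    by (rule bounded_opsE[OF T]) blast
  show ?thesis
  proof (rule bounded_functionalI[where C = "C * L2norm y"])
    fix f assume f: "f \<in> H"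
    have "cmod (ip (T f) y) \<le> L2norm (T f) * L2norm y"
      using f y by (intro ip_Cauchy_Schwarz(1) H_L2 bounded_ops_H[OF T])
    also have "\<dots> \<le> (C * L2norm f) * L2norm y"
      using C(2)[OF f] by (intro mult_right_mono) auto
    finally show "cmod (ip (T f) y) \<le> C * L2norm y * L2norm f"
      by (simp add: mult_ac)
  qed (simp add: bounded_ops_linear[OF T] ip_linear_left H_L2 bounded_ops_H[OF T] y)
qed

end

text \<open>
  With \<open>v\<close> the Gram-Schmidt family of the basis \<open>e\<close> for \<open>ip (P x) y\<close>, where \<open>P = \<bar>B\<bar>\<close>, one has
  \<open>B = \<Sum>\<^sub>j B v\<^sub>j \<otimes> P v\<^sub>j\<close>. This Cholesky-type factorisation replaces the singular value
  decomposition: no compactness or spectral theorem is needed.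
\<close>

locale positive_op = function_hilbert +
  fixes B P :: "(complex \<Rightarrow> complex) \<Rightarrow> complex \<Rightarrow> complex"
  assumes B: "B \<in> bounded_ops H" and abs_op: "is_abs_op H B P"
begin

lemma P: "P \<in> bounded_ops H"
  using abs_op by (simp add: is_abs_op_def)

lemma P_pos: "x \<in> H \<Longrightarrow> ip (P x) x \<in> \<real>\<^sub>\<ge>\<^sub>0"
  using abs_op by (simp add: is_abs_op_def)

lemma P_square: "x \<in> H \<Longrightarrow> y \<in> H \<Longrightarrow> ip (P (P x)) y = ip (B x) (B y)"
  using abs_op by (simp add: is_abs_op_def)

definition br :: "(complex \<Rightarrow> complex) \<Rightarrow> (complex \<Rightarrow> complex) \<Rightarrow> complex" where
  "br x y = ip (P x) y"

lemma P_L2: "x \<in> H \<Longrightarrow> P x \<in> L2"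
  by (intro H_L2 bounded_ops_H[OF P])

lemma br_functional: "y \<in> H \<Longrightarrow> bounded_functional (\<lambda>x. br x y)"
  unfolding br_def by (rule bounded_functional_ops[OF P])

lemma br_linear_left: "x \<in> H \<Longrightarrow> x' \<in> H \<Longrightarrow> y \<in> H \<Longrightarrow> br (\<lambda>z. a * x z + b * x' z) y = a * br x y + b * br x' y"
  by (rule bounded_functional_linear[OF br_functional])

lemma br_linear_right:
  assumes "x \<in> H" "y \<in> H" "y' \<in> H"
  shows "br x (\<lambda>z. a * y z + b * y' z) = cnj a * br x y + cnj b * br x y'"
proof -
  have "cnj (ip (\<lambda>z. a * y z + b * y' z) (P x)) = cnj a * cnj (ip y (P x)) + cnj b * cnj (ip y' (P x))"
    using assms by (simp add: ip_linear_left H_L2 P_L2)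
  then show ?thesis
    by (simp add: br_def cnj_ip)
qed

lemma br_self_nonneg:
  assumes "x \<in> H"
  shows "br x x = of_real (Re (br x x))" "Re (br x x) \<ge> 0"
  using P_pos[OF assms] by (auto simp: br_def complex_nonneg_Reals_iff complex_eq_iff)

text \<open>\<open>is_abs_op\<close> states that the quadratic form of \<open>P\<close> is
  nonnegative. Over the complex scalars a real quadratic form is Hermitian: compare imaginary parts
  at x + y and x + i y.\<close>

lemma br_commute:
  assumes x: "x \<in> H" and y: "y \<in> H"
  shows "br y x = cnj (br x y)"
proof -
  have expand: "br (\<lambda>z. 1 * x z + a * y z) (\<lambda>z. 1 * x z + a * y z)
      = br x x + cnj a * br x y + a * br y x + a * cnj a * br y y" for a
    unfolding br_linear_left[OF x y H_linear[OF x y]] br_linear_right[OF x x y] br_linear_right[OF y x y]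
    by (simp add: algebra_simps)
  have "Im (br (\<lambda>z. 1 * x z + a * y z) (\<lambda>z. 1 * x z + a * y z)) = 0" for a
    using arg_cong[OF br_self_nonneg(1)[OF H_linear[OF x y]], of Im] by (simp only: Im_complex_of_real)
  then have "Im (br x x + cnj a * br x y + a * br y x + a * cnj a * br y y) = 0" for a
    by (simp only: expand)
  from this[of 1] this[of \<i>] show ?thesis
    using arg_cong[OF br_self_nonneg(1)[OF x], of Im] arg_cong[OF br_self_nonneg(1)[OF y], of Im]
    by (simp add: complex_eq_iff)
qed

lemma br_eq_ip_right: "x \<in> H \<Longrightarrow> y \<in> H \<Longrightarrow> br x y = ip x (P y)"
  using br_commute[of y x] by (simp add: br_def cnj_ip)

text \<open>Cauchy-Schwarz for the semi-inner product: a null vector is orthogonal to everything, so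
  \<open>P\<close> kills it, and then so does \<open>B\<close> because ||B x||^2 is the pairing of P
  (P x) with x.\<close>

lemma null_br:
  assumes x: "x \<in> H" and null: "br x x = 0"
  shows "P x = (\<lambda>_. 0)" "B x = (\<lambda>_. 0)"
proof -
  have zero: "br x y = 0" if y: "y \<in> H" for y
  proof (rule ccontr)
    assume nz: "br x y \<noteq> 0"
    define c where "c = (cmod (br x y))\<^sup>2"
    have c: "c > 0"
      using nz by (simp add: c_def)
    have bound: "0 \<le> Re (br y y) - 2 * l * c" for l :: real
    proof -
      let ?a = "- of_real l * cnj (br x y)"
      let ?u = "\<lambda>z. 1 * y z + ?a * x z"
      have u: "?u \<in> H"
        by (intro H_linear x y)
      have "br ?u ?u = br y y + cnj ?a * cnj (br x y) + ?a * br x y"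
        unfolding br_linear_left[OF y x u] br_linear_right[OF y y x] br_linear_right[OF x y x] null br_commute[OF x y]
        by simp
      also have "\<dots> = br y y - of_real (2 * l * c)"
        unfolding c_def of_real_mult complex_norm_square by (simp add: algebra_simps)
      finally have "Re (br ?u ?u) = Re (br y y) - 2 * l * c"
        by simp
      then show ?thesis
        using br_self_nonneg(2)[OF u] by linarith
    qed
    \<comment> \<open>The bound is affine and decreasing in \<open>l\<close>; this value of
      \<open>l\<close> makes it negative.\<close>
    have "0 \<le> Re (br y y) - 2 * ((Re (br y y) + 1) / c) * c"
      by (rule bound)
    also have "\<dots> = - Re (br y y) - 2"
      using c by simp
    finally show False
      using br_self_nonneg(2)[OF y] by linarith
  qed
  have Px: "P x \<in> H"
    by (rule bounded_ops_H[OF P x])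
  show P0: "P x = (\<lambda>_. 0)"
    using zero[OF Px] by (intro definite_ip[OF Px]) (simp add: br_def)
  have "ip (B x) (B x) = ip (P (P x)) x"
    using P_square[OF x x] by simp
  also have "\<dots> = 0"
    by (simp add: P0 bounded_ops_zero[OF P])
  finally show "B x = (\<lambda>_. 0)"
    by (intro definite_ip bounded_ops_H[OF B x])
qed

definition v :: "nat \<Rightarrow> complex \<Rightarrow> complex" where
  "v = gram_schmidt P e"

definition proj :: "nat \<Rightarrow> (complex \<Rightarrow> complex) \<Rightarrow> complex \<Rightarrow> complex" where
  "proj n x z = (\<Sum>j<n. br x (v j) * v j z)"

definition w :: "nat \<Rightarrow> complex \<Rightarrow> complex" where
  "w n z = e n z - proj n (e n) z"

definition s :: "nat \<Rightarrow> real" where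
  "s n = sqrt (Re (br (w n) (w n)))"

lemma v_eq: "v n = (\<lambda>z. 1 / of_real (s n) * w n z)"
proof -
  have "(\<lambda>z. e n z - (\<Sum>j<n. ip (P (e n)) (gram_schmidt P e j) * gram_schmidt P e j z)) = w n"
    by (simp add: fun_eq_iff w_def proj_def br_def v_def)
  then show ?thesis
    unfolding v_def by (subst gram_schmidt.simps) (simp add: Let_def s_def br_def)
qed

lemma v_H: "v n \<in> H"
proof (induction n rule: less_induct)
  case (less n)
  have "proj n (e n) \<in> H"
    unfolding proj_def[abs_def] using less by (intro sum_H) auto
  then have "w n \<in> H"
    unfolding w_def[abs_def] by (intro diff_H e_H)
  then show ?case
    unfolding v_eq by (rule cmult_H)
qed

lemma proj_H: "proj n x \<in> H"
  unfolding proj_def[abs_def] by (intro sum_H v_H)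

lemma w_H: "w n \<in> H"
  unfolding w_def[abs_def] by (intro diff_H e_H proj_H)

lemma br_cmult_left: "x \<in> H \<Longrightarrow> y \<in> H \<Longrightarrow> br (\<lambda>z. a * x z) y = a * br x y"
  using br_linear_left[of x x y a 0] by simp

lemma br_cmult_right: "x \<in> H \<Longrightarrow> y \<in> H \<Longrightarrow> br x (\<lambda>z. a * y z) = cnj a * br x y"
  using br_linear_right[of x y y a 0] by simp

lemma br_diff_left: "x \<in> H \<Longrightarrow> x' \<in> H \<Longrightarrow> y \<in> H \<Longrightarrow> br (\<lambda>z. x z - x' z) y = br x y - br x' y"
  using br_linear_left[of x x' y 1 "-1"] by simp

lemma s_square: "br (w n) (w n) = of_real (s n * s n)"
  using br_self_nonneg[OF w_H[of n]] by (simp add: s_def)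

lemma br_v_self: "br (v n) (v n) = (if s n = 0 then 0 else 1)"
proof -
  have "br (v n) (v n) = 1 / of_real (s n) * (1 / of_real (s n) * of_real (s n * s n))"
    unfolding v_eq br_cmult_left[OF w_H cmult_H[OF w_H]] br_cmult_right[OF w_H w_H] s_square by simp
  then show ?thesis
    by simp
qed

text \<open>Division by zero yields 0, so the convention for null vectors needs no case distinction
  in the construction.\<close>

lemma v_zero: "s n = 0 \<Longrightarrow> v n = (\<lambda>_. 0)"
  by (simp add: v_eq)

lemma br_zero_right [simp]: "br x (\<lambda>_. 0) = 0"
  by (simp add: br_def ip_commute_zero[of "P x"])

lemma br_proj:
  assumes x: "x \<in> H" and y: "y \<in> H"
  shows "br (proj n x) y = (\<Sum>j<n. br x (v j) * br (v j) y)"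
  unfolding proj_def[abs_def] by (rule bounded_functional_sum[OF br_functional[OF y]]) (rule v_H)

lemma br_v_orth: "i \<noteq> j \<Longrightarrow> br (v i) (v j) = 0"
proof -
  have w_v: "br (w n) (v i) = 0" if "i < n" and ortho: "\<And>j k. j < n \<Longrightarrow> k < n \<Longrightarrow> j \<noteq> k \<Longrightarrow> br (v j) (v k) = 0" for n i
  proof -
    have "br (w n) (v i) = br (e n) (v i) - (\<Sum>j<n. br (e n) (v j) * br (v j) (v i))"
      unfolding w_def[abs_def] by (simp add: br_diff_left e_H proj_H v_H br_proj)
    also have "(\<Sum>j<n. br (e n) (v j) * br (v j) (v i)) = (\<Sum>j<n. if j = i then br (e n) (v i) * br (v i) (v i) else 0)"
      using that by (intro sum.cong refl) auto
    also have "\<dots> = br (e n) (v i) * br (v i) (v i)"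
      using that(1) by simp
    also have "\<dots> = br (e n) (v i)"
      by (cases "s i = 0") (simp_all add: v_zero br_v_self)
    finally show ?thesis
      by simp
  qed
  have ortho: "\<forall>j<n. \<forall>k<n. j \<noteq> k \<longrightarrow> br (v j) (v k) = 0" for n
  proof (induction n)
    case (Suc n)
    have n: "br (v n) (v j) = 0" if "j < n" for j
    proof -
      have "br (w n) (v j) = 0"
        using Suc.IH that by (intro w_v) auto
      then show ?thesis
        unfolding v_eq[of n] by (simp only: br_cmult_left[OF w_H v_H] mult_zero_right)
    qed
    moreover have "br (v j) (v n) = 0" if "j < n" for j
      using n[OF that] br_commute[OF v_H v_H, of n j] by simp
    ultimately show ?case
      using Suc.IH by (auto simp: less_Suc_eq)
  qed simp
  assume "i \<noteq> j"
  then show ?thesis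
    using ortho[of "Suc (max i j)"] by auto
qed

lemma br_proj_v:
  assumes x: "x \<in> H" and i: "i < n"
  shows "br (proj n x) (v i) = br x (v i)"
proof -
  have "br (proj n x) (v i) = (\<Sum>j<n. br x (v j) * br (v j) (v i))"
    by (rule br_proj[OF x v_H])
  also have "\<dots> = (\<Sum>j<n. if j = i then br x (v i) * br (v i) (v i) else 0)"
    by (intro sum.cong refl) (auto simp: br_v_orth)
  also have "\<dots> = br x (v i) * br (v i) (v i)"
    using i by simp
  also have "\<dots> = br x (v i)"
    by (cases "s i = 0") (simp_all add: v_zero br_v_self)
  finally show ?thesis .
qed

text \<open>Summed over x = e n, this bounds the sum of all ||P (v j)||^2 by the trace of
  \<open>P\<close>.\<close>

lemma br_Bessel:
  assumes x: "x \<in> H"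
  shows "(\<Sum>j<n. (cmod (br x (v j)))\<^sup>2) \<le> Re (br x x)"
proof -
  let ?r = "\<lambda>z. x z - proj n x z"
  have r: "?r \<in> H"
    by (intro diff_H x proj_H)
  have "br (proj n x) ?r = (\<Sum>j<n. br x (v j) * br (v j) ?r)"
    by (rule br_proj[OF x r])
  also have "\<dots> = 0"
  proof (intro sum.neutral ballI)
    fix j assume "j \<in> {..<n}"
    then have "br ?r (v j) = 0"
      by (simp add: br_diff_left x proj_H v_H br_proj_v)
    then have "br (v j) ?r = 0"
      using br_commute[OF r v_H, of j] by simp
    then show "br x (v j) * br (v j) ?r = 0"
      by simp
  qed
  finally have "br (proj n x) ?r = 0" .
  then have "br ?r ?r = br x ?r"
    by (simp add: br_diff_left x proj_H r)
  also have "\<dots> = cnj (br ?r x)"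
    by (rule br_commute[OF r x])
  also have "br ?r x = br x x - (\<Sum>j<n. br x (v j) * br (v j) x)"
    by (simp add: br_diff_left x proj_H br_proj)
  also have "(\<Sum>j<n. br x (v j) * br (v j) x) = of_real (\<Sum>j<n. (cmod (br x (v j)))\<^sup>2)"
    by (simp add: br_commute[OF x v_H] complex_norm_square[symmetric])
  finally have "Re (br ?r ?r) = Re (br x x) - (\<Sum>j<n. (cmod (br x (v j)))\<^sup>2)"
    by simp
  then show ?thesis
    using br_self_nonneg(2)[OF r] by linarith
qed

text \<open>Modulo null vectors, \<open>e n\<close> lies in the span of \<open>v 0\<close>, ...,
  \<open>v n\<close>. Either the remainder before the last step was null already, or the normalised
  last vector cancels it exactly.\<close>

lemma null_remainder: "br (\<lambda>z. e n z - proj (Suc n) (e n) z) (\<lambda>z. e n z - proj (Suc n) (e n) z) = 0"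
proof -
  have r: "(\<lambda>z. e n z - proj (Suc n) (e n) z) = (\<lambda>z. w n z - br (e n) (v n) * v n z)"
    by (simp add: fun_eq_iff w_def proj_def)
  show ?thesis
  proof (cases "s n = 0")
    case True
    then show ?thesis
      unfolding r by (simp add: v_zero s_square)
  next
    case False
    have "br (proj n (e n)) (v n) = 0"
      by (simp add: br_proj e_H v_H br_v_orth)
    then have "br (e n) (v n) = br (w n) (v n)"
      unfolding w_def[abs_def] by (simp add: br_diff_left e_H proj_H v_H)
    also have "\<dots> = 1 / of_real (s n) * of_real (s n * s n)"
      unfolding v_eq br_cmult_right[OF w_H w_H] s_square by simp
    also have "\<dots> = of_real (s n)"
      by simp
    finally have "(\<lambda>z. w n z - br (e n) (v n) * v n z) = (\<lambda>_. 0)"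
      using False by (simp add: v_eq)
    then show ?thesis
      unfolding r by simp
  qed
qed

text \<open>\<open>B\<close> kills null vectors, so on basis vectors the factorisation is an exact
  finite sum.\<close>

lemma B_e: "ip (B (e n)) y = (\<Sum>j<Suc n. ip (e n) (P (v j)) * ip (B (v j)) y)" if y: "y \<in> H"
proof -
  let ?r = "\<lambda>z. e n z - proj (Suc n) (e n) z"
  have r: "?r \<in> H"
    by (intro diff_H e_H proj_H)
  note f = bounded_functional_ops[OF B y]
  have "ip (B ?r) y = 0"
    by (simp add: null_br(2)[OF r null_remainder])
  moreover have "ip (B ?r) y = ip (B (e n)) y - ip (B (proj (Suc n) (e n))) y"
    using bounded_functional_linear[OF f e_H proj_H, of 1 n "-1" "Suc n" "e n"] by simp
  moreover have "ip (B (proj (Suc n) (e n))) y = (\<Sum>j<Suc n. br (e n) (v j) * ip (B (v j)) y)"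
    unfolding proj_def[abs_def] by (rule bounded_functional_sum[OF f]) (rule v_H)
  ultimately show ?thesis
    by (simp add: br_eq_ip_right e_H v_H)
qed

text \<open>Triangularity of the factorisation: at \<open>e n\<close> the infinite series of
  rank-one terms breaks off at the finite sum of \<open>B_e\<close>.\<close>

lemma ip_e_P_v_zero: "n < j \<Longrightarrow> ip (e n) (P (v j)) = 0"
proof -
  assume nj: "n < j"
  let ?r = "\<lambda>z. e n z - proj (Suc n) (e n) z"
  have r: "?r \<in> H"
    by (intro diff_H e_H proj_H)
  have "br ?r (v j) = 0"
    by (simp add: br_def null_br(1)[OF r null_remainder])
  moreover have "br (proj (Suc n) (e n)) (v j) = 0"
    unfolding br_proj[OF e_H v_H] using nj by (intro sum.neutral) (auto simp: br_v_orth)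
  ultimately have "br (e n) (v j) = 0"
    by (simp add: br_diff_left e_H proj_H v_H)
  then show ?thesis
    by (simp add: br_eq_ip_right e_H v_H)
qed

lemma L2norm_B_v: "L2norm (B (v j)) = L2norm (P (v j))"
proof -
  have "ip (B (v j)) (B (v j)) = ip (P (v j)) (P (v j))"
    using P_square[OF v_H v_H, of j j] br_eq_ip_right[OF bounded_ops_H[OF P v_H] v_H, of j j] by (simp add: br_def)
  then have "(L2norm (B (v j)))\<^sup>2 = (L2norm (P (v j)))\<^sup>2"
    by (simp only: ip_self of_real_eq_iff)
  then show ?thesis
    by simp
qed

end

context function_hilbert
begin

lemma Parseval_e:
  assumes x: "x \<in> H"
  shows "(\<lambda>n. (cmod (ip x (e n)))\<^sup>2) sums (L2norm x)\<^sup>2"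
proof -
  have "((\<lambda>u. ip x u * ip u x) has_sum ip x x) (range e)"
    using orthonormal_basis_Parseval[OF orthonormal_basis_range x x]
      abs_summable_summable[OF orthonormal_basis_abs_summable(1)[OF orthonormal_basis_range x x]]
    by (metis has_sum_infsum)
  then have "(((\<lambda>u. ip x u * ip u x) \<circ> e) has_sum ip x x) UNIV"
    by (subst (asm) has_sum_reindex[OF inj_e])
  then have "(\<lambda>n. ip x (e n) * ip (e n) x) sums ip x x"
    by (auto dest: has_sum_imp_sums simp: o_def)
  moreover have "ip x (e n) * ip (e n) x = of_real ((cmod (ip x (e n)))\<^sup>2)" for n
    unfolding complex_norm_square cnj_ip ..
  ultimately have "(\<lambda>n. complex_of_real ((cmod (ip x (e n)))\<^sup>2)) sums of_real ((L2norm x)\<^sup>2)"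
    by (simp only: ip_self)
  then show ?thesis
    by (simp only: sums_of_real_iff)
qed

lemma summable_ip_ip:
  assumes c: "\<And>n. c n \<in> H" and d: "\<And>n. d n \<in> H" and x: "x \<in> H" and y: "y \<in> H"
    and norm: "\<And>n. L2norm (d n) = L2norm (c n)" and summ: "summable (\<lambda>n. (L2norm (c n))\<^sup>2)"
  shows "summable (\<lambda>n. cmod (ip x (c n) * ip (d n) y))"
    and "(\<Sum>n. cmod (ip x (c n) * ip (d n) y)) \<le> (L2norm y * (\<Sum>n. (L2norm (c n))\<^sup>2)) * L2norm x"
proof -
  have bound: "cmod (ip x (c n) * ip (d n) y) \<le> L2norm x * L2norm y * (L2norm (c n))\<^sup>2" for n
  proof -
    have "cmod (ip x (c n)) * cmod (ip (d n) y) \<le> (L2norm x * L2norm (c n)) * (L2norm (d n) * L2norm y)"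
      by (intro mult_mono ip_Cauchy_Schwarz(1) H_L2 x y c d) auto
    then show ?thesis
      by (simp add: norm_mult norm power2_eq_square mult_ac)
  qed
  show *: "summable (\<lambda>n. cmod (ip x (c n) * ip (d n) y))"
    by (rule summable_comparison_test'[OF summable_mult[OF summ, of "L2norm x * L2norm y"], of 0])
      (use bound in auto)
  have "(\<Sum>n. cmod (ip x (c n) * ip (d n) y)) \<le> (\<Sum>n. L2norm x * L2norm y * (L2norm (c n))\<^sup>2)"
    by (intro suminf_le bound * summable_mult summ)
  also have "\<dots> = L2norm x * L2norm y * (\<Sum>n. (L2norm (c n))\<^sup>2)"
    by (rule suminf_mult[OF summ])
  finally show "(\<Sum>n. cmod (ip x (c n) * ip (d n) y)) \<le> (L2norm y * (\<Sum>n. (L2norm (c n))\<^sup>2)) * L2norm x"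
    by (simp add: mult_ac)
qed

lemma trace_class_bounded: "B \<in> trace_class H \<Longrightarrow> B \<in> bounded_ops H"
  by (simp add: trace_class_def)

lemma trace_class_decomposition:
  assumes "B \<in> trace_class H"
  obtains c d where "\<And>n. c n \<in> H" "\<And>n. d n \<in> H" "\<And>n. L2norm (d n) = L2norm (c n)"
    "summable (\<lambda>n. (L2norm (c n))\<^sup>2)"
    "\<And>x y. x \<in> H \<Longrightarrow> y \<in> H \<Longrightarrow> (\<lambda>n. ip x (c n) * ip (d n) y) sums ip (B x) y"
proof -
  have B: "B \<in> bounded_ops H"
    using assms by (rule trace_class_bounded)
  obtain P where P: "is_abs_op H B P"
    and summ: "\<And>E. orthonormal_basis H E \<Longrightarrow> (\<lambda>u. ip (P u) u) summable_on E"
    using assms unfolding trace_class_def by blast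
  interpret positive_op H e B P
    by unfold_locales (fact B, fact P)
  define c where "c n = P (v n)" for n
  define d where "d n = B (v n)" for n
  have c: "c n \<in> H" and d: "d n \<in> H" and norm: "L2norm (d n) = L2norm (c n)" for n
    by (simp_all add: c_def d_def bounded_ops_H[OF positive_op.P[OF positive_op_axioms]] bounded_ops_H[OF B] v_H L2norm_B_v)
  have "((\<lambda>u. ip (P u) u) \<circ> e) summable_on UNIV"
    using summ[OF orthonormal_basis_range] by (subst (asm) summable_on_reindex[OF inj_e])
  then have "summable (\<lambda>n. br (e n) (e n))"
    by (auto dest: summable_on_imp_summable simp: o_def br_def)
  then have trace: "summable (\<lambda>n. Re (br (e n) (e n)))"
    by (rule summable_Re)
  \<comment> \<open>By Parseval ||P (v j)||^2 is the sum over n of |br (e n) (v j)|^2. For finitely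
    many j, Bessel's inequality bounds the sum over j by the n-th diagonal term of the trace of
    \<open>P\<close>.\<close>
  have c_sum: "summable (\<lambda>n. (L2norm (c n))\<^sup>2)"
  proof (rule summableI_nonneg_bounded)
    fix J
    have ce: "cmod (ip (c j) (e n)) = cmod (br (e n) (v j))" for j n
    proof -
      have "cmod (ip (c j) (e n)) = cmod (cnj (ip (c j) (e n)))"
        by (rule complex_mod_cnj[symmetric])
      then show ?thesis
        by (simp only: cnj_ip c_def br_eq_ip_right[OF e_H v_H])
    qed
    have sums: "(\<lambda>n. (cmod (br (e n) (v j)))\<^sup>2) sums (L2norm (c j))\<^sup>2" for j
      using Parseval_e[OF c[of j]] by (simp only: ce)
    have "(\<lambda>n. \<Sum>j<J. (cmod (br (e n) (v j)))\<^sup>2) sums (\<Sum>j<J. (L2norm (c j))\<^sup>2)"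
      by (intro sums_sum sums)
    then show "(\<Sum>j<J. (L2norm (c j))\<^sup>2) \<le> (\<Sum>n. Re (br (e n) (e n)))"
      by (rule sums_le[OF br_Bessel[OF e_H] _ summable_sums[OF trace]])
  qed simp
  have rep: "(\<lambda>n. ip x (c n) * ip (d n) y) sums ip (B x) y" if x: "x \<in> H" and y: "y \<in> H" for x y
  proof -
    have summ: "summable (\<lambda>n. ip x (c n) * ip (d n) y)" if "x \<in> H" for x
      by (rule summable_norm_cancel[OF summable_ip_ip(1)[OF c d that y norm c_sum]])
    define l where "l x = (\<Sum>n. ip x (c n) * ip (d n) y)" for x
    have l: "bounded_functional l"
    proof (rule bounded_functionalI[where C = "L2norm y * (\<Sum>n. (L2norm (c n))\<^sup>2)"])
      fix f g a b assume fg: "f \<in> H" "g \<in> H"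
      have "l (\<lambda>z. a * f z + b * g z) = (\<Sum>n. a * (ip f (c n) * ip (d n) y) + b * (ip g (c n) * ip (d n) y))"
        unfolding l_def by (rule suminf_cong) (simp add: ip_linear_left H_L2 fg c algebra_simps)
      also have "\<dots> = (\<Sum>n. a * (ip f (c n) * ip (d n) y)) + (\<Sum>n. b * (ip g (c n) * ip (d n) y))"
        by (intro suminf_add[symmetric] summable_mult summ fg)
      also have "\<dots> = a * l f + b * l g"
        unfolding l_def by (intro arg_cong2[where f = "(+)"] suminf_mult summ fg)
      finally show "l (\<lambda>z. a * f z + b * g z) = a * l f + b * l g" .
    next
      fix f assume f: "f \<in> H"
      have "cmod (l f) \<le> (\<Sum>n. cmod (ip f (c n) * ip (d n) y))"
        unfolding l_def by (intro summable_norm summable_ip_ip(1)[OF c d f y norm c_sum])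
      also have "\<dots> \<le> (L2norm y * (\<Sum>n. (L2norm (c n))\<^sup>2)) * L2norm f"
        by (rule summable_ip_ip(2)[OF c d f y norm c_sum])
      finally show "cmod (l f) \<le> (L2norm y * (\<Sum>n. (L2norm (c n))\<^sup>2)) * L2norm f" .
    qed
    \<comment> \<open>Both sides are bounded functionals of \<open>x\<close>, so agreement on the
      basis \<open>e\<close> is enough.\<close>
    have "l x - ip (B x) y = 0"
    proof (rule functional_zero[OF bounded_functional_diff[OF l bounded_functional_ops[OF B y]] _ x])
      fix n
      have "l (e n) = (\<Sum>j<Suc n. ip (e n) (c j) * ip (d j) y)"
        unfolding l_def by (rule suminf_finite) (auto simp: c_def intro!: ip_e_P_v_zero)
      then show "l (e n) - ip (B (e n)) y = 0"
        by (simp add: B_e[OF y] c_def d_def)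
    qed
    then have "l x = ip (B x) y"
      by simp
    then show ?thesis
      using summable_sums[OF summ[OF x]] by (simp only: l_def)
  qed
  show ?thesis
    by (rule that[OF c d norm c_sum rep])
qed

text \<open>The trace is a double sum over the expansion of \<open>B\<close> and the trace basis; it
  is absolutely summable, so the basis can be summed out first by Parseval. The assumptions on
  \<open>S\<close> are spelled out instead of membership in \<open>bounded_ops\<close>, since
  composites with \<open>weyl\<close> need not be extensional.\<close>

lemma trace_comp_sums:
  assumes cd: "\<And>n. c n \<in> H" "\<And>n. d n \<in> H" "\<And>n. L2norm (d n) = L2norm (c n)"
    "summable (\<lambda>n. (L2norm (c n))\<^sup>2)"
    "\<And>x y. x \<in> H \<Longrightarrow> y \<in> H \<Longrightarrow> (\<lambda>n. ip x (c n) * ip (d n) y) sums ip (B x) y"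
    and B: "\<And>x. x \<in> H \<Longrightarrow> B x \<in> H"
    and S: "\<And>x. x \<in> H \<Longrightarrow> S x \<in> H" "\<And>x. x \<in> H \<Longrightarrow> L2norm (S x) \<le> C * L2norm x"
    and adj: "\<And>y. y \<in> H \<Longrightarrow> \<exists>y'\<in>H. \<forall>x\<in>H. ip (S x) y = ip x y'"
  shows "(\<lambda>n. ip (S (d n)) (c n)) sums tr H (S \<circ> B)"
proof -
  let ?E = trace_basis
  have EH: "u \<in> H" if "u \<in> ?E" for u
    using orthonormal_trace_basis that by (auto simp: orthonormal_basis_def)
  note E = orthonormal_trace_basis
  define F where "F n u = ip (S (d n)) u * ip u (c n)" for n u
  have S_rep: "(\<lambda>n. F n y) sums ip (S (B y)) y" "summable (\<lambda>n. cmod (F n y))" if y: "y \<in> H" for y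
  proof -
    obtain y' where y': "y' \<in> H" "\<And>x. x \<in> H \<Longrightarrow> ip (S x) y = ip x y'"
      using adj[OF y] by blast
    have eq: "F n y = ip y (c n) * ip (d n) y'" for n
      by (simp add: F_def y'(2)[OF cd(2)])
    show "(\<lambda>n. F n y) sums ip (S (B y)) y"
      unfolding eq y'(2)[OF B[OF y]] by (rule cd(5)[OF y y'(1)])
    show "summable (\<lambda>n. cmod (F n y))"
      unfolding eq by (rule summable_ip_ip(1)[OF cd(1,2) y y'(1) cd(3,4)])
  qed
  have inner_n: "(\<Sum>\<^sub>\<infinity>n. F n u) = ip (S (B u)) u" if "u \<in> H" for u
    by (rule infsumI[OF norm_summable_imp_has_sum[OF S_rep(2)[OF that] S_rep(1)[OF that]]])
  have inner_u: "(\<Sum>\<^sub>\<infinity>u\<in>?E. F n u) = ip (S (d n)) (c n)" for n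
    unfolding F_def by (rule orthonormal_basis_Parseval[OF E S(1)[OF cd(2)] cd(1)])
  have bound: "L2norm (S (d n)) * L2norm (c n) \<le> C * (L2norm (c n))\<^sup>2" for n
  proof -
    have "L2norm (S (d n)) * L2norm (c n) \<le> (C * L2norm (d n)) * L2norm (c n)"
      by (intro mult_right_mono S(2) cd(2)) simp
    then show ?thesis
      by (simp add: cd(3) power2_eq_square)
  qed
  have "(\<lambda>n. C * (L2norm (c n))\<^sup>2) summable_on UNIV"
    by (intro norm_summable_imp_summable_on)
      (use summable_mult[OF cd(4), of "\<bar>C\<bar>"] in \<open>simp add: abs_mult\<close>)
  then have g: "(\<lambda>n. \<Sum>\<^sub>\<infinity>u\<in>?E. cmod (F n u)) summable_on UNIV"
  proof (rule summable_on_comparison_test)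
    show "(\<Sum>\<^sub>\<infinity>u\<in>?E. cmod (F n u)) \<le> C * (L2norm (c n))\<^sup>2" for n
      unfolding F_def by (rule order.trans[OF orthonormal_basis_abs_summable(2)[OF E S(1)[OF cd(2)] cd(1)] bound])
  qed (simp add: infsum_nonneg)
  have "(\<lambda>(n, u). cmod (F n u)) summable_on UNIV \<times> ?E"
  proof (rule summable_on_SigmaI)
    show "((\<lambda>u. case (n, u) of (n, u) \<Rightarrow> cmod (F n u)) has_sum (\<Sum>\<^sub>\<infinity>u\<in>?E. cmod (F n u))) ?E" for n
      unfolding F_def prod.case by (rule has_sum_infsum[OF orthonormal_basis_abs_summable(1)[OF E S(1)[OF cd(2)] cd(1)]])
  qed (use g in auto)
  then have "(\<lambda>p. norm ((\<lambda>(n, u). F n u) p)) summable_on UNIV \<times> ?E"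
    by (simp add: case_prod_unfold)
  then have "(\<lambda>(n, u). F n u) summable_on UNIV \<times> ?E"
    by (rule abs_summable_summable)
  then have "(\<Sum>\<^sub>\<infinity>n. \<Sum>\<^sub>\<infinity>u\<in>?E. F n u) = (\<Sum>\<^sub>\<infinity>u\<in>?E. \<Sum>\<^sub>\<infinity>n. F n u)"
    by (rule infsum_swap_banach)
  also have "\<dots> = (\<Sum>\<^sub>\<infinity>u\<in>?E. ip (S (B u)) u)"
    by (intro infsum_cong inner_n EH)
  also have "\<dots> = tr H (S \<circ> B)"
    by (simp add: tr_def trace_basis_def)
  finally have tr: "(\<Sum>\<^sub>\<infinity>n. ip (S (d n)) (c n)) = tr H (S \<circ> B)"
    by (simp only: inner_u)
  have "summable (\<lambda>n. cmod (ip (S (d n)) (c n)))"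
  proof (rule summable_comparison_test'[OF summable_mult[OF cd(4), of C], of 0])
    show "norm (cmod (ip (S (d n)) (c n))) \<le> C * (L2norm (c n))\<^sup>2" for n
      using order.trans[OF ip_Cauchy_Schwarz(1)[OF H_L2[OF S(1)[OF cd(2)]] H_L2[OF cd(1)]] bound] by simp
  qed
  then have "((\<lambda>n. ip (S (d n)) (c n)) has_sum (\<Sum>\<^sub>\<infinity>n. ip (S (d n)) (c n))) UNIV"
    by (intro has_sum_infsum norm_summable_imp_summable_on)
  then show ?thesis
    unfolding tr by (rule has_sum_imp_sums)
qed

lemma bounded_ops_adjoint:
  assumes "T \<in> bounded_ops H" "y \<in> H"
  shows "\<exists>y'\<in>H. \<forall>x\<in>H. ip (T x) y = ip x y'"
  by (rule Riesz[OF bounded_functional_ops[OF assms]])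

section \<open>Rank-one operators as test operators\<close>

lemma rank_one_bounded:
  assumes g: "g \<in> H" and h: "h \<in> H"
  shows "rank_one H g h \<in> bounded_ops H"
proof -
  have "L2norm (rank_one H g h x) \<le> (L2norm g * L2norm h) * L2norm x" if x: "x \<in> H" for x
  proof -
    have "(L2norm (\<lambda>z. ip x h * g z))\<^sup>2 = (cmod (ip x h) * L2norm g)\<^sup>2"
      by (simp add: L2norm_square norm_mult power_mult_distrib)
    then have "L2norm (\<lambda>z. ip x h * g z) = cmod (ip x h) * L2norm g"
      by (rule power2_eq_imp_eq) auto
    also have "\<dots> \<le> (L2norm x * L2norm h) * L2norm g"
      by (intro mult_right_mono ip_Cauchy_Schwarz(1) H_L2 x h) simp
    finally show ?thesis
      using x by (simp add: rank_one_def mult_ac)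
  qed
  moreover have "rank_one H g h \<in> H \<rightarrow>\<^sub>E H"
    using cmult_H[OF g] by (auto simp: rank_one_def)
  moreover have "rank_one H g h (\<lambda>z. a * x z + b * y z) = (\<lambda>z. a * rank_one H g h x z + b * rank_one H g h y z)"
    if "x \<in> H" "y \<in> H" for x y a b
    using that H_linear[OF that] by (simp add: rank_one_def ip_linear_left H_L2 h algebra_simps)
  ultimately show ?thesis
    unfolding bounded_ops_def by blast
qed

lemma rank_one_trace_class:
  assumes g: "g \<in> H" and h: "h \<in> H" and nz: "L2norm h \<noteq> 0"
  shows "rank_one H g h \<in> trace_class H"
proof -
  \<comment> \<open>The absolute value of the rank-one operator of g and h is ||g|| / ||h|| times
    that of h and h.\<close>
  define r where "r = L2norm g / L2norm h"
  have r: "r \<ge> 0"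
    by (simp add: r_def)
  let ?k = "\<lambda>z. of_real r * h z"
  have k: "?k \<in> H"
    by (rule cmult_H[OF h])
  define P where "P = rank_one H ?k h"
  have P: "P \<in> bounded_ops H"
    unfolding P_def by (rule rank_one_bounded[OF k h])
  have P_eq: "P x = (\<lambda>z. (ip x h * of_real r) * h z)" if "x \<in> H" for x
    using that by (simp add: P_def rank_one_def mult.assoc)
  have ip_P: "ip (P x) y = of_real r * (ip x h * ip h y)" if "x \<in> H" for x y
    unfolding P_eq[OF that] ip_cmult_left by (simp only: mult_ac)
  have pos: "ip x h * ip h x = of_real ((cmod (ip x h))\<^sup>2)" for x
    unfolding complex_norm_square cnj_ip ..
  have "is_abs_op H (rank_one H g h) P"
    unfolding is_abs_op_def
  proof (intro conjI ballI P)
    fix x assume x: "x \<in> H"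
    show "ip (P x) x \<in> \<real>\<^sub>\<ge>\<^sub>0"
      unfolding ip_P[OF x] pos using r by (simp flip: of_real_mult)
    fix y assume y: "y \<in> H"
    have "ip (P (P x)) y = of_real r * (of_real r * (ip x h * ip h h) * ip h y)"
      using bounded_ops_H[OF P x] by (simp only: ip_P x)
    also have "\<dots> = of_real (r\<^sup>2 * (L2norm h)\<^sup>2) * (ip x h * ip h y)"
      by (simp add: ip_self power2_eq_square mult_ac)
    also have "r\<^sup>2 * (L2norm h)\<^sup>2 = (L2norm g)\<^sup>2"
      using nz by (simp add: r_def power_divide)
    also have "of_real ((L2norm g)\<^sup>2) * (ip x h * ip h y) = ip x h * (cnj (ip y h) * ip g g)"
      by (simp add: ip_self cnj_ip mult_ac)
    also have "\<dots> = ip (rank_one H g h x) (rank_one H g h y)"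
    proof -
      have "ip g (\<lambda>z. ip y h * g z) = cnj (ip (\<lambda>z. ip y h * g z) g)"
        by (simp only: cnj_ip)
      also have "\<dots> = cnj (ip y h) * ip g g"
        by (simp only: ip_cmult_left complex_cnj_mult cnj_ip)
      finally show ?thesis
        using x y by (simp only: rank_one_def restrict_apply' ip_cmult_left[of "ip x h"])
    qed
    finally show "ip (P (P x)) y = ip (rank_one H g h x) (rank_one H g h y)" .
  qed
  moreover have "(\<lambda>u. ip (P u) u) summable_on E" if E: "orthonormal_basis H E" for E
  proof -
    have "(\<lambda>u. of_real r * (ip h u * ip u h)) summable_on E"
      by (rule summable_on_cmult_right[OF abs_summable_summable[OF orthonormal_basis_abs_summable(1)[OF E h h]]])
    moreover have "ip (P u) u = of_real r * (ip h u * ip u h)" if "u \<in> E" for u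
      using E that by (subst ip_P) (auto simp: orthonormal_basis_def)
    ultimately show ?thesis
      using summable_on_cong[of E "\<lambda>u. ip (P u) u" "\<lambda>u. of_real r * (ip h u * ip u h)"] by blast
  qed
  ultimately show ?thesis
    unfolding trace_class_def using rank_one_bounded[OF g h] by blast
qed

lemma tr_rank_one:
  assumes T: "T \<in> bounded_ops H" and g: "g \<in> H" and h: "h \<in> H"
  shows "tr H (T \<circ> rank_one H g h) = ip (T g) h"
proof -
  have Tg: "T g \<in> H"
    by (rule bounded_ops_H[OF T g])
  have EH: "u \<in> H" if "u \<in> trace_basis" for u
    using orthonormal_trace_basis that by (auto simp: orthonormal_basis_def)
  have "ip (T (rank_one H g h u)) u = ip (T g) u * ip u h" if "u \<in> H" for u
  proof -
    have "T (\<lambda>z. ip u h * g z) = (\<lambda>z. ip u h * T g z)"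
      using bounded_ops_linear[OF T g g, of "ip u h" 0] by simp
    then show ?thesis
      using that by (simp add: rank_one_def ip_cmult_left mult.commute)
  qed
  then have "tr H (T \<circ> rank_one H g h) = (\<Sum>\<^sub>\<infinity>u\<in>trace_basis. ip (T g) u * ip u h)"
    unfolding tr_def trace_basis_def[symmetric] by (intro infsum_cong) (simp add: EH)
  also have "\<dots> = ip (T g) h"
    by (rule orthonormal_basis_Parseval[OF orthonormal_trace_basis Tg h])
  finally show ?thesis .
qed

lemma bounded_ops_eqI:
  assumes T: "T \<in> bounded_ops H" and T': "T' \<in> bounded_ops H"
    and eq: "\<And>x y. x \<in> H \<Longrightarrow> y \<in> H \<Longrightarrow> ip (T x) y = ip (T' x) y"
  shows "T = T'"
proof
  fix x
  show "T x = T' x"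
  proof (cases "x \<in> H")
    case True
    then show ?thesis
      by (intro eq_if_ip_eq bounded_ops_H[OF T] bounded_ops_H[OF T'] eq)
  next
    case False
    then show ?thesis
      using T T' by (auto simp: bounded_ops_def PiE_def extensional_def)
  qed
qed

text \<open>Traces against rank-one operators are the matrix entries of an operator. This yields the
  uniqueness behind \<open>THE\<close> in the convolution.\<close>

lemma bounded_ops_eq_if_trace_eq:
  assumes T: "T \<in> bounded_ops H" and T': "T' \<in> bounded_ops H"
    and eq: "\<And>B. B \<in> trace_class H \<Longrightarrow> tr H (T \<circ> B) = tr H (T' \<circ> B)"
  shows "T = T'"
proof (rule bounded_ops_eqI[OF T T'])
  fix x y assume x: "x \<in> H" and y: "y \<in> H"
  show "ip (T x) y = ip (T' x) y"
  proof (cases "L2norm y = 0")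
    case True
    then have "y = (\<lambda>_. 0)"
      by (rule definite[OF y])
    then show ?thesis
      by (simp add: ip_def)
  next
    case False
    then show ?thesis
      using eq[OF rank_one_trace_class[OF x y]] by (simp add: tr_rank_one T T' x y)
  qed
qed

end

subsection \<open>The convolution as a Toeplitz operator\<close>

lemma function_hilbert_true_fock: "function_hilbert (true_fock (Suc m)) (hbasis m)"
proof
  show "f \<in> true_fock (Suc m) \<Longrightarrow> f \<in> L2" for f
    by (rule true_fock_L2)
  show "f \<in> true_fock (Suc m) \<Longrightarrow> g \<in> true_fock (Suc m) \<Longrightarrow> (\<lambda>z. a * f z + b * g z) \<in> true_fock (Suc m)" for f g a b
    by (rule true_fock_linear)
  show "f \<in> true_fock (Suc m) \<Longrightarrow> L2norm f = 0 \<Longrightarrow> f = (\<lambda>_. 0)" for f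
    by (rule zero_if_L2norm_zero[OF true_fock_L2 true_fock_continuous])
  show "hbasis m q \<in> true_fock (Suc m)" for q
    by (rule hbasis_true_fock)
  show "ip (hbasis m q) (hbasis m p) = (if q = p then 1 else 0)" for q p
    by (rule ip_hbasis)
  show "f \<in> true_fock (Suc m) \<Longrightarrow> (\<And>q. ip f (hbasis m q) = 0) \<Longrightarrow> f = (\<lambda>_. 0)" for f
    by (rule hbasis_total)
  show "summable (\<lambda>q. (cmod (A q))\<^sup>2) \<Longrightarrow>
      \<exists>p\<in>true_fock (Suc m). (\<lambda>N. L2norm (\<lambda>z. p z - (\<Sum>q<N. A q * hbasis m q z))) \<longlonglongrightarrow> 0" for A
    by (rule Riesz_Fischer_hbasis)
qed

definition symbol_form :: "(complex \<Rightarrow> complex) \<Rightarrow> (complex \<Rightarrow> complex) \<Rightarrow> (complex \<Rightarrow> complex) \<Rightarrow> complex" where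
  "symbol_form f x y = (LINT z|gauss. f z * (x z * cnj (y z)))"

lemma symbol_form_integrable:
  "f \<in> Linf \<Longrightarrow> x \<in> L2 \<Longrightarrow> y \<in> L2 \<Longrightarrow> integrable gauss (\<lambda>z. f z * (x z * cnj (y z)))"
  by (intro Linf_mult_integrable_gauss L2_ip_integrable)

lemma symbol_form_linear_left:
  assumes "f \<in> Linf" "x \<in> L2" "x' \<in> L2" "y \<in> L2"
  shows "symbol_form f (\<lambda>z. a * x z + b * x' z) y = a * symbol_form f x y + b * symbol_form f x' y"
proof -
  have "symbol_form f (\<lambda>z. a * x z + b * x' z) y
      = (LINT z|gauss. a * (f z * (x z * cnj (y z))) + b * (f z * (x' z * cnj (y z))))"
    unfolding symbol_form_def by (simp add: algebra_simps)
  also have "\<dots> = a * symbol_form f x y + b * symbol_form f x' y"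
    unfolding symbol_form_def
    by (subst Bochner_Integration.integral_add) (auto intro!: symbol_form_integrable assms)
  finally show ?thesis .
qed

lemma symbol_form_linear_right:
  assumes "f \<in> Linf" "x \<in> L2" "y \<in> L2" "y' \<in> L2"
  shows "symbol_form f x (\<lambda>z. a * y z + b * y' z) = cnj a * symbol_form f x y + cnj b * symbol_form f x y'"
proof -
  have "symbol_form f x (\<lambda>z. a * y z + b * y' z)
      = (LINT z|gauss. cnj a * (f z * (x z * cnj (y z))) + cnj b * (f z * (x z * cnj (y' z))))"
    unfolding symbol_form_def by (simp add: algebra_simps)
  also have "\<dots> = cnj a * symbol_form f x y + cnj b * symbol_form f x y'"
    unfolding symbol_form_def
    by (subst Bochner_Integration.integral_add) (auto intro!: symbol_form_integrable assms)
  finally show ?thesis .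
qed

lemma symbol_form_bound:
  assumes f: "f \<in> Linf"
  obtains C where "C \<ge> 0" "\<And>x y. x \<in> L2 \<Longrightarrow> y \<in> L2 \<Longrightarrow> (LINT z|gauss. cmod (f z * (x z * cnj (y z)))) \<le> C * (L2norm x * L2norm y)"
    "\<And>x y. x \<in> L2 \<Longrightarrow> y \<in> L2 \<Longrightarrow> cmod (symbol_form f x y) \<le> C * (L2norm x * L2norm y)"
proof -
  obtain C where C: "C \<ge> 0" "AE z in lborel. cmod (f z) \<le> C"
    by (rule LinfE[OF f]) blast
  have 1: "(LINT z|gauss. cmod (f z * (x z * cnj (y z)))) \<le> C * (L2norm x * L2norm y)" if x: "x \<in> L2" and y: "y \<in> L2" for x y
  proof -
    have int: "integrable gauss (\<lambda>z. cmod (x z) * cmod (y z))"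
      using integrable_norm[OF L2_ip_integrable[OF x y]] by (simp add: norm_mult)
    have "(LINT z|gauss. cmod (f z * (x z * cnj (y z)))) \<le> (LINT z|gauss. C * (cmod (x z) * cmod (y z)))"
    proof (rule integral_mono_AE)
      show "integrable gauss (\<lambda>z. cmod (f z * (x z * cnj (y z))))"
        by (intro integrable_norm symbol_form_integrable f x y)
      have "AE z in gauss. cmod (f z) \<le> C"
        using C(2) by (simp add: AE_gauss_iff)
      then show "AE z in gauss. cmod (f z * (x z * cnj (y z))) \<le> C * (cmod (x z) * cmod (y z))"
        by eventually_elim (auto simp: norm_mult intro!: mult_right_mono)
    qed (use int in simp)
    also have "\<dots> = C * (LINT z|gauss. cmod (x z) * cmod (y z))"
      by simp
    also have "\<dots> \<le> C * (L2norm x * L2norm y)"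
      by (intro mult_left_mono ip_Cauchy_Schwarz(2) x y C)
    finally show ?thesis .
  qed
  have "cmod (symbol_form f x y) \<le> C * (L2norm x * L2norm y)" if "x \<in> L2" "y \<in> L2" for x y
    unfolding symbol_form_def by (rule order.trans[OF integral_norm_bound 1[OF that]])
  then show ?thesis
    using that[OF C(1) 1] by blast
qed

lemma Toeplitz_exists:
  assumes f: "f \<in> Linf"
  shows "\<exists>T\<in>bounded_ops (true_fock (Suc m)).
    \<forall>x\<in>true_fock (Suc m). \<forall>y\<in>true_fock (Suc m). ip (T x) y = of_real pi * symbol_form f x y"
proof -
  interpret function_hilbert "true_fock (Suc m)" "hbasis m"
    by (rule function_hilbert_true_fock)
  let ?H = "true_fock (Suc m)"
  obtain C where C: "C \<ge> 0" "\<And>x y. x \<in> L2 \<Longrightarrow> y \<in> L2 \<Longrightarrow> cmod (symbol_form f x y) \<le> C * (L2norm x * L2norm y)"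
    by (rule symbol_form_bound[OF f]) blast
  have ex: "\<exists>p\<in>?H. \<forall>y\<in>?H. ip p y = of_real pi * symbol_form f x y" if x: "x \<in> ?H" for x
  proof -
    \<comment> \<open>The form is conjugate linear in \<open>y\<close>, so its conjugate is
      represented.\<close>
    have "bounded_functional (\<lambda>y. cnj (of_real pi * symbol_form f x y))"
    proof (rule bounded_functionalI[where C = "pi * (C * L2norm x)"])
      fix y assume y: "y \<in> ?H"
      have "pi * cmod (symbol_form f x y) \<le> pi * (C * (L2norm x * L2norm y))"
        by (intro mult_left_mono C(2) H_L2 x y) simp
      then show "cmod (cnj (of_real pi * symbol_form f x y)) \<le> pi * (C * L2norm x) * L2norm y"
        by (simp add: norm_mult mult_ac)
    qed (simp add: symbol_form_linear_right f H_L2 x algebra_simps)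
    then obtain p where p: "p \<in> ?H" "\<And>y. y \<in> ?H \<Longrightarrow> cnj (of_real pi * symbol_form f x y) = ip y p"
      using Riesz by blast
    have "ip p y = of_real pi * symbol_form f x y" if "y \<in> ?H" for y
      using arg_cong[OF p(2)[OF that], of cnj] by (simp add: cnj_ip)
    then show ?thesis
      using p(1) by blast
  qed
  define T where "T = (\<lambda>x\<in>?H. SOME p. p \<in> ?H \<and> (\<forall>y\<in>?H. ip p y = of_real pi * symbol_form f x y))"
  have T: "T x \<in> ?H \<and> (\<forall>y\<in>?H. ip (T x) y = of_real pi * symbol_form f x y)" if x: "x \<in> ?H" for x
  proof -
    have "\<exists>p. p \<in> ?H \<and> (\<forall>y\<in>?H. ip p y = of_real pi * symbol_form f x y)"
      using ex[OF x] by blast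
    from someI_ex[OF this] show ?thesis
      using x by (simp add: T_def)
  qed
  have T_H: "T x \<in> ?H" and T_ip: "y \<in> ?H \<Longrightarrow> ip (T x) y = of_real pi * symbol_form f x y" if "x \<in> ?H" for x y
    using T[OF that] by auto
  have "T \<in> bounded_ops ?H"
    unfolding bounded_ops_def
  proof (intro CollectI conjI ballI allI)
    show "T \<in> ?H \<rightarrow>\<^sub>E ?H"
      using T_H by (auto simp: T_def)
    fix x x' a b assume x: "x \<in> ?H" "x' \<in> ?H"
    have u: "(\<lambda>z. a * T x z + b * T x' z) \<in> ?H"
      by (intro H_linear T_H x)
    show "T (\<lambda>z. a * x z + b * x' z) = (\<lambda>z. a * T x z + b * T x' z)"
    proof (rule eq_if_ip_eq[OF T_H[OF H_linear[OF x]] u])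
      fix y assume y: "y \<in> ?H"
      have "ip (\<lambda>z. a * T x z + b * T x' z) y = a * ip (T x) y + b * ip (T x') y"
        by (intro ip_linear_left H_L2 T_H x y)
      also have "\<dots> = of_real pi * (a * symbol_form f x y + b * symbol_form f x' y)"
        by (simp add: T_ip x y algebra_simps)
      also have "a * symbol_form f x y + b * symbol_form f x' y = symbol_form f (\<lambda>z. a * x z + b * x' z) y"
        by (rule symbol_form_linear_left[symmetric]) (auto intro: H_L2 x y f)
      finally show "ip (T (\<lambda>z. a * x z + b * x' z)) y = ip (\<lambda>z. a * T x z + b * T x' z) y"
        by (simp only: T_ip[OF H_linear[OF x] y])
    qed
  next
    have "L2norm (T x) \<le> (pi * C) * L2norm x" if x: "x \<in> ?H" for x
    proof (cases "L2norm (T x) = 0")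
      case False
      have "of_real ((L2norm (T x))\<^sup>2) = of_real pi * symbol_form f x (T x)"
        using T_ip[OF x T_H[OF x]] by (simp only: ip_self)
      then have "cmod (of_real ((L2norm (T x))\<^sup>2)) = pi * cmod (symbol_form f x (T x))"
        by (simp add: norm_mult)
      then have "(L2norm (T x))\<^sup>2 = pi * cmod (symbol_form f x (T x))"
        by (simp only: norm_of_real abs_power2)
      also have "\<dots> \<le> pi * (C * (L2norm x * L2norm (T x)))"
        by (intro mult_left_mono C(2) H_L2 T_H x) simp
      finally have "L2norm (T x) * L2norm (T x) \<le> (pi * C * L2norm x) * L2norm (T x)"
        by (simp add: power2_eq_square mult_ac)
      then show ?thesis
        using False by (simp add: mult_le_cancel_right less_le)
    qed (use C in simp)
    then show "\<exists>C. \<forall>x\<in>?H. L2norm (T x) \<le> C * L2norm x"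
      by blast
  qed
  then show ?thesis
    using T_ip by blast
qed

text \<open>Unitarity of the Weyl operator transports evaluation at 0 to evaluation at z, at the
  cost of the exponential factor.\<close>

lemma weyl_reproducing:
  assumes x: "x \<in> true_fock (Suc m)"
  shows "ip x (weyl z (kernel0 (Suc m))) = of_real (exp (- ((cmod z)\<^sup>2 / 2))) * x z"
proof -
  let ?k = "kernel0 (Suc m)"
  have "ip x (weyl z ?k) = ip (weyl z (weyl (- z) x)) (weyl z ?k)"
    by (simp only: weyl_uminus)
  also have "\<dots> = ip (weyl (- z) x) ?k"
    by (intro ip_weyl true_fock_L2[OF true_fock_weyl[OF x]] true_fock_L2[OF kernel0_true_fock])
  also have "\<dots> = weyl (- z) x 0"
    by (rule kernel0_reproducing[OF true_fock_weyl[OF x]])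
  also have "\<dots> = of_real (exp (- ((cmod z)\<^sup>2 / 2))) * x z"
    by (simp add: weyl_def exp_of_real[symmetric])
  finally show ?thesis .
qed

text \<open>By the reproducing property the conjugated rank-one operator has matrix entries
  exp(-|z|^2) x(z) cnj (y(z)): the density of the form of a Toeplitz operator at z.\<close>

lemma trace_weyl_rank_one:
  assumes cd: "\<And>n. c n \<in> true_fock (Suc m)" "\<And>n. d n \<in> true_fock (Suc m)" "\<And>n. L2norm (d n) = L2norm (c n)"
    "summable (\<lambda>n. (L2norm (c n))\<^sup>2)"
    "\<And>x y. x \<in> true_fock (Suc m) \<Longrightarrow> y \<in> true_fock (Suc m) \<Longrightarrow> (\<lambda>n. ip x (c n) * ip (d n) y) sums ip (B x) y"
    and B: "\<And>x. x \<in> true_fock (Suc m) \<Longrightarrow> B x \<in> true_fock (Suc m)"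
    and H: "H = true_fock (Suc m)" and k: "k = kernel0 (Suc m)"
  shows "(\<lambda>n. of_real (exp (- (cmod z)\<^sup>2)) * (d n z * cnj (c n z))) sums tr H (weyl z \<circ> rank_one H k k \<circ> weyl (- z) \<circ> B)"
    and "summable (\<lambda>n. cmod (of_real (exp (- (cmod z)\<^sup>2)) * (d n z * cnj (c n z))))"
proof -
  interpret function_hilbert H "hbasis m"
    unfolding H by (rule function_hilbert_true_fock)
  note cd = cd[folded H]
  let ?S = "weyl z \<circ> rank_one H k k \<circ> weyl (- z)"
  let ?kz = "weyl z k"
  define g where "g = complex_of_real (exp (- ((cmod z)\<^sup>2 / 2)))"
  have gg: "g * g = of_real (exp (- (cmod z)\<^sup>2))" "cnj g = g"
    by (simp_all add: g_def mult_exp_exp flip: of_real_mult)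
  have kz: "?kz \<in> H"
    unfolding H k by (intro true_fock_weyl kernel0_true_fock)
  have rep: "ip x ?kz = g * x z" if "x \<in> H" for x
    using weyl_reproducing[of x m z] that by (simp add: H k g_def)
  have S: "?S x = (\<lambda>w. (g * x z) * ?kz w)" if x: "x \<in> H" for x
  proof -
    have w: "weyl (- z) x \<in> H"
      using x unfolding H by (rule true_fock_weyl)
    have "ip (weyl (- z) x) k = weyl (- z) x 0"
      using kernel0_reproducing[of "weyl (- z) x" m] w by (simp add: H k)
    also have "\<dots> = g * x z"
      by (simp add: weyl_def g_def exp_of_real[symmetric])
    finally show ?thesis
      using w by (simp add: rank_one_def weyl_def fun_eq_iff)
  qed
  have ip_S: "ip (?S x) y = of_real (exp (- (cmod z)\<^sup>2)) * (x z * cnj (y z))" if x: "x \<in> H" and y: "y \<in> H" for x y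
  proof -
    have "ip (?S x) y = (g * x z) * cnj (ip y ?kz)"
      unfolding S[OF x] ip_cmult_left by (simp only: cnj_ip)
    also have "\<dots> = (g * g) * (x z * cnj (y z))"
      unfolding rep[OF y] complex_cnj_mult gg(2) by (simp only: mult_ac)
    finally show ?thesis
      by (simp only: gg(1))
  qed
  have S_H: "?S x \<in> H" if "x \<in> H" for x
    unfolding S[OF that] by (rule cmult_H[OF kz])
  have S_bound: "L2norm (?S x) \<le> (L2norm ?kz)\<^sup>2 * L2norm x" if x: "x \<in> H" for x
  proof -
    have "(L2norm (?S x))\<^sup>2 = (cmod (ip x ?kz) * L2norm ?kz)\<^sup>2"
      unfolding S[OF x] rep[OF x] by (simp add: L2norm_square norm_mult power_mult_distrib)
    then have "L2norm (?S x) = cmod (ip x ?kz) * L2norm ?kz"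
      by (rule power2_eq_imp_eq) auto
    also have "\<dots> \<le> (L2norm x * L2norm ?kz) * L2norm ?kz"
      by (intro mult_right_mono ip_Cauchy_Schwarz(1) H_L2 x kz) simp
    finally show ?thesis
      by (simp add: power2_eq_square mult_ac)
  qed
  have adj: "\<exists>y'\<in>H. \<forall>x\<in>H. ip (?S x) y = ip x y'" if y: "y \<in> H" for y
  proof (intro bexI ballI)
    let ?y' = "\<lambda>w. (g * y z) * ?kz w"
    show "?y' \<in> H"
      by (rule cmult_H[OF kz])
    fix x assume x: "x \<in> H"
    have "ip x ?y' = cnj (ip ?y' x)"
      by (simp only: cnj_ip)
    also have "\<dots> = cnj (g * y z) * ip x ?kz"
      by (simp only: ip_cmult_left complex_cnj_mult cnj_ip)
    also have "\<dots> = (g * g) * (x z * cnj (y z))"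
      unfolding rep[OF x] complex_cnj_mult gg(2) by (simp only: mult_ac)
    finally show "ip (?S x) y = ip x ?y'"
      by (simp only: ip_S[OF x y] gg(1))
  qed
  have "(\<lambda>n. ip (?S (d n)) (c n)) sums tr H (?S \<circ> B)"
    by (rule trace_comp_sums[OF cd B[folded H] S_H S_bound adj])
  then show "(\<lambda>n. of_real (exp (- (cmod z)\<^sup>2)) * (d n z * cnj (c n z))) sums tr H (?S \<circ> B)"
    by (simp only: ip_S[OF cd(2) cd(1)])
  have le: "cmod (ip (?S (d n)) (c n)) \<le> (L2norm ?kz)\<^sup>2 * (L2norm (c n))\<^sup>2" for n
  proof -
    have "cmod (ip (?S (d n)) (c n)) \<le> L2norm (?S (d n)) * L2norm (c n)"
      by (intro ip_Cauchy_Schwarz(1) H_L2 S_H cd)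
    also have "\<dots> \<le> ((L2norm ?kz)\<^sup>2 * L2norm (d n)) * L2norm (c n)"
      by (intro mult_right_mono S_bound cd) simp
    finally show ?thesis
      by (simp add: cd(3) power2_eq_square mult_ac)
  qed
  have "summable (\<lambda>n. cmod (ip (?S (d n)) (c n)))"
    by (rule summable_comparison_test'[OF summable_mult[OF cd(4)], of 0]) (use le in simp)
  then show "summable (\<lambda>n. cmod (of_real (exp (- (cmod z)\<^sup>2)) * (d n z * cnj (c n z))))"
    by (simp only: ip_S[OF cd(2) cd(1)])
qed

text \<open>The Toeplitz operator satisfies the defining trace identity of the convolution, and
  traces determine a bounded operator, so \<open>THE\<close> selects it. The factor pi undoes the
  normalisation of \<open>gauss\<close>.\<close>

lemma Phi_Toeplitz:
  assumes f: "f \<in> Linf"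
  shows "Phi (Suc m) f \<in> bounded_ops (true_fock (Suc m))"
    and "x \<in> true_fock (Suc m) \<Longrightarrow> y \<in> true_fock (Suc m) \<Longrightarrow> ip (Phi (Suc m) f x) y = of_real pi * symbol_form f x y"
proof -
  interpret function_hilbert "true_fock (Suc m)" "hbasis m"
    by (rule function_hilbert_true_fock)
  let ?H = "true_fock (Suc m)"
  let ?k = "kernel0 (Suc m)"
  obtain T where T: "T \<in> bounded_ops ?H"
    and T_ip: "\<And>x y. x \<in> ?H \<Longrightarrow> y \<in> ?H \<Longrightarrow> ip (T x) y = of_real pi * symbol_form f x y"
    using Toeplitz_exists[OF f, of m] by blast
  obtain CT where CT: "CT \<ge> 0" "\<And>x. x \<in> ?H \<Longrightarrow> L2norm (T x) \<le> CT * L2norm x"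
    by (rule bounded_opsE[OF T]) blast
  obtain C where C: "C \<ge> 0"
    "\<And>x y. x \<in> L2 \<Longrightarrow> y \<in> L2 \<Longrightarrow> (LINT z|gauss. cmod (f z * (x z * cnj (y z)))) \<le> C * (L2norm x * L2norm y)"
    by (rule symbol_form_bound[OF f]) blast
  have f_meas [measurable]: "f \<in> borel_measurable borel"
    by (rule Linf_measurable[OF f])
  have key: "integrable lborel (\<lambda>z. f z * tr ?H (weyl z \<circ> rank_one ?H ?k ?k \<circ> weyl (- z) \<circ> B)) \<and>
      tr ?H (T \<circ> B) = (LINT z|lborel. f z * tr ?H (weyl z \<circ> rank_one ?H ?k ?k \<circ> weyl (- z) \<circ> B))"
    if B: "B \<in> trace_class ?H" for B
  proof -
    obtain c d where cd: "\<And>n. c n \<in> ?H" "\<And>n. d n \<in> ?H" "\<And>n. L2norm (d n) = L2norm (c n)"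
      "summable (\<lambda>n. (L2norm (c n))\<^sup>2)"
      "\<And>x y. x \<in> ?H \<Longrightarrow> y \<in> ?H \<Longrightarrow> (\<lambda>n. ip x (c n) * ip (d n) y) sums ip (B x) y"
      by (rule trace_class_decomposition[OF B]) blast
    have B_H: "B x \<in> ?H" if "x \<in> ?H" for x
      using bounded_ops_H[OF trace_class_bounded[OF B] that] .
    have [measurable]: "c n \<in> borel_measurable borel" "d n \<in> borel_measurable borel" for n
      using cd(1,2)[of n] by (auto intro: L2_measurable true_fock_L2)
    \<comment> \<open>The n-th term of the trace under the integral. Its L^1 norm is at most pi C
      ||c n||^2, which is summable, so sum and integral may be exchanged.\<close>
    define G where "G n z = f z * (of_real (exp (- (cmod z)\<^sup>2)) * (d n z * cnj (c n z)))" for n z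
    have G_eq: "G n = (\<lambda>z. of_real pi * ((exp (- (cmod z)\<^sup>2) / pi) *\<^sub>R (f z * (d n z * cnj (c n z)))))" for n
      by (simp add: G_def fun_eq_iff scaleR_conv_of_real mult_ac)
    have int0: "integrable gauss (\<lambda>z. f z * (d n z * cnj (c n z)))" for n
      by (intro symbol_form_integrable f H_L2 cd)
    have G_int: "integrable lborel (G n)" for n
      unfolding G_eq by (intro integrable_mult_right integrable_gauss_iff[THEN iffD1, OF _ int0]) measurable
    have G_lint: "integral\<^sup>L lborel (G n) = of_real pi * symbol_form f (d n) (c n)" for n
      unfolding G_eq symbol_form_def integral_mult_right_zero by (subst integral_gauss) auto
    have G_norm: "(LINT z|lborel. cmod (G n z)) \<le> pi * C * (L2norm (c n))\<^sup>2" for n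
    proof -
      have "cmod (G n z) = pi * ((exp (- (cmod z)\<^sup>2) / pi) *\<^sub>R cmod (f z * (d n z * cnj (c n z))))" for z
        by (simp add: G_def norm_mult)
      then have "(LINT z|lborel. cmod (G n z)) = pi * (LINT z|gauss. cmod (f z * (d n z * cnj (c n z))))"
        by (subst integral_gauss) auto
      also have "\<dots> \<le> pi * (C * (L2norm (d n) * L2norm (c n)))"
        by (intro mult_left_mono C(2) H_L2 cd) simp
      finally show ?thesis
        by (simp add: cd(3) power2_eq_square mult_ac)
    qed
    have tr_sums: "(\<lambda>n. G n z) sums (f z * tr ?H (weyl z \<circ> rank_one ?H ?k ?k \<circ> weyl (- z) \<circ> B))" for z
      unfolding G_def by (intro sums_mult trace_weyl_rank_one(1)[OF cd B_H refl refl])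
    then have tr_eq: "(\<lambda>z. f z * tr ?H (weyl z \<circ> rank_one ?H ?k ?k \<circ> weyl (- z) \<circ> B)) = (\<lambda>z. \<Sum>n. G n z)"
      by (simp add: sums_iff fun_eq_iff)
    have summ1: "AE z in lborel. summable (\<lambda>n. norm (G n z))"
    proof (rule AE_I2)
      fix z
      show "summable (\<lambda>n. norm (G n z))"
        unfolding G_def norm_mult[of "f z"] by (intro summable_mult trace_weyl_rank_one(2)[OF cd B_H refl refl])
    qed
    have summ2: "summable (\<lambda>n. LINT z|lborel. norm (G n z))"
      by (rule summable_comparison_test'[OF summable_mult[OF cd(4), of "pi * C"], of 0]) (use G_norm in simp)
    have "(\<lambda>n. ip (T (d n)) (c n)) sums tr ?H (T \<circ> B)"
      by (rule trace_comp_sums[OF cd B_H bounded_ops_H[OF T] CT(2) bounded_ops_adjoint[OF T]])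
    then have "(\<lambda>n. integral\<^sup>L lborel (G n)) sums tr ?H (T \<circ> B)"
      by (simp only: T_ip[OF cd(2) cd(1)] G_lint)
    from sums_unique2[OF this sums_integral[OF G_int summ1 summ2]]
    have "tr ?H (T \<circ> B) = (LINT z|lborel. (\<Sum>n. G n z))" .
    then show ?thesis
      unfolding tr_eq using integrable_suminf[OF G_int summ1 summ2] by blast
  qed
  have "Phi (Suc m) f = T"
    unfolding Phi_def Defs.convolution_def
  proof (rule the_equality)
    show "T \<in> bounded_ops ?H \<and> (\<forall>B\<in>trace_class ?H.
        integrable lborel (\<lambda>z. f z * tr ?H (weyl z \<circ> rank_one ?H ?k ?k \<circ> weyl (- z) \<circ> B)) \<and>
        tr ?H (T \<circ> B) = (LINT z|lborel. f z * tr ?H (weyl z \<circ> rank_one ?H ?k ?k \<circ> weyl (- z) \<circ> B)))"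
      using T key by blast
    fix T' assume T': "T' \<in> bounded_ops ?H \<and> (\<forall>B\<in>trace_class ?H.
        integrable lborel (\<lambda>z. f z * tr ?H (weyl z \<circ> rank_one ?H ?k ?k \<circ> weyl (- z) \<circ> B)) \<and>
        tr ?H (T' \<circ> B) = (LINT z|lborel. f z * tr ?H (weyl z \<circ> rank_one ?H ?k ?k \<circ> weyl (- z) \<circ> B)))"
    show "T' = T"
    proof (rule bounded_ops_eq_if_trace_eq)
      show "tr ?H (T' \<circ> B) = tr ?H (T \<circ> B)" if "B \<in> trace_class ?H" for B
        using T' key[OF that] that by simp
    qed (use T T' in auto)
  qed
  then show "Phi (Suc m) f \<in> bounded_ops ?H"
    and "x \<in> ?H \<Longrightarrow> y \<in> ?H \<Longrightarrow> ip (Phi (Suc m) f x) y = of_real pi * symbol_form f x y"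
    using T T_ip by auto
qed

subsection \<open>The kernel in terms of Hermite coefficients\<close>

definition hcoeff :: "(complex \<Rightarrow> complex) \<Rightarrow> nat \<Rightarrow> nat \<Rightarrow> complex" where
  "hcoeff f p q = (LINT z|gauss. f z * hermite p q z)"

text \<open>Both indices move together, so each diagonal carries its own recurrence of order
  \<open>m\<close>; as j <= m, no subtraction truncates.\<close>

definition recurrent :: "nat \<Rightarrow> (complex \<Rightarrow> complex) \<Rightarrow> bool" where
  "recurrent m f \<longleftrightarrow> (\<forall>p q. (\<Sum>j\<le>m. of_nat (fact j * (m choose j) * (m choose j)) * hcoeff f (p + m - j) (q + m - j)) = 0)"

lemma hermite_mult_integrable:
  assumes "f \<in> Linf"
  shows "integrable gauss (\<lambda>z. f z * hermite p q z)"
    and "integrable gauss (\<lambda>z. f z * (hermite p q z * hermite p' q' z))"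
  by (intro Linf_mult_integrable_gauss[OF assms] exp_bounded_imp_integrable exp_bounded_mult exp_bounded_hermite)+

lemma symbol_form_hermite:
  "symbol_form f (hermite m q) (hermite m p) = (LINT z|gauss. f z * (hermite m q z * hermite p m z))"
  by (simp add: symbol_form_def cnj_hermite)

text \<open>The linearization formula with a = b = m, integrated against \<open>f\<close>.\<close>

lemma recurrence_sum:
  assumes f: "f \<in> Linf"
  shows "(\<Sum>r\<le>p. (-1) ^ r * of_nat (fact r * (p choose r) * (q choose r)) * symbol_form f (hermite m (q - r)) (hermite m (p - r)))
    = (\<Sum>j\<le>m. of_nat (fact j * (m choose j) * (m choose j)) * hcoeff f (p + m - j) (q + m - j))"
proof -
  have "(\<Sum>r\<le>p. (-1) ^ r * of_nat (fact r * (p choose r) * (q choose r)) * symbol_form f (hermite m (q - r)) (hermite m (p - r)))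
      = (LINT z|gauss. (\<Sum>r\<le>p. (-1) ^ r * of_nat (fact r * (p choose r) * (q choose r)) * (f z * (hermite m (q - r) z * hermite (p - r) m z))))"
    unfolding symbol_form_hermite
    by (subst Bochner_Integration.integral_sum)
      (intro integrable_mult_right hermite_mult_integrable f, simp only: integral_mult_right_zero)
  also have "\<dots> = (LINT z|gauss. f z * (\<Sum>r\<le>p. (-1) ^ r * of_nat (fact r * (p choose r) * (q choose r)) * (hermite m (q - r) z * hermite (p - r) m z)))"
    unfolding sum_distrib_left by (simp only: mult.left_commute[of "f _"])
  also have "\<dots> = (LINT z|gauss. (\<Sum>j\<le>m. of_nat (fact j * (m choose j) * (m choose j)) * (f z * hermite (p + m - j) (q + m - j) z)))"
    unfolding hermite_linearization sum_distrib_left by (simp only: mult.left_commute[of "f _"])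
  also have "\<dots> = (\<Sum>j\<le>m. of_nat (fact j * (m choose j) * (m choose j)) * hcoeff f (p + m - j) (q + m - j))"
    unfolding hcoeff_def
    by (subst Bochner_Integration.integral_sum)
      (intro integrable_mult_right hermite_mult_integrable f, simp only: integral_mult_right_zero)
  finally show ?thesis .
qed

text \<open>The combinations of \<open>recurrence_sum\<close> are unitriangular in \<open>p\<close>, hence can be inverted.\<close>

lemma symbol_form_hermite_zero_iff:
  assumes f: "f \<in> Linf"
  shows "(\<forall>p q. symbol_form f (hermite m q) (hermite m p) = 0) \<longleftrightarrow> recurrent m f"
proof
  assume "\<forall>p q. symbol_form f (hermite m q) (hermite m p) = 0"
  then show "recurrent m f"
    unfolding recurrent_def recurrence_sum[OF f, symmetric] by simp
next
  assume rec: "recurrent m f"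
  have "symbol_form f (hermite m q) (hermite m p) = 0" for p q
  proof (induction p arbitrary: q rule: less_induct)
    case (less p)
    let ?t = "\<lambda>r. (-1) ^ r * of_nat (fact r * (p choose r) * (q choose r)) * symbol_form f (hermite m (q - r)) (hermite m (p - r))"
    have "(\<Sum>r\<le>p. ?t r) = 0"
      unfolding recurrence_sum[OF f] using rec by (simp only: recurrent_def)
    moreover have "(\<Sum>r\<le>p. ?t r) = ?t 0 + (\<Sum>r\<in>{..p} - {0}. ?t r)"
      by (rule sum.remove) auto
    moreover have "(\<Sum>r\<in>{..p} - {0}. ?t r) = 0"
      by (intro sum.neutral) (auto simp: less.IH)
    ultimately show ?case
      by simp
  qed
  then show "\<forall>p q. symbol_form f (hermite m q) (hermite m p) = 0"
    by blast
qed

lemma cnj_symbol_form: "cnj (symbol_form f x y) = symbol_form (\<lambda>z. cnj (f z)) y x"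
  by (simp add: symbol_form_def mult.commute[of "cnj (x _)"] flip: Bochner_Integration.integral_cnj)

lemma Linf_cnj: "f \<in> Linf \<Longrightarrow> (\<lambda>z. cnj (f z)) \<in> Linf"
  by (auto simp: Linf_def)

text \<open>Passes from basis vectors to the whole space one argument at a time. The second argument
  is handled by conjugation, which exchanges the arguments and conjugates the symbol.\<close>

lemma symbol_form_zero_iff:
  assumes f: "f \<in> Linf"
  shows "(\<forall>x\<in>true_fock (Suc m). \<forall>y\<in>true_fock (Suc m). symbol_form f x y = 0) \<longleftrightarrow> recurrent m f"
proof -
  interpret function_hilbert "true_fock (Suc m)" "hbasis m"
    by (rule function_hilbert_true_fock)
  let ?H = "true_fock (Suc m)"
  have functional: "bounded_functional (\<lambda>x. symbol_form f x y)" if f: "f \<in> Linf" and y: "y \<in> ?H" for f y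
  proof -
    obtain C where C: "C \<ge> 0" "\<And>x y. x \<in> L2 \<Longrightarrow> y \<in> L2 \<Longrightarrow> cmod (symbol_form f x y) \<le> C * (L2norm x * L2norm y)"
      by (rule symbol_form_bound[OF f]) blast
    show ?thesis
    proof (rule bounded_functionalI[where C = "C * L2norm y"])
      fix x assume "x \<in> ?H"
      then show "cmod (symbol_form f x y) \<le> C * L2norm y * L2norm x"
        using C(2)[of x y] y by (simp add: H_L2 mult_ac)
    qed (simp add: symbol_form_linear_left f H_L2 y)
  qed
  have vanish: "symbol_form f x y = 0" if f: "f \<in> Linf" and y: "y \<in> ?H" and x: "x \<in> ?H"
    and zero: "\<And>q. symbol_form f (hermite m q) y = 0" for f x y
  proof (rule functional_zero[OF functional[OF f y] _ x])
    fix q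
    have "symbol_form f (hbasis m q) y = 1 / of_real (sqrt (fact m * fact q)) * symbol_form f (hermite m q) y"
      using symbol_form_linear_left[OF f hermite_L2 hermite_L2 H_L2[OF y], of "1 / of_real (sqrt (fact m * fact q))" m q 0 m q]
      by (simp add: hbasis_eq)
    then show "symbol_form f (hbasis m q) y = 0"
      by (simp add: zero)
  qed
  show ?thesis
    unfolding symbol_form_hermite_zero_iff[OF f, symmetric]
  proof
    assume "\<forall>x\<in>?H. \<forall>y\<in>?H. symbol_form f x y = 0"
    then show "\<forall>p q. symbol_form f (hermite m q) (hermite m p) = 0"
      using hermite_true_fock by blast
  next
    assume zero: "\<forall>p q. symbol_form f (hermite m q) (hermite m p) = 0"
    have 1: "symbol_form f x (hermite m p) = 0" if "x \<in> ?H" for x p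
      using zero by (intro vanish[OF f hermite_true_fock that]) blast
    have "symbol_form (\<lambda>z. cnj (f z)) y x = 0" if x: "x \<in> ?H" and y: "y \<in> ?H" for x y
    proof (rule vanish[OF Linf_cnj[OF f] x y])
      fix q
      show "symbol_form (\<lambda>z. cnj (f z)) (hermite m q) x = 0"
        using 1[OF x, of q] cnj_symbol_form[of f x "hermite m q"] by simp
    qed
    then have "cnj (symbol_form f x y) = 0" if "x \<in> ?H" "y \<in> ?H" for x y
      unfolding cnj_symbol_form using that by blast
    then show "\<forall>x\<in>?H. \<forall>y\<in>?H. symbol_form f x y = 0"
      by simp
  qed
qed

lemma symbol_form_diff:
  assumes "f \<in> Linf" "g \<in> Linf" "x \<in> L2" "y \<in> L2"
  shows "symbol_form (\<lambda>z. f z - g z) x y = symbol_form f x y - symbol_form g x y"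
  unfolding symbol_form_def left_diff_distrib
  by (intro Bochner_Integration.integral_diff symbol_form_integrable assms)

lemma Linf_linear:
  assumes "f \<in> Linf" "g \<in> Linf"
  shows "(\<lambda>z. a * f z + b * g z) \<in> Linf"
proof -
  obtain C where C: "C \<ge> 0" "AE z in lborel. cmod (f z) \<le> C"
    by (rule LinfE[OF assms(1)]) blast
  obtain D where D: "D \<ge> 0" "AE z in lborel. cmod (g z) \<le> D"
    by (rule LinfE[OF assms(2)]) blast
  have "AE z in lborel. cmod (a * f z + b * g z) \<le> cmod a * C + cmod b * D"
    using C(2) D(2)
  proof eventually_elim
    case (elim z)
    have "cmod (a * f z + b * g z) \<le> cmod a * cmod (f z) + cmod b * cmod (g z)"
      by (rule order.trans[OF norm_triangle_ineq]) (simp add: norm_mult)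
    also have "\<dots> \<le> cmod a * C + cmod b * D"
      using elim by (intro add_mono mult_left_mono) auto
    finally show ?case .
  qed
  then show ?thesis
    using assms by (auto simp: Linf_def)
qed

lemma Linf_diff: "f \<in> Linf \<Longrightarrow> g \<in> Linf \<Longrightarrow> (\<lambda>z. f z - g z) \<in> Linf"
  using Linf_linear[of f g 1 "-1"] by simp

lemma Phi_eq_iff:
  assumes f: "f \<in> Linf" and g: "g \<in> Linf"
  shows "Phi (Suc m) f = Phi (Suc m) g \<longleftrightarrow> recurrent m (\<lambda>z. f z - g z)"
proof -
  interpret function_hilbert "true_fock (Suc m)" "hbasis m"
    by (rule function_hilbert_true_fock)
  let ?H = "true_fock (Suc m)"
  have "recurrent m (\<lambda>z. f z - g z) \<longleftrightarrow> (\<forall>x\<in>?H. \<forall>y\<in>?H. symbol_form f x y = symbol_form g x y)"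
    unfolding symbol_form_zero_iff[OF Linf_diff[OF f g], symmetric]
    using f g by (auto simp: symbol_form_diff H_L2)
  also have "\<dots> \<longleftrightarrow> Phi (Suc m) f = Phi (Suc m) g"
  proof
    assume eq: "\<forall>x\<in>?H. \<forall>y\<in>?H. symbol_form f x y = symbol_form g x y"
    show "Phi (Suc m) f = Phi (Suc m) g"
      by (rule bounded_ops_eqI) (auto simp: Phi_Toeplitz f g eq)
  next
    assume eq: "Phi (Suc m) f = Phi (Suc m) g"
    have "of_real pi * symbol_form f x y = of_real pi * symbol_form g x y" if "x \<in> ?H" "y \<in> ?H" for x y
      using Phi_Toeplitz(2)[OF f that] Phi_Toeplitz(2)[OF g that] eq by simp
    then show "\<forall>x\<in>?H. \<forall>y\<in>?H. symbol_form f x y = symbol_form g x y"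
      by simp
  qed
  finally show ?thesis ..
qed

lemma Phi_eq_zero_iff:
  assumes f: "f \<in> Linf"
  shows "Phi (Suc m) f = zero_op (true_fock (Suc m)) \<longleftrightarrow> recurrent m f"
proof -
  interpret function_hilbert "true_fock (Suc m)" "hbasis m"
    by (rule function_hilbert_true_fock)
  let ?H = "true_fock (Suc m)"
  have zero: "zero_op ?H \<in> bounded_ops ?H"
  proof -
    have "zero_op ?H = rank_one ?H (\<lambda>_. 0) (\<lambda>_. 0)"
      by (simp add: zero_op_def rank_one_def)
    then show ?thesis
      using rank_one_bounded[OF zero_H zero_H] by simp
  qed
  show ?thesis
    unfolding symbol_form_zero_iff[OF f, symmetric]
  proof
    assume eq: "Phi (Suc m) f = zero_op ?H"
    show "\<forall>x\<in>?H. \<forall>y\<in>?H. symbol_form f x y = 0"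
    proof (intro ballI)
      fix x y assume "x \<in> ?H" "y \<in> ?H"
      then show "symbol_form f x y = 0"
        using Phi_Toeplitz(2)[OF f, of x m y] by (simp add: eq zero_op_def)
    qed
  next
    assume eq: "\<forall>x\<in>?H. \<forall>y\<in>?H. symbol_form f x y = 0"
    show "Phi (Suc m) f = zero_op ?H"
      by (rule bounded_ops_eqI[OF Phi_Toeplitz(1)[OF f] zero]) (simp add: Phi_Toeplitz(2) f eq zero_op_def)
  qed
qed

section \<open>Characters and their Hermite coefficients\<close>

lemma character_eq: "character \<xi> w = exp ((- cnj \<xi>) * w + \<xi> * cnj w)"
proof -
  have "\<i> * complex_of_real (sympl \<xi> w) = \<xi> * cnj w - cnj (\<xi> * cnj w)"
    unfolding sympl_def by (simp add: complex_eq_iff)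
  then show ?thesis
    by (simp add: character_def)
qed

lemma norm_character [simp]: "cmod (character \<xi> w) = 1"
  by (simp add: character_def)

lemma character_continuous: "continuous_on UNIV (character \<xi>)"
  unfolding character_eq[abs_def] by (intro continuous_intros)

lemma measurable_character [measurable]: "character \<xi> \<in> borel_measurable borel"
  by (rule borel_measurable_continuous_onI[OF character_continuous])

lemma character_Linf: "character \<xi> \<in> Linf"
  by (rule LinfI[where C = 1]) auto

lemma hcoeff_character: "hcoeff (character \<xi>) p q = (- cnj \<xi>) ^ p * \<xi> ^ q * of_real (exp (- (cmod \<xi>)\<^sup>2))"
proof -
  have "(- cnj \<xi>) * \<xi> = of_real (- (cmod \<xi>)\<^sup>2)"
    unfolding of_real_minus complex_norm_square by simp
  then have "exp ((- cnj \<xi>) * \<xi>) = of_real (exp (- (cmod \<xi>)\<^sup>2))"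
    by (simp only: exp_of_real)
  then show ?thesis
    unfolding hcoeff_def character_eq integral_exp_hermite by (simp only:)
qed

text \<open>The characteristic polynomial of the recurrence at -|\<xi>|^2, recognised as
  \<open>hermite m m\<close> up to sign.\<close>

lemma laguerre_sum:
  "(\<Sum>j\<le>m. of_nat (fact j * (m choose j) * (m choose j)) * (- (cnj \<xi> * \<xi>)) ^ (m - j))
    = of_real (fact m * laguerre m 0 ((cmod \<xi>)\<^sup>2))"
proof -
  have "of_nat (fact j * (m choose j) * (m choose j)) * (- (cnj \<xi> * \<xi>)) ^ (m - j)
      = (-1) ^ m * ((-1) ^ j * of_nat (fact j * (m choose j) * (m choose j)) * cnj \<xi> ^ (m - j) * \<xi> ^ (m - j))" if "j \<le> m" for j
  proof -
    have "(-1) ^ m = (-1) ^ (m - j) * ((-1) ^ j :: complex)"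
      using that by (simp flip: power_add)
    then have "(-1) ^ m * (-1) ^ j = ((-1) ^ (m - j) :: complex)"
      by (simp add: mult.assoc flip: power_mult_distrib)
    moreover have "(- (cnj \<xi> * \<xi>)) ^ (m - j) = (-1) ^ (m - j) * (cnj \<xi> ^ (m - j) * \<xi> ^ (m - j))"
      by (subst power_minus) (simp add: power_mult_distrib)
    ultimately show ?thesis
      by (simp add: mult_ac)
  qed
  then have "(\<Sum>j\<le>m. of_nat (fact j * (m choose j) * (m choose j)) * (- (cnj \<xi> * \<xi>)) ^ (m - j)) = (-1) ^ m * hermite m m \<xi>"
    unfolding hermite_def sum_distrib_left by (intro sum.cong) auto
  also have "\<dots> = of_real (fact m * laguerre m 0 ((cmod \<xi>)\<^sup>2))"
    unfolding hermite_diagonal by (simp add: mult.assoc[symmetric] flip: power_mult_distrib)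
  finally show ?thesis .
qed

lemma recurrent_character:
  assumes "\<xi> \<in> Sigma_set (Suc m)"
  shows "recurrent m (character \<xi>)"
  unfolding recurrent_def
proof (intro allI)
  fix p q
  define E where "E = complex_of_real (exp (- (cmod \<xi>)\<^sup>2))"
  have "of_nat (fact j * (m choose j) * (m choose j)) * hcoeff (character \<xi>) (p + m - j) (q + m - j)
      = ((- cnj \<xi>) ^ p * \<xi> ^ q * E) * (of_nat (fact j * (m choose j) * (m choose j)) * (- (cnj \<xi> * \<xi>)) ^ (m - j))" if "j \<le> m" for j
  proof -
    have e: "p + m - j = p + (m - j)" "q + m - j = q + (m - j)"
      using that by auto
    have "(- (cnj \<xi> * \<xi>)) ^ (m - j) = (- cnj \<xi>) ^ (m - j) * \<xi> ^ (m - j)"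
      by (simp flip: power_mult_distrib)
    then show ?thesis
      unfolding hcoeff_character e power_add E_def[symmetric] by (simp only: mult_ac)
  qed
  then have "(\<Sum>j\<le>m. of_nat (fact j * (m choose j) * (m choose j)) * hcoeff (character \<xi>) (p + m - j) (q + m - j))
      = ((- cnj \<xi>) ^ p * \<xi> ^ q * E) * of_real (fact m * laguerre m 0 ((cmod \<xi>)\<^sup>2))"
    unfolding laguerre_sum[symmetric] sum_distrib_left by (intro sum.cong) auto
  then show "(\<Sum>j\<le>m. of_nat (fact j * (m choose j) * (m choose j)) * hcoeff (character \<xi>) (p + m - j) (q + m - j)) = 0"
    using assms by (simp add: Sigma_set_def)
qed

subsection \<open>Zeros of Laguerre polynomials\<close>

text \<open>S consists of the nonnegative roots of odd multiplicity, where the sign changes; one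
  more linear factor at each of them makes the product keep its sign. Without nonnegative roots the
  intermediate value theorem gives S = {}.\<close>

lemma poly_sign_change_set:
  fixes t :: "real poly"
  assumes "t \<noteq> 0"
  shows "\<exists>S. finite S \<and> (\<forall>r\<in>S. r \<ge> 0 \<and> poly t r = 0) \<and>
    ((\<forall>x\<ge>0. poly (t * (\<Prod>r\<in>S. [:-r, 1:])) x \<ge> 0) \<or> (\<forall>x\<ge>0. poly (t * (\<Prod>r\<in>S. [:-r, 1:])) x \<le> 0))"
  using assms
proof (induction "degree t" arbitrary: t rule: less_induct)
  case less
  show ?case
  proof (cases "\<exists>r\<ge>0. poly t r = 0")
    case False
    have "(\<forall>x\<ge>0. poly t x \<ge> 0) \<or> (\<forall>x\<ge>0. poly t x \<le> 0)"
    proof (rule ccontr)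
      assume "\<not> ?thesis"
      then obtain x y where xy: "x \<ge> 0" "poly t x < 0" "y \<ge> 0" "poly t y > 0"
        by (auto simp: not_le)
      have cont: "continuous_on A (poly t)" for A
        by (intro continuous_intros)
      consider "x \<le> y" | "y \<le> x"
        by linarith
      then show False
      proof cases
        case 1
        then obtain z where "x \<le> z" "poly t z = 0"
          using IVT'[of "poly t" x 0 y] xy cont by force
        then show False
          using False xy by force
      next
        case 2
        then obtain z where "y \<le> z" "poly t z = 0"
          using IVT2'[of "poly t" x 0 y] xy cont by force
        then show False
          using False xy by force
      qed
    qed
    then show ?thesis
      by (intro exI[of _ "{}"]) auto
  next
    case True
    then obtain r where r: "r \<ge> 0" "poly t r = 0"
      by blast
    then obtain u where u: "t = [:-r, 1:] * u"
      by (auto simp: poly_eq_0_iff_dvd)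
    then have "u \<noteq> 0"
      using less.prems by auto
    then have "degree u < degree t"
      unfolding u by (subst degree_mult_eq) auto
    from less.hyps[OF this \<open>u \<noteq> 0\<close>] obtain S where
      S: "finite S" "\<And>s. s \<in> S \<Longrightarrow> s \<ge> 0 \<and> poly u s = 0"
      and sgn: "(\<forall>x\<ge>0. poly (u * (\<Prod>r\<in>S. [:-r, 1:])) x \<ge> 0) \<or> (\<forall>x\<ge>0. poly (u * (\<Prod>r\<in>S. [:-r, 1:])) x \<le> 0)"
      by blast
    \<comment> \<open>Splitting off one factor at r flips the parity of its multiplicity, so r is
      toggled in \<open>S\<close>: the product is then unchanged or gains the square (x -
      r)^2.\<close>
    show ?thesis
    proof (cases "r \<in> S")
      case True
      have "(\<Prod>s\<in>S. [:-s, 1:]) = [:-r, 1:] * (\<Prod>s\<in>S - {r}. [:-s, 1:])"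
        using S(1) True by (rule prod.remove)
      then have "t * (\<Prod>s\<in>S - {r}. [:-s, 1:]) = u * (\<Prod>s\<in>S. [:-s, 1:])"
        unfolding u by (simp only: mult_ac)
      then show ?thesis
        using S sgn u by (intro exI[of _ "S - {r}"]) auto
    next
      case False
      have "(\<Prod>s\<in>insert r S. [:-s, 1:]) = [:-r, 1:] * (\<Prod>s\<in>S. [:-s, 1:])"
        using S(1) False by (rule prod.insert)
      then have "t * (\<Prod>s\<in>insert r S. [:-s, 1:]) = [:-r, 1:]\<^sup>2 * (u * (\<Prod>s\<in>S. [:-s, 1:]))"
        unfolding u power2_eq_square by (simp only: mult_ac)
      then have "poly (t * (\<Prod>s\<in>insert r S. [:-s, 1:])) x = (x - r)\<^sup>2 * poly (u * (\<Prod>s\<in>S. [:-s, 1:])) x" for x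
        by (simp only: poly_mult poly_power) simp
      moreover have "\<forall>s\<in>insert r S. s \<ge> 0 \<and> poly t s = 0"
        using S r u by auto
      ultimately show ?thesis
        using S(1) sgn by (intro exI[of _ "insert r S"]) (auto simp only: zero_le_mult_iff mult_le_0_iff zero_le_power2 finite_insert)
    qed
  qed
qed

text \<open>A polynomial object for m! L_m, so that roots can be counted and factors split
  off.\<close>

definition laguerre_poly :: "nat \<Rightarrow> real poly" where
  "laguerre_poly m = (\<Sum>j\<le>m. monom ((-1) ^ (m - j) * of_nat (fact j * (m choose j) * (m choose j))) (m - j))"

text \<open>For nonnegative x the identity is \<open>laguerre_sum\<close> at the parameter sqrt
  x.\<close>

lemma poly_laguerre_poly:
  assumes "x \<ge> 0"
  shows "poly (laguerre_poly m) x = fact m * laguerre m 0 x"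
proof -
  let ?z = "complex_of_real (sqrt x)"
  have z: "cnj ?z * ?z = of_real x" "(cmod ?z)\<^sup>2 = x"
    using assms by (simp_all flip: of_real_mult)
  have "complex_of_real (poly (laguerre_poly m) x)
      = (\<Sum>j\<le>m. of_nat (fact j * (m choose j) * (m choose j)) * (- of_real x) ^ (m - j))"
    unfolding laguerre_poly_def poly_sum poly_monom of_real_sum
    by (intro sum.cong refl) (simp add: power_minus[of "complex_of_real x"] mult_ac)
  also have "\<dots> = of_real (fact m * laguerre m 0 x)"
    using laguerre_sum[of m ?z] unfolding z .
  finally show ?thesis
    by (simp only: of_real_eq_iff)
qed

lemma hermite_laguerre_poly: "hermite m m z = of_real ((-1) ^ m * poly (laguerre_poly m) ((cmod z)\<^sup>2))"
  by (simp add: hermite_diagonal poly_laguerre_poly mult.assoc)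

lemma poly_laguerre_poly_0: "poly (laguerre_poly m) 0 = fact m"
  by (simp add: poly_laguerre_poly laguerre_at_zero)

lemma of_real_poly_norm_square:
  "complex_of_real (poly s ((cmod z)\<^sup>2)) = (\<Sum>i\<le>degree s. of_real (coeff s i) * (cnj z ^ i * z ^ i))"
proof -
  have "complex_of_real (((cmod z)\<^sup>2) ^ i) = cnj z ^ i * z ^ i" for i
    unfolding of_real_power[of "(cmod z)\<^sup>2"] complex_norm_square by (simp add: power_mult_distrib mult.commute)
  then show ?thesis
    unfolding poly_altdef of_real_sum of_real_mult by simp
qed

text \<open>The orthogonality of L_m for the weight exp(-x) on the half line, read as a planar
  Gaussian integral of radial functions, where it is
  \<open>integral_monomial_hermite\<close>.\<close>

lemma laguerre_orthogonal:
  assumes "degree s < m"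
  shows "(LINT z|gauss. hermite m m z * complex_of_real (poly s ((cmod z)\<^sup>2))) = 0"
proof -
  have "hermite m m z * complex_of_real (poly s ((cmod z)\<^sup>2))
      = (\<Sum>i\<le>degree s. of_real (coeff s i) * (cnj z ^ i * z ^ i * hermite m m z))" for z
    unfolding of_real_poly_norm_square sum_distrib_left by (simp add: mult_ac)
  moreover have "integrable gauss (\<lambda>z. cnj z ^ i * z ^ i * hermite m m z)" for i
    by (intro exp_bounded_imp_integrable exp_bounded_mult exp_bounded_hermite exp_bounded_power exp_bounded_cnj exp_bounded_ident)
  ultimately have "(LINT z|gauss. hermite m m z * complex_of_real (poly s ((cmod z)\<^sup>2)))
      = (\<Sum>i\<le>degree s. of_real (coeff s i) * (LINT z|gauss. cnj z ^ i * z ^ i * hermite m m z))"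
    by (simp add: Bochner_Integration.integral_sum)
  also have "\<dots> = 0"
    using assms by (intro sum.neutral) (auto simp: integral_monomial_hermite)
  finally show ?thesis .
qed

text \<open>Otherwise \<open>L\<^sub>m\<close> times a polynomial of degree less than \<open>m\<close> would have constant sign on the half line,
  contradicting orthogonality.\<close>

lemma laguerre_roots:
  obtains R where "finite R" "card R = m" "\<And>r. r \<in> R \<Longrightarrow> r > 0 \<and> laguerre m 0 r = 0"
proof -
  let ?Q = "laguerre_poly m"
  have "?Q \<noteq> 0"
    using poly_laguerre_poly_0[of m] by auto
  from poly_sign_change_set[OF this] obtain S where
    S: "finite S" "\<And>r. r \<in> S \<Longrightarrow> r \<ge> 0 \<and> poly ?Q r = 0"
    and sgn: "(\<forall>x\<ge>0. poly (?Q * (\<Prod>r\<in>S. [:-r, 1:])) x \<ge> 0) \<or> (\<forall>x\<ge>0. poly (?Q * (\<Prod>r\<in>S. [:-r, 1:])) x \<le> 0)"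
    by blast
  define s where "s = (\<Prod>r\<in>S. [:-r, 1:])"
  have "s \<noteq> 0"
    unfolding s_def using S(1) by auto
  have "card S \<ge> m"
  proof (rule ccontr)
    assume "\<not> card S \<ge> m"
    moreover have "degree s \<le> card S"
      unfolding s_def by (rule order.trans[OF degree_prod_sum_le]) (use S(1) in auto)
    ultimately have deg: "degree s < m"
      by linarith
    define h where "h z = poly (?Q * s) ((cmod z)\<^sup>2)" for z
    have h: "hermite m m z * complex_of_real (poly s ((cmod z)\<^sup>2)) = of_real ((-1) ^ m * h z)" for z
      by (simp add: hermite_laguerre_poly h_def)
    have cont: "continuous_on UNIV h"
      unfolding h_def by (intro continuous_intros)
    have "integrable gauss (\<lambda>z. complex_of_real ((-1) ^ m * h z))"
    proof -
      have "exp_bounded (\<lambda>z. hermite m m z * complex_of_real (poly s ((cmod z)\<^sup>2)))"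
        unfolding of_real_poly_norm_square
        by (intro exp_bounded_mult exp_bounded_sum exp_bounded_const exp_bounded_hermite exp_bounded_power
          exp_bounded_cnj exp_bounded_ident)
      then show ?thesis
        unfolding h by (rule exp_bounded_imp_integrable)
    qed
    from integrable_Re[OF this] have int: "integrable gauss h"
      by simp
    have "(LINT z|gauss. h z) = 0"
      using laguerre_orthogonal[OF deg] unfolding h by simp
    moreover have "(\<forall>z. h z \<ge> 0) \<or> (\<forall>z. h z \<le> 0)"
      using sgn unfolding h_def s_def[symmetric] by (meson zero_le_power2)
    ultimately have "AE z in gauss. h z = 0"
    proof (elim disjE)
      assume "(LINT z|gauss. h z) = 0" "\<forall>z. h z \<ge> 0"
      then show ?thesis
        using integral_nonneg_eq_0_iff_AE[OF int] by simp
    next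
      assume "(LINT z|gauss. h z) = 0" "\<forall>z. h z \<le> 0"
      moreover have "integrable gauss (\<lambda>z. - h z)"
        using int by simp
      ultimately show ?thesis
        using integral_nonneg_eq_0_iff_AE[of gauss "\<lambda>z. - h z"] by simp
    qed
    then have "AE z in lborel. complex_of_real (h z) = 0"
      unfolding AE_gauss_iff by simp
    then have zero: "complex_of_real (h z) = 0" for z
      by (rule zero_if_AE_zero[rotated]) (intro continuous_intros cont)
    have "poly (?Q * s) x = 0" if "x \<ge> 0" for x
      using zero[of "of_real (sqrt x)"] that by (simp add: h_def)
    then have "{0..} \<subseteq> {x. poly (?Q * s) x = 0}"
      by auto
    moreover have "\<not> finite {0::real..}"
      by (rule infinite_Ici)
    ultimately have "?Q * s = 0"
      using poly_roots_finite[of "?Q * s"] finite_subset by blast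
    then show False
      using \<open>?Q \<noteq> 0\<close> \<open>s \<noteq> 0\<close> by simp
  qed
  \<comment> \<open>Sign changes give at least \<open>m\<close> roots; exactly \<open>m\<close> are
    kept, to match the order of the recurrence.\<close>
  then obtain R where R: "R \<subseteq> S" "card R = m"
    using obtain_subset_with_card_n by metis
  have "r > 0 \<and> laguerre m 0 r = 0" if "r \<in> R" for r
  proof -
    have r: "r \<ge> 0" "poly ?Q r = 0"
      using S(2)[of r] R(1) that by auto
    \<comment> \<open>L_m(0) = 1 excludes the root 0, for which the geometric sequences would
      degenerate.\<close>
    then have "r \<noteq> 0"
      using poly_laguerre_poly_0[of m] by auto
    then show ?thesis
      using r poly_laguerre_poly[of r m] by auto
  qed
  then show ?thesis
    using that[of R] R S(1) finite_subset by blast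
qed

subsection \<open>Linear recurrences with distinct characteristic roots\<close>

text \<open>Invertibility of the Vandermonde system, by induction: passing from x i to x (i + 1) - a
  * x i removes the powers of a and multiplies the other coefficients by \<mu> - a.\<close>

lemma power_sum_interpolation:
  fixes M :: "'a::field set"
  assumes "finite M"
  shows "\<exists>c. \<forall>i<card M. (\<Sum>\<mu>\<in>M. c \<mu> * \<mu> ^ i) = x i"
  using assms
proof (induction M arbitrary: x rule: finite_induct)
  case (insert a M)
  from insert.IH[of "\<lambda>i. x (Suc i) - a * x i"] obtain c
    where c: "\<forall>i<card M. (\<Sum>\<mu>\<in>M. c \<mu> * \<mu> ^ i) = x (Suc i) - a * x i"
    by blast
  \<comment> \<open>The coefficient of a, fixed by the value at i = 0; the differences take care of
    all later indices.\<close>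
  define K where "K = x 0 - (\<Sum>\<mu>\<in>M. c \<mu> / (\<mu> - a))"
  define d where "d \<mu> = (if \<mu> = a then K else c \<mu> / (\<mu> - a))" for \<mu>
  have S: "(\<Sum>\<mu>\<in>insert a M. d \<mu> * \<mu> ^ i) = K * a ^ i + (\<Sum>\<mu>\<in>M. c \<mu> / (\<mu> - a) * \<mu> ^ i)" for i
  proof -
    have "(\<Sum>\<mu>\<in>M. d \<mu> * \<mu> ^ i) = (\<Sum>\<mu>\<in>M. c \<mu> / (\<mu> - a) * \<mu> ^ i)"
      using insert.hyps by (intro sum.cong) (auto simp: d_def)
    then show ?thesis
      using insert.hyps by (simp add: d_def)
  qed
  have "(\<Sum>\<mu>\<in>insert a M. d \<mu> * \<mu> ^ i) = x i" if "i < Suc (card M)" for i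
    using that
  proof (induction i)
    case 0
    then show ?case
      unfolding S by (simp add: K_def)
  next
    case (Suc i)
    have "c \<mu> / (\<mu> - a) * \<mu> ^ Suc i = a * (c \<mu> / (\<mu> - a) * \<mu> ^ i) + c \<mu> * \<mu> ^ i" if "\<mu> \<in> M" for \<mu>
    proof -
      have "\<mu> - a \<noteq> 0"
        using insert.hyps that by auto
      then show ?thesis
        by (simp add: field_simps)
    qed
    then have "(\<Sum>\<mu>\<in>M. c \<mu> / (\<mu> - a) * \<mu> ^ Suc i) = a * (\<Sum>\<mu>\<in>M. c \<mu> / (\<mu> - a) * \<mu> ^ i) + (\<Sum>\<mu>\<in>M. c \<mu> * \<mu> ^ i)"
      by (simp add: sum.distrib sum_distrib_left)
    then have "(\<Sum>\<mu>\<in>insert a M. d \<mu> * \<mu> ^ Suc i) = a * (\<Sum>\<mu>\<in>insert a M. d \<mu> * \<mu> ^ i) + (\<Sum>\<mu>\<in>M. c \<mu> * \<mu> ^ i)"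
      unfolding S by (simp add: algebra_simps)
    then show ?case
      using Suc c by simp
  qed
  then show ?case
    using insert.hyps by auto
qed auto

text \<open>There are as many distinct roots as the order of the recurrence, so a combination of
  geometric sequences can match the initial values. The difference solves the same monic recurrence
  with zero initial values.\<close>

lemma linear_recurrence_solution:
  fixes M :: "'a::field set"
  assumes fin: "finite M" and a0: "a 0 = 1"
    and root: "\<And>\<mu>. \<mu> \<in> M \<Longrightarrow> (\<Sum>j\<le>card M. a j * \<mu> ^ (card M - j)) = 0"
    and x: "\<And>p. (\<Sum>j\<le>card M. a j * x (p + card M - j)) = 0"
  shows "\<exists>c. \<forall>l. (\<Sum>\<mu>\<in>M. c \<mu> * \<mu> ^ l) = x l"
proof -
  let ?m = "card M"
  obtain c where c: "\<forall>i<?m. (\<Sum>\<mu>\<in>M. c \<mu> * \<mu> ^ i) = x i"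
    using power_sum_interpolation[OF fin] by blast
  define D where "D l = (\<Sum>\<mu>\<in>M. c \<mu> * \<mu> ^ l) - x l" for l
  have rec: "(\<Sum>j\<le>?m. a j * D (p + ?m - j)) = 0" for p
  proof -
    have "(\<Sum>j\<le>?m. a j * (\<Sum>\<mu>\<in>M. c \<mu> * \<mu> ^ (p + ?m - j))) = (\<Sum>\<mu>\<in>M. \<Sum>j\<le>?m. a j * (c \<mu> * \<mu> ^ (p + ?m - j)))"
      unfolding sum_distrib_left by (rule sum.swap)
    also have "\<dots> = (\<Sum>\<mu>\<in>M. c \<mu> * \<mu> ^ p * (\<Sum>j\<le>?m. a j * \<mu> ^ (?m - j)))"
      unfolding sum_distrib_left
      by (intro sum.cong refl) (simp add: mult_ac flip: power_add)
    also have "\<dots> = 0"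
      by (simp add: root)
    finally show ?thesis
      using x[of p] by (simp add: D_def right_diff_distrib sum_subtractf)
  qed
  have "D l = 0" for l
  proof (induction l rule: less_induct)
    case (less l)
    show ?case
    proof (cases "l < ?m")
      case True
      then show ?thesis
        using c by (simp add: D_def)
    next
      case False
      then have l: "l - ?m + ?m - j = l - j" for j
        by simp
      have "(\<Sum>j\<in>{..?m} - {0}. a j * D (l - j)) = 0"
        using less.IH False by (intro sum.neutral) (auto intro!: less.IH)
      moreover have "(\<Sum>j\<le>?m. a j * D (l - j)) = a 0 * D (l - 0) + (\<Sum>j\<in>{..?m} - {0}. a j * D (l - j))"
        by (rule sum.remove) auto
      ultimately show ?thesis
        using rec[of "l - ?m"] by (simp add: l a0)
    qed
  qed
  then show ?thesis
    by (intro exI[of _ c]) (simp add: D_def)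
qed

subsection \<open>Recurrent functions are combinations of characters on each angular mode\<close>

lemma Linf_zero: "(\<lambda>_. 0) \<in> Linf"
  by (rule LinfI[where C = 0]) auto

lemma Linf_sum: "(\<And>i. i \<in> I \<Longrightarrow> f i \<in> Linf) \<Longrightarrow> (\<lambda>z. \<Sum>i\<in>I. c i * f i z) \<in> Linf"
proof (induction I rule: infinite_finite_induct)
  case (insert i I)
  then show ?case
    using Linf_linear[of "f i" "\<lambda>z. \<Sum>i\<in>I. c i * f i z" "c i" 1] by simp
qed (auto intro: Linf_zero)

lemma ang_Linf:
  assumes "f \<in> borel_measurable borel" "\<And>z. cmod (f z) \<le> C"
  shows "ang n f \<in> Linf"
  by (rule LinfI[OF measurable_ang[OF assms(1)] ang_bounded[OF assms]])

lemma character_rotate: "character (of_real \<rho>) (cis t * z) = character (of_real \<rho> * cis (- t)) z"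
  by (simp add: character_eq cis_cnj mult_ac)

lemma norm_character_le_1: "cmod (character \<xi> z) \<le> 1"
  by simp

lemma ang_hermite_hcoeff:
  assumes "f \<in> borel_measurable borel" "\<And>z. cmod (f z) \<le> C"
  shows "(LINT z|gauss. ang n f z * hermite p q z) = (if n = int p - int q then hcoeff f p q else 0)"
  unfolding hcoeff_def
  by (intro ang_hermite_integral assms(1) hermite_mult_integrable LinfI[OF assms])

text \<open>A mode of weight \<open>n\<close> has Hermite coefficients on one diagonal only, where
  the recurrence determines them. One character per circle is enough, since the others on that
  circle are its rotations.\<close>

lemma ang_recurrent:
  assumes f: "f \<in> borel_measurable borel" "\<And>z. cmod (f z) \<le> C" and rec: "recurrent m f"
    and R: "finite R" "card R = m" "\<And>r. r \<in> R \<Longrightarrow> r > 0 \<and> laguerre m 0 r = 0"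
  shows "\<exists>c. AE z in lborel. ang n f z = (\<Sum>r\<in>R. c r * ang n (character (of_real (sqrt r))) z)"
proof -
  let ?\<chi> = "\<lambda>r. character (of_real (sqrt r))"
  \<comment> \<open>Positive and negative part of \<open>n\<close>: the diagonal p - q = n consists
    of the pairs (l + N, l + M).\<close>
  define N where "N = nat n"
  define M where "M = nat (- n)"
  define x where "x l = hcoeff f (l + N) (l + M)" for l
  define \<mu> where "\<mu> r = - complex_of_real r" for r
  have inj: "inj_on \<mu> R"
    by (auto simp: inj_on_def \<mu>_def)
  have "\<exists>c. \<forall>l. (\<Sum>\<mu>\<in>\<mu> ` R. c \<mu> * \<mu> ^ l) = x l"
  proof (rule linear_recurrence_solution)
    show "finite (\<mu> ` R)" "of_nat (fact 0 * (m choose 0) * (m choose 0)) = (1::complex)"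
      using R(1) by auto
    have card: "card (\<mu> ` R) = m"
      using R(2) inj by (simp add: card_image)
    show "(\<Sum>j\<le>card (\<mu> ` R). of_nat (fact j * (m choose j) * (m choose j)) * y ^ (card (\<mu> ` R) - j)) = 0" if y: "y \<in> \<mu> ` R" for y
    proof -
      obtain r where r: "r \<in> R" "y = - of_real r"
        using y unfolding \<mu>_def by blast
      have "cnj (of_real (sqrt r)) * of_real (sqrt r) = complex_of_real r" "(cmod (of_real (sqrt r)))\<^sup>2 = r"
        using R(3)[OF r(1)] by (simp_all flip: of_real_mult)
      then show ?thesis
        using laguerre_sum[of m "of_real (sqrt r)"] R(3)[OF r(1)] unfolding card r(2) by simp
    qed
    show "(\<Sum>j\<le>card (\<mu> ` R). of_nat (fact j * (m choose j) * (m choose j)) * x (p + card (\<mu> ` R) - j)) = 0" for p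
    proof -
      have "x (p + m - j) = hcoeff f (p + N + m - j) (p + M + m - j)" if "j \<le> m" for j
      proof -
        have "p + m - j + N = p + N + m - j" "p + m - j + M = p + M + m - j"
          using that by auto
        then show ?thesis
          by (simp add: x_def)
      qed
      then have "(\<Sum>j\<le>m. of_nat (fact j * (m choose j) * (m choose j)) * x (p + m - j))
          = (\<Sum>j\<le>m. of_nat (fact j * (m choose j) * (m choose j)) * hcoeff f (p + N + m - j) (p + M + m - j))"
        by (intro sum.cong) auto
      also have "\<dots> = 0"
        using rec unfolding recurrent_def by blast
      finally show ?thesis
        unfolding card .
    qed
  qed
  then obtain d where "\<forall>l. (\<Sum>\<mu>\<in>\<mu> ` R. d \<mu> * \<mu> ^ l) = x l"
    by blast
  then have d: "(\<Sum>r\<in>R. d (\<mu> r) * \<mu> r ^ l) = x l" for l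
    by (simp add: sum.reindex[OF inj])
  \<comment> \<open>First coefficient of the character on this diagonal; it is nonzero because r >
    0, so dividing by it normalises the geometric sequence.\<close>
  define w where "w r = (- of_real (sqrt r)) ^ N * of_real (sqrt r) ^ M * complex_of_real (exp (- r))" for r
  define c where "c r = d (\<mu> r) / w r" for r
  have w: "w r \<noteq> 0" if "r \<in> R" for r
    using R(3)[OF that] by (simp add: w_def)
  have coeff: "hcoeff (?\<chi> r) (l + N) (l + M) = w r * \<mu> r ^ l" if "r \<in> R" for r l
  proof -
    have r: "r \<ge> 0"
      using R(3)[OF that] by simp
    have "(- complex_of_real (sqrt r)) ^ l * of_real (sqrt r) ^ l = \<mu> r ^ l"
      using r unfolding power_mult_distrib[symmetric] by (simp add: \<mu>_def flip: of_real_mult)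
    then show ?thesis
      using r unfolding hcoeff_character power_add w_def by (simp add: algebra_simps)
  qed
  let ?D = "\<lambda>z. ang n f z - (\<Sum>r\<in>R. c r * ang n (?\<chi> r) z)"
  have ang_\<chi>: "ang n (?\<chi> r) \<in> Linf" for r
    by (rule ang_Linf[where C = 1]) auto
  have "AE z in lborel. ?D z = 0"
  proof (rule Linf_hermite_unique)
    show "?D \<in> Linf"
      by (intro Linf_diff ang_Linf[OF f] Linf_sum ang_\<chi>)
    fix p q
    have "(LINT z|gauss. ?D z * hermite p q z)
        = (LINT z|gauss. ang n f z * hermite p q z - (\<Sum>r\<in>R. c r * (ang n (?\<chi> r) z * hermite p q z)))"
      by (simp add: left_diff_distrib sum_distrib_right mult.assoc)
    also have "\<dots> = (LINT z|gauss. ang n f z * hermite p q z) - (\<Sum>r\<in>R. c r * (LINT z|gauss. ang n (?\<chi> r) z * hermite p q z))"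
    proof -
      have int: "integrable gauss (\<lambda>z. c r * (ang n (?\<chi> r) z * hermite p q z))" for r
        by (intro integrable_mult_right hermite_mult_integrable ang_\<chi>)
      have "(LINT z|gauss. ang n f z * hermite p q z - (\<Sum>r\<in>R. c r * (ang n (?\<chi> r) z * hermite p q z)))
          = (LINT z|gauss. ang n f z * hermite p q z) - (LINT z|gauss. (\<Sum>r\<in>R. c r * (ang n (?\<chi> r) z * hermite p q z)))"
        by (intro Bochner_Integration.integral_diff Bochner_Integration.integrable_sum int hermite_mult_integrable ang_Linf[OF f])
      then show ?thesis
        by (simp only: Bochner_Integration.integral_sum[OF int] integral_mult_right_zero)
    qed
    also have "\<dots> = 0"
    proof (cases "n = int p - int q")
      case True
      obtain l where l: "p = l + N" "q = l + M"
      proof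
        show "p = min p q + N" "q = min p q + M"
          using True by (auto simp: N_def M_def)
      qed
      have "(\<Sum>r\<in>R. c r * hcoeff (?\<chi> r) p q) = x l"
        unfolding d[symmetric] l by (intro sum.cong) (simp_all add: coeff c_def w)
      moreover have "hcoeff f p q = x l"
        by (simp add: x_def l)
      ultimately show ?thesis
        using True by (simp add: ang_hermite_hcoeff[OF f] ang_hermite_hcoeff[OF measurable_character norm_character_le_1])
    next
      case False
      then show ?thesis
        by (simp add: ang_hermite_hcoeff[OF f] ang_hermite_hcoeff[OF measurable_character norm_character_le_1])
    qed
    finally show "(LINT z|gauss. ?D z * hermite p q z) = 0" .
  qed
  then show ?thesis
    by auto
qed

section \<open>Pairing rotated functions with integrable ones\<close>

lemma lborel_rotate:
  fixes g :: "complex \<Rightarrow> 'a::{banach, second_countable_topology}"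
  assumes u: "cmod u = 1" and g: "integrable lborel g"
  shows "integrable lborel (\<lambda>z. g (u * z))" "(LINT z|lborel. g (u * z)) = integral\<^sup>L lborel g"
proof -
  have D: "distr lborel borel ((*) u) = (lborel :: complex measure)"
    by (rule lborel_distr_isometry) (auto simp: norm_mult u bounded_linear_mult_right bounded_linear.linear)
  have [measurable]: "g \<in> borel_measurable borel"
    using g by auto
  have "integrable (distr lborel borel ((*) u)) g"
    using g D by simp
  then show "integrable lborel (\<lambda>z. g (u * z))"
    by (subst (asm) integrable_distr_eq) auto
  have "integral\<^sup>L (distr lborel borel ((*) u)) g = (LINT z|lborel. g (u * z))"
    by (rule integral_distr) auto
  then show "(LINT z|lborel. g (u * z)) = integral\<^sup>L lborel g"
    using D by simp
qed

text \<open>\<open>f\<close> is merely measurable, so its rotations need not converge pointwise; the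
  rotation is moved to \<open>g\<close>, where L^1 continuity is available.\<close>

lemma continuous_rotated_pairing:
  fixes f g :: "complex \<Rightarrow> complex"
  assumes f [measurable]: "f \<in> borel_measurable borel" and C: "\<And>z. cmod (f z) \<le> C" and g: "integrable lborel g"
  shows "continuous_on (sphere 0 1) (\<lambda>u. LINT z|lborel. f (u * z) * g z)"
  unfolding continuous_on_sequentially comp_def
proof safe
  fix U :: "nat \<Rightarrow> complex" and u :: complex
  assume U: "\<forall>n. U n \<in> sphere 0 1" and u: "u \<in> sphere 0 1" and lim: "U \<longlonglongrightarrow> u"
  have C0: "C \<ge> 0"
    using C[of 0] norm_ge_zero order.trans by blast
  have nU: "cmod (U n) = 1" and nu: "cmod u = 1" for n
    using U u by auto
  have inv: "cnj v * v = 1" if "cmod v = 1" for v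
    using complex_norm_square[of v] that by (simp add: mult.commute)
  \<comment> \<open>Substituting this rotation turns U n * z into u * z inside \<open>f\<close> and
    tends to the identity.\<close>
  define T where "T n z = cnj (U n) * u * z" for n z
  have nT: "cmod (cnj (U n) * u) = 1" for n
    by (simp add: norm_mult nU nu)
  have int: "integrable lborel (\<lambda>z. f (v * z) * h z)" if "cmod v = 1" "integrable lborel h" for v h
    by (rule Linf_mult_integrable[OF LinfI[where C = C] that(2)]) (auto simp: C)
  have gT: "integrable lborel (\<lambda>z. g (T n z))" for n
    unfolding T_def by (rule lborel_rotate[OF nT g])
  have eq: "(LINT z|lborel. f (U n * z) * g z) = (LINT z|lborel. f (u * z) * g (T n z))" for n
  proof -
    have "U n * (cnj (U n) * u * z) = (cnj (U n) * U n) * (u * z)" for z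
      by (simp only: mult_ac)
    then have "U n * (cnj (U n) * u * z) = u * z" for z
      by (simp add: inv nU)
    then show ?thesis
      using lborel_rotate(2)[OF nT[of n] int[OF nU[of n] g]] by (simp only: T_def)
  qed
  have "(\<lambda>n. LINT z|lborel. norm (g (T n z) - g z)) \<longlonglongrightarrow> 0"
  proof (rule L1_continuity[OF _ _ _ g])
    show "T n \<in> borel_measurable borel" for n
      unfolding T_def[abs_def] by measurable
    show "distr lborel borel (T n) = lborel" for n
      unfolding T_def[abs_def]
      by (rule lborel_distr_isometry) (auto simp: norm_mult nU nu bounded_linear_mult_right bounded_linear.linear)
    show "(\<lambda>n. T n z) \<longlonglongrightarrow> z" for z
      unfolding T_def by (rule tendsto_eq_intros lim refl)+ (simp add: inv nu)
  qed
  then have "(\<lambda>n. C * (LINT z|lborel. norm (g (T n z) - g z))) \<longlonglongrightarrow> 0"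
    by (rule tendsto_mult_right_zero)
  then have "(\<lambda>n. (LINT z|lborel. f (U n * z) * g z) - (LINT z|lborel. f (u * z) * g z)) \<longlonglongrightarrow> 0"
  proof (rule Lim_null_comparison[rotated], intro always_eventually allI)
    fix n
    have "(LINT z|lborel. f (U n * z) * g z) - (LINT z|lborel. f (u * z) * g z) = (LINT z|lborel. f (u * z) * (g (T n z) - g z))"
      unfolding eq right_diff_distrib by (intro Bochner_Integration.integral_diff[symmetric] int nu g gT)
    also have "cmod \<dots> \<le> (LINT z|lborel. C * norm (g (T n z) - g z))"
    proof (rule order.trans[OF integral_norm_bound integral_mono])
      show "integrable lborel (\<lambda>z. cmod (f (u * z) * (g (T n z) - g z)))"
        by (intro integrable_norm int nu Bochner_Integration.integrable_diff g gT)
      show "integrable lborel (\<lambda>z. C * norm (g (T n z) - g z))"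
        by (intro integrable_mult_right integrable_norm Bochner_Integration.integrable_diff g gT)
      show "cmod (f (u * z) * (g (T n z) - g z)) \<le> C * norm (g (T n z) - g z)" for z
        unfolding norm_mult by (intro mult_right_mono C) auto
    qed
    finally show "norm ((LINT z|lborel. f (U n * z) * g z) - (LINT z|lborel. f (u * z) * g z)) \<le> C * (LINT z|lborel. norm (g (T n z) - g z))"
      by simp
  qed
  then show "(\<lambda>n. LINT z|lborel. f (U n * z) * g z) \<longlonglongrightarrow> (LINT z|lborel. f (u * z) * g z)"
    by (rule LIM_zero_cancel)
qed

lemma ang_pairing:
  fixes f g :: "complex \<Rightarrow> complex"
  assumes f [measurable]: "f \<in> borel_measurable borel" and C: "\<And>z. cmod (f z) \<le> C" and g: "integrable lborel g"
  shows "(LINT z|lborel. ang n f z * g z) = (LINT t|circ. cis (- (of_int n * t)) * (LINT z|lborel. f (cis t * z) * g z))"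
proof (rule ang_Fubini[OF f _ sigma_finite_lborel])
  show int: "integrable lborel (\<lambda>z. f (cis t * z) * g z)" for t
    by (rule Linf_mult_integrable[OF LinfI[where C = C] g]) (auto simp: C)
  show "(LINT z|lborel. cmod (f (cis t * z) * g z)) \<le> (LINT z|lborel. C * cmod (g z))" for t
  proof (rule integral_mono)
    show "integrable lborel (\<lambda>z. C * cmod (g z))"
      by (intro integrable_mult_right integrable_norm g)
    show "cmod (f (cis t * z) * g z) \<le> C * cmod (g z)" for z
      unfolding norm_mult by (intro mult_right_mono C) auto
  qed (intro integrable_norm int)
qed (use g in auto)

text \<open>An integrable function annihilating the characters with parameters on the circles of radius
  \<open>sqrt r\<close> annihilates each angular mode of \<open>f\<close>, so all Fourier coefficients of its pairing with the
  rotations of \<open>f\<close> vanish.\<close>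

lemma recurrent_annihilator_bounded:
  assumes f: "f \<in> borel_measurable borel" "\<And>z. cmod (f z) \<le> C" and rec: "recurrent m f"
    and g: "integrable lborel g"
    and ann: "\<And>\<xi>. \<xi> \<in> Sigma_set (Suc m) \<Longrightarrow> (LINT z|lborel. character \<xi> z * g z) = 0"
  shows "(LINT z|lborel. f z * g z) = 0"
proof -
  obtain R where R: "finite R" "card R = m" "\<And>r. r \<in> R \<Longrightarrow> r > 0 \<and> laguerre m 0 r = 0"
    using laguerre_roots[of m] by blast
  let ?\<psi> = "\<lambda>u. LINT z|lborel. f (u * z) * g z"
  let ?\<chi> = "\<lambda>r. character (of_real (sqrt r))"
  have "?\<psi> 1 = 0"
  proof (rule Fourier_uniqueness)
    show "continuous_on (sphere 0 1) ?\<psi>"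
      by (rule continuous_rotated_pairing[OF f g])
    fix n
    obtain c where c: "AE z in lborel. ang n f z = (\<Sum>r\<in>R. c r * ang n (?\<chi> r) z)"
      using ang_recurrent[OF f rec R] by blast
    have zero: "(LINT z|lborel. ang n (?\<chi> r) z * g z) = 0" if "r \<in> R" for r
    proof -
      \<comment> \<open>Rotating the character at sqrt r gives the character at another point of the
        same circle, which \<open>g\<close> annihilates too.\<close>
      have "of_real (sqrt r) * cis (- t) \<in> Sigma_set (Suc m)" for t
        using R(3)[OF that] by (simp add: Sigma_set_def norm_mult)
      then show ?thesis
        by (subst ang_pairing[OF measurable_character norm_character_le_1 g])
          (simp add: character_rotate ann)
    qed
    have ang_\<chi>: "ang n (?\<chi> r) \<in> Linf" for r
      by (rule ang_Linf[where C = 1]) auto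
    have "(LINT t|circ. ?\<psi> (cis t) * cis (- (of_int n * t))) = (LINT z|lborel. ang n f z * g z)"
      unfolding ang_pairing[OF f g] by (simp only: mult.commute)
    also have "\<dots> = (LINT z|lborel. (\<Sum>r\<in>R. c r * (ang n (?\<chi> r) z * g z)))"
    proof (rule integral_cong_AE)
      show "AE z in lborel. ang n f z * g z = (\<Sum>r\<in>R. c r * (ang n (?\<chi> r) z * g z))"
        using c by eventually_elim (simp add: sum_distrib_right mult.assoc)
    qed (use f g in measurable)
    also have "\<dots> = (\<Sum>r\<in>R. c r * (LINT z|lborel. ang n (?\<chi> r) z * g z))"
      by (subst Bochner_Integration.integral_sum)
        (intro integrable_mult_right Linf_mult_integrable ang_\<chi> g, simp)
    also have "\<dots> = 0"
      using zero by simp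
    finally show "(LINT t|circ. ?\<psi> (cis t) * cis (- (of_int n * t))) = 0" .
  qed
  then show ?thesis
    by simp
qed

lemma hcoeff_cong_AE:
  assumes "f \<in> Linf" "g \<in> Linf" "AE z in lborel. f z = g z"
  shows "hcoeff f p q = hcoeff g p q"
  unfolding hcoeff_def
proof (rule integral_cong_AE)
  have [measurable]: "f \<in> borel_measurable borel" "g \<in> borel_measurable borel"
    using assms by (auto simp: Linf_measurable)
  show "(\<lambda>z. f z * hermite p q z) \<in> borel_measurable gauss" "(\<lambda>z. g z * hermite p q z) \<in> borel_measurable gauss"
    by measurable
  show "AE z in gauss. f z * hermite p q z = g z * hermite p q z"
    unfolding AE_gauss_iff using assms(3) by eventually_elim simp
qed

lemma recurrent_annihilator:
  assumes f: "f \<in> Linf" and rec: "recurrent m f" and g: "integrable lborel g"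
    and ann: "\<And>\<xi>. \<xi> \<in> Sigma_set (Suc m) \<Longrightarrow> (LINT z|lborel. character \<xi> z * g z) = 0"
  shows "(LINT z|lborel. f z * g z) = 0"
proof -
  obtain C where C: "C \<ge> 0" "AE z in lborel. cmod (f z) \<le> C"
    by (rule LinfE[OF f]) blast
  have [measurable]: "f \<in> borel_measurable borel" "g \<in> borel_measurable borel"
    using f g by (auto simp: Linf_measurable)
  \<comment> \<open>A representative bounded at every point: angular components integrate over
    circles, which are null sets, so an almost everywhere bound would not control them.\<close>
  define f' where "f' z = (if cmod (f z) \<le> C then f z else 0)" for z
  have f': "f' \<in> borel_measurable borel" "cmod (f' z) \<le> C" for z
    unfolding f'_def[abs_def] using C(1) by auto
  have eq: "AE z in lborel. f z = f' z"
    using C(2) by eventually_elim (simp add: f'_def)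
  have "recurrent m f'"
    using rec unfolding recurrent_def hcoeff_cong_AE[OF f LinfI[OF f'] eq] .
  from recurrent_annihilator_bounded[OF f' this g ann] have "(LINT z|lborel. f' z * g z) = 0" .
  moreover have "(LINT z|lborel. f z * g z) = (LINT z|lborel. f' z * g z)"
  proof (rule integral_cong_AE)
    show "AE z in lborel. f z * g z = f' z * g z"
      using eq by eventually_elim simp
  qed (use f' in measurable)
  ultimately show ?thesis
    by simp
qed

subsection \<open>The weak* closure\<close>

definition pairing :: "(complex \<Rightarrow> complex) \<Rightarrow> (complex \<Rightarrow> complex) \<Rightarrow> complex" where
  "pairing f g = (LINT z|lborel. f z * g z)"

lemma pairing_add_left:
  assumes "f \<in> Linf" "g \<in> Linf" "integrable lborel h"
  shows "pairing (\<lambda>z. f z + a * g z) h = pairing f h + a * pairing g h"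
  using Bochner_Integration.integral_add[OF Linf_mult_integrable[OF assms(1,3)] integrable_mult_right[OF Linf_mult_integrable[OF assms(2,3)], of a]]
  by (simp add: pairing_def distrib_right mult.assoc)

lemma pairing_diff_right:
  assumes "f \<in> Linf" "integrable lborel g" "integrable lborel h"
  shows "pairing f (\<lambda>z. g z - a * h z) = pairing f g - a * pairing f h"
  using Bochner_Integration.integral_diff[OF Linf_mult_integrable[OF assms(1,2)] integrable_mult_right[OF Linf_mult_integrable[OF assms(1,3)], of a]]
  by (simp add: pairing_def right_diff_distrib mult.left_commute)

lemma pairing_sum_left:
  assumes "\<And>s. s \<in> X \<Longrightarrow> s \<in> Linf" "integrable lborel h"
  shows "pairing (\<lambda>z. \<Sum>s\<in>X. c s * s z) h = (\<Sum>s\<in>X. c s * pairing s h)"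
proof -
  have "pairing (\<lambda>z. \<Sum>s\<in>X. c s * s z) h = (LINT z|lborel. (\<Sum>s\<in>X. c s * (s z * h z)))"
    by (simp add: pairing_def sum_distrib_right mult.assoc)
  also have "\<dots> = (\<Sum>s\<in>X. (LINT z|lborel. c s * (s z * h z)))"
    by (intro Bochner_Integration.integral_sum integrable_mult_right Linf_mult_integrable assms)
  finally show ?thesis
    by (simp add: pairing_def)
qed

definition linear_subspace :: "(complex \<Rightarrow> complex) set \<Rightarrow> bool" where
  "linear_subspace V \<longleftrightarrow> V \<subseteq> Linf \<and> (\<lambda>_. 0) \<in> V \<and> (\<forall>v\<in>V. \<forall>w\<in>V. \<forall>a. (\<lambda>z. v z + a * w z) \<in> V)"

text \<open>A weak* neighbourhood tests finitely many pairings, so linear algebra replaces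
  Hahn-Banach: each functional that is nontrivial on V splits off one dimension, and the induction
  continues on its kernel within V.\<close>

lemma finite_bipolar:
  assumes "linear_subspace V" "f \<in> Linf"
    and "\<And>g. integrable lborel g \<Longrightarrow> (\<And>v. v \<in> V \<Longrightarrow> pairing v g = 0) \<Longrightarrow> pairing f g = 0"
    and "\<And>g. g \<in> set gs \<Longrightarrow> integrable lborel g"
  shows "\<exists>h\<in>V. \<forall>g\<in>set gs. pairing h g = pairing f g"
  using assms
proof (induction gs arbitrary: V f)
  case Nil
  then show ?case
    by (auto simp: linear_subspace_def)
next
  case (Cons g gs)
  have V: "V \<subseteq> Linf" "(\<lambda>_. 0) \<in> V" "\<And>v w a. v \<in> V \<Longrightarrow> w \<in> V \<Longrightarrow> (\<lambda>z. v z + a * w z) \<in> V"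
    using Cons.prems(1) by (auto simp: linear_subspace_def)
  have g: "integrable lborel g" and gs: "\<And>g. g \<in> set gs \<Longrightarrow> integrable lborel g"
    using Cons.prems(4) by auto
  note add = pairing_add_left[OF subsetD[OF V(1)] subsetD[OF V(1)]]
  show ?case
  proof (cases "\<forall>v\<in>V. pairing v g = 0")
    case True
    then have "pairing f g = 0"
      using Cons.prems(3)[OF g] by blast
    moreover obtain h where "h \<in> V" "\<forall>g\<in>set gs. pairing h g = pairing f g"
      using Cons.IH[OF Cons.prems(1,2,3) gs] by blast
    ultimately show ?thesis
      using True by auto
  next
    case False
    then obtain v1 where v1: "v1 \<in> V" "pairing v1 g \<noteq> 0"
      by blast
    \<comment> \<open>Normalised to pair with \<open>g\<close> to 1; the summand 0 matches the form
      of the closure rule for \<open>V\<close>.\<close>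
    define v0 where "v0 z = 0 + (1 / pairing v1 g) * v1 z" for z
    have v0: "v0 \<in> V"
      unfolding v0_def[abs_def] by (rule V(3)[OF V(2) v1(1)])
    have v0g: "pairing v0 g = 1"
      unfolding v0_def[abs_def] add[OF V(2) v1(1) g] using v1(2) by (simp add: pairing_def)
    define V' where "V' = {v \<in> V. pairing v g = 0}"
    define a where "a = pairing f g"
    define f' where "f' z = f z + (- a) * v0 z" for z
    have f'_pairing: "pairing f' k = pairing f k - a * pairing v0 k" if "integrable lborel k" for k
      unfolding f'_def[abs_def] using pairing_add_left[OF Cons.prems(2) subsetD[OF V(1) v0] that, of "- a"] by simp
    have "\<exists>h\<in>V'. \<forall>g\<in>set gs. pairing h g = pairing f' g"
    proof (rule Cons.IH)
      have "pairing (\<lambda>_. 0) g = 0"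
        by (simp add: pairing_def)
      then show "linear_subspace V'"
        using V by (auto simp: linear_subspace_def V'_def add[OF _ _ g])
      show "f' \<in> Linf"
        using Linf_linear[OF Cons.prems(2) subsetD[OF V(1) v0], of 1 "- a"] by (simp add: f'_def[abs_def])
      fix k assume k: "integrable lborel k" and zero: "\<And>v. v \<in> V' \<Longrightarrow> pairing v k = 0"
      \<comment> \<open>A function annihilating only the kernel \<open>V'\<close> is corrected by a
        multiple of \<open>g\<close> so as to annihilate all of \<open>V\<close>; then the
        hypothesis on \<open>f\<close> applies.\<close>
      have "pairing f (\<lambda>z. k z - pairing v0 k * g z) = 0"
      proof (rule Cons.prems(3))
        show "integrable lborel (\<lambda>z. k z - pairing v0 k * g z)"
          by (intro Bochner_Integration.integrable_diff integrable_mult_right k g)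
        fix v assume v: "v \<in> V"
        have "(\<lambda>z. v z + (- pairing v g) * v0 z) \<in> V'"
          unfolding V'_def using V(3)[OF v v0, of "- pairing v g"] add[OF v v0 g, of "- pairing v g"] v0g by simp
        from zero[OF this] have "pairing v k = pairing v g * pairing v0 k"
          using add[OF v v0 k, of "- pairing v g"] by simp
        then show "pairing v (\<lambda>z. k z - pairing v0 k * g z) = 0"
          unfolding pairing_diff_right[OF subsetD[OF V(1) v] k g] by simp
      qed
      then show "pairing f' k = 0"
        unfolding pairing_diff_right[OF Cons.prems(2) k g] f'_pairing[OF k] a_def by simp
    qed (rule gs)
    then obtain h where h: "h \<in> V" "pairing h g = 0" "\<And>k. k \<in> set gs \<Longrightarrow> pairing h k = pairing f' k"
      by (auto simp: V'_def)
    show ?thesis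
    proof (intro bexI ballI)
      show "(\<lambda>z. h z + a * v0 z) \<in> V"
        by (rule V(3)[OF h(1) v0])
      fix k assume k: "k \<in> set (g # gs)"
      then have int: "integrable lborel k"
        using g gs by auto
      show "pairing (\<lambda>z. h z + a * v0 z) k = pairing f k"
        unfolding add[OF h(1) v0 int] using k h(2,3) v0g f'_pairing[OF int] by (auto simp: a_def)
    qed
  qed
qed

section \<open>Weak* neighbourhoods\<close>

lemma weak_star_basic_open:
  assumes "integrable lborel g" "open U"
  shows "openin weak_star {f \<in> Linf. pairing f g \<in> U}"
  unfolding weak_star_def pairing_def
  by (rule topology_generated_by_Basis) (use assms in blast)

lemma topspace_weak_star: "topspace weak_star = Linf"
proof
  show "topspace weak_star \<subseteq> Linf"
    unfolding weak_star_def topology_generated_by_topspace by blast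
  have "openin weak_star {f \<in> Linf. pairing f (\<lambda>_. 0) \<in> UNIV}"
    by (rule weak_star_basic_open) auto
  then show "Linf \<subseteq> topspace weak_star"
    using openin_subset by fastforce
qed

text \<open>Basic open sets restrict one pairing each, and a neighbourhood involves finitely many.
  Prescribing these values exactly stays inside it.\<close>

lemma weak_star_open_finite:
  assumes "openin weak_star W" "f \<in> W"
  shows "\<exists>gs. (\<forall>g\<in>set gs. integrable lborel g) \<and> {h \<in> Linf. \<forall>g\<in>set gs. pairing h g = pairing f g} \<subseteq> W"
proof -
  define B where "B = {{f \<in> Linf. (LINT z|lborel. f z * g z) \<in> U} | g U. integrable lborel g \<and> open U}"
  have "generate_topology_on B W"
    using assms(1) unfolding weak_star_def B_def openin_topology_generated_by_iff .
  then have "\<forall>f\<in>W. \<exists>gs. (\<forall>g\<in>set gs. integrable lborel g) \<and> {h \<in> Linf. \<forall>g\<in>set gs. pairing h g = pairing f g} \<subseteq> W"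
  proof induction
    case Empty
    then show ?case
      by simp
  next
    case (Int X Y)
    show ?case
    proof
      fix f assume "f \<in> X \<inter> Y"
      then obtain gs hs where
        "\<forall>g\<in>set gs. integrable lborel g" "{h \<in> Linf. \<forall>g\<in>set gs. pairing h g = pairing f g} \<subseteq> X"
        "\<forall>g\<in>set hs. integrable lborel g" "{h \<in> Linf. \<forall>g\<in>set hs. pairing h g = pairing f g} \<subseteq> Y"
        using Int.IH by blast
      then show "\<exists>gs. (\<forall>g\<in>set gs. integrable lborel g) \<and> {h \<in> Linf. \<forall>g\<in>set gs. pairing h g = pairing f g} \<subseteq> X \<inter> Y"
        by (intro exI[of _ "gs @ hs"]) auto
    qed
  next
    case (UN K)
    show ?case
    proof
      fix f assume "f \<in> \<Union> K"
      then obtain k where "k \<in> K" "f \<in> k"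
        by blast
      then obtain gs where "\<forall>g\<in>set gs. integrable lborel g" "{h \<in> Linf. \<forall>g\<in>set gs. pairing h g = pairing f g} \<subseteq> k"
        using UN.IH by blast
      then show "\<exists>gs. (\<forall>g\<in>set gs. integrable lborel g) \<and> {h \<in> Linf. \<forall>g\<in>set gs. pairing h g = pairing f g} \<subseteq> \<Union> K"
        using \<open>k \<in> K\<close> by (intro exI[of _ gs]) auto
    qed
  next
    case (Basis X)
    then obtain g U where X: "X = {f \<in> Linf. pairing f g \<in> U}" "integrable lborel g"
      by (auto simp: B_def pairing_def)
    show ?case
      unfolding X(1) using X(2) by (intro ballI exI[of _ "[g]"]) auto
  qed
  then show ?thesis
    using assms(2) by blast
qed

lemma linear_subspace_lin_span:
  assumes S: "S \<subseteq> Linf"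
  shows "linear_subspace (lin_span S)"
  unfolding linear_subspace_def
proof (intro conjI ballI allI)
  show "lin_span S \<subseteq> Linf"
    using S by (auto simp: lin_span_def intro!: Linf_sum)
  show "(\<lambda>_. 0) \<in> lin_span S"
    by (auto simp: lin_span_def intro!: exI[of _ "{}"])
  fix v w a assume "v \<in> lin_span S" "w \<in> lin_span S"
  then obtain X c Y d where
    v: "v = (\<lambda>z. \<Sum>s\<in>X. c s * s z)" "finite X" "X \<subseteq> S" and
    w: "w = (\<lambda>z. \<Sum>s\<in>Y. d s * s z)" "finite Y" "Y \<subseteq> S"
    unfolding lin_span_def by blast
  define b where "b s = (if s \<in> X then c s else 0) + a * (if s \<in> Y then d s else 0)" for s
  have "v z = (\<Sum>s\<in>X \<union> Y. (if s \<in> X then c s else 0) * s z)" for z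
    unfolding v(1) by (rule sum.mono_neutral_cong_left) (use v w in auto)
  moreover have "w z = (\<Sum>s\<in>X \<union> Y. (if s \<in> Y then d s else 0) * s z)" for z
    unfolding w(1) by (rule sum.mono_neutral_cong_left) (use v w in auto)
  ultimately have "v z + a * w z = (\<Sum>s\<in>X \<union> Y. b s * s z)" for z
    by (simp only: b_def distrib_right sum.distrib sum_distrib_left mult.assoc)
  then show "(\<lambda>z. v z + a * w z) \<in> lin_span S"
    unfolding lin_span_def using v w by (auto intro!: exI[of _ "X \<union> Y"] exI[of _ b])
qed

lemma lin_span_superset:
  assumes "s \<in> S"
  shows "s \<in> lin_span S"
  unfolding lin_span_def using assms by (auto intro!: exI[of _ "{s}"] exI[of _ "\<lambda>_. 1"])

text \<open>Each relation of the recurrence is the pairing with this integrable function, hence a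
  weak* continuous condition.\<close>

definition recurrence_density :: "nat \<Rightarrow> nat \<Rightarrow> nat \<Rightarrow> complex \<Rightarrow> complex" where
  "recurrence_density m p q z = (exp (- (cmod z)\<^sup>2) / pi) *\<^sub>R
    (\<Sum>j\<le>m. of_nat (fact j * (m choose j) * (m choose j)) * hermite (p + m - j) (q + m - j) z)"

lemma exp_bounded_recurrence:
  "exp_bounded (\<lambda>z. \<Sum>j\<le>m. of_nat (fact j * (m choose j) * (m choose j)) * hermite (p + m - j) (q + m - j) z)"
  by (intro exp_bounded_sum exp_bounded_mult exp_bounded_const exp_bounded_hermite)

lemma integrable_recurrence_density: "integrable lborel (recurrence_density m p q)"
  unfolding recurrence_density_def[abs_def] integrable_gauss_iff[OF exp_bounded_measurable[OF exp_bounded_recurrence], symmetric]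
  by (rule exp_bounded_imp_integrable[OF exp_bounded_recurrence])

lemma recurrent_iff_pairing:
  assumes f: "f \<in> Linf"
  shows "recurrent m f \<longleftrightarrow> (\<forall>p q. pairing f (recurrence_density m p q) = 0)"
proof -
  let ?S = "\<lambda>p q z. \<Sum>j\<le>m. of_nat (fact j * (m choose j) * (m choose j)) * hermite (p + m - j) (q + m - j) z"
  have [measurable]: "f \<in> borel_measurable borel"
    using f by (rule Linf_measurable)
  have "pairing f (recurrence_density m p q) = (\<Sum>j\<le>m. of_nat (fact j * (m choose j) * (m choose j)) * hcoeff f (p + m - j) (q + m - j))" for p q
  proof -
    have "pairing f (recurrence_density m p q) = (LINT z|lborel. (exp (- (cmod z)\<^sup>2) / pi) *\<^sub>R (f z * ?S p q z))"
      by (simp add: pairing_def recurrence_density_def)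
    also have "\<dots> = (LINT z|gauss. f z * ?S p q z)"
      by (rule integral_gauss[symmetric]) (intro borel_measurable_times exp_bounded_measurable[OF exp_bounded_recurrence], measurable)
    also have "\<dots> = (LINT z|gauss. (\<Sum>j\<le>m. of_nat (fact j * (m choose j) * (m choose j)) * (f z * hermite (p + m - j) (q + m - j) z)))"
      unfolding sum_distrib_left by (simp only: mult.left_commute)
    also have "\<dots> = (\<Sum>j\<le>m. of_nat (fact j * (m choose j) * (m choose j)) * hcoeff f (p + m - j) (q + m - j))"
      unfolding hcoeff_def
      by (subst Bochner_Integration.integral_sum)
        (intro integrable_mult_right hermite_mult_integrable f, simp only: integral_mult_right_zero)
    finally show ?thesis .
  qed
  then show ?thesis
    by (simp only: recurrent_def)
qed

text \<open>One inclusion is the bipolar argument fed with \<open>recurrent_annihilator\<close>; the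
  other holds since the characters satisfy the recurrence and its relations are weak*
  closed.\<close>

lemma recurrent_eq_closure:
  "{f \<in> Linf. recurrent m f} = weak_star closure_of (lin_span (character ` Sigma_set (Suc m)))"
proof (intro equalityI subsetI)
  let ?S = "character ` Sigma_set (Suc m)"
  have S: "?S \<subseteq> Linf"
    using character_Linf by blast
  fix f
  {
    assume "f \<in> {f \<in> Linf. recurrent m f}"
    then have f: "f \<in> Linf" "recurrent m f"
      by auto
    show "f \<in> weak_star closure_of lin_span ?S"
      unfolding in_closure_of topspace_weak_star
    proof (intro conjI allI impI f(1))
      fix W assume "f \<in> W \<and> openin weak_star W"
      then obtain gs where gs: "\<forall>g\<in>set gs. integrable lborel g"
        "{h \<in> Linf. \<forall>g\<in>set gs. pairing h g = pairing f g} \<subseteq> W"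
        using weak_star_open_finite by blast
      have "\<exists>h\<in>lin_span ?S. \<forall>g\<in>set gs. pairing h g = pairing f g"
      proof (rule finite_bipolar[OF linear_subspace_lin_span[OF S] f(1)])
        fix g assume g: "integrable lborel g" and zero: "\<And>v. v \<in> lin_span ?S \<Longrightarrow> pairing v g = 0"
        have "pairing (character \<xi>) g = 0" if "\<xi> \<in> Sigma_set (Suc m)" for \<xi>
          using that by (intro zero lin_span_superset) auto
        then show "pairing f g = 0"
          unfolding pairing_def by (intro recurrent_annihilator[OF f g])
      qed (use gs in auto)
      moreover have "lin_span ?S \<subseteq> Linf"
        using linear_subspace_lin_span[OF S] by (simp add: linear_subspace_def)
      ultimately show "\<exists>h. h \<in> lin_span ?S \<and> h \<in> W"
        using gs(2) by blast
    qed
  }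
  {
    assume "f \<in> weak_star closure_of lin_span ?S"
    then have f: "f \<in> Linf" and cl: "\<And>W. f \<in> W \<Longrightarrow> openin weak_star W \<Longrightarrow> \<exists>h\<in>lin_span ?S. h \<in> W"
      unfolding in_closure_of topspace_weak_star by auto
    let ?G = "recurrence_density m"
    have "pairing f (?G p q) = 0" for p q
    proof (rule ccontr)
      assume "pairing f (?G p q) \<noteq> 0"
      then have "f \<in> {f \<in> Linf. pairing f (?G p q) \<in> - {0}}"
        using f by simp
      from cl[OF this weak_star_basic_open[OF integrable_recurrence_density]] obtain h where "h \<in> lin_span ?S" and nz: "pairing h (?G p q) \<noteq> 0"
        by auto
      then obtain X c where X: "X \<subseteq> ?S" "h = (\<lambda>z. \<Sum>s\<in>X. c s * s z)"
        unfolding lin_span_def by blast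
      have "pairing s (?G p q) = 0" if s: "s \<in> X" for s
      proof -
        obtain \<xi> where "\<xi> \<in> Sigma_set (Suc m)" "s = character \<xi>"
          using X(1) s by blast
        then show ?thesis
          using recurrent_character[of \<xi> m] recurrent_iff_pairing[OF character_Linf, of m \<xi>] by blast
      qed
      moreover have "pairing h (?G p q) = (\<Sum>s\<in>X. c s * pairing s (?G p q))"
        unfolding X(2) by (rule pairing_sum_left[OF _ integrable_recurrence_density]) (use X(1) S in blast)
      ultimately show False
        using nz by simp
    qed
    then show "f \<in> {f \<in> Linf. recurrent m f}"
      using f recurrent_iff_pairing[OF f] by blast
  }
qed

text \<open>For m = 0 only the term j = 0 remains, so every Hermite coefficient vanishes.\<close>

lemma recurrent_0_unique:
  assumes "f \<in> Linf" "recurrent 0 f"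
  shows "AE z in lborel. f z = 0"
  by (rule Linf_hermite_unique[OF assms(1)]) (use assms(2) in \<open>simp add: recurrent_def hcoeff_def\<close>)

text \<open>L_m has a positive zero when m > 0; the corresponding character has modulus 1 everywhere
  and the same image as 0.\<close>

lemma Phi_not_injective:
  assumes "m > 0"
  shows "\<exists>f\<in>Linf. \<exists>g\<in>Linf. Phi (Suc m) f = Phi (Suc m) g \<and> \<not> (AE z in lborel. f z = g z)"
proof -
  obtain R where R: "finite R" "card R = m" "\<And>r. r \<in> R \<Longrightarrow> r > 0 \<and> laguerre m 0 r = 0"
    using laguerre_roots[of m] by blast
  then obtain r where "r \<in> R"
    using assms by fastforce
  then have r: "r > 0" "laguerre m 0 r = 0"
    using R(3) by auto
  define \<xi> where "\<xi> = complex_of_real (sqrt r)"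
  have "\<xi> \<in> Sigma_set (Suc m)"
    using r by (simp add: Sigma_set_def \<xi>_def)
  then have "Phi (Suc m) (character \<xi>) = Phi (Suc m) (\<lambda>_. 0)"
    unfolding Phi_eq_iff[OF character_Linf Linf_zero] using recurrent_character by simp
  moreover have "\<not> (AE z in lborel. character \<xi> z = 0)"
    using zero_if_AE_zero[OF character_continuous, of \<xi> 0] norm_character[of \<xi> 0] by force
  ultimately show ?thesis
    using character_Linf Linf_zero by blast
qed

theorem theorem3p4:
  fixes k :: nat
  assumes "k \<ge> 1"
  shows "Phi k \<in> Linf \<rightarrow> bounded_ops (true_fock k) \<and>
    ((\<forall>f\<in>Linf. \<forall>g\<in>Linf. Phi k f = Phi k g \<longrightarrow> (AE z in lborel. f z = g z)) \<longleftrightarrow> k = 1) \<and>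
    (k > 1 \<longrightarrow>
      {f \<in> Linf. Phi k f = zero_op (true_fock k)} =
      weak_star closure_of (lin_span (character ` Sigma_set k)))"
proof -
  obtain m where k: "k = Suc m"
    using assms by (cases k) auto
  have "Phi k \<in> Linf \<rightarrow> bounded_ops (true_fock k)"
    unfolding k using Phi_Toeplitz(1) by blast
  moreover have "(\<forall>f\<in>Linf. \<forall>g\<in>Linf. Phi k f = Phi k g \<longrightarrow> (AE z in lborel. f z = g z)) \<longleftrightarrow> k = 1"
  proof (cases "m = 0")
    case True
    have "AE z in lborel. f z = g z" if "f \<in> Linf" "g \<in> Linf" "Phi k f = Phi k g" for f g
      using recurrent_0_unique[OF Linf_diff[OF that(1,2)]] that Phi_eq_iff[of f g m] True by (simp add: k)
    then show ?thesis
      using True k by auto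
  next
    case False
    then show ?thesis
      using Phi_not_injective[of m] k by auto
  qed
  moreover have "{f \<in> Linf. Phi k f = zero_op (true_fock k)} = weak_star closure_of (lin_span (character ` Sigma_set k))"
    unfolding k recurrent_eq_closure[symmetric] using Phi_eq_zero_iff by blast
  ultimately show ?thesis
    by blast
qed

end
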